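(* Let $N\ge2$ be an integer, $0\le b<2<q<2^*_b$ and $\eta\in[0,2)$. Let $u\in E^q_b\cap L^r_\eta(\mathbb{R}^N)$ be a weak solution of $$-\Delta u+\frac{|u|^{q-2}u}{|x|^b}=\frac{|u|^{r-2}u}{|x|^\eta}\quad\text{in }\mathbb{R}^N.$$ Assume that $u\in L^\infty_{loc}(\mathbb{R}^N\setminus\{0\})$ if $r>2^*$. Then $u\equiv0$ if one of the following conditions occurs: 1. $N\ge3$, and $r\ge2^*_\eta$ or $1<r\le\frac{q(N-\eta)}{N-b}$; 2. $N=2$, and $1<r\le\frac{q(N-\eta)}{N-b}$.
   Context: For $0\le\eta<N$: $2^*_\eta=+\infty$ if $N=2$ and $2^*_\eta=\frac{2(N-\eta)}{N-2}$ if $N\ge3$; $2^*=2^*_0$. For $r\ge1$, $L^r_\eta(\mathbb{R}^N)=L^r(\mathbb{R}^N;|x|^{-\eta}dx)$. The space $E^q_b=\{u\in L^q_b(\mathbb{R}^N):\nabla u\in (L^2(\mathbb{R}^N))^N\}$ (weak gradient) carries the norm $\|u\|=\big[\int_{\mathbb{R}^N}|\nabla u|^2dx+\big(\int_{\mathbb{R}^N}\frac{|u|^q}{|x|^b}dx\big)^{2/q}\big]^{1/2}$. For a Carathéodory $f$, a weak solution of $-\Delta u+|x|^{-b}|u|^{q-2}u=f(x,u)$ is $u\in E^q_b$ with $f(\cdot,u)\in L^1_{loc}(\mathbb{R}^N)$ and $\int\nabla u\cdot\nabla v\,dx+\int\frac{|u|^{q-2}uv}{|x|^b}dx=\int f(x,u)v\,dx$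 for all $v\in C_c^\infty(\mathbb{R}^N)$. *)

theory Defs
  imports "HOL-Analysis.Analysis"
begin

text \<open>
  Function spaces are sets of representatives: elements of Lebesgue spaces are functions
  measurable for Lebesgue measure, and equality in these spaces is equality almost everywhere.
  Since \<open>0 powr a = 0\<close> in HOL, the weights below vanish at the origin, which is
  a null set.
\<close>

text \<open>The critical exponent \<open>2*_\<eta>\<close>, for \<open>0 \<le> \<eta> < N\<close>; the exponent \<open>2*\<close> is the case
  \<open>\<eta> = 0\<close>.\<close>

definition crit_exp :: "nat \<Rightarrow> real \<Rightarrow> ereal" where
  "crit_exp N \<eta> = (if N = 2 then \<infinity> else ereal (2 * (real N - \<eta>) / (real N - 2)))"

text \<open>\<open>weighted_L r \<eta>\<close> is \<open>L^r(R^N; |x|^(-\<eta>) dx)\<close>.\<close>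

definition weighted_L :: "real \<Rightarrow> real \<Rightarrow> (real ^ 'n \<Rightarrow> real) set" where
  "weighted_L r \<eta> = {u \<in> borel_measurable lebesgue.
     integrable lebesgue (\<lambda>x. \<bar>u x\<bar> powr r * norm x powr (- \<eta>))}"

definition L1_loc :: "(real ^ 'n \<Rightarrow> real) set" where
  "L1_loc = {u. \<forall>K. compact K \<longrightarrow> set_integrable lebesgue K u}"

definition Linfty_loc :: "(real ^ 'n) set \<Rightarrow> (real ^ 'n \<Rightarrow> real) set" where
  "Linfty_loc S = {u \<in> borel_measurable (lebesgue_on S).
     \<forall>K. compact K \<and> K \<subseteq> S \<longrightarrow> (\<exists>M. AE x in lebesgue. x \<in> K \<longrightarrow> \<bar>u x\<bar> \<le> M)}"

definition grad :: "(real ^ 'n \<Rightarrow> real) \<Rightarrow> real ^ 'n \<Rightarrow> real ^ 'n" where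
  "grad f x = (\<chi> i. frechet_derivative f (at x) (axis i 1))"

primrec C_k :: "nat \<Rightarrow> (real ^ 'n \<Rightarrow> real) \<Rightarrow> bool" where
  "C_k 0 f \<longleftrightarrow> continuous_on UNIV f"
| "C_k (Suc k) f \<longleftrightarrow> (\<forall>x. f differentiable (at x)) \<and> (\<forall>i. C_k k (\<lambda>x. grad f x $ i))"

definition test_functions :: "(real ^ 'n \<Rightarrow> real) set" where
  "test_functions = {v. (\<forall>k. C_k k v) \<and> compact (closure {x. v x \<noteq> 0})}"

definition has_weak_gradient ::
  "(real ^ 'n \<Rightarrow> real) \<Rightarrow> (real ^ 'n \<Rightarrow> real ^ 'n) \<Rightarrow> bool" where
  "has_weak_gradient u g \<longleftrightarrow> u \<in> L1_loc \<and> (\<forall>i. (\<lambda>x. g x $ i) \<in> L1_loc) \<and>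
     (\<forall>v \<in> test_functions. \<forall>i.
        (LINT x|lebesgue. u x * grad v x $ i) = - (LINT x|lebesgue. g x $ i * v x))"

text \<open>A weak gradient is unique up to a null set, so the choice of a representative does not
  affect the integrals below.\<close>

definition weak_grad :: "(real ^ 'n \<Rightarrow> real) \<Rightarrow> real ^ 'n \<Rightarrow> real ^ 'n" where
  "weak_grad u = (SOME g. has_weak_gradient u g)"

definition E_space :: "real \<Rightarrow> real \<Rightarrow> (real ^ 'n \<Rightarrow> real) set" where
  "E_space q b = {u \<in> weighted_L q b.
     \<exists>g. has_weak_gradient u g \<and> (\<forall>i. (\<lambda>x. g x $ i) \<in> weighted_L 2 0)}"

text \<open>Weak solutions of \<open>- \<Delta>u + |x|^(-b) |u|^(q-2) u = f(x,u)\<close>, for a Caratheodory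
  function \<open>f\<close>.\<close>

definition weak_solution ::
  "real \<Rightarrow> real \<Rightarrow> (real ^ 'n \<Rightarrow> real \<Rightarrow> real) \<Rightarrow> (real ^ 'n \<Rightarrow> real) \<Rightarrow> bool" where
  "weak_solution q b f u \<longleftrightarrow> u \<in> E_space q b \<and> (\<lambda>x. f x (u x)) \<in> L1_loc \<and>
     (\<forall>v \<in> test_functions.
        (LINT x|lebesgue. weak_grad u x \<bullet> grad v x)
        + (LINT x|lebesgue. \<bar>u x\<bar> powr (q - 2) * u x * v x * norm x powr (- b))
        = (LINT x|lebesgue. f x (u x) * v x))"

end

theory Submission
  imports Defs
begin

text \<open>
  Let \<open>N\<close> be the dimension and let \<open>A\<close>, \<open>B\<close>, \<open>C\<close> be the integrals of \<open>|\<nabla>u|^2\<close>, \<open>|u|^q |x|^(-b)\<close> and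
  \<open>|u|^r |x|^(-\<eta>)\<close>. Testing the equation with \<open>u\<close> and with \<open>x \<bullet> \<nabla>u\<close> should give the Nehari and the
  Pohozaev identities
    \<open>A + B = C\<close>  and  \<open>(N - 2)/2 A + (N - b)/q B = (N - \<eta>)/r C\<close>.
  Eliminating \<open>C\<close> leaves \<open>((N - \<eta>)/r - (N - 2)/2) A + ((N - \<eta>)/r - (N - b)/q) B = 0\<close>. As \<open>q\<close> is subcritical,
  \<open>(N - 2)/2 < (N - b)/q\<close>, and in both ranges of \<open>r\<close> the two coefficients do not have opposite signs.
  Hence \<open>B = 0\<close>, or \<open>A = 0\<close>; in the second case \<open>u(2x) = u(x)\<close> almost everywhere, and since \<open>b < N\<close> scaling
  forces \<open>B = 0\<close> as well (\<open>integral_identities\<close>, \<open>vanishing\<close>).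

  Neither test function is admissible, and \<open>u\<close> has only one weak derivative. No second derivatives are
  constructed: the field \<open>x \<bullet> \<nabla>u\<close> is replaced by the finite difference \<open>w = u(l x) - u(x)\<close>, and the
  equation is tested with \<open>\<psi> w\<close>, where \<open>\<psi>\<close> is the square of a cutoff supported in a shell around the origin.
  The algebraic identity \<open>2 a \<bullet> (c - a) = |c|^2 - |a|^2 - |c - a|^2\<close> and the convexity of powers turn each term
  into a difference of integrals that scale explicitly under dilations, plus a commutator living where
  \<open>\<nabla>\<psi> \<noteq> 0\<close>. The right-hand side is convex on the wrong side and leaves the defect
  \<open>\<psi> (f(u(l x)) - f(u(x))) w\<close> with \<open>f(s) = |s|^(r-2) s\<close> (\<open>dilation_inequality\<close>). This defect is \<open>o(l - 1)\<close> up to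
  half of the quadratic gain \<open>\<integral>\<psi> |\<nabla>w|^2\<close> (\<open>defect_small\<close>): for \<open>r \<le> 2\<close> by Hoelder continuity of \<open>f\<close>, for
  locally bounded \<open>u\<close> because \<open>w\<close> is \<open>O(l - 1)\<close> in \<open>L^2\<close> on shells (\<open>dilation_H1loc\<close>), and for \<open>2 < r \<le> 2*\<close> because
  \<open>|u|^(r-2)\<close> is form-bounded with small constant, which is where the Sobolev inequality enters. Dividing by
  \<open>l - 1\<close> and letting \<open>l\<close> tend to 1 from both sides gives Pohozaev's identity with an error controlled by the
  mass of the three densities near 0 and near infinity (\<open>pohozaev_local\<close>).

  For Nehari's identity the equation is tested with \<open>\<psi> u\<close>, and the error is a product of a scaled \<open>L^2\<close> mass and an
  energy on two dyadic shells (\<open>nehari_local\<close>). Far away the mass is bounded since \<open>q\<close> is subcritical. Near 0 it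
  grows at most linearly in the number of dyadic shells while the energies are summable, so the product is
  small along a subsequence: the harmonic series diverges (\<open>shell_product_small_near_zero\<close>).

  The equation is extended from smooth test functions to Sobolev functions by mollification
  (\<open>weak_eq_ext\<close>), and the Sobolev inequality is derived from the Gagliardo inequality (\<open>grid_lines\<close>,
  \<open>sobolev_step\<close>).
\<close>

section \<open>Smooth functions\<close>

text \<open>\<open>grad\<close> is defined through partial derivatives; it represents the Frechet derivative as an inner product, which is
  the form in which all calculus below is done.\<close>

lemma has_derivative_grad:
  fixes f :: "real ^ 'n \<Rightarrow> real"
  assumes "f differentiable (at x)"
  shows "(f has_derivative (\<lambda>h. grad f x \<bullet> h)) (at x)"
proof -
  let ?D = "frechet_derivative f (at x)"
  have D: "(f has_derivative ?D) (at x)"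
    using assms frechet_derivative_works by blast
  have lin: "linear ?D" using assms by (rule linear_frechet_derivative)
  have "?D h = grad f x \<bullet> h" for h
  proof -
    have "?D h = ?D (\<Sum>i\<in>UNIV. (h $ i) *\<^sub>R axis i 1)"
      using basis_expansion[of h] by (simp add: scalar_mult_eq_scaleR)
    also have "\<dots> = (\<Sum>i\<in>UNIV. h $ i * ?D (axis i 1))"
      by (simp add: linear_sum[OF lin] linear_scale[OF lin])
    also have "\<dots> = grad f x \<bullet> h"
      by (simp add: grad_def inner_vec_def mult.commute)
    finally show ?thesis .
  qed
  then show ?thesis using D by (metis (no_types, lifting) ext)
qed

lemma grad_eqI:
  fixes f :: "real ^ 'n \<Rightarrow> real"
  assumes "(f has_derivative (\<lambda>h. d \<bullet> h)) (at x)"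
  shows "grad f x = d"
proof -
  have "frechet_derivative f (at x) = (\<lambda>h. d \<bullet> h)"
    using frechet_derivative_at[OF assms] by simp
  then show ?thesis by (simp add: grad_def vec_eq_iff inner_axis)
qed

text \<open>The recursive clause of \<open>C_k\<close> mentions \<open>grad\<close>; this rule lets a candidate gradient be exhibited instead.\<close>

lemma C_k_SucI:
  fixes f :: "real ^ 'n \<Rightarrow> real"
  assumes "\<And>x. (f has_derivative (\<lambda>h. d x \<bullet> h)) (at x)"
    and "\<And>i. C_k k (\<lambda>x. d x $ i)"
  shows "C_k (Suc k) f"
proof -
  have "grad f = d" using grad_eqI[OF assms(1)] by auto
  then show ?thesis using assms differentiable_def by fastforce
qed

lemma C_k_Suc_lower: "C_k (Suc k) f \<Longrightarrow> C_k k f"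
proof (induction k arbitrary: f)
  case 0
  then show ?case
    by (simp add: continuous_at_imp_continuous_on differentiable_imp_continuous_within)
next
  case (Suc k)
  have "C_k k (\<lambda>x. grad f x $ i)" for i
    using Suc.prems by (intro Suc.IH) (simp only: C_k.simps(2)[of "Suc k"])
  then show ?case using Suc.prems by simp
qed

lemma C_k_const: "C_k k (\<lambda>x. c)"
proof (induction k arbitrary: c)
  case (Suc k)
  show ?case by (rule C_k_SucI[where d = "\<lambda>x. 0"]) (auto simp: Suc)
qed simp

lemma C_k_add: "C_k k f \<Longrightarrow> C_k k g \<Longrightarrow> C_k k (\<lambda>x. f x + g x)"
proof (induction k arbitrary: f g)
  case 0
  then show ?case by (auto intro: continuous_intros)
next
  case (Suc k)
  show ?case
  proof (rule C_k_SucI[where d = "\<lambda>x. grad f x + grad g x"])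
    show "((\<lambda>x. f x + g x) has_derivative (\<lambda>h. (grad f x + grad g x) \<bullet> h)) (at x)" for x
      using Suc.prems unfolding inner_add_left
      by (intro derivative_intros has_derivative_grad) auto
    show "C_k k (\<lambda>x. (grad f x + grad g x) $ i)" for i
      using Suc.IH Suc.prems by simp
  qed
qed

lemma C_k_mult: "C_k k f \<Longrightarrow> C_k k g \<Longrightarrow> C_k k (\<lambda>x. f x * g x)"
proof (induction k arbitrary: f g)
  case 0
  then show ?case by (auto intro: continuous_intros)
next
  case (Suc k)
  let ?d = "\<lambda>x. f x *\<^sub>R grad g x + g x *\<^sub>R grad f x"
  show ?case
  proof (rule C_k_SucI[where d = ?d])
    fix x
    have "((\<lambda>x. f x * g x) has_derivative (\<lambda>h. f x * (grad g x \<bullet> h) + (grad f x \<bullet> h) * g x)) (at x)"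
      using Suc.prems by (intro derivative_intros has_derivative_grad) auto
    then show "((\<lambda>x. f x * g x) has_derivative (\<lambda>h. ?d x \<bullet> h)) (at x)"
      by (simp add: inner_add_left mult.commute)
    have "C_k k f" "C_k k g" using Suc.prems by (auto intro: C_k_Suc_lower)
    then show "C_k k (\<lambda>x. ?d x $ i)" for i
      using Suc.prems by (auto intro!: C_k_add Suc.IH)
  qed
qed

lemma C_k_affine: "C_k k f \<Longrightarrow> C_k k (\<lambda>x. f (a + c *\<^sub>R x))"
proof (induction k arbitrary: f)
  case 0
  then show ?case
    by (auto intro!: continuous_intros continuous_on_compose2[of UNIV f])
next
  case (Suc k)
  let ?d = "\<lambda>x. c *\<^sub>R grad f (a + c *\<^sub>R x)"
  show ?case
  proof (rule C_k_SucI[where d = ?d])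
    fix x
    have "((\<lambda>x. a + c *\<^sub>R x) has_derivative (\<lambda>h. c *\<^sub>R h)) (at x)"
      by (auto intro!: derivative_eq_intros)
    moreover have "(f has_derivative (\<lambda>h. grad f (a + c *\<^sub>R x) \<bullet> h)) (at (a + c *\<^sub>R x))"
      using Suc.prems by (intro has_derivative_grad) auto
    ultimately have "((\<lambda>x. f (a + c *\<^sub>R x)) has_derivative (\<lambda>h. grad f (a + c *\<^sub>R x) \<bullet> (c *\<^sub>R h))) (at x)"
      by (rule has_derivative_compose)
    then show "((\<lambda>x. f (a + c *\<^sub>R x)) has_derivative (\<lambda>h. ?d x \<bullet> h)) (at x)"
      by simp
    have "C_k k (\<lambda>x. grad f (a + c *\<^sub>R x) $ i)" for i
      using Suc by auto
    then show "C_k k (\<lambda>x. ?d x $ i)" for i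
      by (auto intro!: C_k_mult C_k_const)
  qed
qed

lemma C_k_component: "C_k k (\<lambda>x :: real ^ 'n. x $ j)"
proof (cases k)
  case 0
  then show ?thesis by (auto intro!: continuous_intros)
next
  case (Suc m)
  have "C_k (Suc m) (\<lambda>x :: real ^ 'n. x $ j)"
    by (rule C_k_SucI[where d = "\<lambda>x. axis j 1"])
       (auto simp: inner_axis' C_k_const intro!: bounded_linear_imp_has_derivative bounded_linear_vec_nth)
  then show ?thesis using Suc by simp
qed

section \<open>A flat profile\<close>

text \<open>The extra powers of \<open>1/t\<close> make the family closed under differentiation, up to linear combinations, so that
  smoothness follows by induction over all members at once.\<close>

definition flat_exp :: "nat \<Rightarrow> real \<Rightarrow> real" where
  "flat_exp m t = (if t > 0 then exp (- 1 / t) / t ^ m else 0)"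

lemma power_le_fact_exp: "s \<ge> 0 \<Longrightarrow> s ^ n \<le> fact n * exp (s::real)"
proof -
  assume s: "s \<ge> 0"
  have "(\<Sum>k<Suc n. s ^ k / fact k) \<le> exp s"
    using s sum_le_suminf[OF summable_exp_generic[of s], of "{..<Suc n}"]
    by (simp add: exp_def divide_inverse mult.commute)
  moreover have "(\<Sum>k<n. s ^ k / fact k) \<ge> 0" using s by (intro sum_nonneg) auto
  ultimately have "s ^ n / fact n \<le> exp s" by simp
  then show ?thesis by (simp add: divide_le_eq mult.commute)
qed

text \<open>The factorial bound \<open>s^n \<le> n! e^s\<close> at \<open>s = 1/t\<close> beats every power of \<open>t\<close>; the square gives differentiability
  at 0.\<close>

lemma flat_exp_bound: "\<bar>flat_exp m t\<bar> \<le> fact (m + 2) * t\<^sup>2"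
proof (cases "t > 0")
  case True
  have "(1 / t) ^ (m + 2) \<le> fact (m + 2) * exp (1 / t)"
    using True by (intro power_le_fact_exp) auto
  then have "exp (- (1 / t)) * (1 / t) ^ (m + 2) \<le> exp (- (1 / t)) * (fact (m + 2) * exp (1 / t))"
    by (intro mult_left_mono) auto
  also have "\<dots> = fact (m + 2)" by (simp add: exp_minus del: fact_Suc)
  finally have "exp (- (1 / t)) / t ^ m / t\<^sup>2 \<le> fact (m + 2)"
    by (simp add: power_add power_one_over field_simps power2_eq_square del: fact_Suc)
  then have "exp (- (1 / t)) / t ^ m \<le> fact (m + 2) * t\<^sup>2"
    using True by (simp add: divide_le_eq mult_ac del: fact_Suc)
  then show ?thesis using True by (simp add: flat_exp_def del: fact_Suc)
qed (simp add: flat_exp_def)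

lemma flat_exp_deriv:
  "(flat_exp m has_real_derivative (flat_exp (m + 2) t - m * flat_exp (m + 1) t)) (at t)"
proof -
  consider "t > 0" | "t < 0" | "t = 0" by linarith
  then show ?thesis
  proof cases
    case 1
    have "((\<lambda>t. exp (- 1 / t) / t ^ m) has_real_derivative (flat_exp (m + 2) t - m * flat_exp (m + 1) t)) (at t)"
      using 1 by (auto intro!: derivative_eq_intros simp: flat_exp_def power2_eq_square field_simps; cases m; simp add: field_simps)
    then show ?thesis
      by (rule has_field_derivative_transform_within_open[where S = "{0<..}"])
         (use 1 in \<open>auto simp: flat_exp_def\<close>)
  next
    case 2
    have "((\<lambda>t. 0) has_real_derivative 0) (at t)" by simp
    then have "(flat_exp m has_real_derivative 0) (at t)"
      by (rule has_field_derivative_transform_within_open[where S = "{..<0}"])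
         (use 2 in \<open>auto simp: flat_exp_def\<close>)
    then show ?thesis using 2 by (simp add: flat_exp_def)
  next
    case 3
    have "((\<lambda>h::real. (fact (m + 2) :: real) * \<bar>h\<bar>) \<longlongrightarrow> fact (m + 2) * \<bar>0\<bar>) (at 0)"
      by (intro tendsto_intros)
    then have lim: "((\<lambda>h::real. (fact (m + 2) :: real) * \<bar>h\<bar>) \<longlongrightarrow> 0) (at 0)" by simp
    have "((\<lambda>h. flat_exp m h / h) \<longlongrightarrow> 0) (at 0)"
    proof (rule Lim_null_comparison[OF _ lim])
      show "\<forall>\<^sub>F h in at 0. norm (flat_exp m h / h) \<le> fact (m + 2) * \<bar>h\<bar>"
        using flat_exp_bound[of m]
        by (auto simp: eventually_at_filter divide_le_eq power2_eq_square abs_mult mult.assoc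
            intro!: always_eventually)
    qed
    then show ?thesis using 3 by (simp add: DERIV_def flat_exp_def)
  qed
qed

text \<open>The gradient of \<open>flat_exp m \<circ> s\<close> is a combination of higher members of the family times \<open>\<nabla>s\<close>, so the induction on
  the order of smoothness has to range over all \<open>m\<close>.\<close>

lemma C_k_flat_exp:
  fixes s :: "real ^ 'n \<Rightarrow> real"
  assumes "\<And>k. C_k k s"
  shows "C_k k (\<lambda>x. flat_exp m (s x))"
proof (induction k arbitrary: m)
  case 0
  have "continuous_on UNIV (flat_exp m)"
    using flat_exp_deriv by (meson DERIV_atLeastAtMost_imp_continuous_on DERIV_continuous continuous_at_imp_continuous_on)
  then show ?case using assms[of 0]
    by (auto intro!: continuous_on_compose2[of UNIV "flat_exp m"])
next
  case (Suc k)
  let ?d = "\<lambda>x. (flat_exp (m + 2) (s x) + (- real m) * flat_exp (m + 1) (s x)) *\<^sub>R grad s x"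
  have ck: "C_k k (\<lambda>x. (flat_exp (m + 2) (s x) + (- real m) * flat_exp (m + 1) (s x)) * grad s x $ i)" for i
    using assms[of "Suc k"] by (intro C_k_mult C_k_add C_k_const Suc) auto
  show ?case
  proof (rule C_k_SucI[where d = ?d])
    fix x
    have "(s has_derivative (\<lambda>h. grad s x \<bullet> h)) (at x)"
      using assms[of "Suc k"] by (intro has_derivative_grad) auto
    moreover have "(flat_exp m has_derivative (\<lambda>h. (flat_exp (m + 2) (s x) - m * flat_exp (m + 1) (s x)) * h)) (at (s x))"
      using flat_exp_deriv[of m "s x"] by (simp add: has_field_derivative_def)
    ultimately have "((\<lambda>x. flat_exp m (s x)) has_derivative
        (\<lambda>h. (flat_exp (m + 2) (s x) - m * flat_exp (m + 1) (s x)) * (grad s x \<bullet> h))) (at x)"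
      by (rule has_derivative_compose)
    then show "((\<lambda>x. flat_exp m (s x)) has_derivative (\<lambda>h. ?d x \<bullet> h)) (at x)" by simp
    show "C_k k (\<lambda>x. ?d x $ i)" for i using ck[of i] by simp
  qed
qed

lemma C_k_norm_sq: "C_k k (\<lambda>x :: real ^ 'n. x \<bullet> x)"
proof -
  have sum: "finite A \<Longrightarrow> C_k k (\<lambda>x :: real ^ 'n. \<Sum>i\<in>A. x $ i * x $ i)" for A
    by (induction rule: finite_induct) (auto intro!: C_k_const C_k_add C_k_mult C_k_component)
  show ?thesis unfolding inner_vec_def using sum by simp
qed

section \<open>Test functions\<close>

lemma test_functions_iff:
  "v \<in> test_functions \<longleftrightarrow> (\<forall>k. C_k k v) \<and> (\<exists>R. \<forall>x. v x \<noteq> 0 \<longrightarrow> norm x \<le> R)"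
proof -
  have "compact (closure {x. v x \<noteq> 0}) \<longleftrightarrow> bounded {x. v x \<noteq> 0}"
    by simp
  then show ?thesis by (auto simp: test_functions_def bounded_iff)
qed

lemma test_smooth: "v \<in> test_functions \<Longrightarrow> C_k k v"
  by (simp add: test_functions_iff)

lemma test_support:
  assumes "v \<in> test_functions"
  obtains R where "R > 0" "\<And>x. norm x > R \<Longrightarrow> v x = 0"
proof -
  obtain R where "\<And>x. v x \<noteq> 0 \<Longrightarrow> norm x \<le> R"
    using assms by (auto simp: test_functions_iff)
  then show ?thesis using that[of "max R 1"] by fastforce
qed

lemma test_differentiable: "v \<in> test_functions \<Longrightarrow> v differentiable (at x)"
  using test_smooth[of v "Suc 0"] by simp

lemma test_has_derivative: "v \<in> test_functions \<Longrightarrow> (v has_derivative (\<lambda>h. grad v x \<bullet> h)) (at x)"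
  by (simp add: has_derivative_grad test_differentiable)

lemma test_continuous: "v \<in> test_functions \<Longrightarrow> continuous_on UNIV v"
  using test_smooth[of v 0] by simp

lemma test_borel [measurable_dest]: "v \<in> test_functions \<Longrightarrow> v \<in> borel_measurable borel"
  by (simp add: borel_measurable_continuous_onI test_continuous)

lemma grad_zero_outside:
  fixes v :: "real ^ 'n \<Rightarrow> real"
  assumes "open S" "x \<in> S" "\<And>y. y \<in> S \<Longrightarrow> v y = c"
  shows "grad v x = 0"
proof (rule grad_eqI)
  have "((\<lambda>_. c) has_derivative (\<lambda>h. 0 \<bullet> h)) (at x)" by simp
  then show "(v has_derivative (\<lambda>h. 0 \<bullet> h)) (at x)"
    by (rule has_derivative_transform_within_open[OF _ assms(1,2)]) (use assms in auto)
qed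

lemma test_grad: "v \<in> test_functions \<Longrightarrow> (\<lambda>x. grad v x $ i) \<in> test_functions"
proof -
  assume v: "v \<in> test_functions"
  obtain R where R: "\<And>x. norm x > R \<Longrightarrow> v x = 0" using test_support[OF v] by metis
  have "grad v x = 0" if "norm x > R" for x
    by (rule grad_zero_outside[of "{x. norm x > R}" _ _ 0])
       (use R that in \<open>auto intro!: open_Collect_less continuous_intros\<close>)
  then have "\<forall>x. grad v x $ i \<noteq> 0 \<longrightarrow> norm x \<le> R" by (metis not_le zero_index)
  moreover have "\<forall>k. C_k k (\<lambda>x. grad v x $ i)" using test_smooth[OF v, of "Suc _"] by simp
  ultimately show ?thesis unfolding test_functions_iff by blast
qed

lemma test_smooth_mult:
  assumes "v \<in> test_functions" "\<And>k. C_k k f"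
  shows "(\<lambda>x. f x * v x) \<in> test_functions"
  using assms by (force simp: test_functions_iff intro: C_k_mult)

lemma test_mult: "v \<in> test_functions \<Longrightarrow> w \<in> test_functions \<Longrightarrow> (\<lambda>x. v x * w x) \<in> test_functions"
  by (simp add: test_smooth test_smooth_mult)

lemma test_cmult: "v \<in> test_functions \<Longrightarrow> (\<lambda>x. c * v x) \<in> test_functions"
  by (intro test_smooth_mult C_k_const)

lemma test_add:
  assumes "v \<in> test_functions" "w \<in> test_functions"
  shows "(\<lambda>x. v x + w x) \<in> test_functions"
proof -
  obtain R where "\<And>x. norm x > R \<Longrightarrow> v x = 0" using test_support[OF assms(1)] by metis
  moreover obtain S where "\<And>x. norm x > S \<Longrightarrow> w x = 0" using test_support[OF assms(2)] by metis
  ultimately have "\<forall>x. v x + w x \<noteq> 0 \<longrightarrow> norm x \<le> max R S"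
    by (metis add_0 le_max_iff_disj not_le)
  then show ?thesis using assms by (auto simp: test_functions_iff intro: C_k_add)
qed

lemma test_diff: "v \<in> test_functions \<Longrightarrow> w \<in> test_functions \<Longrightarrow> (\<lambda>x. v x - w x) \<in> test_functions"
  using test_add[of v "\<lambda>x. -1 * w x"] test_cmult[of w "-1"] by simp

lemma test_affine:
  assumes "v \<in> test_functions" "c \<noteq> 0"
  shows "(\<lambda>x. v (a + c *\<^sub>R x)) \<in> test_functions"
proof -
  obtain R where R: "\<And>x. norm x > R \<Longrightarrow> v x = 0" using test_support[OF assms(1)] by metis
  have "norm x \<le> (R + norm a) / \<bar>c\<bar>" if "v (a + c *\<^sub>R x) \<noteq> 0" for x
  proof -
    have "norm (a + c *\<^sub>R x) \<le> R" using R that by (meson not_le)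
    moreover have "norm (c *\<^sub>R x) \<le> norm (a + c *\<^sub>R x) + norm a"
      using norm_triangle_ineq4[of "a + c *\<^sub>R x" a] by simp
    ultimately show ?thesis using assms(2) by (simp add: field_simps)
  qed
  then show ?thesis using assms by (auto simp: test_functions_iff intro!: C_k_affine)
qed

lemma grad_affine:
  assumes "v \<in> test_functions"
  shows "grad (\<lambda>x. v (a + c *\<^sub>R x)) x = c *\<^sub>R grad v (a + c *\<^sub>R x)"
proof (rule grad_eqI)
  have "((\<lambda>x. a + c *\<^sub>R x) has_derivative (\<lambda>h. c *\<^sub>R h)) (at x)"
    by (auto intro!: derivative_eq_intros)
  from has_derivative_compose[OF this test_has_derivative[OF assms]]
  show "((\<lambda>x. v (a + c *\<^sub>R x)) has_derivative (\<lambda>h. (c *\<^sub>R grad v (a + c *\<^sub>R x)) \<bullet> h)) (at x)"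
    by simp
qed

lemma grad_mult:
  assumes "v \<in> test_functions" "w \<in> test_functions"
  shows "grad (\<lambda>x. v x * w x) x = v x *\<^sub>R grad w x + w x *\<^sub>R grad v x"
proof (rule grad_eqI)
  have "((\<lambda>x. v x * w x) has_derivative (\<lambda>h. v x * (grad w x \<bullet> h) + (grad v x \<bullet> h) * w x)) (at x)"
    using assms by (intro derivative_intros test_has_derivative) auto
  then show "((\<lambda>x. v x * w x) has_derivative (\<lambda>h. (v x *\<^sub>R grad w x + w x *\<^sub>R grad v x) \<bullet> h)) (at x)"
    by (simp add: inner_add_left mult.commute)
qed

lemma grad_diff:
  assumes "v \<in> test_functions" "w \<in> test_functions"
  shows "grad (\<lambda>x. v x - w x) x = grad v x - grad w x"
  by (rule grad_eqI) (auto simp: inner_diff_left intro!: derivative_intros test_has_derivative assms)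

lemma test_bounded:
  assumes v: "v \<in> test_functions"
  obtains B where "B > 0" "\<And>x. \<bar>v x\<bar> \<le> B"
proof -
  obtain R where R: "\<And>x. norm x > R \<Longrightarrow> v x = 0" using test_support[OF v] by metis
  have "compact (v ` cball 0 R)"
    by (intro compact_continuous_image continuous_on_subset[OF test_continuous[OF v]]) auto
  then have "bounded (v ` cball 0 R)" by (rule compact_imp_bounded)
  then obtain B where "B > 0" "\<forall>y\<in>v ` cball 0 R. norm y \<le> B"
    unfolding bounded_pos by blast
  then have B: "\<And>x. norm x \<le> R \<Longrightarrow> \<bar>v x\<bar> \<le> B" "B > 0" by auto
  have "\<bar>v x\<bar> \<le> B" for x using B R[of x] by (cases "norm x \<le> R") auto
  then show ?thesis using B(2) that by blast
qed

lemma test_grad_bounded: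
  fixes v :: "real ^ 'n \<Rightarrow> real"
  assumes v: "v \<in> test_functions"
  obtains B where "B > 0" "\<And>x. norm (grad v x) \<le> B"
proof -
  have "\<exists>B>0. \<forall>x. \<bar>grad v x $ i\<bar> \<le> B" for i
    using test_bounded[OF test_grad[OF v]] by metis
  then obtain B where B: "\<And>i. B i > 0" "\<And>i x. \<bar>grad v x $ i\<bar> \<le> B i" by metis
  have "norm (grad v x) \<le> (\<Sum>i\<in>UNIV. B i)" for x
    by (rule order_trans[OF norm_le_l1_cart]) (auto intro!: sum_mono B)
  moreover have "(\<Sum>i\<in>UNIV. B i) > 0" using B by (intro sum_pos) auto
  ultimately show ?thesis using that by blast
qed

lemma test_lipschitz:
  fixes v :: "real ^ 'n \<Rightarrow> real"
  assumes v: "v \<in> test_functions"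
  obtains L where "L > 0" "\<And>x y. \<bar>v x - v y\<bar> \<le> L * norm (x - y)"
proof -
  obtain L where L: "L > 0" "\<And>x. norm (grad v x) \<le> L" using test_grad_bounded[OF v] by metis
  have "norm (v x - v y) \<le> L * norm (x - y)" for x y
  proof (rule differentiable_bound[of UNIV v "\<lambda>x h. grad v x \<bullet> h"])
    show "onorm (\<lambda>h. grad v x \<bullet> h) \<le> L" for x
    proof (rule onorm_le)
      fix y :: "real ^ 'n"
      have "norm (grad v x) * norm y \<le> L * norm y" using L(2) by (simp add: mult_right_mono)
      then show "norm (grad v x \<bullet> y) \<le> L * norm y"
        using Cauchy_Schwarz_ineq2[of "grad v x" y] by simp
    qed
  qed (auto simp: test_has_derivative[OF v])
  then show ?thesis using L(1) that by (metis real_norm_def)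
qed

lemma test_grad_lipschitz:
  fixes v :: "real ^ 'n \<Rightarrow> real"
  assumes v: "v \<in> test_functions"
  obtains L where "L > 0" "\<And>x y. norm (grad v x - grad v y) \<le> L * norm (x - y)"
proof -
  have "\<exists>L>0. \<forall>x y. \<bar>grad v x $ i - grad v y $ i\<bar> \<le> L * norm (x - y)" for i
    using test_lipschitz[OF test_grad[OF v]] by metis
  then obtain L where L: "\<And>i. L i > 0" "\<And>i x y. \<bar>grad v x $ i - grad v y $ i\<bar> \<le> L i * norm (x - y)" by metis
  have "norm (grad v x - grad v y) \<le> (\<Sum>i\<in>UNIV. L i) * norm (x - y)" for x y
    by (rule order_trans[OF norm_le_l1_cart]) (auto intro!: sum_mono L simp: sum_distrib_right)
  moreover have "(\<Sum>i\<in>UNIV. L i) > 0" using L by (intro sum_pos) auto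
  ultimately show ?thesis using that by blast
qed

text \<open>The second order remainder is uniform because the gradient of a test function is again made of test functions,
  hence Lipschitz. This replaces differentiation under the integral sign for convolutions.\<close>

lemma test_taylor:
  fixes v :: "real ^ 'n \<Rightarrow> real"
  assumes v: "v \<in> test_functions"
  obtains L where "L > 0" "\<And>x h. \<bar>v (x + h) - v x - grad v x \<bullet> h\<bar> \<le> L * norm h ^ 2"
proof -
  obtain L where L: "L > 0" "\<And>x y. norm (grad v x - grad v y) \<le> L * norm (x - y)"
    using test_grad_lipschitz[OF v] by metis
  have "norm (v (x + h) - v x - grad v x \<bullet> (x + h - x)) \<le> norm (x + h - x) * (L * norm h)" for x h
  proof (rule differentiable_bound_linearization[of x "x + h" "cball x (norm h)" v "\<lambda>x h. grad v x \<bullet> h"])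
    show "x + t *\<^sub>R (x + h - x) \<in> cball x (norm h)" if "t \<in> {0..1}" for t
      using that by (auto simp: dist_norm mult_left_le_one_le)
    show "(v has_derivative (\<bullet>) (grad v y)) (at y within cball x (norm h))" for y
      using test_has_derivative[OF v, of y] by (simp add: has_derivative_at_withinI)
    show "onorm ((\<bullet>) (grad v y) - (\<bullet>) (grad v x)) \<le> L * norm h" if "y \<in> cball x (norm h)" for y
    proof (rule onorm_le)
      fix i :: "real ^ 'n"
      have "norm (grad v y - grad v x) \<le> L * norm (y - x)" by (rule L)
      also have "\<dots> \<le> L * norm h" using that L(1) by (simp add: dist_norm norm_minus_commute)
      finally have "norm (grad v y - grad v x) * norm i \<le> L * norm h * norm i"
        by (simp add: mult_right_mono)
      then show "norm (((\<bullet>) (grad v y) - (\<bullet>) (grad v x)) i) \<le> L * norm h * norm i"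
        using Cauchy_Schwarz_ineq2[of "grad v y - grad v x" i] by (simp add: inner_diff_left)
    qed
  qed auto
  then show ?thesis using that[of L] L(1) by (simp add: power2_eq_square mult_ac)
qed

section \<open>Affine changes of variable\<close>

lemma nn_integral_affine:
  fixes f :: "real ^ 'n \<Rightarrow> ennreal"
  assumes [measurable]: "f \<in> borel_measurable borel" and c: "c \<noteq> 0"
  shows "(\<integral>\<^sup>+x. f x \<partial>lborel) = ennreal (\<bar>c\<bar> ^ CARD('n)) * (\<integral>\<^sup>+x. f (t + c *\<^sub>R x) \<partial>lborel)"
  by (subst lborel_affine[OF c, of t])
     (simp add: nn_integral_density nn_integral_distr nn_integral_cmult)

lemma integrable_affine:
  fixes f :: "real ^ 'n \<Rightarrow> 'a :: {banach, second_countable_topology}"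
  assumes f: "integrable lborel f" and c: "c \<noteq> 0"
  shows "integrable lborel (\<lambda>x. f (t + c *\<^sub>R x))"
proof -
  have [measurable]: "f \<in> borel_measurable borel" using f by auto
  show ?thesis
    using f c unfolding integrable_iff_bounded
    by (subst (asm) nn_integral_affine[where c = c and t = t]) (auto simp: ennreal_mult_less_top)
qed

lemma integral_affine:
  fixes f :: "real ^ 'n \<Rightarrow> 'a :: {banach, second_countable_topology}"
  assumes [measurable]: "f \<in> borel_measurable borel" and c: "c \<noteq> 0"
  shows "(LBINT x. f x) = (\<bar>c\<bar> ^ CARD('n)) *\<^sub>R (LBINT x. f (t + c *\<^sub>R x))"
  by (subst lborel_affine[OF c, of t])
     (simp add: integral_density integral_distr)

lemma integral_translate:
  fixes f :: "real ^ 'n \<Rightarrow> real"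
  assumes "f \<in> borel_measurable borel"
  shows "(LBINT x. f (x + t)) = (LBINT x. f x)"
  using integral_affine[OF assms, of 1 t] by (simp add: add.commute)

lemma integrable_translate:
  fixes f :: "real ^ 'n \<Rightarrow> real"
  assumes "integrable lborel f"
  shows "integrable lborel (\<lambda>x. f (x + t))"
  using integrable_affine[OF assms, of 1 t] by (simp add: add.commute)

section \<open>Inequalities for real powers\<close>

text \<open>Convexity of \<open>t^p\<close> as a supporting line at \<open>s\<close>, a form of Young's inequality. With \<open>0 powr 0 = 0\<close> it also holds at
  \<open>s = 0\<close>.\<close>

lemma powr_tangent:
  fixes p s t :: real
  assumes "p \<ge> 1" "s \<ge> 0" "t \<ge> 0"
  shows "s powr p + p * s powr (p - 1) * (t - s) \<le> t powr p"
proof (cases "s = 0 \<or> t = 0")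
  case True
  have "s powr (p - 1) * s = s powr p" if "s > 0" using that powr_mult_base[of s "p - 1"] by (simp add: mult.commute)
  then have "s powr p \<le> p * (s powr (p - 1) * s)" using assms
    by (cases "s = 0") (auto simp: mult_le_cancel_right1 mult_right_mono)
  with True show ?thesis using assms by (auto simp: algebra_simps)
next
  case False
  then have pos: "s > 0" "t > 0" using assms by auto
  have "(t powr p) powr (1 / p) * (s powr p) powr (1 - 1 / p) \<le> (1 / p) * t powr p + (1 - 1 / p) * s powr p"
    using assms pos by (intro Youngs_inequality_0) (auto simp: divide_le_eq)
  moreover have "(t powr p) powr (1 / p) = t" using assms pos by (simp add: powr_powr)
  moreover have "(s powr p) powr (1 - 1 / p) = s powr (p - 1)"
    using assms by (simp add: powr_powr right_diff_distrib)
  ultimately have "t * s powr (p - 1) \<le> (1 / p) * t powr p + (1 - 1 / p) * s powr p" by simp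
  then have "p * (t * s powr (p - 1)) \<le> p * ((1 / p) * t powr p + (1 - 1 / p) * s powr p)"
    using assms by (intro mult_left_mono) auto
  also have "\<dots> = t powr p + (p - 1) * s powr p" using assms by (simp add: algebra_simps)
  finally have *: "p * (t * s powr (p - 1)) \<le> t powr p + (p - 1) * s powr p" .
  have "s * s powr (p - 1) = s powr p" using pos powr_mult_base[of s "p - 1"] by simp
  then have "p * s powr (p - 1) * (t - s) = p * (t * s powr (p - 1)) - p * s powr p"
    by (metis (no_types, opaque_lifting) mult.assoc mult.commute right_diff_distrib)
  moreover have "(p - 1) * s powr p = p * s powr p - s powr p" by (simp add: left_diff_distrib)
  ultimately show ?thesis using * by linarith
qed

lemma powr_sum3_le:
  fixes a b c p :: real
  assumes "p \<ge> 0"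
  shows "\<bar>a + b + c\<bar> powr p \<le> 3 powr p * (\<bar>a\<bar> powr p + \<bar>b\<bar> powr p + \<bar>c\<bar> powr p)"
proof -
  define m where "m = max \<bar>a\<bar> (max \<bar>b\<bar> \<bar>c\<bar>)"
  have "\<bar>a + b + c\<bar> powr p \<le> (3 * m) powr p" using assms by (intro powr_mono2) (auto simp: m_def)
  also have "\<dots> = 3 powr p * m powr p" by (subst powr_mult) (auto simp: m_def)
  also have "m powr p \<le> \<bar>a\<bar> powr p + \<bar>b\<bar> powr p + \<bar>c\<bar> powr p"
    unfolding m_def max_def by auto
  finally show ?thesis by simp
qed

lemma powr_sum2_le:
  fixes a b p :: real
  assumes "p \<ge> 0"
  shows "\<bar>a + b\<bar> powr p \<le> 2 powr p * (\<bar>a\<bar> powr p + \<bar>b\<bar> powr p)"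
proof -
  define m where "m = max \<bar>a\<bar> \<bar>b\<bar>"
  have "\<bar>a + b\<bar> powr p \<le> (2 * m) powr p" using assms by (intro powr_mono2) (auto simp: m_def)
  also have "\<dots> = 2 powr p * m powr p" by (subst powr_mult) (auto simp: m_def)
  also have "m powr p \<le> \<bar>a\<bar> powr p + \<bar>b\<bar> powr p"
    unfolding m_def max_def by auto
  finally show ?thesis by simp
qed

lemma powr_diff2_le:
  fixes a b p :: real
  assumes "p \<ge> 0"
  shows "\<bar>a - b\<bar> powr p \<le> 2 powr p * (\<bar>a\<bar> powr p + \<bar>b\<bar> powr p)"
  using powr_sum2_le[OF assms, of a "-b"] by simp

section \<open>Continuity of translations in \<open>L^p\<close>\<close>

text \<open>Enclose \<open>A\<close> in an open set \<open>U\<close> of almost the same measure. A point of \<open>A\<close> shifted out of \<open>A\<close> either leaves \<open>U\<close>, which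
  happens on a set of vanishing measure by dominated convergence, or lands in \<open>U - A\<close>, which is small.\<close>

lemma translation_continuous_indicator:
  fixes A :: "(real ^ 'n) set"
  assumes A[measurable]: "A \<in> sets borel" and fin: "emeasure lborel A < \<infinity>" and h: "h \<longlonglongrightarrow> (0 :: real ^ 'n)"
  shows "(\<lambda>n. LBINT x. indicator A x * indicator (- A) (x + h n)) \<longlonglongrightarrow> (0 :: real)"
proof (rule LIMSEQ_I)
  fix e :: real assume e: "e > 0"
  obtain U where U: "open U" "A \<subseteq> U" "emeasure lborel (U - A) < ennreal (e / 2)"
    using outer_regular_lborel[OF A, of "e / 2"] e by auto
  have [measurable]: "U \<in> sets borel" using U(1) by simp
  have intA: "integrable lborel (indicator A :: _ \<Rightarrow> real)"
    using fin by (simp add: integrable_indicator_iff)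
  have intUA: "integrable lborel (indicator (U - A) :: _ \<Rightarrow> real)"
    using U(3) by (auto simp: integrable_indicator_iff intro: less_trans)
  have mUA: "measure lborel (U - A) < e / 2"
    using U(3) e by (metis emeasure_eq_ennreal_measure ennreal_less_iff half_gt_zero_iff less_imp_le
        measure_nonneg order.strict_trans ennreal_less_top top.not_eq_extremum)
  have "(\<lambda>n. LBINT x. indicator A x * indicator (- U) (x + h n)) \<longlonglongrightarrow> (\<integral>x. (0 :: real) \<partial>(lborel :: (real ^ 'n) measure))"
  proof (rule integral_dominated_convergence[where w = "indicator A"])
    show "AE x in lborel. (\<lambda>n. indicator A x * indicator (- U) (x + h n)) \<longlonglongrightarrow> (0 :: real)"
    proof (rule AE_I2)
      fix x
      show "(\<lambda>n. indicator A x * indicator (- U) (x + h n)) \<longlonglongrightarrow> (0 :: real)"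
      proof (cases "x \<in> A")
        case True
        have "(\<lambda>n. x + h n) \<longlonglongrightarrow> x + 0" by (intro tendsto_intros h)
        then have "\<forall>\<^sub>F n in sequentially. x + h n \<in> U"
          using topological_tendstoD[of "\<lambda>n. x + h n" x sequentially U] U True by auto
        then have "\<forall>\<^sub>F n in sequentially. indicator A x * indicator (- U) (x + h n) = (0 :: real)"
          by eventually_elim simp
        then show ?thesis by (rule tendsto_eventually)
      qed simp
    qed
    show "AE x in lborel. norm (indicator A x * indicator (- U) (x + h n) :: real) \<le> indicator A x" for n
      by (auto simp: indicator_def)
    show "integrable lborel (indicator A :: _ \<Rightarrow> real)" by (rule intA)
  qed measurable
  then have "\<forall>\<^sub>F n in sequentially. (LBINT x. indicator A x * indicator (- U) (x + h n)) < e / 2"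
    using e by (intro order_tendstoD) auto
  then obtain n0 where n0: "\<And>n. n \<ge> n0 \<Longrightarrow> (LBINT x. indicator A x * indicator (- U) (x + h n)) < e / 2"
    by (auto simp: eventually_sequentially)
  have "norm ((LBINT x. indicator A x * indicator (- A) (x + h n)) - (0 :: real)) < e" if "n \<ge> n0" for n
  proof -
    have i1: "integrable lborel (\<lambda>x. indicator A x * indicator (- U) (x + h n) :: real)"
      by (rule Bochner_Integration.integrable_bound[OF intA]) (auto simp: indicator_def)
    have i2: "integrable lborel (\<lambda>x. indicator (U - A) (x + h n) :: real)"
      using integrable_translate[OF intUA] .
    have "(LBINT x. indicator A x * indicator (- A) (x + h n))
        \<le> (LBINT x. indicator A x * indicator (- U) (x + h n) + (indicator (U - A) (x + h n) :: real))"
      by (rule integral_mono')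
         (use i1 i2 in \<open>auto simp: indicator_def\<close>)
    also have "\<dots> = (LBINT x. indicator A x * indicator (- U) (x + h n)) + measure lborel (U - A)"
      using i1 i2 integral_translate[of "indicator (U - A)" "h n"] by simp
    also have "\<dots> < e" using n0[OF that] mUA by simp
    finally have "(LBINT x. indicator A x * indicator (- A) (x + h n)) < e" .
    moreover have "(LBINT x. indicator A x * indicator (- A) (x + h n)) \<ge> (0 :: real)"
      by (intro integral_nonneg_AE) auto
    ultimately show ?thesis by (simp add: abs_of_nonneg)
  qed
  then show "\<exists>no. \<forall>n\<ge>no. norm ((LBINT x. indicator A x * indicator (- A) (x + h n)) - (0 :: real)) < e" by blast
qed

lemma translation_continuous_L1:
  fixes w :: "real ^ 'n \<Rightarrow> real"
  assumes "integrable lborel w" and h: "h \<longlonglongrightarrow> 0"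
  shows "(\<lambda>n. LBINT x. \<bar>w (x + h n) - w x\<bar>) \<longlonglongrightarrow> 0"
  using assms(1)
proof (induction rule: integrable_induct)
  case (base A c)
  then have [measurable]: "A \<in> sets borel" and fin: "emeasure lborel A < \<infinity>" by auto
  have intA: "integrable lborel (indicator A :: _ \<Rightarrow> real)"
    using fin by (simp add: integrable_indicator_iff)
  define F :: "real ^ 'n \<Rightarrow> real" where "F k = (LBINT x. indicator A x * indicator (- A) (x + k))" for k
  have i1: "integrable lborel (\<lambda>x. indicator A x * indicator (- A) (x + k) :: real)" for k
    by (rule Bochner_Integration.integrable_bound[OF intA]) (auto simp: indicator_def)
  have "(LBINT x. \<bar>indicat_real A (x + k) *\<^sub>R c - indicat_real A x *\<^sub>R c\<bar>) = \<bar>c\<bar> * (F k + F (- k))" for k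
  proof -
    have "F (- k) = (LBINT x. indicator A (x + k) * indicator (- A) x)"
      unfolding F_def
      using integral_translate[of "\<lambda>x. indicator A x * indicator (- A) (x + - k)" k] by simp
    moreover have "integrable lborel (\<lambda>x. indicator A (x + k) * indicator (- A) x :: real)"
      using integrable_translate[OF i1[of "-k"], of k] by simp
    ultimately have "F k + F (- k) = (LBINT x. indicator A x * indicator (- A) (x + k) + indicator A (x + k) * indicator (- A) x)"
      using i1[of k] by (simp add: F_def)
    then have "\<bar>c\<bar> * (F k + F (- k)) = (LBINT x. \<bar>c\<bar> * (indicator A x * indicator (- A) (x + k) + indicator A (x + k) * indicator (- A) x))"
      by simp
    also have "\<dots> = (LBINT x. \<bar>indicat_real A (x + k) *\<^sub>R c - indicat_real A x *\<^sub>R c\<bar>)"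
      by (intro Bochner_Integration.integral_cong) (auto simp: indicator_def)
    finally show ?thesis by simp
  qed
  moreover have "(\<lambda>n. \<bar>c\<bar> * (F (h n) + F (- h n))) \<longlonglongrightarrow> \<bar>c\<bar> * (0 + 0)"
    unfolding F_def
    using tendsto_minus[OF h]
    by (intro tendsto_intros translation_continuous_indicator fin h) auto
  ultimately show ?case by simp
next
  case (add f g)
  have f[measurable]: "f \<in> borel_measurable borel" and g[measurable]: "g \<in> borel_measurable borel" using add by auto
  have i: "integrable lborel (\<lambda>x. \<bar>f (x + k) - f x\<bar>)" "integrable lborel (\<lambda>x. \<bar>g (x + k) - g x\<bar>)" for k
    using add.hyps by (auto intro!: integrable_abs Bochner_Integration.integrable_diff integrable_translate)
  have lim: "(\<lambda>n. (LBINT x. \<bar>f (x + h n) - f x\<bar>) + (LBINT x. \<bar>g (x + h n) - g x\<bar>)) \<longlonglongrightarrow> 0"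
    using tendsto_add[OF add.IH] by simp
  show ?case
  proof (rule Lim_null_comparison[OF _ lim], rule always_eventually, rule allI)
    fix n
    have "(LBINT x. \<bar>f (x + h n) + g (x + h n) - (f x + g x)\<bar>) \<le> (LBINT x. \<bar>f (x + h n) - f x\<bar> + \<bar>g (x + h n) - g x\<bar>)"
      by (rule integral_mono') (use i in auto)
    also have "\<dots> = (LBINT x. \<bar>f (x + h n) - f x\<bar>) + (LBINT x. \<bar>g (x + h n) - g x\<bar>)"
      using i by simp
    finally show "norm (LBINT x. \<bar>f (x + h n) + g (x + h n) - (f x + g x)\<bar>) \<le> \<dots>"
      by simp
  qed
next
  case (lim f s)
  have [measurable]: "f \<in> borel_measurable borel" "\<And>i. s i \<in> borel_measurable borel" using lim by auto
  have "(\<lambda>i. LBINT x. \<bar>s i x - f x\<bar>) \<longlonglongrightarrow> (\<integral>x. 0 \<partial>(lborel :: (real ^ 'n) measure))"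
  proof (rule integral_dominated_convergence[where w = "\<lambda>x. 3 * \<bar>f x\<bar>"])
    show "AE x in lborel. (\<lambda>i. \<bar>s i x - f x\<bar>) \<longlonglongrightarrow> 0"
      using lim.hyps(2) by (intro AE_I2) (auto simp: tendsto_rabs_zero_iff LIM_zero_iff)
    show "AE x in lborel. norm \<bar>s i x - f x\<bar> \<le> 3 * \<bar>f x\<bar>" for i
    proof (rule AE_I2)
      fix x show "norm \<bar>s i x - f x\<bar> \<le> 3 * \<bar>f x\<bar>" using lim.hyps(3)[of x i] by auto
    qed
    show "integrable lborel (\<lambda>x. 3 * \<bar>f x\<bar>)" using lim by auto
  qed measurable
  then have limS: "(\<lambda>i. LBINT x. \<bar>s i x - f x\<bar>) \<longlonglongrightarrow> 0" by simp
  show ?case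
  proof (rule LIMSEQ_I)
    fix e :: real assume e: "e > 0"
    obtain i where i: "(LBINT x. \<bar>s i x - f x\<bar>) < e / 4"
      using order_tendstoD(2)[OF limS, of "e / 4"] e by (auto simp: eventually_sequentially)
    obtain n0 where n0: "\<And>n. n \<ge> n0 \<Longrightarrow> (LBINT x. \<bar>s i (x + h n) - s i x\<bar>) < e / 4"
      using order_tendstoD(2)[OF lim.IH[of i], of "e / 4"] e by (auto simp: eventually_sequentially)
    have "norm ((LBINT x. \<bar>f (x + h n) - f x\<bar>) - 0) < e" if "n \<ge> n0" for n
    proof -
      have i1: "integrable lborel (\<lambda>x. \<bar>s i x - f x\<bar>)" using lim by auto
      have i2: "integrable lborel (\<lambda>x. \<bar>s i (x + h n) - f (x + h n)\<bar>)"
        using integrable_translate[OF i1] .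
      have i3: "integrable lborel (\<lambda>x. \<bar>s i (x + h n) - s i x\<bar>)"
        using lim.hyps by (auto intro!: integrable_abs Bochner_Integration.integrable_diff integrable_translate)
      have "(LBINT x. \<bar>f (x + h n) - f x\<bar>) \<le>
         (LBINT x. \<bar>s i (x + h n) - f (x + h n)\<bar> + \<bar>s i (x + h n) - s i x\<bar> + \<bar>s i x - f x\<bar>)"
        by (rule integral_mono') (use i1 i2 i3 in auto)
      also have "\<dots> = (LBINT x. \<bar>s i (x + h n) - f (x + h n)\<bar>) + (LBINT x. \<bar>s i (x + h n) - s i x\<bar>)
          + (LBINT x. \<bar>s i x - f x\<bar>)"
        using i1 i2 i3 by simp
      also have "(LBINT x. \<bar>s i (x + h n) - f (x + h n)\<bar>) = (LBINT x. \<bar>s i x - f x\<bar>)"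
        by (rule integral_translate[of "\<lambda>x. \<bar>s i x - f x\<bar>"]) measurable
      also have "\<dots> + (LBINT x. \<bar>s i (x + h n) - s i x\<bar>) + (LBINT x. \<bar>s i x - f x\<bar>) < e"
        using i n0[OF that] e by linarith
      finally have "(LBINT x. \<bar>f (x + h n) - f x\<bar>) < e" .
      moreover have "(LBINT x. \<bar>f (x + h n) - f x\<bar>) \<ge> 0" by simp
      ultimately show ?thesis by simp
    qed
    then show "\<exists>no. \<forall>n\<ge>no. norm ((LBINT x. \<bar>f (x + h n) - f x\<bar>) - 0) < e" by blast
  qed
qed

lemma integrable_powr_diff:
  fixes f g :: "'a \<Rightarrow> real"
  assumes "p \<ge> 0" "f \<in> borel_measurable M" "g \<in> borel_measurable M"
    "integrable M (\<lambda>x. \<bar>f x\<bar> powr p)" "integrable M (\<lambda>x. \<bar>g x\<bar> powr p)"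
  shows "integrable M (\<lambda>x. \<bar>f x - g x\<bar> powr p)"
proof (rule Bochner_Integration.integrable_bound)
  show "integrable M (\<lambda>x. 2 powr p * (\<bar>f x\<bar> powr p + \<bar>g x\<bar> powr p))" using assms by auto
  show "AE x in M. norm (\<bar>f x - g x\<bar> powr p) \<le> norm (2 powr p * (\<bar>f x\<bar> powr p + \<bar>g x\<bar> powr p))"
    using powr_diff2_le[OF assms(1)] by (auto simp: abs_mult)
qed (use assms in measurable)

text \<open>Truncation at a large height costs little in \<open>L^p\<close>, and for bounded functions the \<open>L^p\<close> modulus is controlled by the
  \<open>L^1\<close> modulus.\<close>

lemma translation_continuous_Lp:
  fixes w :: "real ^ 'n \<Rightarrow> real"
  assumes w[measurable]: "w \<in> borel_measurable borel" and p: "p \<ge> 1"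
    and int: "integrable lborel (\<lambda>x. \<bar>w x\<bar> powr p)" and supp: "\<And>x. norm x > R \<Longrightarrow> w x = 0"
    and h: "h \<longlonglongrightarrow> 0"
  shows "(\<lambda>n. LBINT x. \<bar>w (x + h n) - w x\<bar> powr p) \<longlonglongrightarrow> 0"
proof (rule LIMSEQ_I)
  fix e :: real assume e: "e > 0"
  define c where "c m x = max (- real m) (min (real m) (w x))" for m x
  have [measurable]: "c m \<in> borel_measurable borel" for m unfolding c_def by measurable
  have cw: "\<bar>w x - c m x\<bar> \<le> \<bar>w x\<bar>" "\<bar>c m x\<bar> \<le> m" for m x unfolding c_def by auto
  have "(\<lambda>m. LBINT x. \<bar>w x - c m x\<bar> powr p) \<longlonglongrightarrow> (\<integral>x. 0 \<partial>(lborel :: (real ^ 'n) measure))"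
  proof (rule integral_dominated_convergence[where w = "\<lambda>x. \<bar>w x\<bar> powr p"])
    show "AE x in lborel. (\<lambda>m. \<bar>w x - c m x\<bar> powr p) \<longlonglongrightarrow> 0"
    proof (rule AE_I2)
      fix x
      obtain k where k: "\<bar>w x\<bar> \<le> real k" using real_arch_simple by blast
      have "\<bar>w x - c m x\<bar> powr p = 0" if "m \<ge> k" for m
      proof -
        have "\<bar>w x\<bar> \<le> real m" using k that by linarith
        then have "w x = c m x" unfolding c_def by auto
        then show ?thesis by simp
      qed
      then show "(\<lambda>m. \<bar>w x - c m x\<bar> powr p) \<longlonglongrightarrow> 0"
        by (intro tendsto_eventually) (auto simp: eventually_sequentially)
    qed
    show "AE x in lborel. norm (\<bar>w x - c m x\<bar> powr p) \<le> \<bar>w x\<bar> powr p" for m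
      using cw p by (auto intro!: powr_mono2)
  qed (use int in auto)
  then have "(\<lambda>m. LBINT x. \<bar>w x - c m x\<bar> powr p) \<longlonglongrightarrow> 0" by simp
  moreover define E where "E = e / (3 powr p * 4)"
  moreover have "E > 0" using e by (simp add: E_def)
  ultimately obtain m where m: "(LBINT x. \<bar>w x - c m x\<bar> powr p) < E"
    using order_tendstoD(2) by (metis (mono_tags, lifting) eventually_sequentially order_refl)
  have intb: "integrable lborel (\<lambda>x :: real ^ 'n. real m * indicator (cball 0 R) x :: real)"
    using emeasure_bounded_finite[of "cball (0 :: real ^ 'n) R"]
    by (intro integrable_mult_right integrable_real_indicator) auto
  have intc: "integrable lborel (c m)"
    by (rule Bochner_Integration.integrable_bound[OF intb])
       (use cw supp in \<open>auto simp: indicator_def c_def\<close>)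
  have intcp: "integrable lborel (\<lambda>x. \<bar>c m x\<bar> powr p)"
    by (rule Bochner_Integration.integrable_bound[OF int])
       (use p in \<open>auto intro!: powr_mono2 simp: c_def\<close>)
  have "(\<lambda>n. (2 * real m) powr (p - 1) * (LBINT x. \<bar>c m (x + h n) - c m x\<bar>)) \<longlonglongrightarrow> (2 * real m) powr (p - 1) * 0"
    by (intro tendsto_intros translation_continuous_L1 intc h)
  then have "\<forall>\<^sub>F n in sequentially. (2 * real m) powr (p - 1) * (LBINT x. \<bar>c m (x + h n) - c m x\<bar>) < E"
    using \<open>E > 0\<close> by (intro order_tendstoD) auto
  then obtain n0 where n0: "\<And>n. n \<ge> n0 \<Longrightarrow> (2 * real m) powr (p - 1) * (LBINT x. \<bar>c m (x + h n) - c m x\<bar>) < E"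
    by (auto simp: eventually_sequentially)
  have "norm ((LBINT x. \<bar>w (x + h n) - w x\<bar> powr p) - 0) < e" if "n \<ge> n0" for n
  proof -
    have i1: "integrable lborel (\<lambda>x. \<bar>w x - c m x\<bar> powr p)"
      using p by (intro integrable_powr_diff int intcp) auto
    have i2: "integrable lborel (\<lambda>x. \<bar>w (x + h n) - c m (x + h n)\<bar> powr p)"
      using integrable_translate[OF i1] .
    have i3: "integrable lborel (\<lambda>x. \<bar>c m (x + h n) - c m x\<bar> powr p)"
      using p intcp integrable_translate[OF intcp] by (intro integrable_powr_diff) auto
    have i4: "integrable lborel (\<lambda>x. \<bar>c m (x + h n) - c m x\<bar>)"
      using intc integrable_translate[OF intc] by (intro integrable_abs Bochner_Integration.integrable_diff) auto
    have "(LBINT x. \<bar>c m (x + h n) - c m x\<bar> powr p) \<le> (LBINT x. (2 * real m) powr (p - 1) * \<bar>c m (x + h n) - c m x\<bar>)"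
    proof (rule integral_mono)
      fix x
      let ?d = "\<bar>c m (x + h n) - c m x\<bar>"
      have "?d \<le> 2 * real m" using cw(2)[of m x] cw(2)[of m "x + h n"] by linarith
      then have "?d powr (p - 1) * ?d \<le> (2 * real m) powr (p - 1) * ?d"
        using p by (intro mult_right_mono powr_mono2) auto
      moreover have "?d powr p = ?d powr (p - 1) * ?d"
        using powr_mult_base[of ?d "p - 1"] by (simp add: mult.commute)
      ultimately show "?d powr p \<le> (2 * real m) powr (p - 1) * ?d" by simp
    qed (use i3 i4 in auto)
    also have "\<dots> < E" using n0[OF that] by simp
    finally have b: "(LBINT x. \<bar>c m (x + h n) - c m x\<bar> powr p) < E" .
    have "(LBINT x. \<bar>w (x + h n) - w x\<bar> powr p) \<le>
       (LBINT x. 3 powr p * (\<bar>w (x + h n) - c m (x + h n)\<bar> powr p + \<bar>c m (x + h n) - c m x\<bar> powr p + \<bar>w x - c m x\<bar> powr p))"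
    proof (rule integral_mono')
      fix x
      show "\<bar>w (x + h n) - w x\<bar> powr p \<le> 3 powr p * (\<bar>w (x + h n) - c m (x + h n)\<bar> powr p + \<bar>c m (x + h n) - c m x\<bar> powr p + \<bar>w x - c m x\<bar> powr p)"
        using powr_sum3_le[of p "w (x + h n) - c m (x + h n)" "c m (x + h n) - c m x" "c m x - w x"] p
        by (simp add: abs_minus_commute)
    qed (use i1 i2 i3 in auto)
    also have "\<dots> = 3 powr p * ((LBINT x. \<bar>w (x + h n) - c m (x + h n)\<bar> powr p) + (LBINT x. \<bar>c m (x + h n) - c m x\<bar> powr p)
          + (LBINT x. \<bar>w x - c m x\<bar> powr p))"
      using i1 i2 i3 by simp
    also have "(LBINT x. \<bar>w (x + h n) - c m (x + h n)\<bar> powr p) = (LBINT x. \<bar>w x - c m x\<bar> powr p)"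
      by (rule integral_translate[of "\<lambda>x. \<bar>w x - c m x\<bar> powr p"]) measurable
    also have "3 powr p * (\<dots> + (LBINT x. \<bar>c m (x + h n) - c m x\<bar> powr p) + (LBINT x. \<bar>w x - c m x\<bar> powr p))
        < 3 powr p * (E + E + E)"
      using m b by (intro mult_strict_left_mono add_strict_mono) auto
    also have "\<dots> \<le> e" using e by (simp add: E_def)
    finally show ?thesis by simp
  qed
  then show "\<exists>no. \<forall>n\<ge>no. norm ((LBINT x. \<bar>w (x + h n) - w x\<bar> powr p) - 0) < e" by blast
qed

section \<open>Mollification\<close>

lemma test_integrable:
  fixes v :: "real ^ 'n \<Rightarrow> real"
  assumes "v \<in> test_functions" shows "integrable lborel v"
proof -
  obtain R where R: "\<And>x. norm x > R \<Longrightarrow> v x = 0" using test_support[OF assms] by metis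
  obtain B where B: "\<And>x. \<bar>v x\<bar> \<le> B" using test_bounded[OF assms] by metis
  have "integrable lborel (\<lambda>x :: real ^ 'n. B * indicator (cball 0 R) x :: real)"
    using emeasure_bounded_finite[of "cball (0 :: real ^ 'n) R"]
    by (intro integrable_mult_right integrable_real_indicator) auto
  then show ?thesis
  proof (rule Bochner_Integration.integrable_bound)
    show "AE x in lborel. norm (v x) \<le> norm (B * indicator (cball 0 R) x)"
    proof (rule AE_I2)
      fix x show "norm (v x) \<le> norm (B * indicator (cball 0 R) x)"
        using R[of x] B[of x] by (cases "norm x > R") auto
    qed
  qed (use assms in \<open>simp add: test_borel\<close>)
qed

lemma test_mult_integrable:
  fixes v :: "real ^ 'n \<Rightarrow> real"
  assumes v: "v \<in> test_functions" and f: "integrable lborel f"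
  shows "integrable lborel (\<lambda>x. v x * f x)"
proof -
  obtain B where B: "\<And>x. \<bar>v x\<bar> \<le> B" using test_bounded[OF v] by metis
  have [measurable]: "v \<in> borel_measurable borel" using v by (rule test_borel)
  show ?thesis
  proof (rule Bochner_Integration.integrable_bound)
    show "integrable lborel (\<lambda>x. B * f x)" using f by simp
    show "AE x in lborel. norm (v x * f x) \<le> norm (B * f x)"
    proof (rule AE_I2)
      fix x show "norm (v x * f x) \<le> norm (B * f x)"
        using B[of x] by (auto simp: abs_mult intro!: mult_right_mono)
    qed
  qed (use f in auto)
qed

definition mollifier :: "(real ^ 'n \<Rightarrow> real) \<Rightarrow> bool" where
  "mollifier \<rho> \<longleftrightarrow> \<rho> \<in> test_functions \<and> (\<forall>x. \<rho> x \<ge> 0) \<and> (\<forall>x. norm x \<ge> 1 \<longrightarrow> \<rho> x = 0) \<and> (LBINT x. \<rho> x) = 1"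

lemma mollifier_exists: "\<exists>\<rho> :: real ^ 'n \<Rightarrow> real. mollifier \<rho>"
proof -
  define \<beta> :: "real ^ 'n \<Rightarrow> real" where "\<beta> x = flat_exp 0 (1 + (-1) * (x \<bullet> x))" for x
  have ck: "C_k k \<beta>" for k
    unfolding \<beta>_def by (intro C_k_flat_exp C_k_add C_k_mult C_k_const C_k_norm_sq)
  have pos: "\<beta> x > 0 \<longleftrightarrow> norm x < 1" for x
    by (simp add: \<beta>_def flat_exp_def norm_eq_sqrt_inner)
  have nn: "\<beta> x \<ge> 0" for x by (auto simp: \<beta>_def flat_exp_def)
  have z: "norm x \<ge> 1 \<Longrightarrow> \<beta> x = 0" for x using pos[of x] nn[of x] by linarith
  have t: "\<beta> \<in> test_functions" unfolding test_functions_iff using ck z by (metis linear)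
  have int: "integrable lborel \<beta>" by (rule test_integrable[OF t])
  have "(LBINT x. \<beta> x) \<noteq> 0"
  proof
    assume "(LBINT x. \<beta> x) = 0"
    then have "AE x in lborel. \<beta> x = 0" using integral_nonneg_eq_0_iff_AE[OF int] nn by auto
    then have "AE x :: real ^ 'n in lborel. x \<notin> ball 0 1"
    proof eventually_elim
      case (elim x)
      then show ?case using pos[of x] by simp
    qed
    then have "emeasure lborel (ball (0 :: real ^ 'n) 1) = 0"
      using AE_iff_measurable[of "ball (0 :: real ^ 'n) 1" lborel "\<lambda>x. x \<notin> ball 0 1"] by (auto simp: ball_def)
    moreover have "\<not> negligible (ball (0 :: real ^ 'n) 1)"
      using open_not_negligible[of "ball (0 :: real ^ 'n) 1"] by auto
    ultimately show False by (simp add: negligible_iff_emeasure0)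
  qed
  moreover have "(LBINT x. \<beta> x) \<ge> 0" using nn by (intro integral_nonneg_AE) auto
  ultimately have I: "(LBINT x. \<beta> x) > 0" by linarith
  have "mollifier (\<lambda>x. inverse (LBINT x. \<beta> x) * \<beta> x)"
    unfolding mollifier_def using I nn z test_cmult[OF t] by auto
  then show ?thesis by blast
qed

text \<open>By the uniform Taylor estimate for \<open>K\<close> the remainder of the convolution is at most \<open>L |h|^2\<close> times the \<open>L^1\<close> norm of
  \<open>w\<close>.\<close>

lemma conv_has_derivative:
  fixes K w :: "real ^ 'n \<Rightarrow> real"
  assumes K: "K \<in> test_functions" and w: "integrable lborel w"
  shows "((\<lambda>x. LBINT y. K (x - y) * w y) has_derivative
      (\<lambda>h. (\<chi> i. LBINT y. grad K (x - y) $ i * w y) \<bullet> h)) (at x)"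
proof -
  have KI: "integrable lborel (\<lambda>y. V (x - y) * w y)" if "V \<in> test_functions" for V x
    using test_mult_integrable[OF test_affine[OF that, of "-1" x] w] by simp
  obtain L where L: "L > 0" "\<And>x h. \<bar>K (x + h) - K x - grad K x \<bullet> h\<bar> \<le> L * norm h ^ 2"
    using test_taylor[OF K] by metis
  define W where "W = (LBINT y. \<bar>w y\<bar>)"
  have W: "W \<ge> 0" by (simp add: W_def)
  let ?F = "\<lambda>x. LBINT y. K (x - y) * w y"
  let ?d = "\<chi> i. LBINT y. grad K (x - y) $ i * w y"
  have dI: "integrable lborel (\<lambda>y. grad K (x - y) \<bullet> h * w y)" for h
  proof -
    have "integrable lborel (\<lambda>y. \<Sum>i\<in>UNIV. h $ i * (grad K (x - y) $ i * w y))"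
      by (intro Bochner_Integration.integrable_sum integrable_mult_right KI test_grad K)
    then show ?thesis by (simp add: inner_vec_def sum_distrib_left mult_ac)
  qed
  have dh: "?d \<bullet> h = (LBINT y. grad K (x - y) \<bullet> h * w y)" for h
  proof -
    have "(LBINT y. grad K (x - y) \<bullet> h * w y) = (LBINT y. (\<Sum>i\<in>UNIV. h $ i * (grad K (x - y) $ i * w y)))"
      by (simp add: inner_vec_def sum_distrib_left mult_ac)
    also have "\<dots> = (\<Sum>i\<in>UNIV. h $ i * (LBINT y. grad K (x - y) $ i * w y))"
      using KI[OF test_grad[OF K], of x] by (subst Bochner_Integration.integral_sum) auto
    also have "\<dots> = ?d \<bullet> h" by (simp add: inner_vec_def mult.commute)
    finally show ?thesis by simp
  qed
  have est: "norm (?F (x + h) - ?F x - ?d \<bullet> h) \<le> (L * W * norm h) * norm h" for h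
  proof -
    have "?F (x + h) - ?F x - ?d \<bullet> h = (LBINT y. (K (x + h - y) * w y - K (x - y) * w y) - grad K (x - y) \<bullet> h * w y)"
      unfolding dh using KI[OF K] dI
      by (subst Bochner_Integration.integral_diff) (auto simp: Bochner_Integration.integral_diff)
    also have "norm \<dots> \<le> (LBINT y. L * norm h ^ 2 * \<bar>w y\<bar>)"
    proof (rule Bochner_Integration.integral_norm_bound_integral)
      show "integrable lborel (\<lambda>y. (K (x + h - y) * w y - K (x - y) * w y) - grad K (x - y) \<bullet> h * w y)"
        using KI[OF K] dI by (intro Bochner_Integration.integrable_diff) auto
      show "integrable lborel (\<lambda>y. L * norm h ^ 2 * \<bar>w y\<bar>)" using w by simp
      fix y
      have "\<bar>K ((x - y) + h) - K (x - y) - grad K (x - y) \<bullet> h\<bar> * \<bar>w y\<bar> \<le> L * norm h ^ 2 * \<bar>w y\<bar>"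
        by (intro mult_right_mono L) auto
      then show "norm ((K (x + h - y) * w y - K (x - y) * w y) - grad K (x - y) \<bullet> h * w y) \<le> L * norm h ^ 2 * \<bar>w y\<bar>"
        by (simp add: abs_mult[symmetric] algebra_simps)
    qed
    also have "\<dots> = (L * W * norm h) * norm h" by (simp add: W_def power2_eq_square)
    finally show ?thesis .
  qed
  show ?thesis unfolding has_derivative_at_alt
  proof (intro conjI allI impI)
    show "bounded_linear (\<lambda>h. ?d \<bullet> h)" by (rule bounded_linear_inner_right)
    fix e :: real assume e: "e > 0"
    show "\<exists>d>0. \<forall>y. norm (y - x) < d \<longrightarrow> norm (?F y - ?F x - ?d \<bullet> (y - x)) \<le> e * norm (y - x)"
    proof (intro exI[of _ "e / (L * W + 1)"] conjI allI impI)
      have LW: "L * W + 1 > 0" using L(1) W by (simp add: add_nonneg_pos)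
      show "e / (L * W + 1) > 0" using e LW by simp
      fix y assume "norm (y - x) < e / (L * W + 1)"
      then have "(L * W + 1) * norm (y - x) < e" using LW by (simp add: field_simps)
      then have "L * W * norm (y - x) + norm (y - x) < e" by (simp add: distrib_right)
      then have "L * W * norm (y - x) \<le> e" using norm_ge_zero[of "y - x"] by linarith
      then have "(L * W * norm (y - x)) * norm (y - x) \<le> e * norm (y - x)" by (rule mult_right_mono) simp
      then show "norm (?F y - ?F x - ?d \<bullet> (y - x)) \<le> e * norm (y - x)"
        using est[of "y - x"] by simp
    qed
  qed
qed

lemma conv_C_k:
  fixes K w :: "real ^ 'n \<Rightarrow> real"
  assumes w: "integrable lborel w"
  shows "K \<in> test_functions \<Longrightarrow> C_k k (\<lambda>x. LBINT y. K (x - y) * w y)"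
proof (induction k arbitrary: K)
  case 0
  have "(\<lambda>x. LBINT y. K (x - y) * w y) differentiable (at x)" for x
    using conv_has_derivative[OF 0 w] unfolding differentiable_def by blast
  then show ?case
    by (simp add: continuous_at_imp_continuous_on differentiable_imp_continuous_within)
next
  case (Suc k)
  show ?case
    by (rule C_k_SucI[OF conv_has_derivative[OF Suc.prems w]])
       (simp add: Suc.IH[OF test_grad[OF Suc.prems]])
qed

definition std_moll :: "real ^ 'n \<Rightarrow> real" where "std_moll = (SOME \<rho>. mollifier \<rho>)"

lemma std_moll: "mollifier (std_moll :: real ^ 'n \<Rightarrow> real)"
  unfolding std_moll_def using mollifier_exists by (rule someI_ex)

lemma std_moll_test: "std_moll \<in> test_functions"
  and std_moll_nonneg: "std_moll x \<ge> 0"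
  and std_moll_zero: "norm x \<ge> 1 \<Longrightarrow> std_moll x = 0"
  and std_moll_integral: "(LBINT x. std_moll (x :: real ^ 'n)) = 1"
  using std_moll unfolding mollifier_def by auto

lemma std_moll_borel [measurable]: "std_moll \<in> borel_measurable borel"
  by (rule test_borel[OF std_moll_test])

text \<open>Convolution with the rescaled kernel, written over the unit scale: in this form the dependence on \<open>k\<close> is a
  translation of \<open>w\<close>, which is what the \<open>L^p\<close> estimates see. \<open>moll_ker\<close> gives the convolution form, which
  shows smoothness.\<close>

definition moll :: "nat \<Rightarrow> (real ^ 'n \<Rightarrow> real) \<Rightarrow> real ^ 'n \<Rightarrow> real" where
  "moll k w x = (LBINT y. std_moll y * w (x - y /\<^sub>R real (Suc k)))"

definition moll_ker :: "nat \<Rightarrow> real ^ 'n \<Rightarrow> real" where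
  "moll_ker k z = real (Suc k) ^ CARD('n) * std_moll (real (Suc k) *\<^sub>R z)"

lemma moll_ker_test: "moll_ker k \<in> test_functions"
proof -
  have "(\<lambda>z :: real ^ 'n. std_moll (0 + real (Suc k) *\<^sub>R z)) \<in> test_functions"
    by (rule test_affine[OF std_moll_test]) simp
  then show ?thesis using test_cmult unfolding moll_ker_def[abs_def] by auto
qed

lemma moll_eq_conv:
  fixes w :: "real ^ 'n \<Rightarrow> real"
  assumes [measurable]: "w \<in> borel_measurable borel"
  shows "moll k w x = (LBINT y. moll_ker k (x - y) * w y)"
proof -
  have [measurable]: "moll_ker k \<in> borel_measurable borel" by (rule test_borel[OF moll_ker_test])
  have "(LBINT y. moll_ker k (x - y) * w y) = (\<bar>- inverse (real (Suc k))\<bar> ^ CARD('n)) *\<^sub>R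
     (LBINT y. moll_ker k (x - (x + (- inverse (real (Suc k))) *\<^sub>R y)) * w (x + (- inverse (real (Suc k))) *\<^sub>R y))"
    by (rule integral_affine) auto
  also have "\<dots> = (LBINT y. (inverse (real (Suc k)) ^ CARD('n)) * (moll_ker k (inverse (real (Suc k)) *\<^sub>R y) * w (x - y /\<^sub>R real (Suc k))))"
    by (simp del: of_nat_Suc)
  also have "\<dots> = moll k w x"
    unfolding moll_def moll_ker_def
    by (intro Bochner_Integration.integral_cong) (auto simp: power_inverse simp del: of_nat_Suc)
  finally show ?thesis by simp
qed

lemma moll_C_k:
  assumes "integrable lborel w" shows "C_k m (moll k w)"
proof -
  have "moll k w = (\<lambda>x. LBINT y. moll_ker k (x - y) * w y)"
    using assms by (intro ext moll_eq_conv) auto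
  then show ?thesis using conv_C_k[OF assms moll_ker_test] by simp
qed

lemma moll_borel [measurable]: "integrable lborel w \<Longrightarrow> moll k w \<in> borel_measurable borel"
  using moll_C_k[of w 0 k] by (simp add: borel_measurable_continuous_onI)

lemma moll_nonzeroD:
  assumes "moll k w x \<noteq> 0"
  obtains z where "norm (z - x) \<le> 1 / real (Suc k)" "w z \<noteq> 0"
proof (rule ccontr)
  assume "\<not> thesis"
  then have w0: "norm (z - x) \<le> 1 / real (Suc k) \<Longrightarrow> w z = 0" for z using that by blast
  have "std_moll y * w (x - y /\<^sub>R real (Suc k)) = 0" for y
  proof (cases "norm y \<ge> 1")
    case False
    then have "w (x - y /\<^sub>R real (Suc k)) = 0"
      by (intro w0) (auto simp: field_simps simp del: of_nat_Suc)
    then show ?thesis by simp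
  qed (simp add: std_moll_zero)
  then have "moll k w x = 0" unfolding moll_def by (simp only: Bochner_Integration.integral_zero)
  then show False using assms by simp
qed

lemma moll_support:
  assumes "\<And>x. norm x > R \<Longrightarrow> w x = 0" "norm x > R + 1"
  shows "moll k w x = 0"
proof (rule ccontr)
  assume "moll k w x \<noteq> 0"
  then obtain z where z: "norm (z - x) \<le> 1 / real (Suc k)" "w z \<noteq> 0" by (rule moll_nonzeroD)
  have "1 / real (Suc k) \<le> 1" by simp
  then have "norm (z - x) \<le> 1" using z(1) by linarith
  then have "norm x \<le> norm z + 1" using norm_triangle_sub[of x z] by (simp add: norm_minus_commute)
  moreover have "norm z \<le> R" using z(2) assms(1) by (meson not_le)
  ultimately show False using assms(2) by simp
qed

lemma moll_test:
  assumes "integrable lborel w" "\<And>x. norm x > R \<Longrightarrow> w x = 0"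
  shows "moll k w \<in> test_functions"
  using moll_C_k[OF assms(1)] moll_support[of R w, OF assms(2)]
  unfolding test_functions_iff by (metis not_le)

lemma integrable_of_powr:
  fixes w :: "real ^ 'n \<Rightarrow> real"
  assumes "w \<in> borel_measurable borel" "p \<ge> 1" "integrable lborel (\<lambda>x. \<bar>w x\<bar> powr p)"
    and supp: "\<And>x. norm x > R \<Longrightarrow> w x = 0"
  shows "integrable lborel w"
proof (rule Bochner_Integration.integrable_bound)
  have "integrable lborel (\<lambda>x :: real ^ 'n. indicator (cball 0 R) x :: real)"
    using emeasure_bounded_finite[of "cball (0 :: real ^ 'n) R"]
    by (intro integrable_real_indicator) auto
  then show "integrable lborel (\<lambda>x. indicator (cball 0 R) x + \<bar>w x\<bar> powr p)" using assms(3) by simp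
  show "AE x in lborel. norm (w x) \<le> norm (indicator (cball 0 R) x + \<bar>w x\<bar> powr p)"
  proof (rule AE_I2)
    fix x
    have "\<bar>w x\<bar> \<le> \<bar>w x\<bar> powr p" if "\<bar>w x\<bar> \<ge> 1" using powr_mono[of 1 p "\<bar>w x\<bar>"] that assms(2) by simp
    then show "norm (w x) \<le> norm (indicator (cball 0 R) x + \<bar>w x\<bar> powr p)"
      using supp[of x] powr_ge_zero[of "\<bar>w x\<bar>" p] by (cases "norm x > R"; cases "\<bar>w x\<bar> \<ge> 1") (auto simp del: powr_ge_zero)
  qed
qed (use assms in simp)

text \<open>Jensen's inequality for the probability density \<open>std_moll\<close>, obtained by integrating the supporting line of \<open>t^p\<close> at the
  mean value.\<close>

lemma moll_jensen:
  fixes w :: "real ^ 'n \<Rightarrow> real"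
  assumes w: "integrable lborel w" and p: "p \<ge> 1"
  shows "ennreal (\<bar>moll k w x - w x\<bar> powr p)
     \<le> (\<integral>\<^sup>+y. ennreal (std_moll y * \<bar>w (x - y /\<^sub>R real (Suc k)) - w x\<bar> powr p) \<partial>lborel)"
proof -
  have [measurable]: "w \<in> borel_measurable borel" using w by auto
  let ?a = "\<lambda>y. \<bar>w (x - y /\<^sub>R real (Suc k)) - w x\<bar>"
  have wI: "integrable lborel (\<lambda>y. w (x - y /\<^sub>R real (Suc k)))"
    using integrable_affine[OF w, of "- inverse (real (Suc k))" x] by (simp del: of_nat_Suc)
  have I0: "integrable lborel (\<lambda>y. std_moll y * (w (x - y /\<^sub>R real (Suc k)) - w x))"
    using test_mult_integrable[OF std_moll_test wI] test_integrable[OF std_moll_test]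
    by (auto simp: right_diff_distrib)
  have I1: "integrable lborel (\<lambda>y. std_moll y * ?a y)"
    using integrable_norm[OF I0] by (simp add: abs_mult std_moll_nonneg)
  define s where "s = (LBINT y. std_moll y * ?a y)"
  have s0: "s \<ge> 0" unfolding s_def by (intro integral_nonneg_AE) (auto simp: std_moll_nonneg)
  have "moll k w x - w x = (LBINT y. std_moll y * (w (x - y /\<^sub>R real (Suc k)) - w x))"
    using test_mult_integrable[OF std_moll_test wI] test_integrable[OF std_moll_test, where 'n = 'n]
    by (simp add: right_diff_distrib moll_def std_moll_integral)
  also have "\<bar>\<dots>\<bar> \<le> s"
    unfolding s_def using integral_norm_bound[of lborel "\<lambda>y. std_moll y * (w (x - y /\<^sub>R real (Suc k)) - w x)"]
    by (simp add: abs_mult std_moll_nonneg)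
  finally have le: "\<bar>moll k w x - w x\<bar> powr p \<le> s powr p" using p by (intro powr_mono2) auto
  show ?thesis
  proof (cases "(\<integral>\<^sup>+y. ennreal (std_moll y * ?a y powr p) \<partial>lborel) = \<infinity>")
    case False
    then have I2: "integrable lborel (\<lambda>y. std_moll y * ?a y powr p)"
      by (intro integrableI_nonneg) (auto simp: std_moll_nonneg top.not_eq_extremum)
    have "s powr p = (LBINT y. std_moll y * (s powr p) + p * s powr (p - 1) * (std_moll y * ?a y - s * std_moll y))"
      using I1 test_integrable[OF std_moll_test, where 'n = 'n]
      by (simp add: std_moll_integral s_def[symmetric] del: of_nat_Suc)
    also have "\<dots> \<le> (LBINT y. std_moll y * ?a y powr p)"
    proof (rule integral_mono)
      fix y
      have "std_moll y * (s powr p + p * s powr (p - 1) * (?a y - s)) \<le> std_moll y * ?a y powr p"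
        by (intro mult_left_mono powr_tangent p s0 std_moll_nonneg) auto
      then show "std_moll y * (s powr p) + p * s powr (p - 1) * (std_moll y * ?a y - s * std_moll y) \<le> std_moll y * ?a y powr p"
        by (simp add: algebra_simps)
    qed (use I1 I2 test_integrable[OF std_moll_test, where 'n = 'n] in auto)
    finally have "ennreal (s powr p) \<le> ennreal (LBINT y. std_moll y * ?a y powr p)" by (rule ennreal_leI)
    also have "\<dots> = (\<integral>\<^sup>+y. ennreal (std_moll y * ?a y powr p) \<partial>lborel)"
      by (rule nn_integral_eq_integral[symmetric, OF I2]) (auto simp: std_moll_nonneg)
    finally show ?thesis using le by (meson ennreal_leI order_trans)
  qed auto
qed

text \<open>By Jensen's inequality and Tonelli's theorem the error is at most the average of the \<open>L^p\<close> moduli of translation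
  \<open>T (- y/(k+1))\<close> against the kernel; these are bounded and tend to 0.\<close>

lemma moll_Lp:
  fixes w :: "real ^ 'n \<Rightarrow> real"
  assumes w[measurable]: "w \<in> borel_measurable borel" and p: "p \<ge> 1"
    and int: "integrable lborel (\<lambda>x. \<bar>w x\<bar> powr p)" and supp: "\<And>x. norm x > R \<Longrightarrow> w x = 0"
  shows "(\<lambda>k. LBINT x. \<bar>moll k w x - w x\<bar> powr p) \<longlonglongrightarrow> 0" (is ?lim)
    and "integrable lborel (\<lambda>x. \<bar>moll k w x - w x\<bar> powr p)" (is ?int)
    and "integrable lborel (\<lambda>x. \<bar>moll k w x\<bar> powr p)" (is ?int2)
proof -
  have wI: "integrable lborel w" by (rule integrable_of_powr[OF w p int supp])
  have mk[measurable]: "moll k w \<in> borel_measurable borel" for k by (rule moll_borel[OF wI])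
  define T where "T h = (LBINT x. \<bar>w (x + h) - w x\<bar> powr p)" for h
  define A where "A = (LBINT x. \<bar>w x\<bar> powr p)"
  have iT: "integrable lborel (\<lambda>x. \<bar>w (x + h) - w x\<bar> powr p)" for h
    using p int integrable_translate[OF int] by (intro integrable_powr_diff) auto
  have T0: "T h \<ge> 0" for h unfolding T_def by simp
  have TA: "T h \<le> 2 powr p * (A + A)" for h
  proof -
    have "T h \<le> (LBINT x. 2 powr p * (\<bar>w (x + h)\<bar> powr p + \<bar>w x\<bar> powr p))"
      unfolding T_def using p int integrable_translate[OF int]
      by (intro integral_mono iT powr_diff2_le) auto
    also have "\<dots> = 2 powr p * (A + A)"
      using int integrable_translate[OF int] integral_translate[of "\<lambda>x. \<bar>w x\<bar> powr p" h] by (simp add: A_def)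
    finally show ?thesis .
  qed
  have nT: "(\<integral>\<^sup>+x. ennreal (\<bar>w (x + h) - w x\<bar> powr p) \<partial>lborel) = ennreal (T h)" for h
    unfolding T_def by (rule nn_integral_eq_integral[OF iT]) auto
  define N where "N k = (\<integral>\<^sup>+y. ennreal (std_moll y * T (- (y /\<^sub>R real (Suc k)))) \<partial>lborel)" for k
  have Tm[measurable]: "T \<in> borel_measurable borel"
    unfolding T_def by measurable
  have nn_le: "(\<integral>\<^sup>+x. ennreal (\<bar>moll k w x - w x\<bar> powr p) \<partial>lborel) \<le> N k" for k
  proof -
    have "(\<integral>\<^sup>+x. ennreal (\<bar>moll k w x - w x\<bar> powr p) \<partial>lborel)
       \<le> (\<integral>\<^sup>+x. (\<integral>\<^sup>+y. ennreal (std_moll y * \<bar>w (x - y /\<^sub>R real (Suc k)) - w x\<bar> powr p) \<partial>lborel) \<partial>lborel)"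
      by (intro nn_integral_mono moll_jensen wI p)
    also have "\<dots> = (\<integral>\<^sup>+y. (\<integral>\<^sup>+x. ennreal (std_moll y * \<bar>w (x - y /\<^sub>R real (Suc k)) - w x\<bar> powr p) \<partial>lborel) \<partial>lborel)"
      by (rule lborel_pair.Fubini') measurable
    also have "\<dots> = (\<integral>\<^sup>+y. ennreal (std_moll y) * (\<integral>\<^sup>+x. ennreal (\<bar>w (x + - (y /\<^sub>R real (Suc k))) - w x\<bar> powr p) \<partial>lborel) \<partial>lborel)"
      by (intro nn_integral_cong) (simp add: ennreal_mult std_moll_nonneg nn_integral_cmult)
    also have "\<dots> = N k" unfolding nT N_def by (simp add: ennreal_mult std_moll_nonneg T0)
    finally show ?thesis .
  qed
  have A0: "A \<ge> 0" by (simp add: A_def)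
  have "integrable lborel (\<lambda>y :: real ^ 'n. std_moll y * (2 powr p * (A + A)))"
    using test_integrable[OF std_moll_test, where 'n = 'n] by simp
  from nn_integral_eq_integral[OF this]
  have dom_fin: "(\<integral>\<^sup>+y. ennreal (std_moll (y :: real ^ 'n) * (2 powr p * (A + A))) \<partial>lborel) < \<infinity>"
    using A0 by (simp add: std_moll_nonneg)
  have lim_N: "N \<longlonglongrightarrow> (\<integral>\<^sup>+y. 0 \<partial>(lborel :: (real ^ 'n) measure))"
    unfolding N_def
  proof (rule nn_integral_dominated_convergence[where w = "\<lambda>y. ennreal (std_moll y * (2 powr p * (A + A)))"])
    show "AE y in lborel. ennreal (std_moll y * T (- (y /\<^sub>R real (Suc k)))) \<le> ennreal (std_moll y * (2 powr p * (A + A)))" for k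
      by (intro AE_I2 ennreal_leI mult_left_mono TA std_moll_nonneg)
    show "(\<integral>\<^sup>+y. ennreal (std_moll (y :: real ^ 'n) * (2 powr p * (A + A))) \<partial>lborel) < \<infinity>" by (rule dom_fin)
    show "AE y in lborel. (\<lambda>k. ennreal (std_moll y * T (- (y /\<^sub>R real (Suc k))))) \<longlonglongrightarrow> 0"
    proof (rule AE_I2)
      fix y :: "real ^ 'n"
      have "(\<lambda>k. - (inverse (real (Suc k)) *\<^sub>R y)) \<longlonglongrightarrow> - (0 *\<^sub>R y)"
        by (intro tendsto_intros LIMSEQ_inverse_real_of_nat)
      then have "(\<lambda>k. T (- (y /\<^sub>R real (Suc k)))) \<longlonglongrightarrow> 0"
        unfolding T_def by (intro translation_continuous_Lp[OF w p int supp]) auto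
      then have "(\<lambda>k. std_moll y * T (- (y /\<^sub>R real (Suc k)))) \<longlonglongrightarrow> std_moll y * 0"
        by (intro tendsto_intros)
      then show "(\<lambda>k. ennreal (std_moll y * T (- (y /\<^sub>R real (Suc k))))) \<longlonglongrightarrow> 0"
        using tendsto_ennrealI by fastforce
    qed
  qed measurable
  have Nfin: "N k < \<infinity>" for k
  proof -
    have "N k \<le> (\<integral>\<^sup>+y. ennreal (std_moll (y :: real ^ 'n) * (2 powr p * (A + A))) \<partial>lborel)"
      unfolding N_def by (intro nn_integral_mono ennreal_leI mult_left_mono TA std_moll_nonneg)
    also have "\<dots> < \<infinity>" by (rule dom_fin)
    finally show ?thesis .
  qed
  have int1: "integrable lborel (\<lambda>x. \<bar>moll k w x - w x\<bar> powr p)" for k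
    using order_le_less_trans[OF nn_le[of k] Nfin[of k]] by (intro integrableI_nonneg) auto
  show ?int by (rule int1)
  show ?int2
    using integrable_powr_diff[of p "\<lambda>x. moll k w x - w x" lborel "\<lambda>x. - w x"] p int int1[of k] by simp
  have le: "ennreal (LBINT x. \<bar>moll k w x - w x\<bar> powr p) \<le> N k" for k
    using nn_le[of k] nn_integral_eq_integral[OF int1[of k]] by simp
  have "(\<lambda>k. ennreal (LBINT x. \<bar>moll k w x - w x\<bar> powr p)) \<longlonglongrightarrow> 0"
  proof (rule tendsto_sandwich[where f = "\<lambda>_. 0" and h = N])
    show "\<forall>\<^sub>F k in sequentially. ennreal (LBINT x. \<bar>moll k w x - w x\<bar> powr p) \<le> N k"
      using le by (intro always_eventually) blast
    show "N \<longlonglongrightarrow> 0" using lim_N by simp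
  qed auto
  then have "(\<lambda>k. ennreal (LBINT x. \<bar>moll k w x - w x\<bar> powr p)) \<longlonglongrightarrow> ennreal 0" by simp
  then show ?lim by (rule tendsto_ennrealD) auto
qed

section \<open>Hoelder's inequality and the Gagliardo inequality\<close>

text \<open>Real powers of extended nonnegative numbers with the convention \<open>x^0 = 1\<close>, also at 0 and \<open>\<infinity>\<close>, so that factors with
  exponent 0 disappear from Hoelder's inequality.\<close>

definition epowr :: "ennreal \<Rightarrow> real \<Rightarrow> ennreal" where
  "epowr x p = (if p = 0 then 1 else if x = top then top else ennreal (enn2real x powr p))"

lemma epowr_0 [simp]: "epowr x 0 = 1" by (simp add: epowr_def)

lemma epowr_1 [simp]: "epowr x 1 = x" by (cases x) (auto simp: epowr_def)

lemma epowr_zero_left: "p > 0 \<Longrightarrow> epowr 0 p = 0" by (simp add: epowr_def)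

lemma epowr_top: "p > 0 \<Longrightarrow> epowr top p = top" by (simp add: epowr_def)

lemma epowr_ennreal: "p > 0 \<Longrightarrow> a \<ge> 0 \<Longrightarrow> epowr (ennreal a) p = ennreal (a powr p)"
  by (simp add: epowr_def)

lemma epowr_eq_0: "p > 0 \<Longrightarrow> epowr x p = 0 \<longleftrightarrow> x = 0"
  by (cases x) (auto simp: epowr_ennreal epowr_top)

lemma epowr_mono: "x \<le> y \<Longrightarrow> p \<ge> 0 \<Longrightarrow> epowr x p \<le> epowr y p"
  by (cases x; cases y) (auto simp: epowr_def top_unique intro!: ennreal_leI powr_mono2)

lemma epowr_add: "p \<ge> 0 \<Longrightarrow> q \<ge> 0 \<Longrightarrow> epowr x (p + q) = epowr x p * epowr x q"
  by (cases x) (auto simp: epowr_def ennreal_mult[symmetric] powr_add ennreal_top_mult)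

lemma epowr_mult: "p \<ge> 0 \<Longrightarrow> epowr (x * y) p = epowr x p * epowr y p"
  by (cases x; cases y)
     (auto simp: epowr_def ennreal_mult[symmetric] powr_mult ennreal_top_mult ennreal_mult_top enn2real_mult)

lemma epowr_epowr: "p \<ge> 0 \<Longrightarrow> q \<ge> 0 \<Longrightarrow> epowr (epowr x p) q = epowr x (p * q)"
  by (cases x) (auto simp: epowr_def powr_powr)

lemma epowr_one_left [simp]: "epowr 1 p = 1" by (simp add: epowr_def)

lemma epowr_prod: "p \<ge> 0 \<Longrightarrow> finite A \<Longrightarrow> epowr (\<Prod>k\<in>A. f k) p = (\<Prod>k\<in>A. epowr (f k) p)"
  by (induction A rule: infinite_finite_induct) (auto simp: epowr_mult)

lemma epowr_power: "p \<ge> 0 \<Longrightarrow> epowr x p ^ n = epowr x (real n * p)"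
  by (induction n) (auto simp: distrib_right epowr_add)

lemma measurable_epowr [measurable]:
  assumes [measurable]: "f \<in> borel_measurable M" shows "(\<lambda>x. epowr (f x) p) \<in> borel_measurable M"
  unfolding epowr_def by measurable

lemma epowr_young:
  assumes "0 < \<theta>" "\<theta> < 1"
  shows "epowr a \<theta> * epowr b (1 - \<theta>) \<le> ennreal \<theta> * a + ennreal (1 - \<theta>) * b"
proof (cases "a = 0 \<or> b = 0 \<or> a = top \<or> b = top")
  case True
  then show ?thesis using assms
    by (auto simp: epowr_zero_left ennreal_mult_top)
next
  case False
  then obtain x y where xy: "a = ennreal x" "b = ennreal y" "x > 0" "y > 0"
    by (cases a; cases b) (auto simp: ennreal_eq_0_iff less_le)
  have "x powr \<theta> * y powr (1 - \<theta>) \<le> \<theta> * x + (1 - \<theta>) * y"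
    using assms xy by (intro Youngs_inequality_0) auto
  then show ?thesis
    using assms xy by (simp add: epowr_ennreal ennreal_mult[symmetric] ennreal_plus[symmetric] ennreal_leI del: ennreal_plus)
qed

lemma holder_two:
  assumes [measurable]: "f \<in> borel_measurable M" "g \<in> borel_measurable M" and \<theta>: "0 < \<theta>" "\<theta> < 1"
  shows "(\<integral>\<^sup>+x. epowr (f x) \<theta> * epowr (g x) (1 - \<theta>) \<partial>M) \<le> epowr (\<integral>\<^sup>+x. f x \<partial>M) \<theta> * epowr (\<integral>\<^sup>+x. g x \<partial>M) (1 - \<theta>)"
proof -
  define F G where "F = (\<integral>\<^sup>+x. f x \<partial>M)" and "G = (\<integral>\<^sup>+x. g x \<partial>M)"
  consider "F = 0" | "G = 0" | "F \<noteq> 0" "G \<noteq> 0" "F = top \<or> G = top" | "F \<noteq> 0" "G \<noteq> 0" "F \<noteq> top" "G \<noteq> top" by blast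
  then show ?thesis
  proof cases
    case 1
    then have "AE x in M. f x = 0" by (simp add: F_def nn_integral_0_iff_AE)
    then have "AE x in M. epowr (f x) \<theta> * epowr (g x) (1 - \<theta>) = 0"
      by eventually_elim (use \<theta> in \<open>simp add: epowr_zero_left\<close>)
    then have "(\<integral>\<^sup>+x. epowr (f x) \<theta> * epowr (g x) (1 - \<theta>) \<partial>M) = 0" by (simp add: nn_integral_0_iff_AE)
    then show ?thesis by simp
  next
    case 2
    then have "AE x in M. g x = 0" by (simp add: G_def nn_integral_0_iff_AE)
    then have "AE x in M. epowr (f x) \<theta> * epowr (g x) (1 - \<theta>) = 0"
      by eventually_elim (use \<theta> in \<open>simp add: epowr_zero_left\<close>)
    then have "(\<integral>\<^sup>+x. epowr (f x) \<theta> * epowr (g x) (1 - \<theta>) \<partial>M) = 0" by (simp add: nn_integral_0_iff_AE)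
    then show ?thesis by simp
  next
    case 3
    then have "epowr F \<theta> * epowr G (1 - \<theta>) = top"
      using \<theta> by (auto simp: epowr_top ennreal_top_mult ennreal_mult_top epowr_eq_0)
    then show ?thesis by (simp add: F_def G_def)
  next
    case 4
    then obtain a b where ab: "F = ennreal a" "G = ennreal b" "a > 0" "b > 0"
      by (cases F; cases G) (auto simp: ennreal_eq_0_iff less_le)
    have "epowr (f x) \<theta> * epowr (g x) (1 - \<theta>) \<le> epowr F \<theta> * epowr G (1 - \<theta>) *
        (ennreal (\<theta> / a) * f x + ennreal ((1 - \<theta>) / b) * g x)" for x
    proof -
      have "f x = F * (ennreal (1 / a) * f x)" "g x = G * (ennreal (1 / b) * g x)"
        using ab by (auto simp: mult.assoc[symmetric] ennreal_mult[symmetric])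
      then have "epowr (f x) \<theta> * epowr (g x) (1 - \<theta>) =
          (epowr F \<theta> * epowr (ennreal (1 / a) * f x) \<theta>) * (epowr G (1 - \<theta>) * epowr (ennreal (1 / b) * g x) (1 - \<theta>))"
        using \<theta> by (metis epowr_mult less_eq_real_def diff_ge_0_iff_ge)
      also have "\<dots> = epowr F \<theta> * epowr G (1 - \<theta>) * (epowr (ennreal (1 / a) * f x) \<theta> * epowr (ennreal (1 / b) * g x) (1 - \<theta>))"
        by (simp add: mult_ac)
      also have "\<dots> \<le> epowr F \<theta> * epowr G (1 - \<theta>) * (ennreal \<theta> * (ennreal (1 / a) * f x) + ennreal (1 - \<theta>) * (ennreal (1 / b) * g x))"
        by (intro mult_left_mono epowr_young \<theta>) auto
      also have "\<dots> = epowr F \<theta> * epowr G (1 - \<theta>) * (ennreal (\<theta> / a) * f x + ennreal ((1 - \<theta>) / b) * g x)"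
        using ab \<theta> by (simp add: mult.assoc[symmetric] ennreal_mult[symmetric])
      finally show ?thesis .
    qed
    then have "(\<integral>\<^sup>+x. epowr (f x) \<theta> * epowr (g x) (1 - \<theta>) \<partial>M)
       \<le> (\<integral>\<^sup>+x. epowr F \<theta> * epowr G (1 - \<theta>) * (ennreal (\<theta> / a) * f x + ennreal ((1 - \<theta>) / b) * g x) \<partial>M)"
      by (intro nn_integral_mono)
    also have "\<dots> = epowr F \<theta> * epowr G (1 - \<theta>) * (ennreal (\<theta> / a) * F + ennreal ((1 - \<theta>) / b) * G)"
      by (simp add: nn_integral_cmult nn_integral_add F_def G_def)
    also have "ennreal (\<theta> / a) * F + ennreal ((1 - \<theta>) / b) * G = 1"
      using ab \<theta> by (simp add: ennreal_mult[symmetric] ennreal_plus[symmetric] del: ennreal_plus)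
    finally show ?thesis by (simp add: F_def G_def)
  qed
qed

text \<open>Induction on the number of factors: the factors after the first are grouped into one function whose exponent is their
  sum \<open>\<sigma>\<close>, and the two-factor inequality is applied.\<close>

lemma holder_finite:
  assumes "finite K"
  shows "(\<And>k. k \<in> K \<Longrightarrow> f k \<in> borel_measurable M) \<Longrightarrow> (\<And>k. k \<in> K \<Longrightarrow> \<theta> k \<ge> 0) \<Longrightarrow> (\<Sum>k\<in>K. \<theta> k) = 1 \<Longrightarrow>
    (\<integral>\<^sup>+x. (\<Prod>k\<in>K. epowr (f k x) (\<theta> k)) \<partial>M) \<le> (\<Prod>k\<in>K. epowr (\<integral>\<^sup>+x. f k x \<partial>M) (\<theta> k))"
  using assms
proof (induction K arbitrary: \<theta> rule: finite_induct)
  case (insert k K)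
  note [measurable] = insert.prems(1)
  define \<sigma> where "\<sigma> = (\<Sum>j\<in>K. \<theta> j)"
  have s: "\<theta> k + \<sigma> = 1" using insert by (simp add: \<sigma>_def)
  have \<sigma>0: "\<sigma> \<ge> 0" unfolding \<sigma>_def using insert by (intro sum_nonneg) auto
  have k0: "\<theta> k \<ge> 0" using insert.prems by simp
  consider "\<sigma> = 0" | "\<theta> k = 0" | "\<sigma> > 0" "\<theta> k > 0" using \<sigma>0 k0 by linarith
  then show ?case
  proof cases
    case 1
    then have "\<theta> j = 0" if "j \<in> K" for j
      using that insert sum_nonneg_eq_0_iff[of K \<theta>] by (auto simp: \<sigma>_def)
    then show ?thesis using insert 1 s by simp
  next
    case 2
    then show ?thesis using insert s by (simp add: \<sigma>_def)
  next
    case 3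
    define g where "g x = (\<Prod>j\<in>K. epowr (f j x) (\<theta> j / \<sigma>))" for x
    have [measurable]: "g \<in> borel_measurable M" unfolding g_def by measurable
    have t: "\<theta> k < 1" "1 - \<theta> k = \<sigma>" using 3 s by auto
    have gs: "epowr (g x) \<sigma> = (\<Prod>j\<in>K. epowr (f j x) (\<theta> j))" for x
      using insert 3 by (auto simp: g_def epowr_prod epowr_epowr intro!: prod.cong)
    have "(\<integral>\<^sup>+x. (\<Prod>k\<in>insert k K. epowr (f k x) (\<theta> k)) \<partial>M) = (\<integral>\<^sup>+x. epowr (f k x) (\<theta> k) * epowr (g x) \<sigma> \<partial>M)"
      using insert gs by simp
    also have "\<dots> \<le> epowr (\<integral>\<^sup>+x. f k x \<partial>M) (\<theta> k) * epowr (\<integral>\<^sup>+x. g x \<partial>M) \<sigma>"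
      using holder_two[of "f k" M g "\<theta> k"] 3 t by simp
    also have "epowr (\<integral>\<^sup>+x. g x \<partial>M) \<sigma> \<le> epowr (\<Prod>j\<in>K. epowr (\<integral>\<^sup>+x. f j x \<partial>M) (\<theta> j / \<sigma>)) \<sigma>"
      unfolding g_def using insert 3
      by (intro insert.IH epowr_mono) (auto simp: sum_divide_distrib[symmetric] \<sigma>_def)
    also have "\<dots> = (\<Prod>j\<in>K. epowr (\<integral>\<^sup>+x. f j x \<partial>M) (\<theta> j))"
      using insert 3 by (auto simp: epowr_prod epowr_epowr intro!: prod.cong)
    finally show ?thesis using insert by (simp add: mult_left_mono)
  qed
qed simp

text \<open>The inductive form of the Gagliardo argument. Integrate first over the coordinate \<open>i\<close>: the marginal over \<open>i\<close> does not
  depend on that coordinate and comes out, and Hoelder's inequality applies to the remaining factors, because the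
  exponents \<open>1 - m p\<close> and \<open>m\<close> times \<open>p\<close> add up to 1. What is left has the same shape for the marginal of \<open>f\<close> and one
  coordinate less.\<close>

lemma grid_lines:
  fixes J :: "'i set"
  assumes "finite J" and p: "p \<ge> 0"
  shows "f \<in> borel_measurable (PiM J (\<lambda>_. lborel :: real measure)) \<Longrightarrow> (real (card J) - 1) * p \<le> 1 \<Longrightarrow>
    (\<integral>\<^sup>+x. epowr (f x) (1 - (real (card J) - 1) * p) * (\<Prod>j\<in>J. epowr (\<integral>\<^sup>+t. f (x(j := t)) \<partial>lborel) p) \<partial>PiM J (\<lambda>_. lborel))
    \<le> epowr (\<integral>\<^sup>+x. f x \<partial>PiM J (\<lambda>_. lborel)) (1 + p)"
  using assms(1)
proof (induction J arbitrary: f rule: finite_induct)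
  case empty
  show ?case using p by (simp add: PiM_empty nn_integral_count_space_finite algebra_simps)
next
  case (insert i J)
  interpret product_sigma_finite "\<lambda>_ :: 'i. lborel :: real measure" by standard
  note [measurable] = insert.prems(1)
  define m where "m = real (card J)"
  have m: "real (card (insert i J)) - 1 = m" using insert by (simp add: m_def)
  have mp: "m * p \<le> 1" using insert.prems(2) unfolding m .
  define F where "F x = (\<integral>\<^sup>+y. f (x(i := y)) \<partial>lborel)" for x
  have upd[measurable]: "(\<lambda>(x, y). x(i := y)) \<in> (PiM J (\<lambda>_. lborel) \<Otimes>\<^sub>M (lborel :: real measure)) \<rightarrow>\<^sub>M PiM (insert i J) (\<lambda>_. lborel)"
    using measurable_add_dim[of i J "\<lambda>_. lborel :: real measure"] .
  have Fm[measurable]: "F \<in> borel_measurable (PiM J (\<lambda>_. lborel))" unfolding F_def by measurable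
  let ?L = "\<lambda>x. epowr (f x) (1 - m * p) * (\<Prod>j\<in>insert i J. epowr (\<integral>\<^sup>+t. f (x(j := t)) \<partial>lborel) p)"
  have updj[measurable]: "(\<lambda>(x, t). x(j := t)) \<in> (PiM (insert i J) (\<lambda>_. lborel) \<Otimes>\<^sub>M (lborel :: real measure)) \<rightarrow>\<^sub>M PiM (insert i J) (\<lambda>_. lborel)"
    if "j \<in> insert i J" for j
    using measurable_fun_upd[of "insert i J" "insert i J" j fst "PiM (insert i J) (\<lambda>_. lborel) \<Otimes>\<^sub>M (lborel :: real measure)" "\<lambda>_. lborel" snd] that
    by (auto simp: case_prod_beta')
  have Lm: "?L \<in> borel_measurable (PiM (insert i J) (\<lambda>_. lborel))" by measurable
  have "(\<integral>\<^sup>+x. ?L x \<partial>PiM (insert i J) (\<lambda>_. lborel)) = (\<integral>\<^sup>+x. \<integral>\<^sup>+y. ?L (x(i := y)) \<partial>lborel \<partial>PiM J (\<lambda>_. lborel))"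
    by (rule product_nn_integral_insert[OF insert(1,2) Lm])
  also have "\<dots> \<le> (\<integral>\<^sup>+x. epowr (F x) (1 - (m - 1) * p) * (\<Prod>j\<in>J. epowr (\<integral>\<^sup>+t. F (x(j := t)) \<partial>lborel) p) \<partial>PiM J (\<lambda>_. lborel))"
  proof (rule nn_integral_mono)
    fix x assume x: "x \<in> space (PiM J (\<lambda>_. lborel :: real measure))"
    define G where "G j y = (\<integral>\<^sup>+t. f (x(i := y, j := t)) \<partial>lborel)" for j y
    have xi[measurable]: "(\<lambda>y. x(i := y)) \<in> lborel \<rightarrow>\<^sub>M PiM (insert i J) (\<lambda>_. lborel :: real measure)"
      using measurable_component_update[OF x insert(2)] .
    have fm[measurable]: "(\<lambda>y. f (x(i := y))) \<in> borel_measurable lborel" by measurable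
    have xij[measurable]: "(\<lambda>(y, t). x(i := y, j := t)) \<in> (lborel \<Otimes>\<^sub>M lborel) \<rightarrow>\<^sub>M PiM (insert i J) (\<lambda>_. lborel :: real measure)"
      if "j \<in> J" for j
      using measurable_fun_upd[of "insert i J" "insert i J" j "\<lambda>z. x(i := fst z)" "lborel \<Otimes>\<^sub>M lborel" "\<lambda>_. lborel :: real measure" snd] that
      by (auto simp: case_prod_beta')
    have Gm[measurable]: "G j \<in> borel_measurable lborel" if "j \<in> J" for j
      unfolding G_def using that by measurable
    have GI: "(\<integral>\<^sup>+y. G j y \<partial>lborel) = (\<integral>\<^sup>+t. F (x(j := t)) \<partial>lborel)" if j: "j \<in> J" for j
    proof -
      have "(\<integral>\<^sup>+y. G j y \<partial>lborel) = (\<integral>\<^sup>+t. \<integral>\<^sup>+y. f (x(i := y, j := t)) \<partial>lborel \<partial>lborel)"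
        unfolding G_def using j by (intro lborel_pair.Fubini') measurable
      also have "\<dots> = (\<integral>\<^sup>+t. F (x(j := t)) \<partial>lborel)"
      proof -
        have "x(i := y, j := t) = x(j := t, i := y)" for y t using j insert(2) by (intro fun_upd_twist) auto
        then show ?thesis unfolding F_def by simp
      qed
      finally show ?thesis .
    qed
    define H where "H j y = (if j = i then f (x(i := y)) else G j y)" for j y
    define \<theta> where "\<theta> j = (if j = i then 1 - m * p else p)" for j
    have ne: "j \<noteq> i" if "j \<in> J" for j using that insert(2) by auto
    have pH: "(\<Prod>j\<in>insert i J. epowr (H j y) (\<theta> j)) = epowr (f (x(i := y))) (1 - m * p) * (\<Prod>j\<in>J. epowr (G j y) p)" for y
      using insert(1,2) ne by (auto simp: H_def \<theta>_def intro!: arg_cong2[where f = "(*)"] prod.cong)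
    have L: "?L (x(i := y)) = epowr (F x) p * (\<Prod>j\<in>insert i J. epowr (H j y) (\<theta> j))" for y
      unfolding pH using insert(1,2) by (simp add: F_def G_def mult_ac)
    have Hm[measurable]: "H j \<in> borel_measurable lborel" if "j \<in> insert i J" for j
      using that ne unfolding H_def by (cases "j = i") auto
    have "(\<Sum>j\<in>insert i J. \<theta> j) = (1 - m * p) + (\<Sum>j\<in>J. p)"
      using insert(1,2) ne by (auto simp: \<theta>_def intro!: sum.cong)
    then have th: "(\<Sum>j\<in>insert i J. \<theta> j) = 1" by (simp add: m_def)
    have "(\<integral>\<^sup>+y. ?L (x(i := y)) \<partial>lborel) = epowr (F x) p * (\<integral>\<^sup>+y. (\<Prod>j\<in>insert i J. epowr (H j y) (\<theta> j)) \<partial>lborel)"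
      unfolding L by (rule nn_integral_cmult) measurable
    also have "\<dots> \<le> epowr (F x) p * (\<Prod>j\<in>insert i J. epowr (\<integral>\<^sup>+y. H j y \<partial>lborel) (\<theta> j))"
      using insert(1) mp p th by (intro mult_left_mono holder_finite Hm) (auto simp: \<theta>_def)
    also have "(\<Prod>j\<in>insert i J. epowr (\<integral>\<^sup>+y. H j y \<partial>lborel) (\<theta> j)) = epowr (F x) (1 - m * p) * (\<Prod>j\<in>J. epowr (\<integral>\<^sup>+t. F (x(j := t)) \<partial>lborel) p)"
      using insert(1,2) ne by (auto simp: H_def \<theta>_def F_def[symmetric] GI intro!: arg_cong2[where f = "(*)"] prod.cong)
    also have "epowr (F x) p * (epowr (F x) (1 - m * p) * (\<Prod>j\<in>J. epowr (\<integral>\<^sup>+t. F (x(j := t)) \<partial>lborel) p))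
       = epowr (F x) (1 - (m - 1) * p) * (\<Prod>j\<in>J. epowr (\<integral>\<^sup>+t. F (x(j := t)) \<partial>lborel) p)"
      using epowr_add[of p "1 - m * p" "F x"] p mp by (simp add: algebra_simps)
    finally show "(\<integral>\<^sup>+y. ?L (x(i := y)) \<partial>lborel) \<le> epowr (F x) (1 - (m - 1) * p) * (\<Prod>j\<in>J. epowr (\<integral>\<^sup>+t. F (x(j := t)) \<partial>lborel) p)" .
  qed
  also have "\<dots> \<le> epowr (\<integral>\<^sup>+x. F x \<partial>PiM J (\<lambda>_. lborel)) (1 + p)"
    unfolding m_def by (rule insert.IH[OF Fm]) (use mp p in \<open>simp add: m_def algebra_simps\<close>)
  also have "(\<integral>\<^sup>+x. F x \<partial>PiM J (\<lambda>_. lborel)) = (\<integral>\<^sup>+x. f x \<partial>PiM (insert i J) (\<lambda>_. lborel))"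
    unfolding F_def by (rule product_nn_integral_insert[symmetric, OF insert(1,2,4)])
  finally show ?case unfolding m .
qed

lemma vec_lambda_measurable [measurable]:
  "(\<lambda>f. \<chi> i. f i) \<in> (PiM UNIV (\<lambda>_ :: 'n :: finite. lborel :: real measure)) \<rightarrow>\<^sub>M borel"
proof (rule borel_measurable_euclidean_space[THEN iffD2], rule ballI)
  fix b :: "real ^ 'n" assume "b \<in> Basis"
  then obtain j where "b = axis j 1" by (auto simp: Basis_vec_def)
  then show "(\<lambda>f. (\<chi> i. f i) \<bullet> b) \<in> borel_measurable (PiM UNIV (\<lambda>_. lborel))"
    by (simp add: inner_axis)
qed

lemma lborel_vec_eq: "(lborel :: (real ^ 'n) measure) = distr (PiM UNIV (\<lambda>_. lborel)) borel (\<lambda>f. \<chi> i. f i)"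
proof (rule lborel_eqI)
  interpret finite_product_sigma_finite "\<lambda>_ :: 'n. lborel :: real measure" UNIV by standard simp
  fix l u :: "real ^ 'n" assume le: "\<And>b. b \<in> Basis \<Longrightarrow> l \<bullet> b \<le> u \<bullet> b"
  have le': "l $ i \<le> u $ i" for i using le[of "axis i 1"] by (simp add: inner_axis axis_in_Basis_iff)
  have "(\<lambda>f. \<chi> i. f i) -` box l u \<inter> space (PiM UNIV (\<lambda>_. lborel)) = (\<Pi>\<^sub>E i\<in>UNIV. {l $ i <..< u $ i})"
    by (auto simp: mem_box_cart space_PiM PiE_def Pi_def)
  then have "emeasure (distr (PiM UNIV (\<lambda>_. lborel)) borel (\<lambda>f. \<chi> i. f i)) (box l u) = (\<Prod>i\<in>UNIV. emeasure lborel {l $ i <..< u $ i})"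
    by (simp add: emeasure_distr measure_times)
  also have "\<dots> = ennreal (\<Prod>i\<in>UNIV. (u - l) $ i)"
    using le' by (simp add: prod_ennreal)
  also have "(\<Prod>i\<in>UNIV. (u - l) $ i) = (\<Prod>b\<in>Basis. (u - l) \<bullet> b)"
    by (simp add: Basis_vec_def UNION_singleton_eq_range inner_axis prod.reindex axis_eq_axis inj_on_def)
  finally show "emeasure (distr (PiM UNIV (\<lambda>_. lborel)) borel (\<lambda>f. \<chi> i. f i)) (box l u) = ennreal (\<Prod>b\<in>Basis. (u - l) \<bullet> b)" .
qed simp

lemma prod_mono_epowr:
  assumes "\<And>j. h j \<le> f j" "p \<ge> 0"
  shows "(\<Prod>j\<in>A. epowr (h j) p) \<le> (\<Prod>j\<in>A. epowr (f j) p)"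
  by (induction A rule: infinite_finite_induct) (auto intro!: mult_mono epowr_mono assms)

text \<open>With \<open>p = 1/(N-1)\<close> the factor with exponent \<open>1 - (N-1) p\<close> in \<open>grid_lines\<close> drops out, and \<open>h^(N p)\<close> is a product
  of \<open>N\<close> copies of \<open>h^p\<close>, each bounded by a marginal in its own direction.\<close>

lemma gagliardo:
  fixes h g :: "real ^ 'n \<Rightarrow> ennreal"
  assumes n: "CARD('n) \<ge> 2"
    and [measurable]: "h \<in> borel_measurable borel" "g \<in> borel_measurable borel"
    and le: "\<And>x i. h x \<le> (\<integral>\<^sup>+t. g (\<chi> j. if j = i then t else x $ j) \<partial>lborel)"
  shows "(\<integral>\<^sup>+x. epowr (h x) (real CARD('n) / (real CARD('n) - 1)) \<partial>lborel)
    \<le> epowr (\<integral>\<^sup>+x. g x \<partial>lborel) (real CARD('n) / (real CARD('n) - 1))"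
proof -
  define n where "n = real CARD('n)"
  have n2: "n \<ge> 2" using n by (simp add: n_def)
  define p where "p = 1 / (n - 1)"
  have p: "p > 0" "n * p = n / (n - 1)" "1 + p = n / (n - 1)" "(n - 1) * p = 1"
    using n2 by (auto simp: p_def field_simps)
  let ?P = "PiM UNIV (\<lambda>_ :: 'n. lborel :: real measure)"
  let ?v = "\<lambda>f :: 'n \<Rightarrow> real. \<chi> i. f i"
  define f where "f x = g (?v x)" for x
  have [measurable]: "f \<in> borel_measurable ?P" unfolding f_def by measurable
  have "(\<integral>\<^sup>+x. epowr (h x) (n * p) \<partial>lborel) = (\<integral>\<^sup>+x. epowr (h (?v x)) (n * p) \<partial>?P)"
    by (subst lborel_vec_eq) (simp add: nn_integral_distr)
  also have "\<dots> \<le> (\<integral>\<^sup>+x. epowr (f x) (1 - (real (card (UNIV :: 'n set)) - 1) * p) * (\<Prod>j\<in>UNIV. epowr (\<integral>\<^sup>+t. f (x(j := t)) \<partial>lborel) p) \<partial>?P)"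
  proof (rule nn_integral_mono)
    fix x
    have "epowr (h (?v x)) (n * p) = (\<Prod>j\<in>(UNIV :: 'n set). epowr (h (?v x)) p)"
      using p by (simp add: epowr_power n_def)
    also have "\<dots> \<le> (\<Prod>j\<in>UNIV. epowr (\<integral>\<^sup>+t. f (x(j := t)) \<partial>lborel) p)"
    proof (rule prod_mono_epowr)
      fix j
      have "(\<chi> k. if k = j then t else ?v x $ k) = ?v (x(j := t))" for t by (auto simp: vec_eq_iff)
      then show "h (?v x) \<le> (\<integral>\<^sup>+t. f (x(j := t)) \<partial>lborel)"
        using le[of "?v x" j] by (simp add: f_def)
    qed (use p in auto)
    also have "\<dots> = epowr (f x) (1 - (real (card (UNIV :: 'n set)) - 1) * p) * \<dots>"
      using p by (simp add: n_def)
    finally show "epowr (h (?v x)) (n * p) \<le> \<dots>" .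
  qed
  also have "\<dots> \<le> epowr (\<integral>\<^sup>+x. f x \<partial>?P) (1 + p)"
    using p by (intro grid_lines) (auto simp: n_def)
  also have "(\<integral>\<^sup>+x. f x \<partial>?P) = (\<integral>\<^sup>+x. g x \<partial>lborel)"
    by (subst lborel_vec_eq) (simp add: nn_integral_distr f_def[abs_def])
  finally show ?thesis using p by (simp add: n_def)
qed

section \<open>The Sobolev inequality for test functions\<close>

text \<open>The odd power \<open>|s|^(a-1) s\<close>; \<open>spow (r - 1)\<close> is the nonlinearity \<open>|s|^(r-2) s\<close>.\<close>

definition spow :: "real \<Rightarrow> real \<Rightarrow> real" where
  "spow a s = sgn s * \<bar>s\<bar> powr a"

lemma spow_abs: "\<bar>spow a s\<bar> = \<bar>s\<bar> powr a"
  by (auto simp: spow_def abs_mult sgn_if)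

lemma spow_eq: "\<bar>s\<bar> powr (r - 2) * s = spow (r - 1) s"
proof (cases "s = 0")
  case False
  have "\<bar>s\<bar> powr (r - 1) = \<bar>s\<bar> powr (r - 2) * \<bar>s\<bar>"
    using powr_mult_base[of "\<bar>s\<bar>" "r - 2"] by (simp add: mult.commute)
  then show ?thesis by (simp add: spow_def mult.left_commute[of "sgn s"]) (simp add: sgn_if)
qed (simp add: spow_def)

lemma spow_0 [simp]: "spow a 0 = 0" by (simp add: spow_def)

lemma spow_measurable [measurable]:
  assumes [measurable]: "f \<in> borel_measurable M"
  shows "(\<lambda>x. spow a (f x)) \<in> borel_measurable M"
  unfolding spow_def by measurable

lemma spow_max: "spow a s = (max s 0) powr a - (max (- s) 0) powr a"
  by (auto simp: spow_def sgn_if max_def)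

lemma continuous_spow: "a > 0 \<Longrightarrow> continuous_on UNIV (spow a)"
  unfolding spow_max[abs_def] by (intro continuous_intros continuous_on_powr') auto

lemma abs_powr_derivative:
  assumes "\<gamma> > 1"
  shows "((\<lambda>s. \<bar>s\<bar> powr \<gamma>) has_real_derivative \<gamma> * spow (\<gamma> - 1) s) (at s)"
proof -
  consider "s > 0" | "s < 0" | "s = 0" by linarith
  then show ?thesis
  proof cases
    case 1
    have "((\<lambda>s. s powr \<gamma>) has_real_derivative \<gamma> * spow (\<gamma> - 1) s) (at s)"
      using has_real_derivative_powr[OF 1, of \<gamma>] 1 by (simp add: spow_def)
    then show ?thesis
      by (rule has_field_derivative_transform_within_open[where S = "{0<..}"]) (use 1 in auto)
  next
    case 2
    have "((\<lambda>s. (- s) powr \<gamma>) has_real_derivative \<gamma> * spow (\<gamma> - 1) s) (at s)"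
      using 2 by (auto intro!: derivative_eq_intros simp: spow_def)
    then show ?thesis
      by (rule has_field_derivative_transform_within_open[where S = "{..<0}"]) (use 2 in auto)
  next
    case 3
    have "isCont (spow (\<gamma> - 1)) 0"
      using continuous_spow[of "\<gamma> - 1"] assms by (auto simp: continuous_on_eq_continuous_at)
    then have "(spow (\<gamma> - 1) \<longlongrightarrow> 0) (at 0)" by (simp add: isCont_def)
    moreover have "\<bar>h\<bar> powr \<gamma> / h = spow (\<gamma> - 1) h" for h :: real
    proof (cases "h = 0")
      case False
      have "\<bar>h\<bar> powr \<gamma> = \<bar>h\<bar> powr (\<gamma> - 1) * \<bar>h\<bar>"
        using powr_mult_base[of "\<bar>h\<bar>" "\<gamma> - 1"] by (simp add: mult.commute)
      then show ?thesis using False by (auto simp: spow_def sgn_if field_simps)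
    qed (simp add: spow_def)
    ultimately show ?thesis using 3 by (simp add: DERIV_def)
  qed
qed

lemma compact_support_FTC_bound:
  fixes F F' :: "real \<Rightarrow> real"
  assumes F: "\<And>t. (F has_real_derivative F' t) (at t)" and F': "continuous_on UNIV F'"
    and a: "a \<le> s" "F a = 0"
  shows "ennreal \<bar>F s\<bar> \<le> (\<integral>\<^sup>+t. ennreal \<bar>F' t\<bar> \<partial>lborel)"
proof -
  have c: "continuous_on {a..s} F'" using F' by (rule continuous_on_subset) auto
  have "(LBINT t. indicator {a..s} t *\<^sub>R F' t) = F s - F a"
    using a(1) F c by (intro integral_FTC_atLeastAtMost)
      (auto simp: has_real_derivative_iff_has_vector_derivative[symmetric] intro: has_field_derivative_at_within)
  then have "ennreal \<bar>F s\<bar> = ennreal (norm (LBINT t. indicator {a..s} t *\<^sub>R F' t))" using a by simp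
  also have "\<dots> \<le> (\<integral>\<^sup>+t. ennreal (norm (indicator {a..s} t *\<^sub>R F' t)) \<partial>lborel)"
    using borel_integrable_atLeastAtMost'[OF c]
    by (intro integral_norm_bound_ennreal) (simp add: set_integrable_def)
  also have "\<dots> \<le> (\<integral>\<^sup>+t. ennreal \<bar>F' t\<bar> \<partial>lborel)"
    by (intro nn_integral_mono ennreal_leI) (auto simp: indicator_def)
  finally show ?thesis .
qed

lemma continuous_grad:
  fixes v :: "real ^ 'n \<Rightarrow> real"
  assumes "v \<in> test_functions" shows "continuous_on UNIV (grad v)"
proof -
  have "continuous_on UNIV (\<lambda>x. \<chi> i. grad v x $ i)"
    by (intro continuous_on_vec_lambda test_continuous test_grad assms)
  then show ?thesis by (simp add: vec_nth_inverse)
qed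

lemma grad_borel [measurable_dest]: "v \<in> test_functions \<Longrightarrow> grad v \<in> borel_measurable borel"
  by (simp add: borel_measurable_continuous_onI continuous_grad)

lemma grad_support:
  fixes v :: "real ^ 'n \<Rightarrow> real"
  assumes "\<And>x. norm x > R \<Longrightarrow> v x = 0" "norm x > R"
  shows "grad v x = 0"
  by (rule grad_zero_outside[of "{x. norm x > R}" _ _ 0])
     (use assms in \<open>auto intro!: open_Collect_less continuous_intros\<close>)

lemma continuous_compact_support_integrable:
  fixes f :: "real ^ 'n \<Rightarrow> real"
  assumes "continuous_on UNIV f" "\<And>x. norm x > R \<Longrightarrow> f x = 0"
  shows "integrable lborel f"
proof -
  have "integrable lborel (\<lambda>x. indicator (cball 0 R) x *\<^sub>R f x)"
    by (intro borel_integrable_compact continuous_on_subset[OF assms(1)]) auto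
  moreover have "(\<lambda>x. indicator (cball 0 R) x *\<^sub>R f x) = f"
  proof
    fix x show "indicator (cball 0 R) x *\<^sub>R f x = f x"
      using assms(2)[of x] by (cases "norm x > R") auto
  qed
  ultimately show ?thesis by simp
qed

text \<open>The quadratic polynomial \<open>t \<mapsto> \<integral>(|f| - t |g|)^2\<close> is nonnegative.\<close>

lemma cauchy_schwarz_integral:
  fixes f g :: "'a \<Rightarrow> real"
  assumes [measurable]: "f \<in> borel_measurable M" "g \<in> borel_measurable M"
    and f: "integrable M (\<lambda>x. (f x)\<^sup>2)" and g: "integrable M (\<lambda>x. (g x)\<^sup>2)"
  shows "integrable M (\<lambda>x. f x * g x)"
    and "(\<integral>x. \<bar>f x * g x\<bar> \<partial>M)\<^sup>2 \<le> (\<integral>x. (f x)\<^sup>2 \<partial>M) * (\<integral>x. (g x)\<^sup>2 \<partial>M)"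
proof -
  have le: "\<bar>a * b\<bar> \<le> a\<^sup>2 + b\<^sup>2" for a b :: real
  proof -
    have "2 * (\<bar>a\<bar> * \<bar>b\<bar>) \<le> a\<^sup>2 + b\<^sup>2" using sum_squares_bound[of "\<bar>a\<bar>" "\<bar>b\<bar>"] by (simp add: mult.assoc)
    moreover have "0 \<le> \<bar>a\<bar> * \<bar>b\<bar>" by simp
    ultimately show ?thesis unfolding abs_mult by linarith
  qed
  show fg: "integrable M (\<lambda>x. f x * g x)"
    by (rule Bochner_Integration.integrable_bound[of _ "\<lambda>x. (f x)\<^sup>2 + (g x)\<^sup>2"])
       (use f g le in auto)
  define A B C where "A = (\<integral>x. (f x)\<^sup>2 \<partial>M)" and "B = (\<integral>x. (g x)\<^sup>2 \<partial>M)" and "C = (\<integral>x. \<bar>f x * g x\<bar> \<partial>M)"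
  have q: "A - 2 * t * C + t\<^sup>2 * B \<ge> 0" for t
  proof -
    have "0 \<le> (\<integral>x. (\<bar>f x\<bar> - t * \<bar>g x\<bar>)\<^sup>2 \<partial>M)" by simp
    also have "\<dots> = (\<integral>x. (f x)\<^sup>2 - 2 * t * \<bar>f x * g x\<bar> + t\<^sup>2 * (g x)\<^sup>2 \<partial>M)"
      by (intro Bochner_Integration.integral_cong) (auto simp: power2_diff power_mult_distrib abs_mult)
    also have "\<dots> = A - 2 * t * C + t\<^sup>2 * B"
      using f g fg by (simp add: A_def B_def C_def)
    finally show ?thesis .
  qed
  have B: "B \<ge> 0" and C: "C \<ge> 0" by (simp_all add: B_def C_def)
  show "(\<integral>x. \<bar>f x * g x\<bar> \<partial>M)\<^sup>2 \<le> (\<integral>x. (f x)\<^sup>2 \<partial>M) * (\<integral>x. (g x)\<^sup>2 \<partial>M)"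
    unfolding A_def[symmetric] B_def[symmetric] C_def[symmetric]
  proof (cases "B = 0")
    case True
    have "C = 0"
    proof (rule ccontr)
      assume "C \<noteq> 0"
      with q[of "(A + 1) / (2 * C)"] True show False by (simp add: field_simps)
    qed
    then show "C\<^sup>2 \<le> A * B" using True by simp
  next
    case False
    then have "B > 0" using B by simp
    with q[of "C / B"] show "C\<^sup>2 \<le> A * B" by (simp add: field_simps power2_eq_square)
  qed
qed

text \<open>The Gagliardo inequality is applied to \<open>|W|^\<gamma>\<close>, which along every coordinate line is bounded by the integral of
  \<open>\<gamma> |W|^(\<gamma>-1) |\<nabla>W|\<close>.\<close>

lemma sobolev_step:
  fixes W :: "real ^ 'n \<Rightarrow> real"
  assumes n: "CARD('n) \<ge> 2" and W: "W \<in> test_functions" and g: "\<gamma> > 1"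
  defines "e \<equiv> real CARD('n) / (real CARD('n) - 1)"
  shows "(LBINT x. \<bar>W x\<bar> powr (\<gamma> * e)) \<le> (\<gamma> * (LBINT x. \<bar>W x\<bar> powr (\<gamma> - 1) * norm (grad W x))) powr e"
proof -
  have e: "e > 0" using n by (simp add: e_def)
  obtain R where R: "\<And>x. norm x > R \<Longrightarrow> W x = 0" using test_support[OF W] by metis
  have Wc: "continuous_on UNIV W" by (rule test_continuous[OF W])
  have [measurable]: "W \<in> borel_measurable borel" "grad W \<in> borel_measurable borel"
    using W by (auto intro: test_borel grad_borel)
  let ?g = "\<lambda>x. \<gamma> * (\<bar>W x\<bar> powr (\<gamma> - 1) * norm (grad W x))"
  have line: "ennreal (\<bar>W x\<bar> powr \<gamma>) \<le> (\<integral>\<^sup>+t. ennreal (?g (\<chi> j. if j = i then t else x $ j)) \<partial>lborel)" for x i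
  proof -
    define y where "y t = (\<chi> j. if j = i then t else x $ j)" for t
    have y: "y t = (x - x $ i *\<^sub>R axis i 1) + t *\<^sub>R axis i 1" for t
      by (auto simp: y_def vec_eq_iff axis_def)
    have dy: "(y has_derivative (\<lambda>h. h *\<^sub>R axis i 1)) (at t)" for t
      unfolding y[abs_def] by (auto intro!: derivative_eq_intros)
    have yc: "continuous_on UNIV y" unfolding y[abs_def] by (intro continuous_intros)
    have dW: "((\<lambda>t. W (y t)) has_real_derivative grad W (y t) $ i) (at t)" for t
      using has_derivative_compose[OF dy test_has_derivative[OF W, of "y t"]]
      by (simp add: has_field_derivative_def inner_axis mult_commute_abs)
    define F F' where "F t = \<bar>W (y t)\<bar> powr \<gamma>" and "F' t = \<gamma> * spow (\<gamma> - 1) (W (y t)) * grad W (y t) $ i" for t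
    have dF: "(F has_real_derivative F' t) (at t)" for t
      unfolding F_def[abs_def] F'_def by (rule DERIV_chain2[OF abs_powr_derivative[OF g] dW])
    have cF: "continuous_on UNIV F'"
      unfolding F'_def[abs_def] using g
      by (intro continuous_intros continuous_on_compose2[OF continuous_spow _ subset_UNIV]
          continuous_on_compose2[OF Wc yc subset_UNIV]
          continuous_on_compose2[OF test_continuous[OF test_grad[OF W]] yc subset_UNIV]) auto
    \<comment> \<open>a point of the line to the left of \<open>x\<close> and outside the support\<close>
    define a where "a = min (x $ i) (- \<bar>R\<bar> - 1)"
    have "norm (y a) \<ge> \<bar>y a $ i\<bar>" by (rule component_le_norm_cart)
    then have "norm (y a) > R" by (simp add: y_def a_def)
    then have "F a = 0" using R by (simp add: F_def)
    then have "ennreal \<bar>F (x $ i)\<bar> \<le> (\<integral>\<^sup>+t. ennreal \<bar>F' t\<bar> \<partial>lborel)"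
      by (intro compact_support_FTC_bound[OF dF cF, of a]) (auto simp: a_def)
    also have "\<dots> \<le> (\<integral>\<^sup>+t. ennreal (?g (y t)) \<partial>lborel)"
      using g component_le_norm_cart[of "grad W (y _)" i]
      by (intro nn_integral_mono ennreal_leI) (auto simp: F'_def abs_mult spow_abs mult.assoc intro!: mult_left_mono)
    also have "y (x $ i) = x" by (auto simp: y_def vec_eq_iff)
    then have "\<bar>F (x $ i)\<bar> = \<bar>W x\<bar> powr \<gamma>" by (simp add: F_def)
    finally show ?thesis by (simp add: y_def)
  qed
  have gz: "?g x = 0" if "norm x > R" for x using grad_support[of R W x] R that by simp
  have gc: "continuous_on UNIV ?g"
    using g by (intro continuous_intros continuous_on_powr' Wc continuous_grad W) auto
  have gI: "integrable lborel ?g" by (rule continuous_compact_support_integrable[OF gc gz])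
  have WI: "integrable lborel (\<lambda>x. \<bar>W x\<bar> powr (\<gamma> * e))"
    by (rule continuous_compact_support_integrable[of _ R])
       (use g e in \<open>auto intro!: continuous_intros continuous_on_powr' Wc simp: R\<close>)
  have "(\<integral>\<^sup>+x. epowr (ennreal (\<bar>W x\<bar> powr \<gamma>)) e \<partial>lborel) \<le> epowr (\<integral>\<^sup>+x. ennreal (?g x) \<partial>lborel) e"
    unfolding e_def by (rule gagliardo[OF n _ _ line]) measurable
  also have "(\<integral>\<^sup>+x. ennreal (?g x) \<partial>lborel) = ennreal (LBINT x. ?g x)"
    using g by (intro nn_integral_eq_integral gI) auto
  also have "epowr (ennreal (LBINT x. ?g x)) e = ennreal ((LBINT x. ?g x) powr e)"
    using g e by (intro epowr_ennreal integral_nonneg_AE) auto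
  also have "(\<integral>\<^sup>+x. epowr (ennreal (\<bar>W x\<bar> powr \<gamma>)) e \<partial>lborel) = (\<integral>\<^sup>+x. ennreal (\<bar>W x\<bar> powr (\<gamma> * e)) \<partial>lborel)"
    using e by (simp add: epowr_ennreal powr_powr)
  also have "\<dots> = ennreal (LBINT x. \<bar>W x\<bar> powr (\<gamma> * e))"
    by (intro nn_integral_eq_integral WI) auto
  finally show ?thesis by simp
qed

lemma sobolev_step_L2:
  fixes W :: "real ^ 'n \<Rightarrow> real"
  assumes n: "CARD('n) \<ge> 2" and W: "W \<in> test_functions" and g: "\<gamma> > 1"
  defines "e \<equiv> real CARD('n) / (real CARD('n) - 1)"
  shows "(LBINT x. \<bar>W x\<bar> powr (\<gamma> * e)) \<le>
     (\<gamma>\<^sup>2 * (LBINT x. \<bar>W x\<bar> powr (2 * \<gamma> - 2)) * (LBINT x. (norm (grad W x))\<^sup>2)) powr (e / 2)"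
proof -
  have e: "e > 0" using n by (simp add: e_def)
  obtain R where R: "\<And>x. norm x > R \<Longrightarrow> W x = 0" using test_support[OF W] by metis
  have Wc: "continuous_on UNIV W" by (rule test_continuous[OF W])
  have [measurable]: "W \<in> borel_measurable borel" "grad W \<in> borel_measurable borel"
    using W by (auto intro: test_borel grad_borel)
  have sq: "(\<bar>W x\<bar> powr (\<gamma> - 1))\<^sup>2 = \<bar>W x\<bar> powr (2 * \<gamma> - 2)" for x
    by (simp add: power2_eq_square powr_add[symmetric])
  have I1: "integrable lborel (\<lambda>x. \<bar>W x\<bar> powr (2 * \<gamma> - 2))"
    by (rule continuous_compact_support_integrable[of _ R])
       (use g in \<open>auto intro!: continuous_intros continuous_on_powr' Wc simp: R\<close>)
  have I2: "integrable lborel (\<lambda>x. (norm (grad W x))\<^sup>2)"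
    by (rule continuous_compact_support_integrable[of _ R])
       (use grad_support[of R W] R in \<open>auto intro!: continuous_intros continuous_grad W\<close>)
  define X where "X = (LBINT x. \<bar>W x\<bar> powr (\<gamma> - 1) * norm (grad W x))"
  have X0: "X \<ge> 0" by (simp add: X_def)
  have "(LBINT x. \<bar>\<bar>W x\<bar> powr (\<gamma> - 1) * norm (grad W x)\<bar>)\<^sup>2 \<le> (LBINT x. (\<bar>W x\<bar> powr (\<gamma> - 1))\<^sup>2) * (LBINT x. (norm (grad W x))\<^sup>2)"
    by (rule cauchy_schwarz_integral(2)) (use I1 I2 in \<open>auto simp: sq\<close>)
  then have X2: "X\<^sup>2 \<le> (LBINT x. \<bar>W x\<bar> powr (2 * \<gamma> - 2)) * (LBINT x. (norm (grad W x))\<^sup>2)"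
    by (simp add: X_def sq)
  have "(\<gamma> * X) powr e = ((\<gamma> * X)\<^sup>2) powr (e / 2)"
    using g X0 by (simp add: powr_powr flip: powr_numeral)
  also have "\<dots> \<le> (\<gamma>\<^sup>2 * (LBINT x. \<bar>W x\<bar> powr (2 * \<gamma> - 2)) * (LBINT x. (norm (grad W x))\<^sup>2)) powr (e / 2)"
    using e X2 mult_left_mono[OF X2, of "\<gamma>\<^sup>2"]
    by (intro powr_mono2) (auto simp: power_mult_distrib mult.assoc)
  finally show ?thesis using sobolev_step[OF n W g] unfolding X_def e_def by linarith
qed

text \<open>For \<open>\<gamma> = 2 (N-1)/(N-2)\<close> the same power \<open>2*\<close> of \<open>|W|\<close> stands on both sides of \<open>sobolev_step_L2\<close>, with exponent less
  than 1 on the right, and can be absorbed.\<close>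

lemma sobolev_critical:
  fixes W :: "real ^ 'n \<Rightarrow> real"
  assumes n: "CARD('n) \<ge> 3" and W: "W \<in> test_functions"
  defines "N \<equiv> real CARD('n)"
  shows "(LBINT x. \<bar>W x\<bar> powr (2 * N / (N - 2))) \<le>
     ((2 * (N - 1) / (N - 2))\<^sup>2 * (LBINT x. (norm (grad W x))\<^sup>2)) powr (N / (N - 2))"
proof -
  have N: "N \<ge> 3" using n by (simp add: N_def)
  define \<gamma> where "\<gamma> = 2 * (N - 1) / (N - 2)"
  have g: "\<gamma> > 1" using N by (simp add: \<gamma>_def field_simps)
  define \<tau> where "\<tau> = 2 * N / (N - 2)"
  have "2 * a / c * (N / a) = 2 * N / c" if "a \<noteq> 0" for a c :: real using that by simp
  from this[of "N - 1" "N - 2"] have t1: "\<gamma> * (N / (N - 1)) = \<tau>" using N by (simp add: \<gamma>_def \<tau>_def)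
  have t2: "2 * \<gamma> - 2 = \<tau>" using N by (simp add: \<gamma>_def \<tau>_def field_simps)
  define I D where "I = (LBINT x. \<bar>W x\<bar> powr \<tau>)" and "D = (LBINT x. (norm (grad W x))\<^sup>2)"
  have I0: "I \<ge> 0" and D0: "D \<ge> 0" by (simp_all add: I_def D_def)
  define e where "e = N / (N - 1) / 2"
  have e: "e > 0" "e < 1" "1 - e = (N - 2) / (2 * (N - 1))" using N by (auto simp: e_def field_simps)
  have "CARD('n) \<ge> 2" using n by simp
  from sobolev_step_L2[OF this W g] have *: "I \<le> (\<gamma>\<^sup>2 * I * D) powr e"
    unfolding t2 N_def[symmetric] t1 I_def D_def e_def .
  have "I \<le> (\<gamma>\<^sup>2 * D) powr (N / (N - 2))"
  proof (cases "I = 0")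
    case False
    then have Ip: "I > 0" using I0 by simp
    have "I powr (1 - e) * I powr e = I" using Ip by (simp add: powr_add[symmetric])
    also have "\<dots> \<le> (\<gamma>\<^sup>2 * D) powr e * I powr e" using * D0 Ip by (simp add: powr_mult mult_ac)
    finally have "I powr (1 - e) \<le> (\<gamma>\<^sup>2 * D) powr e" using Ip by simp
    then have "(I powr (1 - e)) powr (1 / (1 - e)) \<le> ((\<gamma>\<^sup>2 * D) powr e) powr (1 / (1 - e))"
    proof (intro powr_mono2)
      show "0 \<le> 1 / (1 - e)" using e(2) by (simp only: zero_le_divide_1_iff)
    qed auto
    moreover have "e / (1 - e) = N / (N - 2)"
    proof -
      have "e = N / (2 * (N - 1))" by (simp add: e_def)
      then show ?thesis unfolding e(3) using N by simp
    qed
    moreover have "(1 - e) * (1 / (1 - e)) = 1" "e * (1 / (1 - e)) = e / (1 - e)" using e(2) by simp_all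
    ultimately have "I powr 1 \<le> (\<gamma>\<^sup>2 * D) powr (N / (N - 2))" unfolding powr_powr by simp
    then show ?thesis using Ip by simp
  qed simp
  then show ?thesis unfolding I_def D_def \<gamma>_def \<tau>_def .
qed

text \<open>In the plane there is no critical exponent: each application of \<open>sobolev_step_L2\<close> raises the power of \<open>|W|\<close> by 2.\<close>

lemma sobolev_plane:
  assumes n: "CARD('n) = 2"
  shows "\<exists>C>0. \<forall>W \<in> (test_functions :: (real ^ 'n \<Rightarrow> real) set). \<forall>M>0.
    (LBINT x. (W x)\<^sup>2) + (LBINT x. (norm (grad W x))\<^sup>2) \<le> M \<longrightarrow>
    (LBINT x. \<bar>W x\<bar> powr (2 * real (Suc m))) \<le> C * M ^ Suc m"
proof (induction m)
  case 0
  show ?case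
  proof (intro exI[of _ 1] conjI ballI allI impI)
    fix W :: "real ^ 'n \<Rightarrow> real" and M :: real
    assume "(LBINT x. (W x)\<^sup>2) + (LBINT x. (norm (grad W x))\<^sup>2) \<le> M"
    moreover have "(LBINT x. (norm (grad W x))\<^sup>2) \<ge> 0" by simp
    ultimately have "(LBINT x. (W x)\<^sup>2) \<le> M" by linarith
    moreover have "\<bar>W x\<bar> powr 2 = (W x)\<^sup>2" for x by (cases "W x = 0") (auto simp: powr_numeral)
    ultimately show "(LBINT x. \<bar>W x\<bar> powr (2 * real (Suc 0))) \<le> 1 * M ^ Suc 0" by simp
  qed simp
next
  case (Suc m)
  then obtain C where C: "C > 0" "\<And>W M. W \<in> (test_functions :: (real ^ 'n \<Rightarrow> real) set) \<Longrightarrow> M > 0 \<Longrightarrow>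
    (LBINT x. (W x)\<^sup>2) + (LBINT x. (norm (grad W x))\<^sup>2) \<le> M \<Longrightarrow>
    (LBINT x. \<bar>W x\<bar> powr (2 * real (Suc m))) \<le> C * M ^ Suc m" by metis
  define \<gamma> where "\<gamma> = real (Suc (Suc m))"
  have g: "\<gamma> > 1" by (simp add: \<gamma>_def)
  show ?case
  proof (intro exI[of _ "\<gamma>\<^sup>2 * C"] conjI ballI allI impI)
    show "\<gamma>\<^sup>2 * C > 0" using C g by simp
    fix W :: "real ^ 'n \<Rightarrow> real" and M :: real
    assume W: "W \<in> test_functions" and M: "M > 0"
      and le: "(LBINT x. (W x)\<^sup>2) + (LBINT x. (norm (grad W x))\<^sup>2) \<le> M"
    have "(LBINT x. (W x)\<^sup>2) \<ge> 0" by simp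
    then have D: "(LBINT x. (norm (grad W x))\<^sup>2) \<le> M" using le by linarith
    have I: "(LBINT x. \<bar>W x\<bar> powr (2 * real (Suc m))) \<le> C * M ^ Suc m" by (rule C(2)[OF W M le])
    have nn: "\<gamma>\<^sup>2 * (LBINT x. \<bar>W x\<bar> powr (2 * real (Suc m))) * (LBINT x. (norm (grad W x))\<^sup>2) \<ge> 0" by simp
    have "(LBINT x. \<bar>W x\<bar> powr (2 * real (Suc (Suc m)))) \<le>
       \<gamma>\<^sup>2 * (LBINT x. \<bar>W x\<bar> powr (2 * real (Suc m))) * (LBINT x. (norm (grad W x))\<^sup>2)"
    proof -
      have n2: "CARD('n) \<ge> 2" using n by simp
      have e1: "\<gamma> * (real CARD('n) / (real CARD('n) - 1)) = 2 * real (Suc (Suc m))" using n by (simp add: \<gamma>_def)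
      have e2: "2 * \<gamma> - 2 = 2 * real (Suc m)" by (simp add: \<gamma>_def)
      have e3: "real CARD('n) / (real CARD('n) - 1) / 2 = 1" using n by simp
      show ?thesis
        using sobolev_step_L2[OF n2 W g] unfolding e1 e2 e3 powr_one[OF nn] .
    qed
    also have "\<dots> \<le> \<gamma>\<^sup>2 * (C * M ^ Suc m) * M"
      using C(1) M I D by (intro mult_mono) auto
    finally show "(LBINT x. \<bar>W x\<bar> powr (2 * real (Suc (Suc m)))) \<le> \<gamma>\<^sup>2 * C * M ^ Suc (Suc m)"
      by (simp add: mult_ac)
  qed
qed

lemma powr_interpolate:
  fixes x r s :: real
  assumes "2 \<le> r" "r \<le> s" "x \<ge> 0" shows "x powr r \<le> x\<^sup>2 + x powr s"
proof (cases "x \<ge> 1")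
  case True
  then have "x powr r \<le> x powr s" using assms by (intro powr_mono) auto
  then show ?thesis by (simp add: add_increasing)
next
  case False
  then have "x powr r \<le> x\<^sup>2" using assms powr_mono'[of 2 r x]
    by (cases "x = 0") (auto simp: powr_numeral)
  then show ?thesis by (simp add: add_increasing2)
qed

text \<open>An exponent between 2 and an admissible \<open>s\<close> is reached by interpolation after normalising \<open>W\<close> by \<open>\<surd>M\<close>, which turns the
  interpolation into the pointwise bound \<open>t^r \<le> t^2 + t^s\<close>.\<close>

lemma sobolev_test:
  assumes n: "CARD('n) \<ge> 2" and r: "r \<ge> 2" "CARD('n) \<ge> 3 \<Longrightarrow> r \<le> 2 * real CARD('n) / (real CARD('n) - 2)"
  shows "\<exists>C>0. \<forall>W \<in> (test_functions :: (real ^ 'n \<Rightarrow> real) set). \<forall>M>0.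
    (LBINT x. (W x)\<^sup>2) + (LBINT x. (norm (grad W x))\<^sup>2) \<le> M \<longrightarrow>
    (LBINT x. \<bar>W x\<bar> powr r) \<le> C * M powr (r / 2)"
proof -
  have "\<exists>s C. s \<ge> r \<and> C > 0 \<and> (\<forall>W \<in> (test_functions :: (real ^ 'n \<Rightarrow> real) set). \<forall>M>0.
    (LBINT x. (W x)\<^sup>2) + (LBINT x. (norm (grad W x))\<^sup>2) \<le> M \<longrightarrow>
    (LBINT x. \<bar>W x\<bar> powr s) \<le> C * M powr (s / 2))"
  proof (cases "CARD('n) = 2")
    case True
    obtain m where m: "r \<le> real m" using real_arch_simple by blast
    obtain C where C: "C > 0" "\<forall>W \<in> (test_functions :: (real ^ 'n \<Rightarrow> real) set). \<forall>M>0.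
      (LBINT x. (W x)\<^sup>2) + (LBINT x. (norm (grad W x))\<^sup>2) \<le> M \<longrightarrow>
      (LBINT x. \<bar>W x\<bar> powr (2 * real (Suc m))) \<le> C * M ^ Suc m"
      using sobolev_plane[OF True] by metis
    have "M ^ Suc m = M powr (2 * real (Suc m) / 2)" if "M > 0" for M :: real
    proof -
      have "2 * real (Suc m) / 2 = real (Suc m)" by simp
      then show ?thesis using that powr_realpow[of M "Suc m"] by (simp only:)
    qed
    moreover have "2 * real (Suc m) \<ge> r" using m by simp
    ultimately show ?thesis using C by metis
  next
    case False
    define N where "N = real CARD('n)"
    have n3: "CARD('n) \<ge> 3" using n False by simp
    then have N: "N \<ge> 3" by (simp add: N_def)
    define \<gamma> where "\<gamma> = 2 * (N - 1) / (N - 2)"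
    have g: "\<gamma> > 0" using N by (simp add: \<gamma>_def)
    show ?thesis
    proof (rule exI[of _ "2 * N / (N - 2)"], rule exI[of _ "(\<gamma>\<^sup>2) powr (N / (N - 2))"], intro conjI ballI allI impI)
      show "r \<le> 2 * N / (N - 2)" using r(2)[OF n3] by (simp add: N_def)
      show "(\<gamma>\<^sup>2) powr (N / (N - 2)) > 0" using g by simp
      fix W :: "real ^ 'n \<Rightarrow> real" and M :: real
      assume W: "W \<in> test_functions" and M: "M > 0"
        and le: "(LBINT x. (W x)\<^sup>2) + (LBINT x. (norm (grad W x))\<^sup>2) \<le> M"
      have "(LBINT x. (W x)\<^sup>2) \<ge> 0" by simp
      then have D: "(LBINT x. (norm (grad W x))\<^sup>2) \<le> M" using le by linarith
      have "(LBINT x. \<bar>W x\<bar> powr (2 * N / (N - 2))) \<le> (\<gamma>\<^sup>2 * (LBINT x. (norm (grad W x))\<^sup>2)) powr (N / (N - 2))"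
        using sobolev_critical[OF n3 W] by (simp add: N_def \<gamma>_def)
      also have "\<dots> \<le> (\<gamma>\<^sup>2 * M) powr (N / (N - 2))"
        using D N by (intro powr_mono2 mult_left_mono) auto
      also have "\<dots> = (\<gamma>\<^sup>2) powr (N / (N - 2)) * M powr (2 * N / (N - 2) / 2)"
      proof -
        have "2 * N / c / 2 = N / c" for c :: real by simp
        from this[of "N - 2"] show ?thesis using M by (simp only:) (simp add: powr_mult)
      qed
      finally show "(LBINT x. \<bar>W x\<bar> powr (2 * N / (N - 2))) \<le> \<dots>" .
    qed
  qed
  then obtain s C where sC: "s \<ge> r" "C > 0" "\<And>W M. W \<in> (test_functions :: (real ^ 'n \<Rightarrow> real) set) \<Longrightarrow> M > 0 \<Longrightarrow>
    (LBINT x. (W x)\<^sup>2) + (LBINT x. (norm (grad W x))\<^sup>2) \<le> M \<Longrightarrow>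
    (LBINT x. \<bar>W x\<bar> powr s) \<le> C * M powr (s / 2)" by metis
  show ?thesis
  proof (intro exI[of _ "1 + C"] conjI ballI allI impI)
    show "1 + C > 0" using sC by simp
    fix W :: "real ^ 'n \<Rightarrow> real" and M :: real
    assume W: "W \<in> test_functions" and M: "M > 0"
      and le: "(LBINT x. (W x)\<^sup>2) + (LBINT x. (norm (grad W x))\<^sup>2) \<le> M"
    obtain R where R: "\<And>x. norm x > R \<Longrightarrow> W x = 0" using test_support[OF W] by metis
    have Wc: "continuous_on UNIV W" by (rule test_continuous[OF W])
    have Ip: "integrable lborel (\<lambda>x. \<bar>W x\<bar> powr p)" if "p > 0" for p
      by (rule continuous_compact_support_integrable[of _ R])
         (use that in \<open>auto intro!: continuous_intros continuous_on_powr' Wc simp: R\<close>)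
    have I2: "integrable lborel (\<lambda>x. (W x)\<^sup>2)"
      by (rule continuous_compact_support_integrable[of _ R])
         (auto intro!: continuous_intros Wc simp: R)
    define \<beta> where "\<beta> = sqrt M"
    have b: "\<beta> > 0" "\<beta>\<^sup>2 = M" using M by (auto simp: \<beta>_def)
    have bp: "\<beta> powr p = M powr (p / 2)" for p
      using M by (simp add: \<beta>_def powr_half_sqrt[symmetric] powr_powr)
    have D: "(LBINT x. (W x)\<^sup>2) \<le> M"
    proof -
      have "(LBINT x. (norm (grad W x))\<^sup>2) \<ge> 0" by simp
      then show ?thesis using le by linarith
    qed
    have pw: "\<bar>W x\<bar> powr r \<le> \<beta> powr r * ((W x)\<^sup>2 / M + \<bar>W x\<bar> powr s / M powr (s / 2))" for x
    proof -
      have eq: "\<bar>W x\<bar> powr r = \<beta> powr r * (\<bar>W x\<bar> / \<beta>) powr r"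
        using b by (simp add: powr_divide)
      have "(\<bar>W x\<bar> / \<beta>) powr r \<le> (\<bar>W x\<bar> / \<beta>)\<^sup>2 + (\<bar>W x\<bar> / \<beta>) powr s"
        using b sC r by (intro powr_interpolate) auto
      also have "\<dots> = (W x)\<^sup>2 / M + \<bar>W x\<bar> powr s / M powr (s / 2)"
        using b by (simp add: power_divide powr_divide bp)
      finally show ?thesis unfolding eq by (rule mult_left_mono) simp
    qed
    have "(LBINT x. \<bar>W x\<bar> powr r) \<le> (LBINT x. \<beta> powr r * ((W x)\<^sup>2 / M + \<bar>W x\<bar> powr s / M powr (s / 2)))"
      using I2 Ip[of r] Ip[of s] r sC by (intro integral_mono pw) auto
    also have "\<dots> = \<beta> powr r * ((LBINT x. (W x)\<^sup>2) / M + (LBINT x. \<bar>W x\<bar> powr s) / M powr (s / 2))"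
      using I2 Ip[of s] r sC by simp
    also have "\<dots> \<le> \<beta> powr r * (1 + C)"
      using M D sC(3)[OF W M le] by (intro mult_left_mono add_mono) (auto simp: divide_le_eq)
    finally show "(LBINT x. \<bar>W x\<bar> powr r) \<le> (1 + C) * M powr (r / 2)" by (simp add: bp mult.commute)
  qed
qed

lemma integrable_indicator_mult:
  fixes f :: "'a \<Rightarrow> real"
  assumes "integrable M f" "A \<in> sets M" shows "integrable M (\<lambda>x. indicator A x * f x)"
  using integrable_mult_indicator[OF assms(2,1)] by simp

lemma power2_sum2_le: "(a + b)\<^sup>2 \<le> 2 * a\<^sup>2 + 2 * b\<^sup>2" for a b :: real
  using zero_le_power2[of "a - b"] by (simp add: power2_eq_square algebra_simps)

lemma power2_sum3_le: "(a + b + c)\<^sup>2 \<le> 3 * (a\<^sup>2 + b\<^sup>2 + c\<^sup>2)" for a b c :: real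
  using zero_le_power2[of "a - b"] zero_le_power2[of "b - c"] zero_le_power2[of "a - c"]
  by (simp add: power2_eq_square algebra_simps)

lemma norm_sum2_le: "(norm (a + b))\<^sup>2 \<le> 2 * (norm a)\<^sup>2 + 2 * (norm b)\<^sup>2"
proof -
  have "(norm (a + b))\<^sup>2 \<le> (norm a + norm b)\<^sup>2" by (intro power_mono norm_triangle_ineq) auto
  then show ?thesis using power2_sum2_le[of "norm a" "norm b"] by linarith
qed

lemma norm_sq_vec: "(norm (x :: real ^ 'n))\<^sup>2 = (\<Sum>i\<in>UNIV. (x $ i)\<^sup>2)"
  unfolding power2_norm_eq_inner inner_vec_def by (simp add: power2_eq_square)

lemma cball_borel [measurable]: "cball (a :: 'a :: euclidean_space) R \<in> sets borel"
  by (simp add: borel_closed)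

lemma abs_powr_2: "\<bar>x\<bar> powr 2 = x\<^sup>2" for x :: real
  by (cases "x = 0") (auto simp: powr_numeral)

section \<open>Radial cutoffs\<close>

text \<open>A mollified indicator function of the ball of radius 3/2 with mollification radius 1/2.\<close>

lemma cutoff_exists:
  "\<exists>\<xi> :: real ^ 'n \<Rightarrow> real. \<xi> \<in> test_functions \<and> (\<forall>x. 0 \<le> \<xi> x \<and> \<xi> x \<le> 1) \<and>
     (\<forall>x. norm x \<le> 1 \<longrightarrow> \<xi> x = 1) \<and> (\<forall>x. norm x > 2 \<longrightarrow> \<xi> x = 0)"
proof -
  define w :: "real ^ 'n \<Rightarrow> real" where "w = indicator (cball 0 (3 / 2))"
  define \<xi> where "\<xi> = moll 1 w"
  have wI: "integrable lborel w"
    unfolding w_def using emeasure_bounded_finite[of "cball (0 :: real ^ 'n) (3 / 2)"]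
    by (intro integrable_real_indicator) auto
  have wm[measurable]: "w \<in> borel_measurable borel" using wI by auto
  have rI: "integrable lborel (std_moll :: real ^ 'n \<Rightarrow> real)" by (rule test_integrable[OF std_moll_test])
  have pI: "integrable lborel (\<lambda>y. std_moll y * w (x - y /\<^sub>R real (Suc 1)))" for x
    by (rule Bochner_Integration.integrable_bound[OF rI]) (auto simp: w_def indicator_def)
  have "\<xi> \<in> test_functions" unfolding \<xi>_def
    by (rule moll_test[OF wI, of "3 / 2"]) (auto simp: w_def)
  moreover have "0 \<le> \<xi> x" for x unfolding \<xi>_def moll_def
    by (intro integral_nonneg_AE) (auto simp: std_moll_nonneg w_def)
  moreover have "\<xi> x \<le> 1" for x
  proof -
    have "\<xi> x \<le> (LBINT y. std_moll (y :: real ^ 'n))"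
      unfolding \<xi>_def moll_def
      by (rule integral_mono[OF pI rI]) (auto simp: w_def indicator_def std_moll_nonneg)
    then show ?thesis by (simp add: std_moll_integral)
  qed
  moreover have "\<xi> x = 1" if x: "norm x \<le> 1" for x
  proof -
    have "std_moll y * w (x - y /\<^sub>R real (Suc 1)) = std_moll y" for y
    proof (cases "norm y \<ge> 1")
      case False
      have "norm (x - y /\<^sub>R 2) \<le> norm x + norm (y /\<^sub>R 2)" by (rule norm_triangle_ineq4)
      also have "\<dots> \<le> 3 / 2" using x False by simp
      finally show ?thesis by (simp add: w_def indicator_def)
    qed (simp add: std_moll_zero)
    then show ?thesis unfolding \<xi>_def moll_def by (simp only: std_moll_integral)
  qed
  moreover have "\<xi> x = 0" if x: "norm x > 2" for x
  proof (rule ccontr)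
    assume "\<xi> x \<noteq> 0"
    then obtain z where "norm (z - x) \<le> 1 / real (Suc 1)" "w z \<noteq> 0" unfolding \<xi>_def by (rule moll_nonzeroD)
    then have "norm (z - x) \<le> 1 / 2" "norm z \<le> 3 / 2" by (auto simp: w_def indicator_def split: if_splits)
    then show False using x norm_triangle_sub[of x z] by (simp add: norm_minus_commute)
  qed
  ultimately show ?thesis by blast
qed

definition cut1 :: "real ^ 'n \<Rightarrow> real" where
  "cut1 = (SOME \<xi>. \<xi> \<in> test_functions \<and> (\<forall>x. 0 \<le> \<xi> x \<and> \<xi> x \<le> 1) \<and>
     (\<forall>x. norm x \<le> 1 \<longrightarrow> \<xi> x = 1) \<and> (\<forall>x. norm x > 2 \<longrightarrow> \<xi> x = 0))"

lemma cut1: "cut1 \<in> test_functions" "0 \<le> cut1 x" "cut1 x \<le> 1" "norm x \<le> 1 \<Longrightarrow> cut1 x = 1" "norm x > 2 \<Longrightarrow> cut1 x = 0"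
  using someI_ex[OF cutoff_exists] unfolding cut1_def by blast+

definition cut :: "real \<Rightarrow> real ^ 'n \<Rightarrow> real" where "cut R x = cut1 (x /\<^sub>R R)"

lemma cut_test: "R > 0 \<Longrightarrow> cut R \<in> test_functions"
  using test_affine[OF cut1(1), of "inverse R" 0] by (simp add: cut_def[abs_def])

lemma cut_range: "0 \<le> cut R x" "cut R x \<le> 1"
  by (simp_all add: cut_def cut1)

lemma cut_eq_1: "R > 0 \<Longrightarrow> norm x \<le> R \<Longrightarrow> cut R x = 1"
  by (simp add: cut_def cut1(4) divide_simps)

lemma cut_eq_0: "R > 0 \<Longrightarrow> norm x > 2 * R \<Longrightarrow> cut R x = 0"
  by (simp add: cut_def cut1(5) divide_simps mult.commute)

lemma grad_cut: "grad (cut R) x = grad cut1 (x /\<^sub>R R) /\<^sub>R R"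
  using grad_affine[OF cut1(1), of 0 "inverse R" x] by (simp add: cut_def[abs_def])

lemma grad_cut_0:
  assumes "R > 0" "norm x < R \<or> norm x > 2 * R" shows "grad (cut R) x = 0"
proof (cases "norm x < R")
  case True
  show ?thesis
    by (rule grad_zero_outside[of "{x. norm x < R}" _ _ 1])
       (use True assms in \<open>auto intro!: open_Collect_less continuous_intros cut_eq_1\<close>)
next
  case False
  show ?thesis
    by (rule grad_zero_outside[of "{x. norm x > 2 * R}" _ _ 0])
       (use False assms in \<open>auto intro!: open_Collect_less continuous_intros cut_eq_0\<close>)
qed

section \<open>Weak gradients\<close>

definition wgrad :: "(real ^ 'n \<Rightarrow> real) \<Rightarrow> (real ^ 'n \<Rightarrow> real ^ 'n) \<Rightarrow> bool" where
  "wgrad w g \<longleftrightarrow> (\<forall>v\<in>test_functions. \<forall>i.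
     (LBINT x. w x * grad v x $ i) = - (LBINT x. g x $ i * v x))"

text \<open>Compactly supported Sobolev functions together with their weak gradient.\<close>

definition H1c :: "(real ^ 'n \<Rightarrow> real) \<Rightarrow> (real ^ 'n \<Rightarrow> real ^ 'n) \<Rightarrow> bool" where
  "H1c w g \<longleftrightarrow> w \<in> borel_measurable borel \<and> g \<in> borel_measurable borel \<and>
     integrable lborel (\<lambda>x. (w x)\<^sup>2) \<and> integrable lborel (\<lambda>x. (norm (g x))\<^sup>2) \<and>
     (\<exists>R. \<forall>x. norm x > R \<longrightarrow> w x = 0 \<and> g x = 0) \<and> wgrad w g"

text \<open>Functions that are locally square integrable, with a weak gradient that is globally so; this is what membership in the
  energy space gives, and it is stable under dilations.\<close>

definition H1loc :: "(real ^ 'n \<Rightarrow> real) \<Rightarrow> (real ^ 'n \<Rightarrow> real ^ 'n) \<Rightarrow> bool" where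
  "H1loc u g \<longleftrightarrow> u \<in> borel_measurable borel \<and> g \<in> borel_measurable borel \<and>
     (\<forall>R. integrable lborel (\<lambda>x. indicator (cball 0 R) x * (u x)\<^sup>2)) \<and>
     integrable lborel (\<lambda>x. (norm (g x))\<^sup>2) \<and> wgrad u g"

lemma vec_nth_borel [measurable]:
  fixes g :: "'a \<Rightarrow> real ^ 'n"
  assumes "g \<in> borel_measurable M" shows "(\<lambda>x. g x $ i) \<in> borel_measurable M"
proof -
  have "(\<lambda>x. g x \<bullet> axis i 1) \<in> borel_measurable M" using assms by measurable
  then show ?thesis by (simp add: inner_axis)
qed

lemma L2loc_test_integrable:
  fixes u v :: "real ^ 'n \<Rightarrow> real"
  assumes [measurable]: "u \<in> borel_measurable borel"
    and u: "\<And>R. integrable lborel (\<lambda>x. indicator (cball 0 R) x * (u x)\<^sup>2)" and v: "v \<in> test_functions"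
  shows "integrable lborel (\<lambda>x. u x * v x)"
proof -
  obtain R where R: "\<And>x. norm x > R \<Longrightarrow> v x = 0" using test_support[OF v] by metis
  have [measurable]: "v \<in> borel_measurable borel" by (rule test_borel[OF v])
  have "integrable lborel (\<lambda>x. (indicator (cball 0 R) x * u x) * v x)"
  proof (rule cauchy_schwarz_integral(1))
    have "(indicator (cball 0 R) x * u x)\<^sup>2 = indicator (cball 0 R) x * (u x)\<^sup>2" for x by (auto simp: indicator_def)
    then show "integrable lborel (\<lambda>x. (indicator (cball 0 R) x * u x)\<^sup>2)" using u[of R] by simp
    show "integrable lborel (\<lambda>x. (v x)\<^sup>2)"
      using test_integrable[OF test_mult[OF v v]] by (simp add: power2_eq_square)
  qed measurable
  moreover have "(indicator (cball 0 R) x * u x) * v x = u x * v x" for x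
    using R[of x] by (cases "norm x > R") auto
  ultimately show ?thesis by simp
qed

lemma L2_test_integrable:
  fixes g :: "real ^ 'n \<Rightarrow> real ^ 'n"
  assumes [measurable]: "g \<in> borel_measurable borel"
    and g: "integrable lborel (\<lambda>x. (norm (g x))\<^sup>2)" and v: "v \<in> test_functions"
  shows "integrable lborel (\<lambda>x. g x $ i * v x)"
proof (rule L2loc_test_integrable[OF _ _ v])
  fix R
  show "integrable lborel (\<lambda>x. indicator (cball 0 R) x * (g x $ i)\<^sup>2)"
  proof (rule Bochner_Integration.integrable_bound[OF g])
    show "AE x in lborel. norm (indicator (cball 0 R) x * (g x $ i)\<^sup>2) \<le> norm ((norm (g x))\<^sup>2)"
    proof (rule AE_I2)
      fix x
      have "\<bar>g x $ i\<bar>\<^sup>2 \<le> (norm (g x))\<^sup>2" by (intro power_mono component_le_norm_cart) auto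
      then show "norm (indicator (cball 0 R) x * (g x $ i)\<^sup>2) \<le> norm ((norm (g x))\<^sup>2)"
        by (auto simp: indicator_def)
    qed
  qed measurable
qed measurable

lemma H1loc_diff:
  assumes "H1loc u g" "H1loc u' g'"
  shows "H1loc (\<lambda>x. u x - u' x) (\<lambda>x. g x - g' x)"
proof -
  have [measurable]: "u \<in> borel_measurable borel" "u' \<in> borel_measurable borel"
    "g \<in> borel_measurable borel" "g' \<in> borel_measurable borel" using assms by (auto simp: H1loc_def)
  have u: "integrable lborel (\<lambda>x. indicator (cball 0 R) x * (u x)\<^sup>2)" "integrable lborel (\<lambda>x. indicator (cball 0 R) x * (u' x)\<^sup>2)" for R
    using assms by (auto simp: H1loc_def)
  have g: "integrable lborel (\<lambda>x. (norm (g x))\<^sup>2)" "integrable lborel (\<lambda>x. (norm (g' x))\<^sup>2)"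
    using assms by (auto simp: H1loc_def)
  show ?thesis unfolding H1loc_def
  proof (intro conjI allI)
    fix R
    show "integrable lborel (\<lambda>x. indicator (cball 0 R) x * (u x - u' x)\<^sup>2)"
    proof (rule Bochner_Integration.integrable_bound)
      show "integrable lborel (\<lambda>x. 2 * (indicator (cball 0 R) x * (u x)\<^sup>2) + 2 * (indicator (cball 0 R) x * (u' x)\<^sup>2))"
        using u by (intro Bochner_Integration.integrable_add integrable_mult_right) auto
      show "AE x in lborel. norm (indicator (cball 0 R) x * (u x - u' x)\<^sup>2) \<le>
         norm (2 * (indicator (cball 0 R) x * (u x)\<^sup>2) + 2 * (indicator (cball 0 R) x * (u' x)\<^sup>2))"
      proof (rule AE_I2)
        fix x show "norm (indicator (cball 0 R) x * (u x - u' x)\<^sup>2) \<le>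
           norm (2 * (indicator (cball 0 R) x * (u x)\<^sup>2) + 2 * (indicator (cball 0 R) x * (u' x)\<^sup>2))"
          using power2_sum2_le[of "u x" "- u' x"] by (auto simp: indicator_def)
      qed
    qed measurable
    show "integrable lborel (\<lambda>x. (norm (g x - g' x))\<^sup>2)"
    proof (rule Bochner_Integration.integrable_bound)
      show "integrable lborel (\<lambda>x. 2 * (norm (g x))\<^sup>2 + 2 * (norm (g' x))\<^sup>2)" using g by simp
      show "AE x in lborel. norm ((norm (g x - g' x))\<^sup>2) \<le> norm (2 * (norm (g x))\<^sup>2 + 2 * (norm (g' x))\<^sup>2)"
      proof (rule AE_I2)
        fix x show "norm ((norm (g x - g' x))\<^sup>2) \<le> norm (2 * (norm (g x))\<^sup>2 + 2 * (norm (g' x))\<^sup>2)"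
          using norm_sum2_le[of "g x" "- g' x"] by simp
      qed
    qed measurable
    show "wgrad (\<lambda>x. u x - u' x) (\<lambda>x. g x - g' x)" unfolding wgrad_def
    proof (intro ballI allI)
      fix v :: "real ^ 'a \<Rightarrow> real" and i assume v: "v \<in> test_functions"
      have "(LBINT x. (u x - u' x) * grad v x $ i) = (LBINT x. u x * grad v x $ i) - (LBINT x. u' x * grad v x $ i)"
        using L2loc_test_integrable[OF _ u(1) test_grad[OF v], of i] L2loc_test_integrable[OF _ u(2) test_grad[OF v], of i]
        by (simp add: left_diff_distrib)
      also have "\<dots> = - (LBINT x. g x $ i * v x) + (LBINT x. g' x $ i * v x)"
        using assms v by (simp add: H1loc_def wgrad_def)
      also have "\<dots> = - (LBINT x. (g x - g' x) $ i * v x)"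
        using L2_test_integrable[OF _ g(1) v, of i] L2_test_integrable[OF _ g(2) v, of i] by (simp add: left_diff_distrib)
      finally show "(LBINT x. (u x - u' x) * grad v x $ i) = - (LBINT x. (g x - g' x) $ i * v x)" .
    qed
  qed measurable
qed

lemma H1loc_dilate:
  fixes u :: "real ^ 'n \<Rightarrow> real"
  assumes H: "H1loc u g" and l: "l > 0"
  shows "H1loc (\<lambda>x. u (l *\<^sub>R x)) (\<lambda>x. l *\<^sub>R g (l *\<^sub>R x))"
proof -
  have [measurable]: "u \<in> borel_measurable borel" "g \<in> borel_measurable borel" using H by (auto simp: H1loc_def)
  show ?thesis unfolding H1loc_def
  proof (intro conjI allI)
    fix R
    have "integrable lborel (\<lambda>x. indicator (cball 0 (l * R)) (0 + l *\<^sub>R x) * (u (0 + l *\<^sub>R x))\<^sup>2)"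
      by (rule integrable_affine[where f = "\<lambda>x. indicator (cball 0 (l * R)) x * (u x)\<^sup>2"])
         (use H l in \<open>auto simp: H1loc_def\<close>)
    moreover have "indicator (cball 0 (l * R)) (0 + l *\<^sub>R x) = (indicator (cball 0 R) x :: real)" for x :: "real ^ 'n"
      using l by (auto simp: indicator_def)
    ultimately show "integrable lborel (\<lambda>x. indicator (cball 0 R) x * (u (l *\<^sub>R x))\<^sup>2)" by simp
    have "integrable lborel (\<lambda>x. (norm (g (0 + l *\<^sub>R x)))\<^sup>2)"
      by (rule integrable_affine[where f = "\<lambda>x. (norm (g x))\<^sup>2"]) (use H l in \<open>auto simp: H1loc_def\<close>)
    then show "integrable lborel (\<lambda>x. (norm (l *\<^sub>R g (l *\<^sub>R x)))\<^sup>2)"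
      by (simp add: power_mult_distrib)
    show "wgrad (\<lambda>x. u (l *\<^sub>R x)) (\<lambda>x. l *\<^sub>R g (l *\<^sub>R x))" unfolding wgrad_def
    proof (intro ballI allI)
      fix v :: "real ^ 'n \<Rightarrow> real" and i assume v: "v \<in> test_functions"
      define V where "V x = v (0 + inverse l *\<^sub>R x)" for x
      have V: "V \<in> test_functions" unfolding V_def[abs_def] by (rule test_affine[OF v]) (use l in simp)
      have gV: "grad V x = inverse l *\<^sub>R grad v (inverse l *\<^sub>R x)" for x
        using grad_affine[OF v, of 0 "inverse l" x] by (simp add: V_def[abs_def])
      have [measurable]: "v \<in> borel_measurable borel" "grad v \<in> borel_measurable borel"
        "V \<in> borel_measurable borel" "grad V \<in> borel_measurable borel"
        using v V by (auto intro: test_borel grad_borel)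
      have "(LBINT x. u x * grad V x $ i) = - (LBINT x. g x $ i * V x)"
        using H V by (simp add: H1loc_def wgrad_def)
      moreover have "(LBINT x. u x * grad V x $ i) = (\<bar>l\<bar> ^ CARD('n)) *\<^sub>R (LBINT x. u (0 + l *\<^sub>R x) * grad V (0 + l *\<^sub>R x) $ i)"
        by (rule integral_affine) (use l in auto)
      moreover have "(LBINT x. g x $ i * V x) = (\<bar>l\<bar> ^ CARD('n)) *\<^sub>R (LBINT x. g (0 + l *\<^sub>R x) $ i * V (0 + l *\<^sub>R x))"
        by (rule integral_affine) (use l in auto)
      ultimately have "l ^ CARD('n) * (LBINT x. u (l *\<^sub>R x) * grad V (l *\<^sub>R x) $ i)
          = l ^ CARD('n) * (- (LBINT x. g (l *\<^sub>R x) $ i * V (l *\<^sub>R x)))"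
        using l by simp
      then have "(LBINT x. u (l *\<^sub>R x) * grad V (l *\<^sub>R x) $ i) = - (LBINT x. g (l *\<^sub>R x) $ i * V (l *\<^sub>R x))"
        using l by (simp only: mult_cancel_left) simp
      then have "inverse l * (LBINT x. u (l *\<^sub>R x) * grad v x $ i) = - (LBINT x. g (l *\<^sub>R x) $ i * v x)"
        using l by (simp add: gV V_def mult.left_commute[of _ "inverse l"])
      then show "(LBINT x. u (l *\<^sub>R x) * grad v x $ i) = - (LBINT x. (l *\<^sub>R g (l *\<^sub>R x)) $ i * v x)"
        using l by (simp add: field_simps)
    qed
  qed measurable
qed

text \<open>The product rule is passed to the test function: \<open>\<phi> \<partial>v = \<partial>(\<phi> v) - v \<partial>\<phi>\<close>.\<close>

lemma H1loc_cutoff: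
  fixes u :: "real ^ 'n \<Rightarrow> real"
  assumes H: "H1loc u g" and p: "\<phi> \<in> test_functions"
  shows "H1c (\<lambda>x. \<phi> x * u x) (\<lambda>x. \<phi> x *\<^sub>R g x + u x *\<^sub>R grad \<phi> x)"
proof -
  have [measurable]: "u \<in> borel_measurable borel" "g \<in> borel_measurable borel" using H by (auto simp: H1loc_def)
  have [measurable]: "\<phi> \<in> borel_measurable borel" "grad \<phi> \<in> borel_measurable borel"
    using p by (auto intro: test_borel grad_borel)
  have u: "integrable lborel (\<lambda>x. indicator (cball 0 R) x * (u x)\<^sup>2)" for R using H by (auto simp: H1loc_def)
  have g: "integrable lborel (\<lambda>x. (norm (g x))\<^sup>2)" using H by (auto simp: H1loc_def)
  obtain R where R: "\<And>x. norm x > R \<Longrightarrow> \<phi> x = 0" using test_support[OF p] by metis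
  obtain B where B: "B > 0" "\<And>x. \<bar>\<phi> x\<bar> \<le> B" using test_bounded[OF p] by metis
  obtain L where L: "L > 0" "\<And>x. norm (grad \<phi> x) \<le> L" using test_grad_bounded[OF p] by metis
  have gR: "norm x > R \<Longrightarrow> grad \<phi> x = 0" for x by (rule grad_support[OF R])
  have pB: "(\<phi> x)\<^sup>2 \<le> B\<^sup>2" for x using B power_mono[of "\<bar>\<phi> x\<bar>" B 2] by auto
  have gL: "(norm (grad \<phi> x))\<^sup>2 \<le> L\<^sup>2" for x using L by (intro power_mono) auto
  show ?thesis unfolding H1c_def
  proof (intro conjI)
    show "integrable lborel (\<lambda>x. (\<phi> x * u x)\<^sup>2)"
    proof (rule Bochner_Integration.integrable_bound)
      show "integrable lborel (\<lambda>x. B\<^sup>2 * (indicator (cball 0 R) x * (u x)\<^sup>2))" using u by simp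
      show "AE x in lborel. norm ((\<phi> x * u x)\<^sup>2) \<le> norm (B\<^sup>2 * (indicator (cball 0 R) x * (u x)\<^sup>2))"
      proof (rule AE_I2)
        fix x show "norm ((\<phi> x * u x)\<^sup>2) \<le> norm (B\<^sup>2 * (indicator (cball 0 R) x * (u x)\<^sup>2))"
          using R[of x] pB[of x] by (cases "norm x > R") (auto simp: power_mult_distrib abs_mult intro!: mult_right_mono)
      qed
    qed measurable
    show "integrable lborel (\<lambda>x. (norm (\<phi> x *\<^sub>R g x + u x *\<^sub>R grad \<phi> x))\<^sup>2)"
    proof (rule Bochner_Integration.integrable_bound)
      show "integrable lborel (\<lambda>x. 2 * (B\<^sup>2 * (norm (g x))\<^sup>2) + 2 * (L\<^sup>2 * (indicator (cball 0 R) x * (u x)\<^sup>2)))"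
        using u g by (intro Bochner_Integration.integrable_add integrable_mult_right) auto
      show "AE x in lborel. norm ((norm (\<phi> x *\<^sub>R g x + u x *\<^sub>R grad \<phi> x))\<^sup>2) \<le>
          norm (2 * (B\<^sup>2 * (norm (g x))\<^sup>2) + 2 * (L\<^sup>2 * (indicator (cball 0 R) x * (u x)\<^sup>2)))"
      proof (rule AE_I2)
        fix x
        have a: "(norm (\<phi> x *\<^sub>R g x))\<^sup>2 \<le> B\<^sup>2 * (norm (g x))\<^sup>2"
          using pB[of x] by (auto simp: power_mult_distrib intro!: mult_right_mono)
        have b: "(norm (u x *\<^sub>R grad \<phi> x))\<^sup>2 \<le> L\<^sup>2 * (indicator (cball 0 R) x * (u x)\<^sup>2)"
          using gR[of x] gL[of x] by (cases "norm x > R") (auto simp: power_mult_distrib mult.commute[of "L\<^sup>2"] intro!: mult_left_mono)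
        have c: "0 \<le> 2 * (B\<^sup>2 * (norm (g x))\<^sup>2) + 2 * (L\<^sup>2 * (indicator (cball 0 R) x * (u x)\<^sup>2))" by simp
        show "norm ((norm (\<phi> x *\<^sub>R g x + u x *\<^sub>R grad \<phi> x))\<^sup>2) \<le>
          norm (2 * (B\<^sup>2 * (norm (g x))\<^sup>2) + 2 * (L\<^sup>2 * (indicator (cball 0 R) x * (u x)\<^sup>2)))"
          using norm_sum2_le[of "\<phi> x *\<^sub>R g x" "u x *\<^sub>R grad \<phi> x"] a b
          unfolding real_norm_def abs_of_nonneg[OF c] by simp
      qed
    qed measurable
    show "\<exists>R. \<forall>x. norm x > R \<longrightarrow> \<phi> x * u x = 0 \<and> \<phi> x *\<^sub>R g x + u x *\<^sub>R grad \<phi> x = 0"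
      using R gR by (intro exI[of _ R]) auto
    show "wgrad (\<lambda>x. \<phi> x * u x) (\<lambda>x. \<phi> x *\<^sub>R g x + u x *\<^sub>R grad \<phi> x)" unfolding wgrad_def
    proof (intro ballI allI)
      fix v :: "real ^ 'n \<Rightarrow> real" and i assume v: "v \<in> test_functions"
      have pv: "(\<lambda>x. \<phi> x * v x) \<in> test_functions" by (rule test_mult[OF p v])
      have vp: "(\<lambda>x. grad \<phi> x $ i * v x) \<in> test_functions" by (rule test_mult[OF test_grad[OF p] v])
      have pv': "(\<lambda>x. \<phi> x * grad v x $ i) \<in> test_functions" by (rule test_mult[OF p test_grad[OF v]])
      have I1: "integrable lborel (\<lambda>x. u x * (\<phi> x * grad v x $ i))" by (rule L2loc_test_integrable[OF _ u pv']) simp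
      have I2: "integrable lborel (\<lambda>x. u x * (grad \<phi> x $ i * v x))" by (rule L2loc_test_integrable[OF _ u vp]) simp
      have I3: "integrable lborel (\<lambda>x. g x $ i * (\<phi> x * v x))" by (rule L2_test_integrable[OF _ g pv]) simp
      have "(LBINT x. u x * grad (\<lambda>x. \<phi> x * v x) x $ i) = - (LBINT x. g x $ i * (\<phi> x * v x))"
        using H pv by (simp add: H1loc_def wgrad_def)
      moreover have "u x * grad (\<lambda>x. \<phi> x * v x) x $ i = u x * (\<phi> x * grad v x $ i) + u x * (grad \<phi> x $ i * v x)" for x
        by (simp add: grad_mult[OF p v] algebra_simps)
      ultimately have "(LBINT x. u x * (\<phi> x * grad v x $ i)) + (LBINT x. u x * (grad \<phi> x $ i * v x))
         = - (LBINT x. g x $ i * (\<phi> x * v x))" using I1 I2 by simp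
      moreover have "(LBINT x. (\<phi> x *\<^sub>R g x + u x *\<^sub>R grad \<phi> x) $ i * v x)
         = (LBINT x. g x $ i * (\<phi> x * v x) + u x * (grad \<phi> x $ i * v x))"
        by (intro Bochner_Integration.integral_cong) (auto simp: algebra_simps)
      moreover have "(LBINT x. \<phi> x * u x * grad v x $ i) = (LBINT x. u x * (\<phi> x * grad v x $ i))"
        by (intro Bochner_Integration.integral_cong) auto
      ultimately show "(LBINT x. \<phi> x * u x * grad v x $ i) = - (LBINT x. (\<phi> x *\<^sub>R g x + u x *\<^sub>R grad \<phi> x) $ i * v x)"
        using I2 I3 by simp
    qed
  qed measurable
qed

section \<open>Mollification of Sobolev functions\<close>

lemma moll_L2:
  fixes w :: "real ^ 'n \<Rightarrow> real"
  assumes "w \<in> borel_measurable borel" "integrable lborel (\<lambda>x. (w x)\<^sup>2)" "\<And>x. norm x > R \<Longrightarrow> w x = 0"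
  shows "(\<lambda>k. LBINT x. (moll k w x - w x)\<^sup>2) \<longlonglongrightarrow> 0" "integrable lborel (\<lambda>x. (moll k w x - w x)\<^sup>2)"
    "integrable lborel w"
  using moll_Lp[of w 2 R] integrable_of_powr[of w 2 R] assms by (auto simp: abs_powr_2)

text \<open>The gradient of the mollification is the mollification of the weak gradient, since \<open>y \<mapsto> K (x - y)\<close> is a test
  function; convergence then follows from \<open>moll_Lp\<close> in each component.\<close>

lemma H1c_moll:
  fixes w :: "real ^ 'n \<Rightarrow> real"
  assumes H: "H1c w g"
  shows "moll k w \<in> test_functions"
    and "(\<lambda>k. LBINT x. (moll k w x - w x)\<^sup>2) \<longlonglongrightarrow> 0"
    and "integrable lborel (\<lambda>x. (moll k w x - w x)\<^sup>2)"
    and "(\<lambda>k. LBINT x. (norm (grad (moll k w) x - g x))\<^sup>2) \<longlonglongrightarrow> 0"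
    and "integrable lborel (\<lambda>x. (norm (grad (moll k w) x - g x))\<^sup>2)"
proof -
  have wm[measurable]: "w \<in> borel_measurable borel" and gm[measurable]: "g \<in> borel_measurable borel"
    and wI: "integrable lborel (\<lambda>x. (w x)\<^sup>2)" and gI: "integrable lborel (\<lambda>x. (norm (g x))\<^sup>2)"
    and wg: "wgrad w g" using H by (auto simp: H1c_def)
  obtain R where R: "\<And>x. norm x > R \<Longrightarrow> w x = 0" "\<And>x. norm x > R \<Longrightarrow> g x = 0"
    using H unfolding H1c_def by metis
  note M = moll_L2[OF wm wI R(1)]
  show "(\<lambda>k. LBINT x. (moll k w x - w x)\<^sup>2) \<longlonglongrightarrow> 0" "integrable lborel (\<lambda>x. (moll k w x - w x)\<^sup>2)"
    using M by auto
  show mt: "moll k w \<in> test_functions" for k by (rule moll_test[OF M(3) R(1)])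
  have giI: "integrable lborel (\<lambda>x. (g x $ i)\<^sup>2)" for i
  proof (rule Bochner_Integration.integrable_bound[OF gI])
    show "AE x in lborel. norm ((g x $ i)\<^sup>2) \<le> norm ((norm (g x))\<^sup>2)"
    proof (rule AE_I2)
      fix x
      have "\<bar>g x $ i\<bar>\<^sup>2 \<le> (norm (g x))\<^sup>2" by (intro power_mono component_le_norm_cart) auto
      then show "norm ((g x $ i)\<^sup>2) \<le> norm ((norm (g x))\<^sup>2)" by simp
    qed
  qed measurable
  have giR: "norm x > R \<Longrightarrow> g x $ i = 0" for x i using R(2) by simp
  note Mi = moll_L2[OF vec_nth_borel[OF gm] giI giR]
  have gr: "grad (moll k w) x $ i = moll k (\<lambda>x. g x $ i) x" for k x i
  proof -
    have "moll k w = (\<lambda>x. LBINT y. moll_ker k (x - y) * w y)"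
      by (intro ext moll_eq_conv) simp
    then have "grad (moll k w) x = (\<chi> i. LBINT y. grad (moll_ker k) (x - y) $ i * w y)"
      using grad_eqI[OF conv_has_derivative[OF moll_ker_test M(3)]] by simp
    then have "grad (moll k w) x $ i = (LBINT y. grad (moll_ker k) (x - y) $ i * w y)" by simp
    moreover define V where "V y = moll_ker k (x + (-1) *\<^sub>R y)" for y
    moreover have V: "V \<in> test_functions" unfolding V_def[abs_def] by (rule test_affine[OF moll_ker_test]) simp
    moreover have "grad V y = (-1) *\<^sub>R grad (moll_ker k) (x + (-1) *\<^sub>R y)" for y
      unfolding V_def[abs_def] by (rule grad_affine[OF moll_ker_test])
    moreover have "(LBINT y. w y * grad V y $ i) = - (LBINT y. g y $ i * V y)"
      using wg V by (simp add: wgrad_def)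
    ultimately have "grad (moll k w) x $ i = (LBINT y. moll_ker k (x - y) * g y $ i)"
      by (simp add: mult.commute)
    then show ?thesis by (simp add: moll_eq_conv)
  qed
  have eq: "(norm (grad (moll k w) x - g x))\<^sup>2 = (\<Sum>i\<in>UNIV. (moll k (\<lambda>x. g x $ i) x - g x $ i)\<^sup>2)" for k x
    by (simp add: norm_sq_vec gr)
  show "integrable lborel (\<lambda>x. (norm (grad (moll k w) x - g x))\<^sup>2)"
    unfolding eq by (intro Bochner_Integration.integrable_sum Mi(2))
  have "(LBINT x. (norm (grad (moll k w) x - g x))\<^sup>2) = (\<Sum>i\<in>UNIV. LBINT x. (moll k (\<lambda>x. g x $ i) x - g x $ i)\<^sup>2)" for k
    unfolding eq by (intro Bochner_Integration.integral_sum Mi(2))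
  moreover have "(\<lambda>k. \<Sum>i\<in>UNIV. LBINT x. (moll k (\<lambda>x. g x $ i) x - g x $ i)\<^sup>2) \<longlonglongrightarrow> (\<Sum>i\<in>(UNIV :: 'n set). 0)"
    by (intro tendsto_sum Mi(1))
  ultimately show "(\<lambda>k. LBINT x. (norm (grad (moll k w) x - g x))\<^sup>2) \<longlonglongrightarrow> 0" by simp
qed

section \<open>Monotonicity and convexity of powers\<close>

lemma powr_prod_le_sum:
  fixes x y r :: real
  assumes "x \<ge> 0" "y \<ge> 0" "r > 2" shows "x powr (r - 2) * y\<^sup>2 \<le> x powr r + y powr r"
proof -
  define m where "m = max x y"
  have m: "m \<ge> 0" "m powr r \<le> x powr r + y powr r" using assms by (auto simp: m_def max_def)
  have "x powr (r - 2) * y\<^sup>2 \<le> m powr (r - 2) * m\<^sup>2"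
    using assms by (intro mult_mono powr_mono2 power_mono) (auto simp: m_def)
  also have "\<dots> = m powr r"
    using m(1) by (cases "m = 0") (auto simp: powr_add[symmetric] simp flip: powr_numeral)
  finally show ?thesis using m by linarith
qed

lemma powr_prod1_le_sum:
  fixes x y p :: real
  assumes "x \<ge> 0" "y \<ge> 0" "p > 1" shows "x powr (p - 1) * y \<le> x powr p + y powr p"
proof -
  define m where "m = max x y"
  have m: "m \<ge> 0" "m powr p \<le> x powr p + y powr p" using assms by (auto simp: m_def max_def)
  have "x powr (p - 1) * y \<le> m powr (p - 1) * m"
    using assms by (intro mult_mono powr_mono2) (auto simp: m_def)
  also have "\<dots> = m powr p" using powr_mult_base[of m "p - 1"] m by (simp add: mult.commute)
  finally show ?thesis using m by linarith
qed

lemma spow_mult_self: "spow p a * a = \<bar>a\<bar> powr (p + 1)"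
  using powr_mult_base[of "\<bar>a\<bar>" p] by (cases "a = 0") (auto simp: spow_def sgn_if add.commute mult.commute)

text \<open>Convexity of \<open>|s|^r\<close>. It is used at \<open>u x\<close> for the absorption term and at \<open>u (l x)\<close> for the source term, which is why
  only the latter leaves a defect.\<close>

lemma powr_convex_tangent:
  fixes a b r :: real
  assumes "r \<ge> 1"
  shows "\<bar>b\<bar> powr r + r * (spow (r - 1) b * (a - b)) \<le> \<bar>a\<bar> powr r"
proof -
  have "spow (r - 1) b * (a - b) = \<bar>b\<bar> powr (r - 1) * (sgn b * a - \<bar>b\<bar>)"
    by (auto simp: spow_def sgn_if algebra_simps)
  also have "\<dots> \<le> \<bar>b\<bar> powr (r - 1) * (\<bar>a\<bar> - \<bar>b\<bar>)"
    by (intro mult_left_mono) (auto simp: sgn_if)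
  finally have "r * (spow (r - 1) b * (a - b)) \<le> r * (\<bar>b\<bar> powr (r - 1) * (\<bar>a\<bar> - \<bar>b\<bar>))"
    using assms by (intro mult_left_mono) auto
  moreover have "\<bar>b\<bar> powr r + r * (\<bar>b\<bar> powr (r - 1) * (\<bar>a\<bar> - \<bar>b\<bar>)) \<le> \<bar>a\<bar> powr r"
    using powr_tangent[of r "\<bar>b\<bar>" "\<bar>a\<bar>"] assms by (simp add: mult.assoc)
  ultimately show ?thesis by linarith
qed

text \<open>For equal signs this is convexity of \<open>t^p\<close> in both directions; for opposite signs \<open>|a - b| = |a| + |b|\<close>.\<close>

lemma spow_lipschitz_ge:
  fixes a b p :: real
  assumes p: "p \<ge> 1"
  shows "\<bar>spow p a - spow p b\<bar> \<le> p * (\<bar>a\<bar> powr (p - 1) + \<bar>b\<bar> powr (p - 1)) * \<bar>a - b\<bar>"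
proof -
  have same: "\<bar>t powr p - s powr p\<bar> \<le> p * (s powr (p - 1) + t powr (p - 1)) * \<bar>t - s\<bar>" if "s \<ge> 0" "t \<ge> 0" for s t :: real
  proof -
    have le: "y powr p - x powr p \<le> p * (x powr (p - 1) + y powr (p - 1)) * \<bar>y - x\<bar>" if "x \<ge> 0" "y \<ge> 0" for x y :: real
    proof -
      have "y powr p - x powr p \<le> p * y powr (p - 1) * (y - x)"
        using powr_tangent[of p y x] p that by (simp add: algebra_simps)
      also have "\<dots> \<le> p * y powr (p - 1) * \<bar>y - x\<bar>" using p by (intro mult_left_mono) auto
      also have "\<dots> \<le> p * (x powr (p - 1) + y powr (p - 1)) * \<bar>y - x\<bar>"
        using p by (intro mult_right_mono mult_left_mono) auto
      finally show ?thesis .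
    qed
    show ?thesis using le[OF that] le[OF that(2,1)] by (simp add: abs_le_iff abs_minus_commute add.commute)
  qed
  have opp: "s powr p + t powr p \<le> p * (s powr (p - 1) + t powr (p - 1)) * (s + t)" if "s \<ge> 0" "t \<ge> 0" for s t :: real
  proof -
    have "s powr p = s powr (p - 1) * s" "t powr p = t powr (p - 1) * t"
      using powr_mult_base[of s "p - 1"] powr_mult_base[of t "p - 1"] that by (auto simp: mult.commute)
    moreover have "s powr (p - 1) * s + t powr (p - 1) * t \<le> (s powr (p - 1) + t powr (p - 1)) * (s + t)"
      using that by (simp add: algebra_simps)
    moreover have "1 * ((s powr (p - 1) + t powr (p - 1)) * (s + t)) \<le> p * ((s powr (p - 1) + t powr (p - 1)) * (s + t))"
      using p that by (intro mult_right_mono) auto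
    ultimately show ?thesis by (simp add: mult.assoc)
  qed
  consider "a \<ge> 0" "b \<ge> 0" | "a \<le> 0" "b \<le> 0" | "a > 0" "b < 0" | "a < 0" "b > 0" by linarith
  then show ?thesis
  proof cases
    case 1
    then show ?thesis using same[of b a] by (simp add: spow_max add.commute)
  next
    case 2
    then show ?thesis using same[of "-a" "-b"] by (simp add: spow_max abs_minus_commute)
  next
    case 3
    then show ?thesis using opp[of a "-b"] by (simp add: spow_max)
  next
    case 4
    then have "spow p a - spow p b = - ((- a) powr p + b powr p)" by (simp add: spow_max)
    then have "\<bar>spow p a - spow p b\<bar> = (- a) powr p + b powr p" by (simp only: abs_minus_cancel) simp
    then show ?thesis using opp[of "-a" b] 4 by simp
  qed
qed

lemma powr_subadditive:
  fixes s d p :: real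
  assumes "0 < p" "p \<le> 1" "s \<ge> 0" "d \<ge> 0"
  shows "(s + d) powr p \<le> s powr p + d powr p"
proof (cases "s + d = 0")
  case False
  define m where "m = s + d"
  have m: "m > 0" using False assms by (simp add: m_def)
  have le: "x / m \<le> x powr p / m powr p" if "0 \<le> x" "x \<le> m" for x
  proof -
    have "(x / m) powr 1 \<le> (x / m) powr p" using that m assms by (intro powr_mono') auto
    then show ?thesis using that m by (simp add: powr_divide)
  qed
  have "1 = s / m + d / m" using m by (simp add: m_def add_divide_distrib[symmetric])
  also have "\<dots> \<le> s powr p / m powr p + d powr p / m powr p"
    using assms by (intro add_mono le) (auto simp: m_def)
  finally have "1 \<le> (s powr p + d powr p) / m powr p" by (simp add: add_divide_distrib)
  then show ?thesis using m by (simp add: m_def[symmetric] le_divide_eq)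
qed (use assms in auto)

text \<open>For equal signs this is subadditivity of \<open>t^p\<close>; for opposite signs each term is at most \<open>|a - b|^p\<close>.\<close>

lemma spow_holder_le:
  fixes a b p :: real
  assumes p: "0 < p" "p \<le> 1"
  shows "\<bar>spow p a - spow p b\<bar> \<le> 2 * \<bar>a - b\<bar> powr p"
proof -
  have same: "\<bar>t powr p - s powr p\<bar> \<le> 2 * \<bar>t - s\<bar> powr p" if "s \<ge> 0" "t \<ge> 0" for s t :: real
  proof -
    have le: "\<bar>y powr p - x powr p\<bar> \<le> (y - x) powr p" if "x \<ge> 0" "y \<ge> x" for x y :: real
      using powr_subadditive[of p x "y - x"] powr_mono2[of p x y] p that by simp
    show ?thesis
    proof (cases "s \<le> t")
      case True
      have "\<bar>t powr p - s powr p\<bar> \<le> \<bar>t - s\<bar> powr p" using le[OF that(1) True] True by simp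
      then show ?thesis using powr_ge_zero[of "\<bar>t - s\<bar>" p] by linarith
    next
      case False
      have "\<bar>t powr p - s powr p\<bar> \<le> \<bar>t - s\<bar> powr p" using le[of t s] that False by (simp add: abs_minus_commute)
      then show ?thesis using powr_ge_zero[of "\<bar>t - s\<bar>" p] by linarith
    qed
  qed
  have opp: "s powr p + t powr p \<le> 2 * (s + t) powr p" if "s \<ge> 0" "t \<ge> 0" for s t :: real
    using powr_mono2[of p s "s + t"] powr_mono2[of p t "s + t"] p that by simp
  consider "a \<ge> 0" "b \<ge> 0" | "a \<le> 0" "b \<le> 0" | "a > 0" "b < 0" | "a < 0" "b > 0" by linarith
  then show ?thesis
  proof cases
    case 1
    then show ?thesis using same[of b a] by (simp add: spow_max)
  next
    case 2
    then show ?thesis using same[of "-a" "-b"] by (simp add: spow_max abs_minus_commute)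
  next
    case 3
    then show ?thesis using opp[of a "-b"] by (simp add: spow_max)
  next
    case 4
    then have "spow p a - spow p b = - ((- a) powr p + b powr p)" by (simp add: spow_max)
    then have "\<bar>spow p a - spow p b\<bar> = (- a) powr p + b powr p" by (simp only: abs_minus_cancel) simp
    then show ?thesis using opp[of "-a" b] 4 by simp
  qed
qed

section \<open>Finite differences under dilation\<close>

definition ann :: "real \<Rightarrow> real \<Rightarrow> (real ^ 'n) set" where
  "ann s t = {x. s \<le> norm x \<and> norm x \<le> t}"

lemma ann_borel [measurable]: "ann s t \<in> sets borel"
  unfolding ann_def by measurable

lemma dilate_integral:
  fixes f :: "real ^ 'n \<Rightarrow> real"
  assumes [measurable]: "f \<in> borel_measurable borel" and l: "l > 0"
  shows "(LBINT x. f (l *\<^sub>R x)) = (LBINT x. f x) / l ^ CARD('n)"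
  using integral_affine[of f l 0] assms by simp

lemma dilate_integral_le:
  fixes f :: "real ^ 'n \<Rightarrow> real"
  assumes [measurable]: "f \<in> borel_measurable borel" and l: "l \<ge> 1 / 2" and nn: "\<And>x. f x \<ge> 0"
  shows "(LBINT x. f (l *\<^sub>R x)) \<le> 2 ^ CARD('n) * (LBINT x. f x)"
proof -
  have "(1 / 2) ^ CARD('n) \<le> l ^ CARD('n)" using l by (intro power_mono) auto
  then have "1 \<le> 2 ^ CARD('n) * l ^ CARD('n)" by (simp add: power_one_over field_simps)
  moreover have "(LBINT x. f (l *\<^sub>R x)) \<ge> 0" using nn by simp
  ultimately have "1 * (LBINT x. f (l *\<^sub>R x)) \<le> (2 ^ CARD('n) * l ^ CARD('n)) * (LBINT x. f (l *\<^sub>R x))"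
    by (intro mult_right_mono) auto
  also have "\<dots> = 2 ^ CARD('n) * (LBINT x. f x)"
    using dilate_integral[of f l] l by simp
  finally show ?thesis by simp
qed

lemma dilate_integrable:
  fixes f :: "real ^ 'n \<Rightarrow> real"
  assumes "integrable lborel f" and l: "l > 0"
  shows "integrable lborel (\<lambda>x. f (l *\<^sub>R x))"
  using integrable_affine[OF assms(1), of l 0] l by simp

lemma dilation_pointwise:
  fixes v :: "real ^ 'n \<Rightarrow> real"
  assumes v: "v \<in> test_functions"
  shows "ennreal ((v (l *\<^sub>R x) - v x)\<^sup>2) \<le>
    (\<integral>\<^sup>+\<tau>. ennreal (indicator {0..1} \<tau> * ((l - 1)\<^sup>2 * (norm x)\<^sup>2 * (norm (grad v ((1 + \<tau> * (l - 1)) *\<^sub>R x)))\<^sup>2)) \<partial>lborel)"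
proof -
  define y where "y \<tau> = (1 + \<tau> * (l - 1)) *\<^sub>R x" for \<tau>
  define F F' where "F \<tau> = v (y \<tau>)" and "F' \<tau> = grad v (y \<tau>) \<bullet> ((l - 1) *\<^sub>R x)" for \<tau>
  define G where "G \<tau> = (l - 1)\<^sup>2 * (norm x)\<^sup>2 * (norm (grad v (y \<tau>)))\<^sup>2" for \<tau>
  have yc: "continuous_on UNIV y" unfolding y_def[abs_def] by (intro continuous_intros)
  have dy: "(y has_derivative (\<lambda>h. h *\<^sub>R ((l - 1) *\<^sub>R x))) (at \<tau>)" for \<tau>
    unfolding y_def[abs_def] by (auto intro!: derivative_eq_intros)
  have dF: "(F has_real_derivative F' \<tau>) (at \<tau>)" for \<tau>
    using has_derivative_compose[OF dy test_has_derivative[OF v, of "y \<tau>"]]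
    by (simp add: has_field_derivative_def F_def[abs_def] F'_def mult_commute_abs mult_ac)
  have gc: "continuous_on UNIV (\<lambda>\<tau>. grad v (y \<tau>))"
    by (rule continuous_on_compose2[OF continuous_grad[OF v] yc subset_UNIV])
  have F'c: "continuous_on A F'" for A unfolding F'_def[abs_def]
    by (rule continuous_on_subset[OF _ subset_UNIV]) (intro continuous_intros gc)
  have Gc: "continuous_on A G" for A unfolding G_def[abs_def]
    by (rule continuous_on_subset[OF _ subset_UNIV]) (intro continuous_intros gc)
  have [measurable]: "F' \<in> borel_measurable borel" by (rule borel_measurable_continuous_onI[OF F'c])
  have IG: "integrable lborel (\<lambda>\<tau>. indicator {0..1} \<tau> * G \<tau>)"
    using borel_integrable_atLeastAtMost'[OF Gc] by (simp add: set_integrable_def)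
  have IF2: "integrable lborel (\<lambda>\<tau>. indicator {0..1} \<tau> * (F' \<tau>)\<^sup>2)"
    using borel_integrable_atLeastAtMost'[of 0 1 "\<lambda>\<tau>. (F' \<tau>)\<^sup>2"] F'c
    by (simp add: set_integrable_def continuous_intros)
  have F'G: "(F' \<tau>)\<^sup>2 \<le> G \<tau>" for \<tau>
  proof -
    have "\<bar>F' \<tau>\<bar>\<^sup>2 \<le> (norm (grad v (y \<tau>)) * norm ((l - 1) *\<^sub>R x))\<^sup>2"
      unfolding F'_def by (intro power_mono Cauchy_Schwarz_ineq2) auto
    then show ?thesis by (simp add: G_def power_mult_distrib mult_ac)
  qed
  have i01: "integrable lborel (\<lambda>\<tau>::real. (indicator {0..1} \<tau> :: real)\<^sup>2)"
  proof -
    have "(indicator {0..1} \<tau> :: real)\<^sup>2 = indicator {0..1} \<tau>" for \<tau> :: real by (auto simp: indicator_def)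
    then show ?thesis by (simp add: integrable_real_indicator)
  qed
  have sq: "(indicator {0..1} \<tau> * F' \<tau>)\<^sup>2 = indicator {0..1} \<tau> * (F' \<tau>)\<^sup>2" "(indicator {0..1} \<tau> :: real)\<^sup>2 = indicator {0..1} \<tau>" for \<tau> :: real
    by (auto simp: indicator_def)
  have "F 1 - F 0 = (LBINT \<tau>. indicator {0..1} \<tau> *\<^sub>R F' \<tau>)"
    using dF F'c by (intro integral_FTC_atLeastAtMost[symmetric])
      (auto simp: has_real_derivative_iff_has_vector_derivative[symmetric] intro: has_field_derivative_at_within)
  also have "\<dots> = (LBINT \<tau>. indicator {0..1} \<tau> * (indicator {0..1} \<tau> * F' \<tau>))"
    by (intro Bochner_Integration.integral_cong) (auto simp: indicator_def)
  finally have "\<bar>F 1 - F 0\<bar> \<le> (LBINT \<tau>. \<bar>indicator {0..1} \<tau> * (indicator {0..1} \<tau> * F' \<tau>)\<bar>)"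
    using integral_norm_bound[of lborel "\<lambda>\<tau>. indicator {0..1} \<tau> * (indicator {0..1} \<tau> * F' \<tau>)"] by simp
  then have "\<bar>F 1 - F 0\<bar>\<^sup>2 \<le> (LBINT \<tau>. \<bar>indicator {0..1} \<tau> * (indicator {0..1} \<tau> * F' \<tau>)\<bar>)\<^sup>2"
    by (intro power_mono) auto
  also have "\<dots> \<le> (LBINT \<tau>. (indicator {0..1} (\<tau> :: real) :: real)\<^sup>2) * (LBINT \<tau>. (indicator {0..1} \<tau> * F' \<tau>)\<^sup>2)"
    by (rule cauchy_schwarz_integral(2)) (use IF2 i01 in \<open>auto simp: sq(1)\<close>)
  also have "\<dots> = (LBINT \<tau>. indicator {0..1} \<tau> * (F' \<tau>)\<^sup>2)" unfolding sq by simp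
  also have "\<dots> \<le> (LBINT \<tau>. indicator {0..1} \<tau> * G \<tau>)"
    by (intro integral_mono IF2 IG mult_left_mono F'G) auto
  finally have "(v (l *\<^sub>R x) - v x)\<^sup>2 \<le> (LBINT \<tau>. indicator {0..1} \<tau> * G \<tau>)"
    by (simp add: F_def y_def)
  then have "ennreal ((v (l *\<^sub>R x) - v x)\<^sup>2) \<le> ennreal (LBINT \<tau>. indicator {0..1} \<tau> * G \<tau>)" by (rule ennreal_leI)
  also have "\<dots> = (\<integral>\<^sup>+\<tau>. ennreal (indicator {0..1} \<tau> * G \<tau>) \<partial>lborel)"
    by (rule nn_integral_eq_integral[symmetric, OF IG]) (auto simp: G_def)
  finally show ?thesis by (simp add: G_def y_def)
qed

text \<open>Integrate \<open>\<nabla>v\<close> along the segment from \<open>x\<close> to \<open>l x\<close>, use the Cauchy-Schwarz inequality on the segment and exchange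
  the integrals; each intermediate dilation has ratio in \<open>[1/2, 2]\<close> and maps the annulus into the larger one.\<close>

lemma dilation_test:
  fixes v :: "real ^ 'n \<Rightarrow> real"
  assumes v: "v \<in> test_functions" and l: "1 / 2 \<le> l" "l \<le> 2" and st: "0 \<le> s" "0 \<le> t"
  shows "(LBINT x. indicator (ann s t) x * (v (l *\<^sub>R x) - v x)\<^sup>2) \<le>
     2 ^ CARD('n) * (l - 1)\<^sup>2 * t\<^sup>2 * (LBINT x. indicator (ann (s / 2) (2 * t)) x * (norm (grad v x))\<^sup>2)"
proof -
  have [measurable]: "v \<in> borel_measurable borel" "grad v \<in> borel_measurable borel"
    using v by (auto intro: test_borel grad_borel)
  obtain R where R: "\<And>x. norm x > R \<Longrightarrow> v x = 0" using test_support[OF v] by metis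
  have gI: "integrable lborel (\<lambda>x. (norm (grad v x))\<^sup>2)"
    by (rule continuous_compact_support_integrable[of _ R])
       (use grad_support[of R v] R in \<open>auto intro!: continuous_intros continuous_grad v\<close>)
  define f where "f x = indicator (ann (s / 2) (2 * t)) x * (norm (grad v x))\<^sup>2" for x
  have [measurable]: "f \<in> borel_measurable borel" unfolding f_def by measurable
  have fI: "integrable lborel f" unfolding f_def by (intro integrable_indicator_mult gI) simp
  have f0: "f x \<ge> 0" for x by (simp add: f_def)
  define D where "D = (LBINT x. f x)"
  define c where "c = (l - 1)\<^sup>2 * t\<^sup>2"
  have c0: "c \<ge> 0" by (simp add: c_def)
  have "(\<integral>\<^sup>+x. ennreal (indicator (ann s t) x * (v (l *\<^sub>R x) - v x)\<^sup>2) \<partial>lborel)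
     \<le> (\<integral>\<^sup>+x. \<integral>\<^sup>+\<tau>. ennreal (indicator (ann s t) x * (indicator {0..1} \<tau> * ((l - 1)\<^sup>2 * (norm x)\<^sup>2 * (norm (grad v ((1 + \<tau> * (l - 1)) *\<^sub>R x)))\<^sup>2))) \<partial>lborel \<partial>lborel)"
    (is "_ \<le> (\<integral>\<^sup>+x. \<integral>\<^sup>+\<tau>. ennreal (?h x \<tau>) \<partial>lborel \<partial>lborel)")
  proof (rule nn_integral_mono)
    fix x :: "real ^ 'n"
    show "ennreal (indicator (ann s t) x * (v (l *\<^sub>R x) - v x)\<^sup>2) \<le> (\<integral>\<^sup>+\<tau>. ennreal (?h x \<tau>) \<partial>lborel)"
      using dilation_pointwise[OF v, of l x] by (cases "x \<in> ann s t") auto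
  qed
  also have "\<dots> = (\<integral>\<^sup>+\<tau>. \<integral>\<^sup>+x. ennreal (?h x \<tau>) \<partial>lborel \<partial>lborel)"
    by (rule lborel_pair.Fubini') measurable
  also have "\<dots> \<le> (\<integral>\<^sup>+\<tau>. ennreal (c * (2 ^ CARD('n) * D)) * indicator {0..1} \<tau> \<partial>(lborel :: real measure))"
  proof (rule nn_integral_mono)
    fix \<tau> :: real
    show "(\<integral>\<^sup>+x. ennreal (?h x \<tau>) \<partial>lborel) \<le> ennreal (c * (2 ^ CARD('n) * D)) * indicator {0..1} \<tau>"
    proof (cases "\<tau> \<in> {0..1}")
      case True
      define m where "m = 1 + \<tau> * (l - 1)"
      have t01: "0 \<le> \<tau>" "\<tau> \<le> 1" using True by auto
      have m: "1 / 2 \<le> m" "m \<le> 2"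
      proof -
        have "\<tau> * (l - 1) \<ge> \<tau> * (- 1 / 2)" "\<tau> * (l - 1) \<le> \<tau> * 1" using l t01 by (intro mult_left_mono; simp)+
        then show "1 / 2 \<le> m" "m \<le> 2" using t01 by (auto simp: m_def)
      qed
      have "?h x \<tau> \<le> c * f (m *\<^sub>R x)" for x
      proof (cases "x \<in> ann s t")
        case x: True
        have "m *\<^sub>R x \<in> ann (s / 2) (2 * t)"
          using x m mult_mono[of "1 / 2" m s "norm x"] mult_mono[of m 2 "norm x" t] st by (auto simp: ann_def)
        moreover have "(l - 1)\<^sup>2 * (norm x)\<^sup>2 \<le> c"
          unfolding c_def using x by (intro mult_left_mono power_mono) (auto simp: ann_def)
        ultimately show ?thesis using x True
          by (auto simp: f_def m_def intro!: mult_right_mono)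
      qed (simp add: c0 f0)
      then have "(\<integral>\<^sup>+x. ennreal (?h x \<tau>) \<partial>lborel) \<le> (\<integral>\<^sup>+x. ennreal (c * f (m *\<^sub>R x)) \<partial>lborel)"
        by (intro nn_integral_mono ennreal_leI)
      also have "\<dots> = ennreal (LBINT x. c * f (m *\<^sub>R x))"
        using dilate_integrable[OF fI, of m] m c0 f0 by (intro nn_integral_eq_integral) auto
      also have "\<dots> \<le> ennreal (c * (2 ^ CARD('n) * D))"
        using dilate_integral_le[of f m] m f0 c0 by (intro ennreal_leI) (auto simp: D_def intro!: mult_left_mono)
      finally show ?thesis using True by simp
    qed simp
  qed
  also have "\<dots> = ennreal (c * (2 ^ CARD('n) * D))" by (simp add: nn_integral_cmult)
  finally have le: "(\<integral>\<^sup>+x. ennreal (indicator (ann s t) x * (v (l *\<^sub>R x) - v x)\<^sup>2) \<partial>lborel) \<le> ennreal (c * (2 ^ CARD('n) * D))" .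
  have "(LBINT x. indicator (ann s t) x * (v (l *\<^sub>R x) - v x)\<^sup>2) \<le> c * (2 ^ CARD('n) * D)"
  proof -
    have "D \<ge> 0" unfolding D_def using f0 by simp
    then have nn: "c * (2 ^ CARD('n) * D) \<ge> 0" using c0 by simp
    have "enn2real (\<integral>\<^sup>+x. ennreal (indicator (ann s t) x * (v (l *\<^sub>R x) - v x)\<^sup>2) \<partial>lborel) \<le> enn2real (ennreal (c * (2 ^ CARD('n) * D)))"
      by (rule enn2real_mono[OF le]) simp
    then show ?thesis using nn by (subst integral_eq_nn_integral) auto
  qed
  then show ?thesis unfolding c_def D_def f_def by (simp add: mult_ac)
qed

text \<open>Passage to the limit along mollifications; the factor 6 pays for the triangle inequalities on squares.\<close>

lemma dilation_H1c:
  fixes w :: "real ^ 'n \<Rightarrow> real"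
  assumes H: "H1c w g" and l: "1 / 2 \<le> l" "l \<le> 2" and st: "0 \<le> s" "0 \<le> t"
  shows "(LBINT x. indicator (ann s t) x * (w (l *\<^sub>R x) - w x)\<^sup>2) \<le>
     6 * 2 ^ CARD('n) * (l - 1)\<^sup>2 * t\<^sup>2 * (LBINT x. indicator (ann (s / 2) (2 * t)) x * (norm (g x))\<^sup>2)"
proof -
  note M = H1c_moll[OF H]
  have wm[measurable]: "w \<in> borel_measurable borel" and gm[measurable]: "g \<in> borel_measurable borel"
    and wI: "integrable lborel (\<lambda>x. (w x)\<^sup>2)" and gI: "integrable lborel (\<lambda>x. (norm (g x))\<^sup>2)"
    using H by (auto simp: H1c_def)
  define E where "E k = (LBINT x. (moll k w x - w x)\<^sup>2)" for k
  define F where "F k = (LBINT x. (norm (grad (moll k w) x - g x))\<^sup>2)" for k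
  define G where "G = (LBINT x. indicator (ann (s / 2) (2 * t)) x * (norm (g x))\<^sup>2)"
  define c where "c = 2 ^ CARD('n) * (l - 1)\<^sup>2 * t\<^sup>2"
  have c0: "c \<ge> 0" by (simp add: c_def)
  have l0: "l > 0" using l by simp
  have GI: "integrable lborel (\<lambda>x. indicator (ann (s / 2) (2 * t)) x * (norm (g x))\<^sup>2)"
    by (intro integrable_indicator_mult gI) simp
  have main: "(LBINT x. indicator (ann s t) x * (w (l *\<^sub>R x) - w x)\<^sup>2)
      \<le> 3 * (2 ^ CARD('n) * E k + c * (2 * G + 2 * F k) + E k)" for k
  proof -
    define v where "v = moll k w"
    have v: "v \<in> test_functions" unfolding v_def by (rule M(1))
    have [measurable]: "v \<in> borel_measurable borel" "grad v \<in> borel_measurable borel"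
      using v by (auto intro: test_borel grad_borel)
    have vI: "integrable lborel (\<lambda>x. (v x)\<^sup>2)"
      using test_integrable[OF test_mult[OF v v]] by (simp add: power2_eq_square)
    have IE: "integrable lborel (\<lambda>x. (v x - w x)\<^sup>2)" unfolding v_def by (rule M(3))
    have IEl: "integrable lborel (\<lambda>x. (v (l *\<^sub>R x) - w (l *\<^sub>R x))\<^sup>2)" by (rule dilate_integrable[OF IE l0])
    have IV: "integrable lborel (\<lambda>x. indicator (ann s t) x * (v (l *\<^sub>R x) - v x)\<^sup>2)"
    proof (rule Bochner_Integration.integrable_bound)
      show "integrable lborel (\<lambda>x. 2 * (v (l *\<^sub>R x))\<^sup>2 + 2 * (v x)\<^sup>2)"
        using vI dilate_integrable[OF vI l0] by simp
      show "AE x in lborel. norm (indicator (ann s t) x * (v (l *\<^sub>R x) - v x)\<^sup>2) \<le> norm (2 * (v (l *\<^sub>R x))\<^sup>2 + 2 * (v x)\<^sup>2)"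
      proof (rule AE_I2)
        fix x show "norm (indicator (ann s t) x * (v (l *\<^sub>R x) - v x)\<^sup>2) \<le> norm (2 * (v (l *\<^sub>R x))\<^sup>2 + 2 * (v x)\<^sup>2)"
          using power2_sum2_le[of "v (l *\<^sub>R x)" "- v x"] by (auto simp: indicator_def)
      qed
    qed measurable
    have "(LBINT x. indicator (ann s t) x * (norm (grad v x))\<^sup>2) \<ge> 0" for s t by simp
    have "(LBINT x. indicator (ann (s / 2) (2 * t)) x * (norm (grad v x))\<^sup>2)
       \<le> (LBINT x. 2 * (indicator (ann (s / 2) (2 * t)) x * (norm (g x))\<^sup>2) + 2 * (norm (grad v x - g x))\<^sup>2)"
    proof (rule integral_mono')
      show "integrable lborel (\<lambda>x. 2 * (indicator (ann (s / 2) (2 * t)) x * (norm (g x))\<^sup>2) + 2 * (norm (grad v x - g x))\<^sup>2)"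
        using GI M(5)[of k] by (simp add: v_def)
      fix x
      show "indicator (ann (s / 2) (2 * t)) x * (norm (grad v x))\<^sup>2 \<le> 2 * (indicator (ann (s / 2) (2 * t)) x * (norm (g x))\<^sup>2) + 2 * (norm (grad v x - g x))\<^sup>2"
        using norm_sum2_le[of "g x" "grad v x - g x"] by (auto simp: indicator_def)
    qed simp
    also have "\<dots> = 2 * G + 2 * F k"
      using GI M(5)[of k] by (simp add: v_def G_def F_def)
    finally have gle: "c * (LBINT x. indicator (ann (s / 2) (2 * t)) x * (norm (grad v x))\<^sup>2) \<le> c * (2 * G + 2 * F k)"
      using c0 by (intro mult_left_mono)
    have "(LBINT x. indicator (ann s t) x * (w (l *\<^sub>R x) - w x)\<^sup>2)
      \<le> (LBINT x. 3 * ((v (l *\<^sub>R x) - w (l *\<^sub>R x))\<^sup>2 + indicator (ann s t) x * (v (l *\<^sub>R x) - v x)\<^sup>2 + (v x - w x)\<^sup>2))"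
    proof (rule integral_mono')
      show "integrable lborel (\<lambda>x. 3 * ((v (l *\<^sub>R x) - w (l *\<^sub>R x))\<^sup>2 + indicator (ann s t) x * (v (l *\<^sub>R x) - v x)\<^sup>2 + (v x - w x)\<^sup>2))"
        using IE IEl IV by simp
      fix x
      show "indicator (ann s t) x * (w (l *\<^sub>R x) - w x)\<^sup>2 \<le> 3 * ((v (l *\<^sub>R x) - w (l *\<^sub>R x))\<^sup>2 + indicator (ann s t) x * (v (l *\<^sub>R x) - v x)\<^sup>2 + (v x - w x)\<^sup>2)"
        using power2_sum3_le[of "w (l *\<^sub>R x) - v (l *\<^sub>R x)" "v (l *\<^sub>R x) - v x" "v x - w x"]
        by (auto simp: indicator_def power2_commute[of "w (l *\<^sub>R x)"])
    qed simp
    also have "\<dots> = 3 * ((LBINT x. (v (l *\<^sub>R x) - w (l *\<^sub>R x))\<^sup>2) + (LBINT x. indicator (ann s t) x * (v (l *\<^sub>R x) - v x)\<^sup>2) + E k)"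
      using IE IEl IV by (simp add: E_def v_def)
    also have "\<dots> \<le> 3 * (2 ^ CARD('n) * E k + c * (2 * G + 2 * F k) + E k)"
    proof -
      have "(LBINT x. (v (l *\<^sub>R x) - w (l *\<^sub>R x))\<^sup>2) \<le> 2 ^ CARD('n) * E k"
      proof -
        have "E k = (LBINT x. (v x - w x)\<^sup>2)" by (simp add: E_def v_def)
        then show ?thesis using dilate_integral_le[of "\<lambda>x. (v x - w x)\<^sup>2" l] l by simp
      qed
      moreover have "(LBINT x. indicator (ann s t) x * (v (l *\<^sub>R x) - v x)\<^sup>2) \<le> c * (2 * G + 2 * F k)"
        using dilation_test[OF v l st] gle unfolding c_def by linarith
      ultimately show ?thesis by simp
    qed
    finally show ?thesis .
  qed
  have "(\<lambda>k. 3 * (2 ^ CARD('n) * E k + c * (2 * G + 2 * F k) + E k)) \<longlonglongrightarrow> 3 * (2 ^ CARD('n) * 0 + c * (2 * G + 2 * 0) + 0)"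
    unfolding E_def F_def by (intro tendsto_intros M(2) M(4))
  then have "(LBINT x. indicator (ann s t) x * (w (l *\<^sub>R x) - w x)\<^sup>2) \<le> 3 * (2 ^ CARD('n) * 0 + c * (2 * G + 2 * 0) + 0)"
    by (rule LIMSEQ_le_const) (use main in auto)
  then show ?thesis by (simp add: c_def G_def mult_ac)
qed

text \<open>Only values in the ball of radius \<open>2 t\<close> enter, and there \<open>u\<close> agrees with a cut-off of itself. With the enlarged annulus on
  the right-hand side in place of the whole space, the commutator error is bounded by the energy of the tail.\<close>

lemma dilation_H1loc:
  fixes u :: "real ^ 'n \<Rightarrow> real"
  assumes H: "H1loc u g" and l: "1 / 2 \<le> l" "l \<le> 2" and st: "0 \<le> s" "0 \<le> t"
  shows "(LBINT x. indicator (ann s t) x * (u (l *\<^sub>R x) - u x)\<^sup>2) \<le>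
     6 * 2 ^ CARD('n) * (l - 1)\<^sup>2 * t\<^sup>2 * (LBINT x. indicator (ann (s / 2) (2 * t)) x * (norm (g x))\<^sup>2)"
proof -
  define R where "R = 2 * t + 1"
  have R: "R > 0" using st by (simp add: R_def)
  define W where "W x = cut R x * u x" for x
  define Wg where "Wg x = cut R x *\<^sub>R g x + u x *\<^sub>R grad (cut R) x" for x
  have HW: "H1c W Wg" unfolding W_def[abs_def] Wg_def[abs_def] by (rule H1loc_cutoff[OF H cut_test[OF R]])
  have W: "W x = u x" if "norm x \<le> 2 * t" for x using that R by (simp add: W_def cut_eq_1 R_def)
  have Wg: "Wg x = g x" if "norm x \<le> 2 * t" for x
    using that R by (simp add: Wg_def cut_eq_1 grad_cut_0 R_def)
  have "indicator (ann s t) x * (u (l *\<^sub>R x) - u x)\<^sup>2 = indicator (ann s t) x * (W (l *\<^sub>R x) - W x)\<^sup>2" for x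
  proof (cases "x \<in> ann s t")
    case True
    have "norm x \<le> t" using True by (simp add: ann_def)
    moreover have "l * norm x \<le> 2 * t" using l \<open>norm x \<le> t\<close> by (intro mult_mono) auto
    moreover have "norm x \<le> 2 * t" using \<open>norm x \<le> t\<close> st by simp
    ultimately show ?thesis using l by (simp add: W)
  qed simp
  moreover have "indicator (ann (s / 2) (2 * t)) x * (norm (Wg x))\<^sup>2 = indicator (ann (s / 2) (2 * t)) x * (norm (g x))\<^sup>2" for x
    by (cases "x \<in> ann (s / 2) (2 * t)") (auto simp: ann_def Wg)
  ultimately show ?thesis using dilation_H1c[OF HW l st] by (simp only:)
qed

lemma dilation_H1loc_integrable:
  fixes u :: "real ^ 'n \<Rightarrow> real"
  assumes H: "H1loc u g" and l: "l > 0"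
  shows "integrable lborel (\<lambda>x. indicator (ann s t) x * (u (l *\<^sub>R x) - u x)\<^sup>2)"
proof -
  have "integrable lborel (\<lambda>x. indicator (cball 0 t) x * (u (l *\<^sub>R x) - u x)\<^sup>2)"
    using H1loc_diff[OF H1loc_dilate[OF H l] H] by (auto simp: H1loc_def)
  from integrable_indicator_mult[OF this, of "ann s t"]
  have "integrable lborel (\<lambda>x. indicator (ann s t) x * (indicator (cball 0 t) x * (u (l *\<^sub>R x) - u x)\<^sup>2))" by simp
  moreover have "indicator (ann s t) x * (indicator (cball 0 t) x * (u (l *\<^sub>R x) - u x)\<^sup>2) = indicator (ann s t) x * (u (l *\<^sub>R x) - u x)\<^sup>2" for x
    by (auto simp: indicator_def ann_def)
  ultimately show ?thesis by simp
qed

section \<open>The Sobolev inequality for compactly supported functions\<close>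

text \<open>The constant grows by the triangle inequality, but not the homogeneity in \<open>M\<close>, which is what matters for the form
  bound. Integrability of \<open>|w|^r\<close> is assumed so that mollification converges in \<open>L^r\<close> too.\<close>

lemma sobolev_H1c:
  assumes n: "CARD('n) \<ge> 2" and r: "r \<ge> 2" "CARD('n) \<ge> 3 \<Longrightarrow> r \<le> 2 * real CARD('n) / (real CARD('n) - 2)"
  shows "\<exists>C>0. \<forall>(w :: real ^ 'n \<Rightarrow> real) g. \<forall>M>0. H1c w g \<longrightarrow> integrable lborel (\<lambda>x. \<bar>w x\<bar> powr r) \<longrightarrow>
    (LBINT x. (w x)\<^sup>2) + (LBINT x. (norm (g x))\<^sup>2) \<le> M \<longrightarrow>
    (LBINT x. \<bar>w x\<bar> powr r) \<le> C * M powr (r / 2)"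
proof -
  obtain C where C: "C > 0" "\<And>W M. W \<in> (test_functions :: (real ^ 'n \<Rightarrow> real) set) \<Longrightarrow> M > 0 \<Longrightarrow>
    (LBINT x. (W x)\<^sup>2) + (LBINT x. (norm (grad W x))\<^sup>2) \<le> M \<Longrightarrow>
    (LBINT x. \<bar>W x\<bar> powr r) \<le> C * M powr (r / 2)"
    using sobolev_test[OF n r] by metis
  show ?thesis
  proof (intro exI[of _ "2 powr r * (C * 4 powr (r / 2))"] conjI allI impI)
    show "2 powr r * (C * 4 powr (r / 2)) > 0" using C by simp
    fix w :: "real ^ 'n \<Rightarrow> real" and g and M :: real
    assume M: "M > 0" and H: "H1c w g" and wr: "integrable lborel (\<lambda>x. \<bar>w x\<bar> powr r)"
      and le: "(LBINT x. (w x)\<^sup>2) + (LBINT x. (norm (g x))\<^sup>2) \<le> M"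
    note Mo = H1c_moll[OF H]
    have wm[measurable]: "w \<in> borel_measurable borel" and gm[measurable]: "g \<in> borel_measurable borel"
      and wI: "integrable lborel (\<lambda>x. (w x)\<^sup>2)" and gI: "integrable lborel (\<lambda>x. (norm (g x))\<^sup>2)"
      using H by (auto simp: H1c_def)
    obtain R where R: "\<And>x. norm x > R \<Longrightarrow> w x = 0"
      using H unfolding H1c_def by metis
    have r1: "r \<ge> 1" using r by simp
    note Lr = moll_Lp[of w r R, OF wm r1 wr R]
    define E where "E k = (LBINT x. (moll k w x - w x)\<^sup>2)" for k
    define F where "F k = (LBINT x. (norm (grad (moll k w) x - g x))\<^sup>2)" for k
    define Q where "Q k = (LBINT x. \<bar>moll k w x - w x\<bar> powr r)" for k
    have "(\<lambda>k. 2 * E k + 2 * F k) \<longlonglongrightarrow> 2 * 0 + 2 * 0"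
      unfolding E_def F_def by (intro tendsto_intros Mo(2) Mo(4))
    then have "\<forall>\<^sub>F k in sequentially. 2 * E k + 2 * F k < 2 * M" using M by (intro order_tendstoD) auto
    moreover have "(LBINT x. \<bar>w x\<bar> powr r) \<le> 2 powr r * (Q k + C * (4 * M) powr (r / 2))"
      if k: "2 * E k + 2 * F k < 2 * M" for k
    proof -
      define v where "v = moll k w"
      have v: "v \<in> test_functions" unfolding v_def by (rule Mo(1))
      have [measurable]: "v \<in> borel_measurable borel" "grad v \<in> borel_measurable borel"
        using v by (auto intro: test_borel grad_borel)
      have "(LBINT x. (v x)\<^sup>2) \<le> (LBINT x. 2 * (w x)\<^sup>2 + 2 * (v x - w x)\<^sup>2)"
      proof (rule integral_mono')
        show "integrable lborel (\<lambda>x. 2 * (w x)\<^sup>2 + 2 * (v x - w x)\<^sup>2)" using wI Mo(3) by (simp add: v_def)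
        fix x show "(v x)\<^sup>2 \<le> 2 * (w x)\<^sup>2 + 2 * (v x - w x)\<^sup>2" using power2_sum2_le[of "w x" "v x - w x"] by simp
      qed simp
      also have "\<dots> = 2 * (LBINT x. (w x)\<^sup>2) + 2 * E k" using wI Mo(3) by (simp add: v_def E_def)
      finally have a: "(LBINT x. (v x)\<^sup>2) \<le> 2 * (LBINT x. (w x)\<^sup>2) + 2 * E k" .
      have "(LBINT x. (norm (grad v x))\<^sup>2) \<le> (LBINT x. 2 * (norm (g x))\<^sup>2 + 2 * (norm (grad v x - g x))\<^sup>2)"
      proof (rule integral_mono')
        show "integrable lborel (\<lambda>x. 2 * (norm (g x))\<^sup>2 + 2 * (norm (grad v x - g x))\<^sup>2)" using gI Mo(5) by (simp add: v_def)
        fix x show "(norm (grad v x))\<^sup>2 \<le> 2 * (norm (g x))\<^sup>2 + 2 * (norm (grad v x - g x))\<^sup>2"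
          using norm_sum2_le[of "g x" "grad v x - g x"] by simp
      qed simp
      also have "\<dots> = 2 * (LBINT x. (norm (g x))\<^sup>2) + 2 * F k" using gI Mo(5) by (simp add: v_def F_def)
      finally have "(LBINT x. (v x)\<^sup>2) + (LBINT x. (norm (grad v x))\<^sup>2) \<le> 4 * M"
        using a le k by linarith
      then have s: "(LBINT x. \<bar>v x\<bar> powr r) \<le> C * (4 * M) powr (r / 2)"
        using C(2)[OF v, of "4 * M"] M by simp
      have "(LBINT x. \<bar>w x\<bar> powr r) \<le> (LBINT x. 2 powr r * (\<bar>v x - w x\<bar> powr r + \<bar>v x\<bar> powr r))"
      proof (rule integral_mono')
        show "integrable lborel (\<lambda>x. 2 powr r * (\<bar>v x - w x\<bar> powr r + \<bar>v x\<bar> powr r))"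
          using Lr(2)[of k] Lr(3)[of k] by (simp add: v_def)
        fix x show "\<bar>w x\<bar> powr r \<le> 2 powr r * (\<bar>v x - w x\<bar> powr r + \<bar>v x\<bar> powr r)"
          using powr_diff2_le[of r "v x - w x" "v x"] r by simp
      qed simp
      also have "\<dots> = 2 powr r * (Q k + (LBINT x. \<bar>v x\<bar> powr r))"
        using Lr(2)[of k] Lr(3)[of k] by (simp add: v_def Q_def)
      also have "\<dots> \<le> 2 powr r * (Q k + C * (4 * M) powr (r / 2))" using s by (intro mult_left_mono) auto
      finally show ?thesis .
    qed
    ultimately have ev: "\<forall>\<^sub>F k in sequentially. (LBINT x. \<bar>w x\<bar> powr r) \<le> 2 powr r * (Q k + C * (4 * M) powr (r / 2))"
      by (auto elim: eventually_mono)
    have "(\<lambda>k. 2 powr r * (Q k + C * (4 * M) powr (r / 2))) \<longlonglongrightarrow> 2 powr r * (0 + C * (4 * M) powr (r / 2))"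
      unfolding Q_def by (intro tendsto_intros Lr(1))
    then have "(LBINT x. \<bar>w x\<bar> powr r) \<le> 2 powr r * (0 + C * (4 * M) powr (r / 2))"
      by (rule tendsto_lowerbound[OF _ ev]) simp
    then show "(LBINT x. \<bar>w x\<bar> powr r) \<le> 2 powr r * (C * 4 powr (r / 2)) * M powr (r / 2)"
      using M by (simp add: powr_mult mult_ac)
  qed
qed

section \<open>The equation tested with Sobolev functions\<close>

text \<open>Young's inequality with a free parameter; it takes the place of Hoelder's inequality, as the first term can be made
  small independently of \<open>d\<close>.\<close>

lemma pairing_bound:
  fixes p \<beta> s d :: real
  assumes "p > 1" "\<beta> > 0"
  shows "\<bar>spow (p - 1) s * d\<bar> \<le> \<beta> * \<bar>s\<bar> powr p + \<beta> powr (1 - p) * \<bar>d\<bar> powr p"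
proof -
  have "\<bar>s\<bar> powr (p - 1) * (\<bar>d\<bar> / \<beta>) \<le> \<bar>s\<bar> powr p + (\<bar>d\<bar> / \<beta>) powr p"
    using assms by (intro powr_prod1_le_sum) auto
  then have "\<beta> * (\<bar>s\<bar> powr (p - 1) * (\<bar>d\<bar> / \<beta>)) \<le> \<beta> * (\<bar>s\<bar> powr p + (\<bar>d\<bar> / \<beta>) powr p)"
    using assms by (intro mult_left_mono) auto
  moreover have "\<beta> * (\<bar>d\<bar> / \<beta>) powr p = \<beta> powr (1 - p) * \<bar>d\<bar> powr p"
    using assms by (simp add: powr_divide powr_diff)
  ultimately show ?thesis using assms by (simp add: abs_mult spow_abs distrib_left)
qed

lemma pairing_integrable:
  fixes u v \<omega> :: "real ^ 'n \<Rightarrow> real"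
  assumes p: "p > 1" and [measurable]: "u \<in> borel_measurable borel" "\<omega> \<in> borel_measurable borel" "v \<in> borel_measurable borel"
    and w: "\<And>x. \<omega> x \<ge> 0" and u: "integrable lborel (\<lambda>x. \<bar>u x\<bar> powr p * \<omega> x)"
    and v: "integrable lborel (\<lambda>x. \<bar>v x\<bar> powr p)" and K: "\<And>x. v x \<noteq> 0 \<Longrightarrow> \<omega> x \<le> K"
  shows "integrable lborel (\<lambda>x. spow (p - 1) (u x) * v x * \<omega> x)"
    and "\<beta> > 0 \<Longrightarrow> (LBINT x. \<bar>spow (p - 1) (u x) * v x * \<omega> x\<bar>) \<le>
        \<beta> * (LBINT x. \<bar>u x\<bar> powr p * \<omega> x) + \<beta> powr (1 - p) * K * (LBINT x. \<bar>v x\<bar> powr p)"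
proof -
  have pw: "\<bar>spow (p - 1) (u x) * v x * \<omega> x\<bar> \<le> \<beta> * (\<bar>u x\<bar> powr p * \<omega> x) + \<beta> powr (1 - p) * K * \<bar>v x\<bar> powr p" if "\<beta> > 0" for \<beta> x
  proof (cases "v x = 0")
    case False
    have "\<bar>spow (p - 1) (u x) * v x\<bar> * \<omega> x \<le> (\<beta> * \<bar>u x\<bar> powr p + \<beta> powr (1 - p) * \<bar>v x\<bar> powr p) * \<omega> x"
      by (intro mult_right_mono pairing_bound p that w)
    also have "\<dots> \<le> \<beta> * (\<bar>u x\<bar> powr p * \<omega> x) + \<beta> powr (1 - p) * K * \<bar>v x\<bar> powr p"
      using mult_left_mono[OF K[OF False], of "\<beta> powr (1 - p) * \<bar>v x\<bar> powr p"] by (simp add: algebra_simps)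
    finally show ?thesis using w[of x] by (simp add: abs_mult)
  qed (use that w in simp)
  have I: "integrable lborel (\<lambda>x. \<beta> * (\<bar>u x\<bar> powr p * \<omega> x) + \<beta> powr (1 - p) * K * \<bar>v x\<bar> powr p)" for \<beta>
    using u v by simp
  show II: "integrable lborel (\<lambda>x. spow (p - 1) (u x) * v x * \<omega> x)"
    by (rule Bochner_Integration.integrable_bound[OF I[of 1]])
       (use pw[of 1] in \<open>auto intro: order_trans[OF _ abs_ge_self]\<close>)
  assume b: "\<beta> > 0"
  have "(LBINT x. \<bar>spow (p - 1) (u x) * v x * \<omega> x\<bar>) \<le> (LBINT x. \<beta> * (\<bar>u x\<bar> powr p * \<omega> x) + \<beta> powr (1 - p) * K * \<bar>v x\<bar> powr p)"
    by (intro integral_mono integrable_abs II I pw b)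
  then show "(LBINT x. \<bar>spow (p - 1) (u x) * v x * \<omega> x\<bar>) \<le>
        \<beta> * (LBINT x. \<bar>u x\<bar> powr p * \<omega> x) + \<beta> powr (1 - p) * K * (LBINT x. \<bar>v x\<bar> powr p)"
    using u v by simp
qed

lemma pairing_tendsto:
  fixes u v \<omega> :: "real ^ 'n \<Rightarrow> real" and V :: "nat \<Rightarrow> real ^ 'n \<Rightarrow> real"
  assumes p: "p > 1" and m[measurable]: "u \<in> borel_measurable borel" "\<omega> \<in> borel_measurable borel" "v \<in> borel_measurable borel"
    "\<And>k. V k \<in> borel_measurable borel"
    and w: "\<And>x. \<omega> x \<ge> 0" and u: "integrable lborel (\<lambda>x. \<bar>u x\<bar> powr p * \<omega> x)"
    and v: "integrable lborel (\<lambda>x. \<bar>v x\<bar> powr p)" "\<And>k. integrable lborel (\<lambda>x. \<bar>V k x\<bar> powr p)"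
    "\<And>k. integrable lborel (\<lambda>x. \<bar>V k x - v x\<bar> powr p)"
    and lim: "(\<lambda>k. LBINT x. \<bar>V k x - v x\<bar> powr p) \<longlonglongrightarrow> 0"
    and K: "\<And>x. v x \<noteq> 0 \<Longrightarrow> \<omega> x \<le> K" "\<And>k x. V k x \<noteq> 0 \<Longrightarrow> \<omega> x \<le> K" "K \<ge> 0"
  shows "(\<lambda>k. LBINT x. spow (p - 1) (u x) * V k x * \<omega> x) \<longlonglongrightarrow> (LBINT x. spow (p - 1) (u x) * v x * \<omega> x)"
proof (rule LIMSEQ_I)
  fix e :: real assume e: "e > 0"
  define B where "B = (LBINT x. \<bar>u x\<bar> powr p * \<omega> x)"
  have B: "B \<ge> 0" unfolding B_def using w by (intro integral_nonneg_AE) auto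
  define \<beta> where "\<beta> = e / (2 * (B + 1))"
  have \<beta>: "\<beta> > 0" "\<beta> * B < e / 2" using e B by (auto simp: \<beta>_def field_simps)
  have "(\<lambda>k. \<beta> powr (1 - p) * K * (LBINT x. \<bar>V k x - v x\<bar> powr p)) \<longlonglongrightarrow> \<beta> powr (1 - p) * K * 0"
    by (intro tendsto_intros lim)
  then have "\<forall>\<^sub>F k in sequentially. \<beta> powr (1 - p) * K * (LBINT x. \<bar>V k x - v x\<bar> powr p) < e / 2"
    using e by (intro order_tendstoD) auto
  then obtain k0 where k0: "\<And>k. k \<ge> k0 \<Longrightarrow> \<beta> powr (1 - p) * K * (LBINT x. \<bar>V k x - v x\<bar> powr p) < e / 2"
    by (auto simp: eventually_sequentially)
  have "norm ((LBINT x. spow (p - 1) (u x) * V k x * \<omega> x) - (LBINT x. spow (p - 1) (u x) * v x * \<omega> x)) < e" if "k \<ge> k0" for k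
  proof -
    have K': "V k x - v x \<noteq> 0 \<Longrightarrow> \<omega> x \<le> K" for x using K(1)[of x] K(2)[of k x] by (cases "v x = 0") auto
    have d[measurable]: "(\<lambda>x. V k x - v x) \<in> borel_measurable borel" by measurable
    note P = pairing_integrable[OF p m(1,2) d w u v(3) K']
    have "(LBINT x. spow (p - 1) (u x) * V k x * \<omega> x) - (LBINT x. spow (p - 1) (u x) * v x * \<omega> x)
        = (LBINT x. spow (p - 1) (u x) * V k x * \<omega> x - spow (p - 1) (u x) * v x * \<omega> x)"
      using pairing_integrable(1)[OF p m(1,2,4) w u v(2) K(2)] pairing_integrable(1)[OF p m(1,2,3) w u v(1) K(1)]
      by (intro Bochner_Integration.integral_diff[symmetric]) auto
    also have "\<dots> = (LBINT x. spow (p - 1) (u x) * (V k x - v x) * \<omega> x)"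
      by (intro Bochner_Integration.integral_cong) (auto simp: algebra_simps)
    also have "norm \<dots> \<le> (LBINT x. \<bar>spow (p - 1) (u x) * (V k x - v x) * \<omega> x\<bar>)"
      using integral_norm_bound[of lborel "\<lambda>x. spow (p - 1) (u x) * (V k x - v x) * \<omega> x"] by simp
    also have "\<dots> \<le> \<beta> * B + \<beta> powr (1 - p) * K * (LBINT x. \<bar>V k x - v x\<bar> powr p)"
      using P(2)[OF _ \<beta>(1)] by (simp add: B_def)
    also have "\<dots> < e" using \<beta>(2) k0[OF that] by linarith
    finally show ?thesis .
  qed
  then show "\<exists>no. \<forall>k\<ge>no. norm ((LBINT x. spow (p - 1) (u x) * V k x * \<omega> x) - (LBINT x. spow (p - 1) (u x) * v x * \<omega> x)) < e" by blast
qed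

text \<open>The Cauchy-Schwarz inequality for vector fields.\<close>

lemma gradient_pairing:
  fixes g d :: "real ^ 'n \<Rightarrow> real ^ 'n"
  assumes [measurable]: "g \<in> borel_measurable borel" "d \<in> borel_measurable borel"
    and g: "integrable lborel (\<lambda>x. (norm (g x))\<^sup>2)" and d: "integrable lborel (\<lambda>x. (norm (d x))\<^sup>2)"
  shows "integrable lborel (\<lambda>x. g x \<bullet> d x)"
    and "(LBINT x. g x \<bullet> d x)\<^sup>2 \<le> (LBINT x. (norm (g x))\<^sup>2) * (LBINT x. (norm (d x))\<^sup>2)"
proof -
  have I: "integrable lborel (\<lambda>x. norm (g x) * norm (d x))" by (rule cauchy_schwarz_integral(1)) (use g d in auto)
  show II: "integrable lborel (\<lambda>x. g x \<bullet> d x)"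
    by (rule Bochner_Integration.integrable_bound[OF I]) (auto simp: Cauchy_Schwarz_ineq2)
  have "\<bar>LBINT x. g x \<bullet> d x\<bar> \<le> (LBINT x. \<bar>norm (g x) * norm (d x)\<bar>)"
  proof (rule order_trans)
    show "\<bar>LBINT x. g x \<bullet> d x\<bar> \<le> (LBINT x. \<bar>g x \<bullet> d x\<bar>)"
      using integral_norm_bound[of lborel "\<lambda>x. g x \<bullet> d x"] by (simp only: real_norm_def)
    show "(LBINT x. \<bar>g x \<bullet> d x\<bar>) \<le> (LBINT x. \<bar>norm (g x) * norm (d x)\<bar>)"
      using II I by (intro integral_mono integrable_abs) (auto simp: Cauchy_Schwarz_ineq2)
  qed
  then have "\<bar>LBINT x. g x \<bullet> d x\<bar>\<^sup>2 \<le> (LBINT x. \<bar>norm (g x) * norm (d x)\<bar>)\<^sup>2" by (intro power_mono) auto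
  also have "\<dots> \<le> (LBINT x. (norm (g x))\<^sup>2) * (LBINT x. (norm (d x))\<^sup>2)"
    by (rule cauchy_schwarz_integral(2)) (use g d in auto)
  finally show "(LBINT x. g x \<bullet> d x)\<^sup>2 \<le> (LBINT x. (norm (g x))\<^sup>2) * (LBINT x. (norm (d x))\<^sup>2)" by simp
qed

lemma weight_borel [measurable]: "(\<lambda>x :: real ^ 'n. norm x powr c) \<in> borel_measurable borel"
  by measurable

lemma weight_le:
  fixes x :: "real ^ 'n" assumes "a > 0" "norm x \<ge> a" "c \<ge> 0" shows "norm x powr (- c) \<le> a powr (- c)"
  using assms powr_mono2'[of "-c" a "norm x"] by simp

text \<open>Away from the origin and from infinity the weight is bounded below, so the weighted space is locally \<open>L^p\<close>.\<close>

lemma ann_Lp: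
  fixes u :: "real ^ 'n \<Rightarrow> real"
  assumes [measurable]: "u \<in> borel_measurable borel"
    and u: "integrable lborel (\<lambda>x. \<bar>u x\<bar> powr p * norm x powr (- c))" and c: "c \<ge> 0" and a: "a > 0" "R > 0"
  shows "integrable lborel (\<lambda>x. indicator (ann a R) x * \<bar>u x\<bar> powr p)"
    and "indicator (ann a R) x * \<bar>u x\<bar> powr p \<le> R powr c * (\<bar>u x\<bar> powr p * norm x powr (- c))"
proof -
  show pw: "indicator (ann a R) x * \<bar>u x\<bar> powr p \<le> R powr c * (\<bar>u x\<bar> powr p * norm x powr (- c))" for x
  proof (cases "x \<in> ann a R")
    case True
    then have x: "norm x > 0" "norm x \<le> R" using a by (auto simp: ann_def)
    have "1 \<le> (R / norm x) powr c" using x c by (intro ge_one_powr_ge_zero) auto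
    also have "\<dots> = R powr c * norm x powr (- c)" using x a by (simp add: powr_divide powr_minus_divide)
    finally have "1 * \<bar>u x\<bar> powr p \<le> (R powr c * norm x powr (- c)) * \<bar>u x\<bar> powr p" by (intro mult_right_mono) auto
    then show ?thesis using True by (simp add: mult_ac)
  qed simp
  show "integrable lborel (\<lambda>x. indicator (ann a R) x * \<bar>u x\<bar> powr p)"
  proof (rule Bochner_Integration.integrable_bound)
    show "integrable lborel (\<lambda>x. R powr c * (\<bar>u x\<bar> powr p * norm x powr (- c)))" using u by simp
    show "AE x in lborel. norm (indicator (ann a R) x * \<bar>u x\<bar> powr p) \<le> norm (R powr c * (\<bar>u x\<bar> powr p * norm x powr (- c)))"
      using pw by (intro AE_I2) (simp add: abs_mult)
  qed measurable
qed

text \<open>The data of the theorem for Borel representatives, with integrals over \<open>lborel\<close>. Subcriticality of \<open>q\<close> and the relation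
  between \<open>r\<close> and the other exponents enter as hypotheses of the individual lemmas.\<close>

locale dilation_setting =
  fixes u :: "real ^ 'n \<Rightarrow> real" and g :: "real ^ 'n \<Rightarrow> real ^ 'n" and b q r \<eta> :: real
  assumes dim: "CARD('n) \<ge> 2"
    and b: "0 \<le> b" "b < 2" and q: "q > 2" and \<eta>: "0 \<le> \<eta>" "\<eta> < 2" and r: "r > 1"
    and H: "H1loc u g"
    and Bint: "integrable lborel (\<lambda>x. \<bar>u x\<bar> powr q * norm x powr (- b))"
    and Cint: "integrable lborel (\<lambda>x. \<bar>u x\<bar> powr r * norm x powr (- \<eta>))"
    and eq: "v \<in> test_functions \<Longrightarrow>
      (LBINT x. g x \<bullet> grad v x) + (LBINT x. spow (q - 1) (u x) * v x * norm x powr (- b))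
      = (LBINT x. spow (r - 1) (u x) * v x * norm x powr (- \<eta>))"
begin

lemma um [measurable]: "u \<in> borel_measurable borel" and gm [measurable]: "g \<in> borel_measurable borel"
  and Aint: "integrable lborel (\<lambda>x. (norm (g x))\<^sup>2)"
  using H by (auto simp: H1loc_def)

text \<open>Mollifications of \<open>v\<close> are test functions, supported away from the origin once the mollification radius is below
  \<open>a/2\<close>; there the weights are bounded, and \<open>L^q\<close>, \<open>L^r\<close> and energy convergence pass to the limit in each term.\<close>

lemma weak_eq_ext:
  fixes v :: "real ^ 'n \<Rightarrow> real" and gv :: "real ^ 'n \<Rightarrow> real ^ 'n"
  assumes Hv: "H1c v gv" and a: "a > 0" "\<And>x. norm x < a \<Longrightarrow> v x = 0"
    and vq: "integrable lborel (\<lambda>x. \<bar>v x\<bar> powr q)" and vr: "integrable lborel (\<lambda>x. \<bar>v x\<bar> powr r)"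
  shows "(LBINT x. g x \<bullet> gv x) + (LBINT x. spow (q - 1) (u x) * v x * norm x powr (- b))
      = (LBINT x. spow (r - 1) (u x) * v x * norm x powr (- \<eta>))"
    and "integrable lborel (\<lambda>x. g x \<bullet> gv x)"
    and "integrable lborel (\<lambda>x. spow (q - 1) (u x) * v x * norm x powr (- b))"
    and "integrable lborel (\<lambda>x. spow (r - 1) (u x) * v x * norm x powr (- \<eta>))"
proof -
  note M = H1c_moll[OF Hv]
  have vm[measurable]: "v \<in> borel_measurable borel" and gvm[measurable]: "gv \<in> borel_measurable borel"
    and gvI: "integrable lborel (\<lambda>x. (norm (gv x))\<^sup>2)" using Hv by (auto simp: H1c_def)
  obtain R where R: "\<And>x. norm x > R \<Longrightarrow> v x = 0" using Hv unfolding H1c_def by metis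
  have q1: "q \<ge> 1" "q > 1" and r1: "r \<ge> 1" using q r by auto
  note Lq = moll_Lp[of v q R, OF vm q1(1) vq R] and Lr = moll_Lp[of v r R, OF vm r1 vr R]
  \<comment> \<open>from the index \<open>k0\<close> on the mollification radius is below \<open>a/2\<close>\<close>
  obtain k0 where k0: "2 / a < real k0" using reals_Archimedean2 by blast
  define V where "V k = moll (k + k0) v" for k
  have V: "V k \<in> test_functions" for k unfolding V_def by (rule M(1))
  have Vm[measurable]: "V k \<in> borel_measurable borel" and gVm[measurable]: "grad (V k) \<in> borel_measurable borel" for k
    using V[of k] by (auto intro: test_borel grad_borel)
  have V0: "norm x \<ge> a / 2" if nz: "V k x \<noteq> 0" for k x
  proof -
    obtain z where z: "norm (z - x) \<le> 1 / real (Suc (k + k0))" "v z \<noteq> 0"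
      using nz unfolding V_def by (rule moll_nonzeroD)
    have "2 / a < real (Suc (k + k0))" using k0 by simp
    then have "1 / real (Suc (k + k0)) \<le> a / 2" using a by (simp add: field_simps)
    moreover have "norm z \<ge> a" using z(2) a(2) by (meson not_le)
    ultimately show ?thesis using z(1) norm_triangle_sub[of z x] by linarith
  qed
  define Kb where "Kb c = (a / 2) powr (- c)" for c
  have w1: "v x \<noteq> 0 \<Longrightarrow> norm x powr (- c) \<le> Kb c" if "c \<ge> 0" for x c
    using a(2)[of x] a(1) that unfolding Kb_def by (intro weight_le) force+
  have w2: "V k x \<noteq> 0 \<Longrightarrow> norm x powr (- c) \<le> Kb c" if "c \<ge> 0" for k x c
    using V0[of k x] a(1) that unfolding Kb_def by (intro weight_le) auto
  have Kb: "Kb c \<ge> 0" for c by (simp add: Kb_def)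
  have lq: "(\<lambda>k. LBINT x. \<bar>V k x - v x\<bar> powr q) \<longlonglongrightarrow> 0"
    unfolding V_def by (rule LIMSEQ_ignore_initial_segment[OF Lq(1)])
  have lr: "(\<lambda>k. LBINT x. \<bar>V k x - v x\<bar> powr r) \<longlonglongrightarrow> 0"
    unfolding V_def by (rule LIMSEQ_ignore_initial_segment[OF Lr(1)])
  have t1: "(\<lambda>k. LBINT x. spow (q - 1) (u x) * V k x * norm x powr (- b)) \<longlonglongrightarrow> (LBINT x. spow (q - 1) (u x) * v x * norm x powr (- b))"
  proof (rule pairing_tendsto[where K = "Kb b"])
    show "integrable lborel (\<lambda>x. \<bar>V k x\<bar> powr q)" for k unfolding V_def by (rule Lq(3))
    show "integrable lborel (\<lambda>x. \<bar>V k x - v x\<bar> powr q)" for k unfolding V_def by (rule Lq(2))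
    show "norm x powr - b \<le> Kb b" if "v x \<noteq> 0" for x using w1[OF b(1) that] .
    show "norm x powr - b \<le> Kb b" if "V k x \<noteq> 0" for k x using w2[OF b(1) that] .
  qed (simp_all add: q1 Bint vq lq Kb)
  have t2: "(\<lambda>k. LBINT x. spow (r - 1) (u x) * V k x * norm x powr (- \<eta>)) \<longlonglongrightarrow> (LBINT x. spow (r - 1) (u x) * v x * norm x powr (- \<eta>))"
  proof (rule pairing_tendsto[where K = "Kb \<eta>"])
    show "integrable lborel (\<lambda>x. \<bar>V k x\<bar> powr r)" for k unfolding V_def by (rule Lr(3))
    show "integrable lborel (\<lambda>x. \<bar>V k x - v x\<bar> powr r)" for k unfolding V_def by (rule Lr(2))
    show "norm x powr - \<eta> \<le> Kb \<eta>" if "v x \<noteq> 0" for x using w1[OF \<eta>(1) that] .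
    show "norm x powr - \<eta> \<le> Kb \<eta>" if "V k x \<noteq> 0" for k x using w2[OF \<eta>(1) that] .
  qed (simp_all add: r Cint vr lr Kb)
  show "integrable lborel (\<lambda>x. spow (q - 1) (u x) * v x * norm x powr (- b))"
  proof (rule pairing_integrable(1)[where K = "Kb b"])
    show "norm x powr - b \<le> Kb b" if "v x \<noteq> 0" for x using w1[OF b(1) that] .
  qed (simp_all add: q1 Bint vq)
  show "integrable lborel (\<lambda>x. spow (r - 1) (u x) * v x * norm x powr (- \<eta>))"
  proof (rule pairing_integrable(1)[where K = "Kb \<eta>"])
    show "norm x powr - \<eta> \<le> Kb \<eta>" if "v x \<noteq> 0" for x using w1[OF \<eta>(1) that] .
  qed (simp_all add: r Cint vr)
  show gI: "integrable lborel (\<lambda>x. g x \<bullet> gv x)" by (rule gradient_pairing(1)[OF _ _ Aint gvI]) auto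
  define A where "A = (LBINT x. (norm (g x))\<^sup>2)"
  define F where "F k = (LBINT x. (norm (grad (V k) x - gv x))\<^sup>2)" for k
  have FI: "integrable lborel (\<lambda>x. (norm (grad (V k) x - gv x))\<^sup>2)" for k unfolding V_def by (rule M(5))
  have Flim: "F \<longlonglongrightarrow> 0" unfolding F_def V_def by (rule LIMSEQ_ignore_initial_segment[OF M(4)])
  have dI: "integrable lborel (\<lambda>x. g x \<bullet> (grad (V k) x - gv x))" for k
    by (rule gradient_pairing(1)[OF _ _ Aint FI]) auto
  have gVI: "integrable lborel (\<lambda>x. g x \<bullet> grad (V k) x)" for k
    using Bochner_Integration.integrable_add[OF dI[of k] gI] by (simp add: inner_diff_right)
  have bd: "\<bar>(LBINT x. g x \<bullet> grad (V k) x) - (LBINT x. g x \<bullet> gv x)\<bar> \<le> sqrt (A * F k)" for k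
  proof -
    have "(LBINT x. g x \<bullet> grad (V k) x) - (LBINT x. g x \<bullet> gv x) = (LBINT x. g x \<bullet> (grad (V k) x - gv x))"
      using gVI gI by (simp add: inner_diff_right)
    moreover have "(LBINT x. g x \<bullet> (grad (V k) x - gv x))\<^sup>2 \<le> A * F k"
      unfolding A_def F_def by (rule gradient_pairing(2)[OF _ _ Aint FI]) simp_all
    ultimately show ?thesis by (metis real_le_rsqrt power2_abs)
  qed
  have "(\<lambda>k. sqrt (A * F k)) \<longlonglongrightarrow> sqrt (A * 0)" by (intro tendsto_intros Flim)
  then have s0: "(\<lambda>k. sqrt (A * F k)) \<longlonglongrightarrow> 0" by simp
  have "(\<lambda>k. (LBINT x. g x \<bullet> grad (V k) x) - (LBINT x. g x \<bullet> gv x)) \<longlonglongrightarrow> 0"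
    by (rule Lim_null_comparison[OF _ s0], rule always_eventually) (simp add: bd del: real_sqrt_mult)
  then have t3: "(\<lambda>k. LBINT x. g x \<bullet> grad (V k) x) \<longlonglongrightarrow> (LBINT x. g x \<bullet> gv x)" by (simp add: LIM_zero_iff)
  have "(\<lambda>k. (LBINT x. g x \<bullet> grad (V k) x) + (LBINT x. spow (q - 1) (u x) * V k x * norm x powr (- b)))
      \<longlonglongrightarrow> (LBINT x. g x \<bullet> gv x) + (LBINT x. spow (q - 1) (u x) * v x * norm x powr (- b))"
    by (intro tendsto_add t1 t3)
  then show "(LBINT x. g x \<bullet> gv x) + (LBINT x. spow (q - 1) (u x) * v x * norm x powr (- b))
      = (LBINT x. spow (r - 1) (u x) * v x * norm x powr (- \<eta>))"
    unfolding eq[OF V] using t2 by (rule LIMSEQ_unique)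
qed

end

section \<open>Shell cutoffs and scaling\<close>

text \<open>A cutoff for the shell between \<open>\<delta>\<close> and \<open>2 R\<close>, equal to 1 between \<open>2 \<delta>\<close> and \<open>R\<close>. Both transition layers are rescalings
  of one profile, so constants do not depend on \<open>\<delta>\<close> and \<open>R\<close>.\<close>

definition phi :: "real \<Rightarrow> real \<Rightarrow> real ^ 'n \<Rightarrow> real" where
  "phi \<delta> R x = cut R x - cut \<delta> x"

text \<open>The square of the cutoff weights the tested equation, so that the gain \<open>\<integral>\<psi> |\<nabla>w|^2\<close> controls the gradient of
  \<open>\<phi> w\<close>, to which the Sobolev inequality applies.\<close>

definition psi :: "real \<Rightarrow> real \<Rightarrow> real ^ 'n \<Rightarrow> real" where
  "psi \<delta> R x = phi \<delta> R x * phi \<delta> R x"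

text \<open>A common bound for the Lipschitz constant and the gradient of the profile; the type argument fixes the dimension.\<close>

definition cut_lipschitz :: "'n::finite itself \<Rightarrow> real \<Rightarrow> bool" where
  "cut_lipschitz _ L \<longleftrightarrow> L > 0 \<and> (\<forall>x y :: real ^ 'n. \<bar>cut1 x - cut1 y\<bar> \<le> L * norm (x - y)) \<and>
     (\<forall>x :: real ^ 'n. norm (grad cut1 x) \<le> L)"

lemma cut_lipschitz_exists: "\<exists>L. cut_lipschitz TYPE('n::finite) L"
proof -
  obtain L1 where L1: "L1 > 0" "\<And>x y :: real ^ 'n. \<bar>cut1 x - cut1 y\<bar> \<le> L1 * norm (x - y)"
    using test_lipschitz[OF cut1(1)] by metis
  obtain L2 where L2: "L2 > 0" "\<And>x :: real ^ 'n. norm (grad cut1 x) \<le> L2"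
    using test_grad_bounded[OF cut1(1)] by metis
  have "\<bar>cut1 x - cut1 y\<bar> \<le> (L1 + L2) * norm (x - y)" for x y :: "real ^ 'n"
    using L1(2)[of x y] L2(1) by (simp add: distrib_right add_increasing2)
  moreover have "norm (grad cut1 x) \<le> L1 + L2" for x :: "real ^ 'n"
    using L2(2)[of x] L1(1) by linarith
  ultimately show ?thesis using L1(1) L2(1) unfolding cut_lipschitz_def by (intro exI[of _ "L1 + L2"]) auto
qed

lemma phi_test: "0 < \<delta> \<Longrightarrow> 0 < R \<Longrightarrow> phi \<delta> R \<in> test_functions"
  unfolding phi_def[abs_def] by (intro test_diff cut_test)

lemma psi_test: "0 < \<delta> \<Longrightarrow> 0 < R \<Longrightarrow> psi \<delta> R \<in> test_functions"
  unfolding psi_def[abs_def] by (intro test_mult phi_test)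

lemma phi_range:
  assumes "0 < \<delta>" "8 * \<delta> \<le> R" shows "0 \<le> phi \<delta> R x" "phi \<delta> R x \<le> 1"
proof -
  have "cut \<delta> x \<le> cut R x"
  proof (cases "norm x \<le> R")
    case True then show ?thesis using cut_eq_1[of R x] cut_range(2)[of \<delta> x] assms by simp
  next
    case False then show ?thesis using cut_eq_0[of \<delta> x] cut_range(1)[of R x] assms by simp
  qed
  then show "0 \<le> phi \<delta> R x" by (simp add: phi_def)
  show "phi \<delta> R x \<le> 1" using cut_range(1)[of \<delta> x] cut_range(2)[of R x] by (simp add: phi_def)
qed

lemma psi_range:
  assumes "0 < \<delta>" "8 * \<delta> \<le> R" shows "0 \<le> psi \<delta> R x" "psi \<delta> R x \<le> 1"
  using phi_range[OF assms, of x] by (auto simp: psi_def mult_le_one)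

lemma phi_0:
  assumes "0 < \<delta>" "8 * \<delta> \<le> R" "x \<notin> ann \<delta> (2 * R)" shows "phi \<delta> R x = 0"
  using assms by (cases "norm x < \<delta>") (auto simp: phi_def ann_def cut_eq_1 cut_eq_0)

lemma psi_0:
  assumes "0 < \<delta>" "8 * \<delta> \<le> R" "x \<notin> ann \<delta> (2 * R)" shows "psi \<delta> R x = 0"
  using phi_0[OF assms] by (simp add: psi_def)

lemma phi_1: "0 < \<delta> \<Longrightarrow> 0 < R \<Longrightarrow> 2 * \<delta> < norm x \<Longrightarrow> norm x \<le> R \<Longrightarrow> phi \<delta> R x = 1"
  by (simp add: phi_def cut_eq_1 cut_eq_0)

text \<open>Outside this set \<open>x\<close> and its dilations by factors in \<open>[1/2, 2]\<close> stay where the cutoff is 1.\<close>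

definition tail :: "real \<Rightarrow> real \<Rightarrow> (real ^ 'n) set" where
  "tail \<delta> R = {x. norm x \<le> 4 * \<delta> \<or> R / 2 \<le> norm x}"

lemma tail_borel [measurable]: "tail \<delta> R \<in> sets borel"
  unfolding tail_def by measurable

lemma cut_dilate:
  fixes x :: "real ^ 'n"
  assumes L: "cut_lipschitz TYPE('n) L" and l: "1 / 2 \<le> l" "l \<le> 2" and R: "R > 0"
  shows "\<bar>cut R (x /\<^sub>R l) - cut R x\<bar> \<le> 8 * L * \<bar>l - 1\<bar>"
proof -
  define y where "y = x /\<^sub>R R"
  have L0: "L > 0" using L by (simp add: cut_lipschitz_def)
  have e: "cut R (x /\<^sub>R l) = cut1 (y /\<^sub>R l)" "cut R x = cut1 y" by (simp_all add: cut_def y_def mult.commute)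
  show ?thesis
  proof (cases "norm y > 4")
    case True
    have "norm (y /\<^sub>R l) > 2" using True l by (simp add: divide_simps)
    then show ?thesis using True L0 by (simp add: e cut1(5))
  next
    case False
    have "\<bar>cut1 (y /\<^sub>R l) - cut1 y\<bar> \<le> L * norm (y /\<^sub>R l - y)" using L by (simp add: cut_lipschitz_def)
    also have "y /\<^sub>R l - y = (inverse l * (1 - l)) *\<^sub>R y" using l by (simp add: algebra_simps)
    also have "norm ((inverse l * (1 - l)) *\<^sub>R y) = inverse l * \<bar>l - 1\<bar> * norm y"
      using l by (simp add: abs_mult abs_minus_commute)
    also have "\<dots> \<le> (2 * \<bar>l - 1\<bar>) * 4"
      using l False by (intro mult_mono mult_right_mono) (auto simp: divide_simps)
    finally show ?thesis using L0 by (simp add: e mult_ac)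
  qed
qed

text \<open>Outside the tail both values are 1. On the tail, \<open>x\<close> may be large, but then the profile vanishes at both points; where
  it does not, \<open>|x|/R \<le> 4\<close> turns the Lipschitz bound into one proportional to \<open>|l - 1|\<close>.\<close>

lemma psi_dilate:
  fixes x :: "real ^ 'n"
  assumes L: "cut_lipschitz TYPE('n) L" and l: "1 / 2 \<le> l" "l \<le> 2" and R: "0 < \<delta>" "8 * \<delta> \<le> R"
  shows "\<bar>psi \<delta> R (x /\<^sub>R l) - psi \<delta> R x\<bar> \<le> 32 * L * \<bar>l - 1\<bar> * indicator (tail \<delta> R) x"
proof (cases "x \<in> tail \<delta> R")
  case True
  have "\<bar>phi \<delta> R (x /\<^sub>R l) - phi \<delta> R x\<bar> \<le> 16 * L * \<bar>l - 1\<bar>"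
    using cut_dilate[OF L l, of R x] cut_dilate[OF L l, of \<delta> x] R by (simp add: phi_def)
  moreover have "\<bar>phi \<delta> R (x /\<^sub>R l) + phi \<delta> R x\<bar> \<le> 2"
    using phi_range[OF R, of x] phi_range[OF R, of "x /\<^sub>R l"] by linarith
  ultimately have "\<bar>phi \<delta> R (x /\<^sub>R l) - phi \<delta> R x\<bar> * \<bar>phi \<delta> R (x /\<^sub>R l) + phi \<delta> R x\<bar> \<le> (16 * L * \<bar>l - 1\<bar>) * 2"
    using L by (intro mult_mono) (auto simp: cut_lipschitz_def)
  moreover have "psi \<delta> R (x /\<^sub>R l) - psi \<delta> R x = (phi \<delta> R (x /\<^sub>R l) - phi \<delta> R x) * (phi \<delta> R (x /\<^sub>R l) + phi \<delta> R x)"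
    by (simp add: psi_def algebra_simps)
  ultimately show ?thesis using True by (simp add: abs_mult)
next
  case False
  then have x: "4 * \<delta> < norm x" "norm x < R / 2" by (auto simp: tail_def)
  have "phi \<delta> R x = 1" using x R by (intro phi_1) auto
  moreover have "phi \<delta> R (x /\<^sub>R l) = 1"
  proof (rule phi_1)
    have l0: "l > 0" using l by simp
    have n: "norm (x /\<^sub>R l) = norm x / l" using l0 by (simp add: divide_inverse_commute)
    have "2 * \<delta> * l \<le> 2 * \<delta> * 2" using R l by (intro mult_left_mono) auto
    then show "2 * \<delta> < norm (x /\<^sub>R l)" unfolding n using x(1) l by (simp add: less_divide_eq)
    have "R * (1 / 2) \<le> R * l" using R l by (intro mult_left_mono) auto
    then show "norm (x /\<^sub>R l) \<le> R" unfolding n using x(2) l by (simp add: divide_le_eq)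
  qed (use R in auto)
  ultimately show ?thesis using False by (simp add: psi_def)
qed

lemma psi_mult_integrable:
  fixes d :: "real ^ 'n \<Rightarrow> real"
  assumes R: "0 < \<delta>" "8 * \<delta> \<le> R" and d: "integrable lborel d"
  shows "integrable lborel (\<lambda>x. psi \<delta> R x * d x)" "l > 0 \<Longrightarrow> integrable lborel (\<lambda>x. psi \<delta> R (x /\<^sub>R l) * d x)"
proof -
  have R0: "R > 0" using R by simp
  have t: "psi \<delta> R \<in> test_functions" by (rule psi_test[OF R(1) R0])
  show "integrable lborel (\<lambda>x. psi \<delta> R x * d x)" by (rule test_mult_integrable[OF t d])
  assume l: "l > 0"
  have "(\<lambda>x. psi \<delta> R (0 + inverse l *\<^sub>R x)) \<in> test_functions" by (rule test_affine[OF t]) (use l in simp)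
  from test_mult_integrable[OF this d] show "integrable lborel (\<lambda>x. psi \<delta> R (x /\<^sub>R l) * d x)" by simp
qed

text \<open>The dependence on the dilation is a tail error: it carries only the mass of \<open>d\<close> on the tail.\<close>

lemma cutoff_integral_dilate:
  fixes d :: "real ^ 'n \<Rightarrow> real"
  assumes L: "cut_lipschitz TYPE('n) L" and l: "1 / 2 \<le> l" "l \<le> 2" and R: "0 < \<delta>" "8 * \<delta> \<le> R"
    and d: "integrable lborel d" "\<And>x. d x \<ge> 0"
  shows "\<bar>(LBINT x. psi \<delta> R (x /\<^sub>R l) * d x) - (LBINT x. psi \<delta> R x * d x)\<bar>
     \<le> 32 * L * \<bar>l - 1\<bar> * (LBINT x. indicator (tail \<delta> R) x * d x)"
proof -
  have l0: "l > 0" using l by simp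
  note I = psi_mult_integrable(1)[OF R d(1)] psi_mult_integrable(2)[OF R d(1) l0]
  have TI: "integrable lborel (\<lambda>x. indicator (tail \<delta> R) x * d x)" by (intro integrable_indicator_mult d) simp
  have "(LBINT x. psi \<delta> R (x /\<^sub>R l) * d x) - (LBINT x. psi \<delta> R x * d x)
      = (LBINT x. psi \<delta> R (x /\<^sub>R l) * d x - psi \<delta> R x * d x)"
    using I by simp
  also have "\<bar>\<dots>\<bar> \<le> (LBINT x. 32 * L * \<bar>l - 1\<bar> * (indicator (tail \<delta> R) x * d x))"
  proof (rule integral_abs_bound_integral)
    show "integrable lborel (\<lambda>x. psi \<delta> R (x /\<^sub>R l) * d x - psi \<delta> R x * d x)" using I by simp
    show "integrable lborel (\<lambda>x. 32 * L * \<bar>l - 1\<bar> * (indicator (tail \<delta> R) x * d x))" using TI by simp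
    fix x
    have "\<bar>psi \<delta> R (x /\<^sub>R l) - psi \<delta> R x\<bar> * d x \<le> 32 * L * \<bar>l - 1\<bar> * indicator (tail \<delta> R) x * d x"
      by (intro mult_right_mono psi_dilate L l R d)
    then show "\<bar>psi \<delta> R (x /\<^sub>R l) * d x - psi \<delta> R x * d x\<bar> \<le> 32 * L * \<bar>l - 1\<bar> * (indicator (tail \<delta> R) x * d x)"
      using d(2)[of x] by (simp add: left_diff_distrib[symmetric] abs_mult)
  qed
  finally show ?thesis by simp
qed

lemma density_dilate:
  fixes u :: "real ^ 'n \<Rightarrow> real"
  assumes [measurable]: "u \<in> borel_measurable borel" and l: "l > 0"
    and u: "integrable lborel (\<lambda>x. \<bar>u x\<bar> powr p * norm x powr (- c))"
  shows "integrable lborel (\<lambda>x. \<bar>u (l *\<^sub>R x)\<bar> powr p * norm x powr (- c))"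
proof -
  have "integrable lborel (\<lambda>x. l powr c * (\<bar>u (l *\<^sub>R x)\<bar> powr p * norm (l *\<^sub>R x) powr (- c)))"
    using dilate_integrable[OF u l] by simp
  moreover have "l powr c * (\<bar>u (l *\<^sub>R x)\<bar> powr p * norm (l *\<^sub>R x) powr (- c)) = \<bar>u (l *\<^sub>R x)\<bar> powr p * norm x powr (- c)" for x
    using l by (simp add: powr_mult powr_minus field_simps)
  ultimately show ?thesis by (simp only:)
qed

lemma density_scaling:
  fixes u \<xi> :: "real ^ 'n \<Rightarrow> real"
  assumes [measurable]: "u \<in> borel_measurable borel" "\<xi> \<in> borel_measurable borel" and l: "l > 0"
  shows "(LBINT x. \<xi> x * (\<bar>u (l *\<^sub>R x)\<bar> powr p * norm x powr (- c)))
    = l powr (c - real CARD('n)) * (LBINT x. \<xi> (x /\<^sub>R l) * (\<bar>u x\<bar> powr p * norm x powr (- c)))"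
proof -
  define f where "f y = \<xi> (y /\<^sub>R l) * (\<bar>u y\<bar> powr p * norm y powr (- c))" for y
  have [measurable]: "f \<in> borel_measurable borel" unfolding f_def by measurable
  have "\<xi> x * (\<bar>u (l *\<^sub>R x)\<bar> powr p * norm x powr (- c)) = l powr c * f (l *\<^sub>R x)" for x
    using l by (simp add: f_def powr_mult powr_minus field_simps)
  then have "(LBINT x. \<xi> x * (\<bar>u (l *\<^sub>R x)\<bar> powr p * norm x powr (- c))) = l powr c * (LBINT x. f (l *\<^sub>R x))"
    by simp
  also have "\<dots> = l powr (c - real CARD('n)) * (LBINT x. f x)"
    using l by (simp add: dilate_integral powr_diff powr_realpow)
  finally show ?thesis by (simp add: f_def)
qed

lemma gradient_scaling:
  fixes g :: "real ^ 'n \<Rightarrow> real ^ 'n" and \<xi> :: "real ^ 'n \<Rightarrow> real"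
  assumes [measurable]: "g \<in> borel_measurable borel" "\<xi> \<in> borel_measurable borel" and l: "l > 0"
  shows "(LBINT x. \<xi> x * (norm (l *\<^sub>R g (l *\<^sub>R x)))\<^sup>2)
    = l powr (2 - real CARD('n)) * (LBINT x. \<xi> (x /\<^sub>R l) * (norm (g x))\<^sup>2)"
proof -
  define f where "f y = \<xi> (y /\<^sub>R l) * (norm (g y))\<^sup>2" for y
  have [measurable]: "f \<in> borel_measurable borel" unfolding f_def by measurable
  have "\<xi> x * (norm (l *\<^sub>R g (l *\<^sub>R x)))\<^sup>2 = l\<^sup>2 * f (l *\<^sub>R x)" for x
    using l by (simp add: f_def power_mult_distrib)
  then have "(LBINT x. \<xi> x * (norm (l *\<^sub>R g (l *\<^sub>R x)))\<^sup>2) = l\<^sup>2 * (LBINT x. f (l *\<^sub>R x))"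
    by simp
  also have "\<dots> = l powr (2 - real CARD('n)) * (LBINT x. f x)"
    using l by (simp add: dilate_integral powr_diff powr_realpow)
  finally show ?thesis by (simp add: f_def)
qed

lemma psi_Lp:
  fixes f :: "real ^ 'n \<Rightarrow> real"
  assumes R: "0 < \<delta>" "8 * \<delta> \<le> R" and [measurable]: "f \<in> borel_measurable borel"
    and f: "integrable lborel (\<lambda>x. \<bar>f x\<bar> powr p * norm x powr (- c))" and c: "c \<ge> 0" and p: "p \<ge> 0"
  shows "integrable lborel (\<lambda>x. \<bar>psi \<delta> R x * f x\<bar> powr p)" "integrable lborel (\<lambda>x. \<bar>phi \<delta> R x * f x\<bar> powr p)"
proof -
  have R0: "R > 0" using R by simp
  have [measurable]: "psi \<delta> R \<in> borel_measurable borel" "phi \<delta> R \<in> borel_measurable borel"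
    using psi_test[OF R(1) R0] phi_test[OF R(1) R0] by (auto intro: test_borel)
  have I: "integrable lborel (\<lambda>x. indicator (ann \<delta> (2 * R)) x * \<bar>f x\<bar> powr p)"
    using R0 by (intro ann_Lp(1)[OF _ f c R(1)]) auto
  have *: "integrable lborel (\<lambda>x. \<bar>\<xi> x * f x\<bar> powr p)"
    if [measurable]: "\<xi> \<in> borel_measurable borel" and x: "\<And>x. 0 \<le> \<xi> x" "\<And>x. \<xi> x \<le> 1" "\<And>x. x \<notin> ann \<delta> (2 * R) \<Longrightarrow> \<xi> x = 0" for \<xi>
  proof (rule Bochner_Integration.integrable_bound[OF I])
    show "AE x in lborel. norm (\<bar>\<xi> x * f x\<bar> powr p) \<le> norm (indicator (ann \<delta> (2 * R)) x * \<bar>f x\<bar> powr p)"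
    proof (rule AE_I2)
      fix y
      show "norm (\<bar>\<xi> y * f y\<bar> powr p) \<le> norm (indicator (ann \<delta> (2 * R)) y * \<bar>f y\<bar> powr p)"
      proof (cases "y \<in> ann \<delta> (2 * R)")
        case True
        have "\<bar>\<xi> y * f y\<bar> powr p \<le> \<bar>f y\<bar> powr p"
          using x(1,2)[of y] p by (intro powr_mono2) (auto simp: abs_mult intro: mult_left_le_one_le)
        then show ?thesis using True by simp
      qed (simp add: x(3))
    qed
  qed measurable
  show "integrable lborel (\<lambda>x. \<bar>psi \<delta> R x * f x\<bar> powr p)"
    by (rule *) (simp_all add: psi_range[OF R] psi_0[OF R])
  show "integrable lborel (\<lambda>x. \<bar>phi \<delta> R x * f x\<bar> powr p)"
    by (rule *) (simp_all add: phi_range[OF R] phi_0[OF R])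
qed

section \<open>Testing with a cut-off dilation increment\<close>

context dilation_setting
begin

abbreviation "Ad x \<equiv> (norm (g x))\<^sup>2"
abbreviation "Bd x \<equiv> \<bar>u x\<bar> powr q * norm x powr (- b)"
abbreviation "Cd x \<equiv> \<bar>u x\<bar> powr r * norm x powr (- \<eta>)"

text \<open>The finite difference that replaces the field \<open>x \<bullet> \<nabla>u\<close>.\<close>

definition w :: "real \<Rightarrow> real ^ 'n \<Rightarrow> real" where "w l x = u (l *\<^sub>R x) - u x"
definition Dw :: "real \<Rightarrow> real ^ 'n \<Rightarrow> real ^ 'n" where "Dw l x = l *\<^sub>R g (l *\<^sub>R x) - g x"

lemma w_H1loc: "l > 0 \<Longrightarrow> H1loc (w l) (Dw l)"
  unfolding w_def[abs_def] Dw_def[abs_def] by (intro H1loc_diff H1loc_dilate H)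

lemma w_borel [measurable]: "w l \<in> borel_measurable borel"
  unfolding w_def by measurable

lemma Dw_borel [measurable]: "Dw l \<in> borel_measurable borel"
  unfolding Dw_def by measurable

text \<open>The monotonicity gap of the source term between \<open>u\<close> and its dilation.\<close>

definition defect :: "real \<Rightarrow> real ^ 'n \<Rightarrow> real" where
  "defect l x = (spow (r - 1) (u (l *\<^sub>R x)) - spow (r - 1) (u x)) * w l x * norm x powr (- \<eta>)"

text \<open>The equation tested with \<open>\<psi> w\<close>. The gradient term is an exact difference of squares minus \<open>|Dw|^2/2\<close>; the
  absorption term is bounded above by convexity at \<open>u x\<close>, the source term below by convexity at \<open>u (l x)\<close>, which costs
  the defect. Change of variables moves the dilation onto the cutoff.\<close>

lemma dilation_inequality:
  assumes l: "l > 0" and R: "0 < \<delta>" "8 * \<delta> \<le> R"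
  shows "0 \<le> (l powr (2 - real CARD('n)) * (LBINT x. psi \<delta> R (x /\<^sub>R l) * Ad x) - (LBINT x. psi \<delta> R x * Ad x)) / 2
     - (LBINT x. psi \<delta> R x * (norm (Dw l x))\<^sup>2) / 2
     + (l powr (b - real CARD('n)) * (LBINT x. psi \<delta> R (x /\<^sub>R l) * Bd x) - (LBINT x. psi \<delta> R x * Bd x)) / q
     - (l powr (\<eta> - real CARD('n)) * (LBINT x. psi \<delta> R (x /\<^sub>R l) * Cd x) - (LBINT x. psi \<delta> R x * Cd x)) / r
     + (LBINT x. w l x * (g x \<bullet> grad (psi \<delta> R) x))
     + (LBINT x. psi \<delta> R x * defect l x)"
    and "integrable lborel (\<lambda>x. psi \<delta> R x * (norm (Dw l x))\<^sup>2)"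
    and "integrable lborel (\<lambda>x. psi \<delta> R x * defect l x)"
    and "integrable lborel (\<lambda>x. w l x * (g x \<bullet> grad (psi \<delta> R) x))"
proof -
  have R0: "R > 0" using R by simp
  let ?p = "psi \<delta> R"
  have pt: "?p \<in> test_functions" by (rule psi_test[OF R(1) R0])
  have pm[measurable]: "?p \<in> borel_measurable borel" by (rule test_borel[OF pt])
  define v where "v x = ?p x * w l x" for x
  define gv where "gv x = ?p x *\<^sub>R Dw l x + w l x *\<^sub>R grad ?p x" for x
  have Hv: "H1c v gv" unfolding v_def[abs_def] gv_def[abs_def] by (rule H1loc_cutoff[OF w_H1loc[OF l] pt])
  have v0: "norm x < \<delta> \<Longrightarrow> v x = 0" for x using psi_0[OF R, of x] by (auto simp: v_def ann_def)
  have vm[measurable]: "v \<in> borel_measurable borel" unfolding v_def by measurable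
  have ulm[measurable]: "(\<lambda>x. u (l *\<^sub>R x)) \<in> borel_measurable borel" by measurable
  note Bl = density_dilate[OF um l Bint] and Cl = density_dilate[OF um l Cint]
  have vq: "integrable lborel (\<lambda>x. \<bar>v x\<bar> powr q)"
    using integrable_powr_diff[of q "\<lambda>x. ?p x * u (l *\<^sub>R x)" lborel "\<lambda>x. ?p x * u x"]
      psi_Lp(1)[OF R ulm Bl b(1)] psi_Lp(1)[OF R um Bint b(1)] q
    by (simp add: v_def w_def right_diff_distrib)
  have vr: "integrable lborel (\<lambda>x. \<bar>v x\<bar> powr r)"
    using integrable_powr_diff[of r "\<lambda>x. ?p x * u (l *\<^sub>R x)" lborel "\<lambda>x. ?p x * u x"]
      psi_Lp(1)[OF R ulm Cl \<eta>(1)] psi_Lp(1)[OF R um Cint \<eta>(1)] r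
    by (simp add: v_def w_def right_diff_distrib)
  note E = weak_eq_ext[OF Hv R(1) v0 vq vr]
  have gl: "integrable lborel (\<lambda>x. (norm (l *\<^sub>R g (l *\<^sub>R x)))\<^sup>2)"
    using H1loc_dilate[OF H l] by (auto simp: H1loc_def)
  have DI: "integrable lborel (\<lambda>x. (norm (Dw l x))\<^sup>2)" using w_H1loc[OF l] by (auto simp: H1loc_def)
  note pI = psi_mult_integrable(1)[OF R]
  show PD: "integrable lborel (\<lambda>x. ?p x * (norm (Dw l x))\<^sup>2)" by (rule pI[OF DI])
  have gD: "g x \<bullet> Dw l x = ((norm (l *\<^sub>R g (l *\<^sub>R x)))\<^sup>2 - (norm (g x))\<^sup>2 - (norm (Dw l x))\<^sup>2) / 2" for x
    unfolding Dw_def power2_norm_eq_inner by (simp add: inner_diff_left inner_diff_right inner_commute)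
  have IgD: "integrable lborel (\<lambda>x. ?p x * (g x \<bullet> Dw l x))"
    unfolding gD using gl DI Aint by (intro pI) auto
  have ggv: "g x \<bullet> gv x = ?p x * (g x \<bullet> Dw l x) + w l x * (g x \<bullet> grad ?p x)" for x
    by (simp add: gv_def inner_add_right)
  have "integrable lborel (\<lambda>x. g x \<bullet> gv x - ?p x * (g x \<bullet> Dw l x))" using E(2) IgD by simp
  then show IZ: "integrable lborel (\<lambda>x. w l x * (g x \<bullet> grad ?p x))" by (simp add: ggv)
  have "integrable lborel (\<lambda>x. spow (r - 1) (u (l *\<^sub>R x)) * v x * norm x powr (- \<eta>))"
  proof (rule pairing_integrable(1)[where K = "\<delta> powr (- \<eta>)"])
    show "norm x powr - \<eta> \<le> \<delta> powr - \<eta>" if "v x \<noteq> 0" for x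
      using v0[of x] that R \<eta> by (intro weight_le) force+
  qed (simp_all add: r Cl vr)
  then have "integrable lborel (\<lambda>x. spow (r - 1) (u (l *\<^sub>R x)) * v x * norm x powr (- \<eta>) - spow (r - 1) (u x) * v x * norm x powr (- \<eta>))"
    using E(4) by simp
  then show IS: "integrable lborel (\<lambda>x. ?p x * defect l x)"
    by (simp add: defect_def v_def algebra_simps)
  have t1: "(LBINT x. g x \<bullet> gv x) = ((LBINT x. ?p x * (norm (l *\<^sub>R g (l *\<^sub>R x)))\<^sup>2) - (LBINT x. ?p x * Ad x)
       - (LBINT x. ?p x * (norm (Dw l x))\<^sup>2)) / 2 + (LBINT x. w l x * (g x \<bullet> grad ?p x))"
  proof -
    have "(LBINT x. ?p x * (g x \<bullet> Dw l x)) = (LBINT x. (?p x * (norm (l *\<^sub>R g (l *\<^sub>R x)))\<^sup>2 - ?p x * Ad x - ?p x * (norm (Dw l x))\<^sup>2) / 2)"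
      unfolding gD by (intro Bochner_Integration.integral_cong) (auto simp: algebra_simps)
    also have "\<dots> = ((LBINT x. ?p x * (norm (l *\<^sub>R g (l *\<^sub>R x)))\<^sup>2) - (LBINT x. ?p x * Ad x) - (LBINT x. ?p x * (norm (Dw l x))\<^sup>2)) / 2"
      using pI[OF gl] pI[OF Aint] PD by simp
    finally show ?thesis unfolding ggv using IgD IZ by simp
  qed
  have t2: "(LBINT x. spow (q - 1) (u x) * v x * norm x powr (- b))
     \<le> ((LBINT x. ?p x * (\<bar>u (l *\<^sub>R x)\<bar> powr q * norm x powr (- b))) - (LBINT x. ?p x * Bd x)) / q"
  proof -
    have "(LBINT x. spow (q - 1) (u x) * v x * norm x powr (- b))
      \<le> (LBINT x. (?p x * (\<bar>u (l *\<^sub>R x)\<bar> powr q * norm x powr (- b)) - ?p x * Bd x) / q)"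
    proof (rule integral_mono)
      fix x
      have "q * (spow (q - 1) (u x) * w l x) \<le> \<bar>u (l *\<^sub>R x)\<bar> powr q - \<bar>u x\<bar> powr q"
        using powr_convex_tangent[of q "u x" "u (l *\<^sub>R x)"] q by (simp add: w_def)
      then have "?p x * norm x powr (- b) * (q * (spow (q - 1) (u x) * w l x)) \<le> ?p x * norm x powr (- b) * (\<bar>u (l *\<^sub>R x)\<bar> powr q - \<bar>u x\<bar> powr q)"
        using psi_range[OF R, of x] by (intro mult_left_mono) auto
      then show "spow (q - 1) (u x) * v x * norm x powr (- b) \<le> (?p x * (\<bar>u (l *\<^sub>R x)\<bar> powr q * norm x powr (- b)) - ?p x * Bd x) / q"
        using q by (simp add: v_def le_divide_eq algebra_simps)
    qed (use E(3) pI[OF Bl] pI[OF Bint] in auto)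
    then show ?thesis using pI[OF Bl] pI[OF Bint] by simp
  qed
  have t3: "((LBINT x. ?p x * (\<bar>u (l *\<^sub>R x)\<bar> powr r * norm x powr (- \<eta>))) - (LBINT x. ?p x * Cd x)) / r
     \<le> (LBINT x. spow (r - 1) (u x) * v x * norm x powr (- \<eta>)) + (LBINT x. ?p x * defect l x)"
  proof -
    have "(LBINT x. (?p x * (\<bar>u (l *\<^sub>R x)\<bar> powr r * norm x powr (- \<eta>)) - ?p x * Cd x) / r)
      \<le> (LBINT x. spow (r - 1) (u x) * v x * norm x powr (- \<eta>) + ?p x * defect l x)"
    proof (rule integral_mono)
      fix x
      have "\<bar>u (l *\<^sub>R x)\<bar> powr r - \<bar>u x\<bar> powr r \<le> r * (spow (r - 1) (u (l *\<^sub>R x)) * w l x)"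
        using powr_convex_tangent[of r "u (l *\<^sub>R x)" "u x"] r by (simp add: w_def algebra_simps)
      then have "?p x * norm x powr (- \<eta>) * (\<bar>u (l *\<^sub>R x)\<bar> powr r - \<bar>u x\<bar> powr r) \<le> ?p x * norm x powr (- \<eta>) * (r * (spow (r - 1) (u (l *\<^sub>R x)) * w l x))"
        using psi_range[OF R, of x] by (intro mult_left_mono) auto
      then show "(?p x * (\<bar>u (l *\<^sub>R x)\<bar> powr r * norm x powr (- \<eta>)) - ?p x * Cd x) / r \<le> spow (r - 1) (u x) * v x * norm x powr (- \<eta>) + ?p x * defect l x"
        using r by (simp add: v_def defect_def divide_le_eq algebra_simps)
    qed (use E(4) IS pI[OF Cl] pI[OF Cint] in auto)
    then show ?thesis using pI[OF Cl] pI[OF Cint] E(4) IS by simp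
  qed
  show "0 \<le> (l powr (2 - real CARD('n)) * (LBINT x. ?p (x /\<^sub>R l) * Ad x) - (LBINT x. ?p x * Ad x)) / 2
     - (LBINT x. ?p x * (norm (Dw l x))\<^sup>2) / 2
     + (l powr (b - real CARD('n)) * (LBINT x. ?p (x /\<^sub>R l) * Bd x) - (LBINT x. ?p x * Bd x)) / q
     - (l powr (\<eta> - real CARD('n)) * (LBINT x. ?p (x /\<^sub>R l) * Cd x) - (LBINT x. ?p x * Cd x)) / r
     + (LBINT x. w l x * (g x \<bullet> grad ?p x))
     + (LBINT x. ?p x * defect l x)"
    using E(1) t1 t2 t3
    unfolding density_scaling[OF um pm l] gradient_scaling[OF gm pm l] diff_divide_distrib by linarith
qed

lemma grad_cut_bound:
  fixes x :: "real ^ 'n"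
  assumes L: "cut_lipschitz TYPE('n) L" and \<rho>: "\<rho> > 0"
  shows "norm (grad (cut \<rho>) x) \<le> L / \<rho> * indicator (ann \<rho> (2 * \<rho>)) x"
proof (cases "x \<in> ann \<rho> (2 * \<rho>)")
  case True
  have "norm (grad cut1 (x /\<^sub>R \<rho>)) \<le> L" using L by (simp add: cut_lipschitz_def)
  then show ?thesis using True \<rho> by (simp add: grad_cut divide_simps)
next
  case False
  then show ?thesis using grad_cut_0[OF \<rho>, of x] by (auto simp: ann_def)
qed

lemma grad_psi_bound:
  fixes x :: "real ^ 'n"
  assumes L: "cut_lipschitz TYPE('n) L" and R: "0 < \<delta>" "8 * \<delta> \<le> R"
  shows "norm (grad (psi \<delta> R) x) \<le> 2 * (L / \<delta> * indicator (ann \<delta> (2 * \<delta>)) x + L / R * indicator (ann R (2 * R)) x)"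
proof -
  have R0: "R > 0" using R by simp
  have pe: "psi \<delta> R = (\<lambda>x. phi \<delta> R x * phi \<delta> R x)" by (simp add: psi_def[abs_def])
  have "grad (psi \<delta> R) x = phi \<delta> R x *\<^sub>R grad (phi \<delta> R) x + phi \<delta> R x *\<^sub>R grad (phi \<delta> R) x"
    unfolding pe by (rule grad_mult[OF phi_test[OF R(1) R0] phi_test[OF R(1) R0]])
  also have "\<dots> = (2 * phi \<delta> R x) *\<^sub>R grad (phi \<delta> R) x"
    by (simp only: scaleR_left_distrib[symmetric] mult_2)
  finally have "norm (grad (psi \<delta> R) x) = 2 * phi \<delta> R x * norm (grad (phi \<delta> R) x)"
    using phi_range[OF R, of x] by simp
  also have "\<dots> \<le> 2 * 1 * norm (grad (phi \<delta> R) x)"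
    using phi_range[OF R, of x] by (intro mult_right_mono mult_left_mono) auto
  also have "grad (phi \<delta> R) x = grad (cut R) x - grad (cut \<delta>) x"
    unfolding phi_def[abs_def] by (rule grad_diff[OF cut_test[OF R0] cut_test[OF R(1)]])
  also have "norm (grad (cut R) x - grad (cut \<delta>) x) \<le> norm (grad (cut R) x) + norm (grad (cut \<delta>) x)"
    by (rule norm_triangle_ineq4)
  finally show ?thesis using grad_cut_bound[OF L R0, of x] grad_cut_bound[OF L R(1), of x] by simp
qed

text \<open>On each transition layer \<open>\<rho> \<le> |x| \<le> 2 \<rho>\<close> one has \<open>|\<nabla>\<psi>| \<le> 2 L/\<rho>\<close> while \<open>w\<close> is of size \<open>\<rho> |l - 1|\<close> in \<open>L^2\<close>
  relative to the energy of a slightly larger layer, so the factors of \<open>\<rho>\<close> cancel.\<close>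

lemma commutator_bound:
  assumes L: "cut_lipschitz TYPE('n) L" and l: "1 / 2 \<le> l" "l \<le> 2" "l \<noteq> 1" and R: "0 < \<delta>" "8 * \<delta> \<le> R"
  shows "\<bar>LBINT x. w l x * (g x \<bullet> grad (psi \<delta> R) x)\<bar> \<le>
    \<bar>l - 1\<bar> * (2 * L * (24 * 2 ^ CARD('n) + 1) * (LBINT x. indicator (tail \<delta> R) x * Ad x))"
proof -
  have R0: "R > 0" using R by simp
  have l0: "l > 0" using l by simp
  have L0: "L > 0" using L by (simp add: cut_lipschitz_def)
  define e where "e = \<bar>l - 1\<bar>"
  have e: "e > 0" "e\<^sup>2 = (l - 1)\<^sup>2" using l by (auto simp: e_def)
  define T where "T = (LBINT x. indicator (tail \<delta> R) x * Ad x)"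
  have TI: "integrable lborel (\<lambda>x. indicator (tail \<delta> R) x * Ad x)" by (intro integrable_indicator_mult Aint) simp
  define M where "M \<rho> x = L / \<rho> * (indicator (ann \<rho> (2 * \<rho>)) x * (w l x)\<^sup>2 / (\<rho> * e) + \<rho> * e * (indicator (ann \<rho> (2 * \<rho>)) x * Ad x))" for \<rho> x
  have wI: "integrable lborel (\<lambda>x. indicator (ann s t) x * (w l x)\<^sup>2)" for s t
    unfolding w_def by (rule dilation_H1loc_integrable[OF H l0])
  have aI: "integrable lborel (\<lambda>x. indicator (ann s t) x * Ad x)" for s t
    by (intro integrable_indicator_mult Aint) simp
  have MI: "integrable lborel (M \<rho>)" for \<rho> unfolding M_def using wI aI by simp
  have Mint: "(LBINT x. M \<rho> x) \<le> e * (L * (24 * 2 ^ CARD('n) + 1) * T)"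
    if \<rho>: "\<rho> > 0" and sub: "ann (\<rho> / 2) (4 * \<rho>) \<subseteq> (tail \<delta> R :: (real ^ 'n) set)" for \<rho>
  proof -
    define G where "G = (LBINT x. indicator (ann (\<rho> / 2) (4 * \<rho>)) x * Ad x)"
    have GT: "G \<le> T" unfolding G_def T_def
      by (intro integral_mono aI TI mult_right_mono) (use sub in \<open>auto simp: indicator_def\<close>)
    have G1: "(LBINT x. indicator (ann \<rho> (2 * \<rho>)) x * Ad x) \<le> G" unfolding G_def
      by (intro integral_mono aI mult_right_mono) (use \<rho> in \<open>auto simp: indicator_def ann_def\<close>)
    have W: "(LBINT x. indicator (ann \<rho> (2 * \<rho>)) x * (w l x)\<^sup>2) \<le> 6 * 2 ^ CARD('n) * e\<^sup>2 * (2 * \<rho>)\<^sup>2 * G"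
      using dilation_H1loc[OF H l(1,2), of \<rho> "2 * \<rho>"] \<rho> by (simp add: w_def e G_def)
    have "(LBINT x. M \<rho> x) = L / \<rho> * ((LBINT x. indicator (ann \<rho> (2 * \<rho>)) x * (w l x)\<^sup>2) / (\<rho> * e)
        + \<rho> * e * (LBINT x. indicator (ann \<rho> (2 * \<rho>)) x * Ad x))"
      unfolding M_def using wI aI by simp
    also have "\<dots> \<le> L / \<rho> * ((6 * 2 ^ CARD('n) * e\<^sup>2 * (2 * \<rho>)\<^sup>2 * G) / (\<rho> * e) + \<rho> * e * G)"
      using W G1 \<rho> e L0 by (intro mult_left_mono add_mono divide_right_mono) auto
    also have "\<dots> = e * (L * (24 * 2 ^ CARD('n) + 1) * G)"
      using \<rho> e by (simp add: power2_eq_square field_simps)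
    also have "\<dots> \<le> e * (L * (24 * 2 ^ CARD('n) + 1) * T)"
      using GT e L0 by (intro mult_left_mono) auto
    finally show ?thesis .
  qed
  have pw: "\<bar>w l x * (g x \<bullet> grad (psi \<delta> R) x)\<bar> \<le> M \<delta> x + M R x" for x
  proof -
    have am: "2 * (L / \<rho> * indicator (ann \<rho> (2 * \<rho>)) x) * (\<bar>w l x\<bar> * norm (g x)) \<le> M \<rho> x" if \<rho>: "\<rho> > 0" for \<rho>
    proof (cases "x \<in> ann \<rho> (2 * \<rho>)")
      case True
      define k where "k = \<rho> * e"
      have k: "k > 0" using \<rho> e by (simp add: k_def)
      have "0 \<le> (\<bar>w l x\<bar> - k * norm (g x))\<^sup>2 / k" using k by simp
      also have "\<dots> = (w l x)\<^sup>2 / k + k * Ad x - 2 * (\<bar>w l x\<bar> * norm (g x))"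
        using k by (simp add: power2_diff field_simps power2_eq_square)
      finally have "L / \<rho> * (2 * (\<bar>w l x\<bar> * norm (g x))) \<le> L / \<rho> * ((w l x)\<^sup>2 / k + k * Ad x)"
        using L0 \<rho> by (intro mult_left_mono) auto
      then show ?thesis using True by (simp add: M_def k_def mult_ac)
    qed (simp add: M_def)
    have "\<bar>w l x * (g x \<bullet> grad (psi \<delta> R) x)\<bar> \<le> \<bar>w l x\<bar> * (norm (g x) * norm (grad (psi \<delta> R) x))"
      by (simp add: abs_mult mult_left_mono Cauchy_Schwarz_ineq2)
    also have "\<dots> \<le> \<bar>w l x\<bar> * (norm (g x) * (2 * (L / \<delta> * indicator (ann \<delta> (2 * \<delta>)) x + L / R * indicator (ann R (2 * R)) x)))"
      by (intro mult_left_mono grad_psi_bound L R) auto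
    also have "\<dots> = 2 * (L / \<delta> * indicator (ann \<delta> (2 * \<delta>)) x) * (\<bar>w l x\<bar> * norm (g x)) + 2 * (L / R * indicator (ann R (2 * R)) x) * (\<bar>w l x\<bar> * norm (g x))"
      by (simp add: algebra_simps)
    also have "\<dots> \<le> M \<delta> x + M R x" by (intro add_mono am R R0)
    finally show ?thesis .
  qed
  have "\<bar>LBINT x. w l x * (g x \<bullet> grad (psi \<delta> R) x)\<bar> \<le> (LBINT x. M \<delta> x + M R x)"
    by (rule integral_abs_bound_integral) (use pw MI dilation_inequality(4)[OF l0 R] in auto)
  also have "\<dots> = (LBINT x. M \<delta> x) + (LBINT x. M R x)" using MI by simp
  also have "\<dots> \<le> e * (L * (24 * 2 ^ CARD('n) + 1) * T) + e * (L * (24 * 2 ^ CARD('n) + 1) * T)"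
    by (intro add_mono Mint R R0) (auto simp: tail_def ann_def)
  finally show ?thesis by (simp add: e_def T_def algebra_simps)
qed

end

section \<open>The convexity defect is negligible\<close>

lemma AE_dilate:
  fixes Q :: "real ^ 'n \<Rightarrow> bool"
  assumes [measurable]: "Measurable.pred borel Q" and l: "l > 0" and Q: "AE x in lborel. Q x"
  shows "AE x in lborel. Q (l *\<^sub>R x)"
proof -
  let ?f = "\<lambda>x. indicator {x. \<not> Q x} x :: ennreal"
  have "(\<integral>\<^sup>+x. ?f x \<partial>lborel) = 0"
    using Q by (subst nn_integral_0_iff_AE) (auto elim!: eventually_mono)
  then have "ennreal (\<bar>l\<bar> ^ CARD('n)) * (\<integral>\<^sup>+x. ?f (0 + l *\<^sub>R x) \<partial>lborel) = 0"
    using nn_integral_affine[of ?f l 0] l by simp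
  then have "(\<integral>\<^sup>+x. ?f (l *\<^sub>R x) \<partial>lborel) = 0" using l by (simp add: ennreal_zero_less_mult_iff)
  then have "AE x in lborel. ?f (l *\<^sub>R x) = 0" by (subst (asm) nn_integral_0_iff_AE) auto
  then show ?thesis by eventually_elim (simp add: indicator_def split: if_splits)
qed

lemma powr_le_one_plus_square:
  fixes t r :: real assumes "t \<ge> 0" "0 \<le> r" "r \<le> 2" shows "t powr r \<le> 1 + t\<^sup>2"
proof (cases "t \<le> 1")
  case True
  then have "t powr r \<le> 1" using assms by (intro powr_le1) auto
  then show ?thesis by (simp add: add_increasing2)
next
  case False
  then have "t powr r \<le> t powr 2" using assms by (intro powr_mono) auto
  then show ?thesis using False by (simp add: powr_numeral)
qed

lemma square_le_one_plus_powr: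
  fixes t q :: real assumes "t \<ge> 0" "q \<ge> 2" shows "t\<^sup>2 \<le> 1 + t powr q"
proof (cases "t \<le> 1")
  case True
  then have "t\<^sup>2 \<le> 1" using assms by (simp add: power_le_one)
  then show ?thesis by (simp add: add_increasing2)
next
  case False
  then have "t powr 2 \<le> t powr q" using assms by (intro powr_mono) auto
  then show ?thesis using False by (simp add: powr_numeral)
qed

lemma ann_integrable: "integrable lborel (indicator (ann s t) :: real ^ 'n \<Rightarrow> real)"
proof -
  have "emeasure lborel (ann s t :: (real ^ 'n) set) \<le> emeasure lborel (cball (0 :: real ^ 'n) t)"
    by (intro emeasure_mono) (auto simp: ann_def)
  also have "\<dots> < \<infinity>" using emeasure_bounded_finite[of "cball (0 :: real ^ 'n) t"] by auto
  finally show ?thesis by (intro integrable_real_indicator) auto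
qed

context dilation_setting
begin

text \<open>The summand 1 keeps the constant positive.\<close>

definition w_const :: "real \<Rightarrow> real" where
  "w_const R = 6 * 2 ^ CARD('n) * (2 * R)\<^sup>2 * (LBINT x. Ad x) + 1"

lemma w_const_pos: "w_const R > 0"
proof -
  have "(LBINT x. Ad x) \<ge> 0" by simp
  then have "6 * 2 ^ CARD('n) * (2 * R)\<^sup>2 * (LBINT x. Ad x) \<ge> 0" by (intro mult_nonneg_nonneg) auto
  then show ?thesis unfolding w_const_def by linarith
qed

lemma w_annulus:
  assumes l: "1 / 2 \<le> l" "l \<le> 2" and R: "0 < \<delta>" "0 < R"
  shows "(LBINT x. indicator (ann \<delta> (2 * R)) x * (w l x)\<^sup>2) \<le> w_const R * (l - 1)\<^sup>2"
    and "integrable lborel (\<lambda>x. indicator (ann \<delta> (2 * R)) x * (w l x)\<^sup>2)"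
proof -
  have l0: "l > 0" using l by simp
  have aI: "integrable lborel (\<lambda>x. indicator (ann s t) x * Ad x)" for s t
    by (intro integrable_indicator_mult Aint) simp
  have "(LBINT x. indicator (ann (\<delta> / 2) (2 * (2 * R))) x * Ad x) \<le> (LBINT x. Ad x)"
    by (intro integral_mono aI Aint) (auto simp: indicator_def)
  then have "6 * 2 ^ CARD('n) * (l - 1)\<^sup>2 * (2 * R)\<^sup>2 * (LBINT x. indicator (ann (\<delta> / 2) (2 * (2 * R))) x * Ad x)
     \<le> 6 * 2 ^ CARD('n) * (l - 1)\<^sup>2 * (2 * R)\<^sup>2 * (LBINT x. Ad x)"
    by (intro mult_left_mono) auto
  moreover have "(LBINT x. indicator (ann \<delta> (2 * R)) x * (w l x)\<^sup>2) \<le>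
     6 * 2 ^ CARD('n) * (l - 1)\<^sup>2 * (2 * R)\<^sup>2 * (LBINT x. indicator (ann (\<delta> / 2) (2 * (2 * R))) x * Ad x)"
    unfolding w_def by (rule dilation_H1loc[OF H l]) (use R in auto)
  moreover have "w_const R * (l - 1)\<^sup>2 = 6 * 2 ^ CARD('n) * (l - 1)\<^sup>2 * (2 * R)\<^sup>2 * (LBINT x. Ad x) + (l - 1)\<^sup>2"
    by (simp add: w_const_def algebra_simps)
  ultimately show "(LBINT x. indicator (ann \<delta> (2 * R)) x * (w l x)\<^sup>2) \<le> w_const R * (l - 1)\<^sup>2"
    using zero_le_power2[of "l - 1"] by linarith
  show "integrable lborel (\<lambda>x. indicator (ann \<delta> (2 * R)) x * (w l x)\<^sup>2)"
    unfolding w_def by (rule dilation_H1loc_integrable[OF H l0])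
qed

text \<open>On the support of \<open>\<psi>\<close> the weight is at most \<open>\<delta>^(-\<eta>)\<close>.\<close>

lemma defect_bound:
  assumes R: "0 < \<delta>" "8 * \<delta> \<le> R"
    and d: "x \<in> ann \<delta> (2 * R) \<Longrightarrow> \<bar>spow (r - 1) (u (l *\<^sub>R x)) - spow (r - 1) (u x)\<bar> * \<bar>w l x\<bar> \<le> Z" and Z: "Z \<ge> 0"
  shows "psi \<delta> R x * defect l x \<le> \<delta> powr (- \<eta>) * (psi \<delta> R x * Z)"
proof (cases "x \<in> ann \<delta> (2 * R)")
  case True
  have "norm x powr (- \<eta>) \<le> \<delta> powr (- \<eta>)" using True R \<eta> by (intro weight_le) (auto simp: ann_def)
  moreover have "(spow (r - 1) (u (l *\<^sub>R x)) - spow (r - 1) (u x)) * w l x \<le> Z"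
    using d[OF True] by (metis abs_ge_self abs_mult order_trans)
  ultimately have "defect l x \<le> Z * \<delta> powr (- \<eta>)"
    unfolding defect_def using Z by (intro mult_mono) auto
  then have "psi \<delta> R x * defect l x \<le> psi \<delta> R x * (Z * \<delta> powr (- \<eta>))"
    using psi_range[OF R, of x] by (intro mult_left_mono) auto
  then show ?thesis by (simp add: mult_ac)
qed (simp add: psi_0[OF R])

text \<open>Here the nonlinearity is \<open>(r - 1)\<close>-Hoelder, so the defect is at most a multiple of \<open>|w|^r\<close>. Measuring \<open>w\<close> in units of
  \<open>\<epsilon> = |l - 1|\<close> bounds its integral by \<open>\<epsilon>^r\<close> times a constant, and \<open>r > 1\<close>.\<close>

lemma defect_small_sublinear:
  assumes r2: "r \<le> 2" and R: "0 < \<delta>" "8 * \<delta> \<le> R" and e: "e > 0"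
  shows "\<exists>d>0. \<forall>l. \<bar>l - 1\<bar> < d \<and> l \<noteq> 1 \<longrightarrow> (LBINT x. psi \<delta> R x * defect l x) \<le> e * \<bar>l - 1\<bar>"
proof -
  define X where "X = (ann \<delta> (2 * R) :: (real ^ 'n) set)"
  define V :: real where "V = (\<integral>x. indicator X x \<partial>(lborel :: (real ^ 'n) measure))"
  have VI: "integrable lborel (indicator X :: real ^ 'n \<Rightarrow> real)" unfolding X_def by (rule ann_integrable)
  define K where "K = \<delta> powr (- \<eta>) * 2 * (V + w_const R)"
  have K: "K > 0" unfolding K_def V_def using R w_const_pos[of R] by (intro mult_pos_pos add_nonneg_pos) auto
  define d where "d = min (1 / 2) ((e / K) powr (1 / (r - 1)))"
  have d: "d > 0" using e K by (simp add: d_def)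
  have "(LBINT x. psi \<delta> R x * defect l x) \<le> e * \<bar>l - 1\<bar>" if l: "\<bar>l - 1\<bar> < d" "l \<noteq> 1" for l
  proof -
    have l2: "1 / 2 \<le> l" "l \<le> 2" using l(1) unfolding d_def by linarith+
    have R0: "R > 0" using R by simp
    define \<epsilon> where "\<epsilon> = \<bar>l - 1\<bar>"
    have ep: "\<epsilon> > 0" "\<epsilon>\<^sup>2 = (l - 1)\<^sup>2" using l by (auto simp: \<epsilon>_def)
    note W = w_annulus[OF l2 R(1) R0, folded X_def]
    have pw: "psi \<delta> R x * defect l x \<le> \<delta> powr (- \<eta>) * 2 * \<epsilon> powr r * (indicator X x + indicator X x * (w l x)\<^sup>2 / \<epsilon>\<^sup>2)" for x
    proof -
      define Z where "Z = 2 * \<epsilon> powr r * (1 + (w l x)\<^sup>2 / \<epsilon>\<^sup>2)"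
      have Z0: "Z \<ge> 0" by (simp add: Z_def)
      have "\<bar>spow (r - 1) (u (l *\<^sub>R x)) - spow (r - 1) (u x)\<bar> * \<bar>w l x\<bar> \<le> (2 * \<bar>w l x\<bar> powr (r - 1)) * \<bar>w l x\<bar>"
        unfolding w_def by (intro mult_right_mono spow_holder_le) (use r r2 in auto)
      also have "\<dots> = 2 * \<bar>w l x\<bar> powr r"
        using powr_mult_base[of "\<bar>w l x\<bar>" "r - 1"] by (simp add: mult.commute)
      also have "\<dots> = 2 * (\<epsilon> powr r * (\<bar>w l x\<bar> / \<epsilon>) powr r)" using ep by (simp add: powr_divide)
      also have "\<dots> \<le> 2 * (\<epsilon> powr r * (1 + (\<bar>w l x\<bar> / \<epsilon>)\<^sup>2))"
        using ep r r2 by (intro mult_left_mono powr_le_one_plus_square) auto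
      also have "\<dots> = Z" by (simp add: Z_def power_divide)
      finally have "psi \<delta> R x * defect l x \<le> \<delta> powr (- \<eta>) * (psi \<delta> R x * Z)"
        using Z0 by (intro defect_bound[OF R])
      also have "psi \<delta> R x * Z \<le> indicator X x * Z"
        using psi_range[OF R, of x] psi_0[OF R, of x] Z0 by (cases "x \<in> X") (auto simp: X_def mult_left_le_one_le)
      finally have "psi \<delta> R x * defect l x \<le> \<delta> powr (- \<eta>) * (indicator X x * Z)" by (simp add: mult_left_mono)
      then show ?thesis by (simp add: Z_def algebra_simps)
    qed
    have "(LBINT x. psi \<delta> R x * defect l x) \<le> (LBINT x. \<delta> powr (- \<eta>) * 2 * \<epsilon> powr r * (indicator X x + indicator X x * (w l x)\<^sup>2 / \<epsilon>\<^sup>2))"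
      by (intro integral_mono' pw) (use VI W(2) in auto)
    also have "\<dots> = \<delta> powr (- \<eta>) * 2 * \<epsilon> powr r * (V + (LBINT x. indicator X x * (w l x)\<^sup>2) / \<epsilon>\<^sup>2)"
      using VI W(2) by (simp add: V_def)
    also have "\<dots> \<le> \<delta> powr (- \<eta>) * 2 * \<epsilon> powr r * (V + w_const R)"
      using W(1) ep by (intro mult_left_mono add_left_mono) (auto simp: divide_le_eq)
    also have "\<dots> = K * \<epsilon> powr (r - 1) * \<epsilon>"
      using powr_mult_base[of \<epsilon> "r - 1"] ep by (simp add: K_def mult_ac)
    also have "\<dots> \<le> e * \<epsilon>"
    proof (rule mult_right_mono)
      have "\<epsilon> powr (r - 1) \<le> ((e / K) powr (1 / (r - 1))) powr (r - 1)"
        using l(1) r ep by (intro powr_mono2) (auto simp: \<epsilon>_def d_def)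
      also have "\<dots> = e / K" using r e K by (simp add: powr_powr)
      finally show "K * \<epsilon> powr (r - 1) \<le> e" using K by (simp add: field_simps)
    qed (use ep in auto)
    finally show ?thesis by (simp add: \<epsilon>_def)
  qed
  then show ?thesis using d by blast
qed

text \<open>For bounded \<open>u\<close> and \<open>r > 2\<close> the nonlinearity is Lipschitz on the range of \<open>u\<close>, so the defect is quadratic in \<open>w\<close>.\<close>

lemma defect_small_bounded:
  assumes r2: "r > 2" and R: "0 < \<delta>" "8 * \<delta> \<le> R"
    and M: "AE x in lborel. x \<in> ann (\<delta> / 2) (4 * R) \<longrightarrow> \<bar>u x\<bar> \<le> M"
  shows "\<exists>K\<ge>0. \<forall>l. 1 / 2 \<le> l \<and> l \<le> 2 \<longrightarrow> (LBINT x. psi \<delta> R x * defect l x) \<le> K * (l - 1)\<^sup>2"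
proof -
  define X where "X = (ann \<delta> (2 * R) :: (real ^ 'n) set)"
  define c where "c = (r - 1) * (2 * \<bar>M\<bar> powr (r - 2))"
  have c: "c \<ge> 0" using r by (simp add: c_def)
  have R0: "R > 0" using R by simp
  have "(LBINT x. psi \<delta> R x * defect l x) \<le> \<delta> powr (- \<eta>) * c * w_const R * (l - 1)\<^sup>2" if l2: "1 / 2 \<le> l" "l \<le> 2" for l
  proof -
    have l0: "l > 0" using l2 by simp
    note W = w_annulus[OF l2 R(1) R0, folded X_def]
    have Ml: "AE x in lborel. l *\<^sub>R x \<in> ann (\<delta> / 2) (4 * R) \<longrightarrow> \<bar>u (l *\<^sub>R x)\<bar> \<le> M"
      using AE_dilate[OF _ l0 M] by simp
    have "AE x in lborel. psi \<delta> R x * defect l x \<le> \<delta> powr (- \<eta>) * c * (indicator X x * (w l x)\<^sup>2)"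
      using M Ml
    proof eventually_elim
      case (elim x)
      define Z where "Z = c * (w l x)\<^sup>2"
      have Z0: "Z \<ge> 0" using c by (simp add: Z_def)
      have "psi \<delta> R x * defect l x \<le> \<delta> powr (- \<eta>) * (psi \<delta> R x * Z)"
      proof (rule defect_bound[OF R _ Z0])
        assume x: "x \<in> ann \<delta> (2 * R)"
        have "x \<in> ann (\<delta> / 2) (4 * R)" using x R R0 by (auto simp: ann_def)
        moreover have "l *\<^sub>R x \<in> ann (\<delta> / 2) (4 * R)"
          using x l2 R R0 mult_mono[of "1 / 2" l \<delta> "norm x"] mult_mono[of l 2 "norm x" "2 * R"] by (auto simp: ann_def)
        ultimately have u: "\<bar>u x\<bar> \<le> \<bar>M\<bar>" "\<bar>u (l *\<^sub>R x)\<bar> \<le> \<bar>M\<bar>" using elim by auto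
        have "\<bar>spow (r - 1) (u (l *\<^sub>R x)) - spow (r - 1) (u x)\<bar> \<le> (r - 1) * (\<bar>u (l *\<^sub>R x)\<bar> powr (r - 2) + \<bar>u x\<bar> powr (r - 2)) * \<bar>w l x\<bar>"
          using spow_lipschitz_ge[of "r - 1" "u (l *\<^sub>R x)" "u x"] r2 by (simp add: w_def)
        also have "\<dots> \<le> (r - 1) * (\<bar>M\<bar> powr (r - 2) + \<bar>M\<bar> powr (r - 2)) * \<bar>w l x\<bar>"
          using u r2 by (intro mult_right_mono mult_left_mono add_mono powr_mono2) auto
        also have "\<dots> = c * \<bar>w l x\<bar>" by (simp add: c_def)
        finally have "\<bar>spow (r - 1) (u (l *\<^sub>R x)) - spow (r - 1) (u x)\<bar> * \<bar>w l x\<bar> \<le> c * \<bar>w l x\<bar> * \<bar>w l x\<bar>"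
          by (intro mult_right_mono) auto
        then show "\<bar>spow (r - 1) (u (l *\<^sub>R x)) - spow (r - 1) (u x)\<bar> * \<bar>w l x\<bar> \<le> Z"
          by (simp add: Z_def power2_eq_square)
      qed
      also have "psi \<delta> R x * Z \<le> indicator X x * Z"
        using psi_range[OF R, of x] psi_0[OF R, of x] Z0 by (cases "x \<in> X") (auto simp: X_def mult_left_le_one_le)
      finally have "psi \<delta> R x * defect l x \<le> \<delta> powr (- \<eta>) * (indicator X x * Z)" by (simp add: mult_left_mono)
      then show ?case by (simp add: Z_def mult_ac)
    qed
    then have "(LBINT x. psi \<delta> R x * defect l x) \<le> (LBINT x. \<delta> powr (- \<eta>) * c * (indicator X x * (w l x)\<^sup>2))"
      using dilation_inequality(3)[OF l0 R] W(2) by (intro integral_mono_AE) auto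
    also have "\<dots> = \<delta> powr (- \<eta>) * c * (LBINT x. indicator X x * (w l x)\<^sup>2)" by simp
    also have "\<dots> \<le> \<delta> powr (- \<eta>) * c * (w_const R * (l - 1)\<^sup>2)"
      using W(1) c by (intro mult_left_mono) auto
    finally show ?thesis by (simp add: mult_ac)
  qed
  moreover have "\<delta> powr (- \<eta>) * c * w_const R \<ge> 0" using c w_const_pos[of R] by simp
  ultimately show ?thesis by blast
qed

text \<open>The defect is at most \<open>(r - 1) (|u(l x)|^(r-2) + |u|^(r-2)) |\<phi> w|^2\<close> up to the weight. Where \<open>|u|\<close> is at most a
  level \<open>k\<close> this is \<open>O((l - 1)^2)\<close>. The part above the level is small relative to the squared \<open>H^1\<close> norm of \<open>\<phi> w\<close>, by
  the Sobolev inequality and since \<open>|u|^r\<close> has little mass on high levels; dilations change that mass by a bounded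
  factor only, so one level serves all \<open>l\<close>. The smallness is chosen so that half the quadratic gain absorbs it.\<close>

lemma defect_small_sobolev:
  assumes r2: "r > 2" and R: "0 < \<delta>" "8 * \<delta> \<le> R"
    and crit: "CARD('n) \<ge> 3 \<Longrightarrow> r \<le> 2 * real CARD('n) / (real CARD('n) - 2)"
  shows "\<exists>K\<ge>0. \<forall>l. 1 / 2 \<le> l \<and> l \<le> 2 \<and> l \<noteq> 1 \<longrightarrow>
    (LBINT x. psi \<delta> R x * defect l x) \<le> (LBINT x. psi \<delta> R x * (norm (Dw l x))\<^sup>2) / 2 + K * (l - 1)\<^sup>2"
proof -
  have R0: "R > 0" using R by simp
  define X where "X = (ann \<delta> (2 * R) :: (real ^ 'n) set)"
  define Y where "Y = (ann (\<delta> / 2) (4 * R) :: (real ^ 'n) set)"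
  have [measurable]: "X \<in> sets borel" "Y \<in> sets borel" by (simp_all add: X_def Y_def)
  have XY: "x \<in> Y" "1 / 2 \<le> l \<Longrightarrow> l \<le> 2 \<Longrightarrow> l *\<^sub>R x \<in> Y" if "x \<in> X" for x l
  proof -
    show "x \<in> Y" using that R R0 by (auto simp: X_def Y_def ann_def)
    assume l2: "1 / 2 \<le> l" "l \<le> 2"
    show "l *\<^sub>R x \<in> Y"
      using that l2 R R0 mult_mono[of "1 / 2" l \<delta> "norm x"] mult_mono[of l 2 "norm x" "2 * R"] by (auto simp: X_def Y_def ann_def)
  qed
  have r2': "r \<ge> 2" using r2 by simp
  obtain C where C: "C > 0" "\<And>(w :: real ^ 'n \<Rightarrow> real) g M. M > 0 \<Longrightarrow> H1c w g \<Longrightarrow> integrable lborel (\<lambda>x. \<bar>w x\<bar> powr r) \<Longrightarrow>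
    (LBINT x. (w x)\<^sup>2) + (LBINT x. (norm (g x))\<^sup>2) \<le> M \<Longrightarrow> (LBINT x. \<bar>w x\<bar> powr r) \<le> C * M powr (r / 2)"
    using sobolev_H1c[OF dim r2' crit] by metis
  have pt: "(phi \<delta> R :: real ^ 'n \<Rightarrow> real) \<in> test_functions" by (rule phi_test[OF R(1) R0])
  have [measurable]: "(phi \<delta> R :: real ^ 'n \<Rightarrow> real) \<in> borel_measurable borel" "grad (phi \<delta> R :: real ^ 'n \<Rightarrow> real) \<in> borel_measurable borel"
    using pt by (auto intro: test_borel grad_borel)
  obtain L where L: "L > 0" "\<And>x :: real ^ 'n. norm (grad (phi \<delta> R) x) \<le> L" using test_grad_bounded[OF pt] by metis
  have gphi0: "grad (phi \<delta> R) x = 0" if "x \<notin> X" for x :: "real ^ 'n"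
  proof -
    have "grad (phi \<delta> R) x = grad (cut R) x - grad (cut \<delta>) x"
      unfolding phi_def[abs_def] by (rule grad_diff[OF cut_test[OF R0] cut_test[OF R(1)]])
    moreover have "norm x < \<delta> \<or> norm x > 2 * R" using that by (auto simp: X_def ann_def)
    ultimately show ?thesis using R R0 by (auto simp: grad_cut_0)
  qed
  define W0 where "W0 = \<delta> powr (- \<eta>)"
  have W0: "W0 > 0" using R by (simp add: W0_def)
  define D where "D = w_const R"
  have D: "D > 0" by (simp add: D_def w_const_pos)
  define D' where "D' = (1 + 2 * L\<^sup>2) * D"
  have D': "D' > 0" using D L by (simp add: D'_def add_pos_nonneg)
  \<comment> \<open>chosen so that the high level part is at most a quarter of \<open>M\<close>, that is half of \<open>P\<close> plus \<open>O((l - 1)^2)\<close>\<close>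
  define \<kappa>' where "\<kappa>' = 1 / (8 * W0 * (r - 1) * (1 + C))"
  have \<kappa>': "\<kappa>' > 0" using W0 r C by (simp add: \<kappa>'_def)
  define \<kappa> where "\<kappa> = \<kappa>' powr (r / (r - 2))"
  have \<kappa>: "\<kappa> > 0" "\<kappa> powr ((r - 2) / r) = \<kappa>'" using \<kappa>' r2 by (auto simp: \<kappa>_def powr_powr)
  \<comment> \<open>the mass of \<open>|u|^r\<close> on the enlarged shell above the level \<open>k\<close>\<close>
  define h where "h k x = indicator Y x * (if \<bar>u x\<bar> > real k then \<bar>u x\<bar> powr r else 0)" for k :: nat and x
  have [measurable]: "h k \<in> borel_measurable borel" for k unfolding h_def by measurable
  have h0: "h k x \<ge> 0" for k x by (simp add: h_def)
  have YI: "integrable lborel (\<lambda>x. indicator Y x * \<bar>u x\<bar> powr r)"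
    unfolding Y_def using R R0 \<eta> by (intro ann_Lp(1)[OF um Cint]) auto
  have hI: "integrable lborel (h k)" for k
    by (rule Bochner_Integration.integrable_bound[OF YI]) (auto simp: h_def)
  have "(\<lambda>k. LBINT x. h k x) \<longlonglongrightarrow> (\<integral>x. 0 \<partial>(lborel :: (real ^ 'n) measure))"
  proof (rule integral_dominated_convergence[OF _ _ YI])
    show "AE x in lborel. (\<lambda>k. h k x) \<longlonglongrightarrow> 0"
    proof (rule AE_I2)
      fix x
      obtain k0 where k0: "\<bar>u x\<bar> \<le> real k0" using real_arch_simple by blast
      have "h k x = 0" if "k \<ge> k0" for k
      proof -
        have "real k0 \<le> real k" using that by simp
        then have "\<not> \<bar>u x\<bar> > real k" using k0 by linarith
        then show ?thesis by (simp add: h_def)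
      qed
      then show "(\<lambda>k. h k x) \<longlonglongrightarrow> 0" by (intro tendsto_eventually) (auto simp: eventually_sequentially)
    qed
  qed (auto simp: h_def)
  then have "(\<lambda>k. 2 ^ CARD('n) * (LBINT x. h k x)) \<longlonglongrightarrow> 2 ^ CARD('n) * 0" by (intro tendsto_intros) simp
  then have "\<forall>\<^sub>F k in sequentially. 2 ^ CARD('n) * (LBINT x. h k x) < \<kappa>" using \<kappa> by (intro order_tendstoD) auto
  then obtain k where k: "2 ^ CARD('n) * (LBINT x. h k x) < \<kappa>" by (auto simp: eventually_sequentially)
  define K where "K = 2 * W0 * (r - 1) * real k powr (r - 2) * D + D' / 4"
  have K: "K \<ge> 0" using W0 r D D' by (simp add: K_def)
  have "(LBINT x. psi \<delta> R x * defect l x) \<le> (LBINT x. psi \<delta> R x * (norm (Dw l x))\<^sup>2) / 2 + K * (l - 1)\<^sup>2"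
    if l2: "1 / 2 \<le> l" "l \<le> 2" and l1: "l \<noteq> 1" for l
  proof -
    have l0: "l > 0" using l2 by simp
    note WX = w_annulus[OF l2 R(1) R0, folded X_def D_def]
    define P where "P = (LBINT x. psi \<delta> R x * (norm (Dw l x))\<^sup>2)"
    have PI: "integrable lborel (\<lambda>x. psi \<delta> R x * (norm (Dw l x))\<^sup>2)" by (rule dilation_inequality(2)[OF l0 R])
    have P0: "P \<ge> 0" unfolding P_def by (intro integral_nonneg_AE AE_I2 mult_nonneg_nonneg psi_range(1)[OF R]) simp
    define W where "W x = phi \<delta> R x * w l x" for x
    define G where "G x = phi \<delta> R x *\<^sub>R Dw l x + w l x *\<^sub>R grad (phi \<delta> R) x" for x
    have HW: "H1c W G" unfolding W_def[abs_def] G_def[abs_def] by (rule H1loc_cutoff[OF w_H1loc[OF l0] pt])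
    have W2I: "integrable lborel (\<lambda>x. (W x)\<^sup>2)" and G2I: "integrable lborel (\<lambda>x. (norm (G x))\<^sup>2)"
      and Wm[measurable]: "W \<in> borel_measurable borel"
      using HW by (auto simp: H1c_def)
    have Wout: "x \<notin> X \<Longrightarrow> W x = 0" for x using phi_0[OF R, of x] by (simp add: W_def X_def)
    have ulm[measurable]: "(\<lambda>x. u (l *\<^sub>R x)) \<in> borel_measurable borel" by measurable
    have WrI: "integrable lborel (\<lambda>x. \<bar>W x\<bar> powr r)"
      using integrable_powr_diff[of r "\<lambda>x. phi \<delta> R x * u (l *\<^sub>R x)" lborel "\<lambda>x. phi \<delta> R x * u x"]
        psi_Lp(2)[OF R ulm density_dilate[OF um l0 Cint] \<eta>(1)] psi_Lp(2)[OF R um Cint \<eta>(1)] r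
      by (simp add: W_def w_def right_diff_distrib)
    have W2: "(LBINT x. (W x)\<^sup>2) \<le> D * (l - 1)\<^sup>2"
    proof -
      have "(LBINT x. (W x)\<^sup>2) \<le> (LBINT x. indicator X x * (w l x)\<^sup>2)"
      proof (rule integral_mono[OF W2I WX(2)])
        fix x :: "real ^ 'n"
        have "(phi \<delta> R x)\<^sup>2 \<le> 1" using phi_range[OF R, of x] by (simp add: power_le_one)
        then have "(phi \<delta> R x)\<^sup>2 * (w l x)\<^sup>2 \<le> 1 * (w l x)\<^sup>2" by (intro mult_right_mono) auto
        then show "(W x)\<^sup>2 \<le> indicator X x * (w l x)\<^sup>2"
          using Wout[of x] by (cases "x \<in> X") (auto simp: W_def power_mult_distrib)
      qed
      then show ?thesis using WX(1) by linarith
    qed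
    have G2: "(LBINT x. (norm (G x))\<^sup>2) \<le> 2 * P + 2 * L\<^sup>2 * (D * (l - 1)\<^sup>2)"
    proof -
      have "(LBINT x. (norm (G x))\<^sup>2) \<le> (LBINT x. 2 * (psi \<delta> R x * (norm (Dw l x))\<^sup>2) + 2 * L\<^sup>2 * (indicator X x * (w l x)\<^sup>2))"
      proof (rule integral_mono[OF G2I])
        fix x :: "real ^ 'n"
        have "(norm (grad (phi \<delta> R) x))\<^sup>2 \<le> L\<^sup>2" using L by (intro power_mono) auto
        then have "(w l x)\<^sup>2 * (norm (grad (phi \<delta> R) x))\<^sup>2 \<le> L\<^sup>2 * (indicator X x * (w l x)\<^sup>2)"
          using gphi0[of x] by (cases "x \<in> X") (auto simp: mult.commute[of "L\<^sup>2"] intro!: mult_left_mono)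
        then show "(norm (G x))\<^sup>2 \<le> 2 * (psi \<delta> R x * (norm (Dw l x))\<^sup>2) + 2 * L\<^sup>2 * (indicator X x * (w l x)\<^sup>2)"
          using norm_sum2_le[of "phi \<delta> R x *\<^sub>R Dw l x" "w l x *\<^sub>R grad (phi \<delta> R) x"]
          by (simp add: G_def psi_def power_mult_distrib power2_eq_square[of "phi \<delta> R x"])
      qed (use PI WX(2) in auto)
      also have "\<dots> = 2 * P + 2 * L\<^sup>2 * (LBINT x. indicator X x * (w l x)\<^sup>2)" using PI WX(2) by (simp add: P_def)
      also have "\<dots> \<le> 2 * P + 2 * L\<^sup>2 * (D * (l - 1)\<^sup>2)" using WX(1) by (intro add_left_mono mult_left_mono) auto
      finally show ?thesis .
    qed
    \<comment> \<open>positive for \<open>l \<noteq> 1\<close>, as the normalisation by \<open>\<surd>M\<close> requires\<close>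
    define M where "M = 2 * P + D' * (l - 1)\<^sup>2"
    have M: "M > 0" using P0 D' l1 by (simp add: M_def add_nonneg_pos)
    have "(LBINT x. (W x)\<^sup>2) + (LBINT x. (norm (G x))\<^sup>2) \<le> M"
      using W2 G2 by (simp add: M_def D'_def algebra_simps)
    from C(2)[OF M HW WrI this] have Sob: "(LBINT x. \<bar>W x\<bar> powr r) \<le> C * M powr (r / 2)" .
    \<comment> \<open>majorant of \<open>|z|^(r-2) W^2\<close> for \<open>z = u\<close> and for the dilated \<open>u\<close>\<close>
    define T where "T z x = real k powr (r - 2) * (W x)\<^sup>2 +
       \<kappa>' * M * (indicator X x * (if \<bar>z x\<bar> > real k then \<bar>z x\<bar> powr r else 0) / \<kappa> + \<bar>W x\<bar> powr r / M powr (r / 2))" for z :: "real ^ 'n \<Rightarrow> real" and x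
    have T0: "T z x \<ge> 0" for z x using \<kappa> \<kappa>' M by (simp add: T_def)
    have Tle: "\<bar>z x\<bar> powr (r - 2) * (W x)\<^sup>2 \<le> T z x" for z x
    proof (cases "\<bar>z x\<bar> > real k \<and> x \<in> X")
      case False
      have "\<bar>z x\<bar> powr (r - 2) * (W x)\<^sup>2 \<le> real k powr (r - 2) * (W x)\<^sup>2"
      proof (cases "x \<in> X")
        case True
        then show ?thesis using False r2 by (intro mult_right_mono powr_mono2) auto
      qed (simp add: Wout)
      moreover have "\<kappa>' * M * (indicator X x * (if \<bar>z x\<bar> > real k then \<bar>z x\<bar> powr r else 0) / \<kappa> + \<bar>W x\<bar> powr r / M powr (r / 2)) \<ge> 0"
        using \<kappa> \<kappa>' M by simp
      ultimately show ?thesis unfolding T_def by linarith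
    next
      case True
      define \<alpha> \<beta> where "\<alpha> = \<kappa> powr (1 / r)" and "\<beta> = M powr (1 / 2)"
      have ab: "\<alpha> > 0" "\<beta> > 0" "\<alpha> powr (r - 2) = \<kappa>'" "\<beta>\<^sup>2 = M" "\<alpha> powr r = \<kappa>" "\<beta> powr r = M powr (r / 2)"
      proof -
        show "\<alpha> > 0" "\<beta> > 0" using \<kappa> M by (auto simp: \<alpha>_def \<beta>_def)
        show "\<alpha> powr (r - 2) = \<kappa>'" using \<kappa>(2) by (simp add: \<alpha>_def powr_powr)
        show "\<beta>\<^sup>2 = M" using M by (simp add: \<beta>_def powr_half_sqrt)
        show "\<alpha> powr r = \<kappa>" using \<kappa> r by (simp add: \<alpha>_def powr_powr)
        show "\<beta> powr r = M powr (r / 2)" by (simp add: \<beta>_def powr_powr)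
      qed
      have "(\<bar>z x\<bar> / \<alpha>) powr (r - 2) * (\<bar>W x\<bar> / \<beta>)\<^sup>2 \<le> (\<bar>z x\<bar> / \<alpha>) powr r + (\<bar>W x\<bar> / \<beta>) powr r"
        using ab r2 by (intro powr_prod_le_sum) auto
      then have "\<kappa>' * M * ((\<bar>z x\<bar> / \<alpha>) powr (r - 2) * (\<bar>W x\<bar> / \<beta>)\<^sup>2) \<le> \<kappa>' * M * ((\<bar>z x\<bar> / \<alpha>) powr r + (\<bar>W x\<bar> / \<beta>) powr r)"
        using \<kappa>' M by (intro mult_left_mono) auto
      moreover have "\<kappa>' * M * ((\<bar>z x\<bar> / \<alpha>) powr (r - 2) * (\<bar>W x\<bar> / \<beta>)\<^sup>2) = \<bar>z x\<bar> powr (r - 2) * (W x)\<^sup>2"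
        using ab(1,2) \<kappa>' M by (simp add: powr_divide power_divide ab(3,4))
      moreover have "(\<bar>z x\<bar> / \<alpha>) powr r + (\<bar>W x\<bar> / \<beta>) powr r = \<bar>z x\<bar> powr r / \<kappa> + \<bar>W x\<bar> powr r / M powr (r / 2)"
        using ab(1,2) by (simp add: powr_divide ab(5,6))
      moreover have "real k powr (r - 2) * (W x)\<^sup>2 \<ge> 0" by simp
      ultimately show ?thesis using True unfolding T_def by (simp add: add_increasing)
    qed
    have Tint: "integrable lborel (T z) \<and> (LBINT x. T z x) \<le> real k powr (r - 2) * (D * (l - 1)\<^sup>2) + \<kappa>' * M * (1 + C)"
      if [measurable]: "z \<in> borel_measurable borel" and hz: "integrable lborel hz" "(LBINT x. hz x) \<le> \<kappa>"
        "\<And>x. indicator X x * (if \<bar>z x\<bar> > real k then \<bar>z x\<bar> powr r else 0) \<le> hz x" for z hz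
    proof -
      let ?i = "\<lambda>x. indicator X x * (if \<bar>z x\<bar> > real k then \<bar>z x\<bar> powr r else 0)"
      have iI: "integrable lborel ?i"
      proof (rule Bochner_Integration.integrable_bound[OF hz(1)])
        show "AE x in lborel. norm (?i x) \<le> norm (hz x)"
        proof (rule AE_I2)
          fix x have "?i x \<ge> 0" by simp
          then show "norm (?i x) \<le> norm (hz x)" using hz(3)[of x] by simp
        qed
      qed measurable
      have ile: "(LBINT x. ?i x) \<le> \<kappa>" using integral_mono[OF iI hz(1) hz(3)] hz(2) by linarith
      have "(LBINT x. T z x) = real k powr (r - 2) * (LBINT x. (W x)\<^sup>2) +
          \<kappa>' * M * ((LBINT x. ?i x) / \<kappa> + (LBINT x. \<bar>W x\<bar> powr r) / M powr (r / 2))"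
        unfolding T_def using W2I iI WrI by simp
      also have "\<dots> \<le> real k powr (r - 2) * (D * (l - 1)\<^sup>2) + \<kappa>' * M * (1 + C)"
        using W2 ile Sob \<kappa> \<kappa>' M by (intro add_mono mult_left_mono) (auto simp: divide_le_eq)
      finally show ?thesis unfolding T_def using W2I iI WrI by simp
    qed
    have hnn: "(LBINT x. h k x) \<ge> 0" using h0 by simp
    have Tu: "integrable lborel (T u) \<and> (LBINT x. T u x) \<le> real k powr (r - 2) * (D * (l - 1)\<^sup>2) + \<kappa>' * M * (1 + C)"
    proof (rule Tint[of u "h k"])
      have "(1::real) \<le> 2 ^ CARD('n)" by simp
      then have "1 * (LBINT x. h k x) \<le> 2 ^ CARD('n) * (LBINT x. h k x)" using hnn by (intro mult_right_mono)
      then show "(LBINT x. h k x) \<le> \<kappa>" using k by linarith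
      show "indicator X x * (if \<bar>u x\<bar> > real k then \<bar>u x\<bar> powr r else 0) \<le> h k x" for x
        using XY(1)[of x] by (auto simp: h_def indicator_def)
    qed (use hI in auto)
    have Tul: "integrable lborel (T (\<lambda>x. u (l *\<^sub>R x))) \<and> (LBINT x. T (\<lambda>x. u (l *\<^sub>R x)) x) \<le> real k powr (r - 2) * (D * (l - 1)\<^sup>2) + \<kappa>' * M * (1 + C)"
    proof (rule Tint[of "\<lambda>x. u (l *\<^sub>R x)" "\<lambda>x. h k (l *\<^sub>R x)"])
      have "(LBINT x. h k (l *\<^sub>R x)) \<le> 2 ^ CARD('n) * (LBINT x. h k x)"
        by (rule dilate_integral_le[OF _ l2(1) h0]) simp
      then show "(LBINT x. h k (l *\<^sub>R x)) \<le> \<kappa>" using k by linarith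
      show "indicator X x * (if \<bar>u (l *\<^sub>R x)\<bar> > real k then \<bar>u (l *\<^sub>R x)\<bar> powr r else 0) \<le> h k (l *\<^sub>R x)" for x
        using XY(2)[of x l] l2 by (auto simp: h_def indicator_def)
    qed (use dilate_integrable[OF hI l0] in auto)
    have pw: "psi \<delta> R x * defect l x \<le> W0 * (r - 1) * (T (\<lambda>x. u (l *\<^sub>R x)) x + T u x)" for x
    proof -
      define Z where "Z = (r - 1) * (\<bar>u (l *\<^sub>R x)\<bar> powr (r - 2) + \<bar>u x\<bar> powr (r - 2)) * (w l x)\<^sup>2"
      have Z0: "Z \<ge> 0" using r by (simp add: Z_def)
      have "\<bar>spow (r - 1) (u (l *\<^sub>R x)) - spow (r - 1) (u x)\<bar> * \<bar>w l x\<bar> \<le> (r - 1) * (\<bar>u (l *\<^sub>R x)\<bar> powr (r - 2) + \<bar>u x\<bar> powr (r - 2)) * \<bar>w l x\<bar> * \<bar>w l x\<bar>"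
        using spow_lipschitz_ge[of "r - 1" "u (l *\<^sub>R x)" "u x"] r2 by (intro mult_right_mono) (auto simp: w_def)
      also have "\<dots> = Z" by (simp add: Z_def power2_eq_square)
      finally have "psi \<delta> R x * defect l x \<le> W0 * (psi \<delta> R x * Z)"
        unfolding W0_def using Z0 by (intro defect_bound[OF R])
      also have "psi \<delta> R x * Z = (r - 1) * (\<bar>u (l *\<^sub>R x)\<bar> powr (r - 2) * (W x)\<^sup>2 + \<bar>u x\<bar> powr (r - 2) * (W x)\<^sup>2)"
        by (simp add: Z_def W_def psi_def power2_eq_square algebra_simps)
      also have "W0 * \<dots> \<le> W0 * ((r - 1) * (T (\<lambda>x. u (l *\<^sub>R x)) x + T u x))"
        using W0 r Tle[of "\<lambda>x. u (l *\<^sub>R x)" x] Tle[of u x] by (intro mult_left_mono add_mono) auto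
      finally show ?thesis by (simp add: mult_ac)
    qed
    have "(LBINT x. psi \<delta> R x * defect l x) \<le> (LBINT x. W0 * (r - 1) * (T (\<lambda>x. u (l *\<^sub>R x)) x + T u x))"
      by (intro integral_mono dilation_inequality(3)[OF l0 R] pw) (use Tu Tul in auto)
    also have "\<dots> = W0 * (r - 1) * ((LBINT x. T (\<lambda>x. u (l *\<^sub>R x)) x) + (LBINT x. T u x))"
      using Tu Tul by simp
    also have "\<dots> \<le> W0 * (r - 1) * ((real k powr (r - 2) * (D * (l - 1)\<^sup>2) + \<kappa>' * M * (1 + C)) + (real k powr (r - 2) * (D * (l - 1)\<^sup>2) + \<kappa>' * M * (1 + C)))"
      using Tu Tul W0 r by (intro mult_left_mono add_mono) auto
    also have "\<dots> = 2 * W0 * (r - 1) * real k powr (r - 2) * D * (l - 1)\<^sup>2 + (\<kappa>' * (8 * W0 * (r - 1) * (1 + C))) * M / 4"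
    proof -
      have "W0 * s * ((y + \<kappa>' * M * c) + (y + \<kappa>' * M * c)) = 2 * W0 * s * y + (\<kappa>' * (8 * W0 * s * c)) * M / 4" for s y c
        by (simp add: algebra_simps)
      from this[of "r - 1" "real k powr (r - 2) * (D * (l - 1)\<^sup>2)" "1 + C"] show ?thesis by (simp only: mult.assoc)
    qed
    also have "\<kappa>' * (8 * W0 * (r - 1) * (1 + C)) = 1" using W0 r C by (simp add: \<kappa>'_def)
    also have "2 * W0 * (r - 1) * real k powr (r - 2) * D * (l - 1)\<^sup>2 + 1 * M / 4 = P / 2 + K * (l - 1)\<^sup>2"
    proof -
      have "y * z + 1 * (2 * P + D' * z) / 4 = P / 2 + (y + D' / 4) * z" for y z :: real by (simp add: field_simps)
      then show ?thesis unfolding M_def K_def .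
    qed
    finally show ?thesis by (simp only: P_def)
  qed
  then show ?thesis using K by blast
qed

text \<open>The three situations in which the defect can be controlled: sublinear source, local boundedness away from the origin,
  and source exponent at most \<open>2*\<close> (no restriction in the plane).\<close>

definition regular :: bool where
  "regular \<longleftrightarrow> r \<le> 2 \<or> (\<forall>s>0. \<forall>t. \<exists>M. AE x in lborel. x \<in> ann s t \<longrightarrow> \<bar>u x\<bar> \<le> M) \<or>
     (CARD('n) \<ge> 3 \<longrightarrow> r \<le> 2 * real CARD('n) / (real CARD('n) - 2))"

lemma defect_small:
  assumes reg: regular and R: "0 < \<delta>" "8 * \<delta> \<le> R" and e: "e > 0"
  shows "\<exists>d>0. \<forall>l. \<bar>l - 1\<bar> < d \<and> l \<noteq> 1 \<longrightarrow>
    (LBINT x. psi \<delta> R x * defect l x) \<le> (LBINT x. psi \<delta> R x * (norm (Dw l x))\<^sup>2) / 2 + e * \<bar>l - 1\<bar>"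
proof -
  have P0: "(LBINT x. psi \<delta> R x * (norm (Dw l x))\<^sup>2) \<ge> 0" for l
    by (intro integral_nonneg_AE AE_I2 mult_nonneg_nonneg psi_range(1)[OF R]) simp
  show ?thesis
  proof (cases "r \<le> 2")
    case True
    obtain d where "d > 0" "\<And>l. \<bar>l - 1\<bar> < d \<Longrightarrow> l \<noteq> 1 \<Longrightarrow> (LBINT x. psi \<delta> R x * defect l x) \<le> e * \<bar>l - 1\<bar>"
      using defect_small_sublinear[OF True R e] by metis
    then show ?thesis using P0 by (intro exI[of _ d]) (auto simp: add_increasing)
  next
    case False
    then have r2: "r > 2" by simp
    have "\<exists>K\<ge>0. \<forall>l. 1 / 2 \<le> l \<and> l \<le> 2 \<and> l \<noteq> 1 \<longrightarrow>
      (LBINT x. psi \<delta> R x * defect l x) \<le> (LBINT x. psi \<delta> R x * (norm (Dw l x))\<^sup>2) / 2 + K * (l - 1)\<^sup>2"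
    proof (cases "CARD('n) \<ge> 3 \<longrightarrow> r \<le> 2 * real CARD('n) / (real CARD('n) - 2)")
      case True
      then show ?thesis by (intro defect_small_sobolev[OF r2 R]) auto
    next
      case F: False
      have "\<delta> / 2 > 0" using R by simp
      moreover have "\<forall>s>0. \<forall>t. \<exists>M. AE x in lborel. x \<in> ann s t \<longrightarrow> \<bar>u x\<bar> \<le> M"
        using reg F False unfolding regular_def by (elim disjE) auto
      ultimately obtain M where "AE x in lborel. x \<in> ann (\<delta> / 2) (4 * R) \<longrightarrow> \<bar>u x\<bar> \<le> M" by blast
      from defect_small_bounded[OF r2 R this] obtain K where K: "K \<ge> 0"
        "\<And>l. 1 / 2 \<le> l \<Longrightarrow> l \<le> 2 \<Longrightarrow> (LBINT x. psi \<delta> R x * defect l x) \<le> K * (l - 1)\<^sup>2" by metis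
      show ?thesis
      proof (intro exI[of _ K] conjI allI impI)
        fix l :: real assume "1 / 2 \<le> l \<and> l \<le> 2 \<and> l \<noteq> 1"
        then show "(LBINT x. psi \<delta> R x * defect l x) \<le> (LBINT x. psi \<delta> R x * (norm (Dw l x))\<^sup>2) / 2 + K * (l - 1)\<^sup>2"
          using K(2)[of l] P0[of l] by linarith
      qed (rule K(1))
    qed
    then obtain K where K: "K \<ge> 0" and K': "\<forall>l. 1 / 2 \<le> l \<and> l \<le> 2 \<and> l \<noteq> 1 \<longrightarrow>
      (LBINT x. psi \<delta> R x * defect l x) \<le> (LBINT x. psi \<delta> R x * (norm (Dw l x))\<^sup>2) / 2 + K * (l - 1)\<^sup>2" by (elim exE conjE)
    show ?thesis
    proof (intro exI[of _ "min (1 / 2) (e / (K + 1))"] conjI allI impI)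
      show "min (1 / 2) (e / (K + 1)) > 0" using e K by simp
      fix l :: real assume l: "\<bar>l - 1\<bar> < min (1 / 2) (e / (K + 1)) \<and> l \<noteq> 1"
      then have h: "\<bar>l - 1\<bar> < 1 / 2" "\<bar>l - 1\<bar> < e / (K + 1)" by auto
      have l2: "1 / 2 \<le> l" "l \<le> 2" using h(1) by linarith+
      define t where "t = \<bar>l - 1\<bar>"
      have t: "t \<ge> 0" "t < e / (K + 1)" "(l - 1)\<^sup>2 = t * t"
      proof -
        show "t \<ge> 0" "t < e / (K + 1)" using h(2) by (simp_all only: t_def abs_ge_zero)
        show "(l - 1)\<^sup>2 = t * t" by (simp only: t_def power2_eq_square abs_mult_self_eq)
      qed
      have "t * (K + 1) < e" using t(2) K by (simp add: less_divide_eq)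
      then have "t * K + t < e" by (simp add: distrib_left)
      then have "t * K \<le> e" using t(1) by linarith
      then have "t * K * t \<le> e * t" using t(1) by (intro mult_right_mono) auto
      then have "K * (l - 1)\<^sup>2 \<le> e * t" by (simp add: t(3) mult_ac)
      then have "K * (l - 1)\<^sup>2 \<le> e * \<bar>l - 1\<bar>" by (simp only: t_def)
      then show "(LBINT x. psi \<delta> R x * defect l x) \<le> (LBINT x. psi \<delta> R x * (norm (Dw l x))\<^sup>2) / 2 + e * \<bar>l - 1\<bar>"
        using spec[OF K', of l] l l2 by linarith
    qed
  qed
qed

end

section \<open>The Pohozaev identity on a shell\<close>

lemma powr_linear_approx:
  fixes s e :: real
  assumes "e > 0"
  shows "\<exists>d>0. \<forall>l. \<bar>l - 1\<bar> < d \<longrightarrow> \<bar>l powr s - 1 - s * (l - 1)\<bar> \<le> e * \<bar>l - 1\<bar>"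
proof -
  have "((\<lambda>z. z powr s) has_derivative (\<lambda>h. s * h)) (at 1)"
    using has_real_derivative_powr[of 1 s] by (simp add: has_field_derivative_def)
  then have "\<forall>e>0. \<exists>d>0. \<forall>y. norm (y - 1) < d \<longrightarrow> norm (y powr s - 1 powr s - s * (y - 1)) \<le> e * norm (y - 1)"
    unfolding has_derivative_at_alt by blast
  with assms show ?thesis by simp
qed

lemma powr_bound_near_1:
  fixes l s m :: real
  assumes "1 / 2 \<le> l" "l \<le> 2" "\<bar>s\<bar> \<le> m" shows "l powr s \<le> 2 powr m"
proof -
  have "l powr s \<le> 2 powr \<bar>s\<bar>"
  proof (cases "s \<ge> 0")
    case True
    then show ?thesis using assms by (intro order_trans[OF powr_mono2[of s l 2]]) auto
  next
    case False
    have "l powr s \<le> (1 / 2) powr s" using assms False by (intro powr_mono2') auto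
    also have "\<dots> = 2 powr \<bar>s\<bar>" using False by (simp add: powr_divide powr_minus_divide[symmetric])
    finally show ?thesis .
  qed
  also have "\<dots> \<le> 2 powr m" using assms by (intro powr_mono) auto
  finally show ?thesis .
qed

lemma psi_tail_limits:
  fixes d :: "real ^ 'n \<Rightarrow> real" and \<delta> R :: "nat \<Rightarrow> real"
  assumes d: "integrable lborel d"
    and lim: "\<delta> \<longlonglongrightarrow> 0" "filterlim R at_top sequentially" and pos: "\<And>n. 0 < \<delta> n" "\<And>n. 8 * \<delta> n \<le> R n"
  shows "(\<lambda>n. LBINT x. psi (\<delta> n) (R n) x * d x) \<longlonglongrightarrow> (LBINT x. d x)"
    and "(\<lambda>n. LBINT x. indicator (tail (\<delta> n) (R n)) x * d x) \<longlonglongrightarrow> 0"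
proof -
  have [measurable]: "d \<in> borel_measurable borel" using d by auto
  have R0: "R n > 0" for n using pos[of n] by linarith
  have [measurable]: "(psi (\<delta> n) (R n) :: real ^ 'n \<Rightarrow> real) \<in> borel_measurable borel" for n
    by (rule test_borel[OF psi_test[OF pos(1) R0]])
  have ev: "\<forall>\<^sub>F n in sequentially. 4 * \<delta> n < norm x \<and> norm x < R n / 2" if x: "x \<noteq> 0" for x :: "real ^ 'n"
  proof -
    have "\<forall>\<^sub>F n in sequentially. \<delta> n < norm x / 4" using x by (intro order_tendstoD(2)[OF lim(1)]) auto
    moreover have "\<forall>\<^sub>F n in sequentially. R n > 2 * norm x"
      using lim(2) by (auto simp: filterlim_at_top_dense)
    ultimately show ?thesis by eventually_elim auto
  qed
  have nz: "AE x in lborel. x \<noteq> (0 :: real ^ 'n)" by (rule AE_lborel_singleton)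
  show "(\<lambda>n. LBINT x. psi (\<delta> n) (R n) x * d x) \<longlonglongrightarrow> (LBINT x. d x)"
  proof (rule integral_dominated_convergence[where w = "\<lambda>x. \<bar>d x\<bar>"])
    show "AE x in lborel. (\<lambda>n. psi (\<delta> n) (R n) x * d x) \<longlonglongrightarrow> d x"
      using nz
    proof eventually_elim
      case (elim x)
      have "\<forall>\<^sub>F n in sequentially. psi (\<delta> n) (R n) x * d x = d x"
        using ev[OF elim]
      proof eventually_elim
        case (elim n)
        then have "phi (\<delta> n) (R n) x = 1" using pos[of n] R0[of n] by (intro phi_1) auto
        then show ?case by (simp add: psi_def)
      qed
      then show ?case by (rule tendsto_eventually)
    qed
    show "AE x in lborel. norm (psi (\<delta> n) (R n) x * d x) \<le> \<bar>d x\<bar>" for n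
    proof (rule AE_I2)
      fix x
      show "norm (psi (\<delta> n) (R n) x * d x) \<le> \<bar>d x\<bar>"
        using psi_range[OF pos(1)[of n] pos(2)[of n], of x] by (simp add: abs_mult mult_left_le_one_le)
    qed
  qed (use d in auto)
  have "(\<lambda>n. LBINT x. indicator (tail (\<delta> n) (R n)) x * d x) \<longlonglongrightarrow> (\<integral>x. 0 \<partial>(lborel :: (real ^ 'n) measure))"
  proof (rule integral_dominated_convergence[where w = "\<lambda>x. \<bar>d x\<bar>"])
    show "AE x in lborel. (\<lambda>n. indicator (tail (\<delta> n) (R n)) x * d x) \<longlonglongrightarrow> 0"
      using nz
    proof eventually_elim
      case (elim x)
      have "\<forall>\<^sub>F n in sequentially. indicator (tail (\<delta> n) (R n)) x * d x = 0"
        using ev[OF elim] by eventually_elim (auto simp: tail_def)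
      then show ?case by (rule tendsto_eventually)
    qed
    show "AE x in lborel. norm (indicator (tail (\<delta> n) (R n)) x * d x) \<le> \<bar>d x\<bar>" for n
      by (intro AE_I2) (auto simp: indicator_def)
  qed (use d in auto)
  then show "(\<lambda>n. LBINT x. indicator (tail (\<delta> n) (R n)) x * d x) \<longlonglongrightarrow> 0" by simp
qed

context dilation_setting
begin

text \<open>The derivative at \<open>l = 1\<close> of \<open>l^s\<close> times a dilated cutoff integral, up to a tail error and \<open>o(l - 1)\<close>.\<close>

lemma scaled_linear_part:
  fixes d :: "real ^ 'n \<Rightarrow> real"
  assumes L: "cut_lipschitz TYPE('n) L" and l: "1 / 2 \<le> l" "l \<le> 2" and R: "0 < \<delta>" "8 * \<delta> \<le> R"
    and d: "integrable lborel d" "\<And>x. d x \<ge> 0" and s: "\<bar>s\<bar> \<le> real CARD('n)"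
    and e: "\<bar>l powr s - 1 - s * (l - 1)\<bar> \<le> e * \<bar>l - 1\<bar>"
  shows "\<bar>(l powr s * (LBINT x. psi \<delta> R (x /\<^sub>R l) * d x) - (LBINT x. psi \<delta> R x * d x)) - s * (l - 1) * (LBINT x. psi \<delta> R x * d x)\<bar>
    \<le> \<bar>l - 1\<bar> * (2 powr real CARD('n) * (32 * L) * (LBINT x. indicator (tail \<delta> R) x * d x) + e * (LBINT x. psi \<delta> R x * d x))"
proof -
  define J J1 T where "J = (LBINT x. psi \<delta> R (x /\<^sub>R l) * d x)" and "J1 = (LBINT x. psi \<delta> R x * d x)"
    and "T = (LBINT x. indicator (tail \<delta> R) x * d x)"
  have L0: "L > 0" using L by (simp add: cut_lipschitz_def)
  have J1: "J1 \<ge> 0" unfolding J1_def by (intro integral_nonneg_AE AE_I2 mult_nonneg_nonneg psi_range(1)[OF R] d)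
  have T0: "T \<ge> 0" unfolding T_def using d by (intro integral_nonneg_AE) auto
  have "\<bar>J - J1\<bar> \<le> 32 * L * \<bar>l - 1\<bar> * T" unfolding J_def J1_def T_def by (rule cutoff_integral_dilate[OF L l R d])
  then have a: "l powr s * \<bar>J - J1\<bar> \<le> 2 powr real CARD('n) * (32 * L * \<bar>l - 1\<bar> * T)"
    using powr_bound_near_1[OF l s] by (intro mult_mono) auto
  have b: "\<bar>l powr s - 1 - s * (l - 1)\<bar> * J1 \<le> e * \<bar>l - 1\<bar> * J1" by (intro mult_right_mono e J1)
  have "(l powr s * J - J1) - s * (l - 1) * J1 = l powr s * (J - J1) + (l powr s - 1 - s * (l - 1)) * J1"
    by (simp add: algebra_simps)
  also have "\<bar>\<dots>\<bar> \<le> l powr s * \<bar>J - J1\<bar> + \<bar>l powr s - 1 - s * (l - 1)\<bar> * J1"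
    using J1 by (intro order_trans[OF abs_triangle_ineq]) (simp add: abs_mult)
  also have "\<dots> \<le> \<bar>l - 1\<bar> * (2 powr real CARD('n) * (32 * L) * T + e * J1)"
    using a b by (simp add: algebra_simps)
  finally show ?thesis unfolding J_def J1_def T_def .
qed

text \<open>In \<open>dilation_inequality\<close> the gain absorbs half the defect bound, and every other term is linear in \<open>l - 1\<close> up to tail
  errors. The values \<open>l = 1 + t\<close> and \<open>l = 1 - t\<close> give the two inequalities.\<close>

lemma pohozaev_local:
  assumes reg: regular and L: "cut_lipschitz TYPE('n) L" and R: "0 < \<delta>" "8 * \<delta> \<le> R"
  shows "\<bar>(2 - real CARD('n)) / 2 * (LBINT x. psi \<delta> R x * Ad x) + (b - real CARD('n)) / q * (LBINT x. psi \<delta> R x * Bd x)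
     - (\<eta> - real CARD('n)) / r * (LBINT x. psi \<delta> R x * Cd x)\<bar>
   \<le> (2 powr real CARD('n) * (32 * L) + 2 * L * (24 * 2 ^ CARD('n) + 1)) *
      ((LBINT x. indicator (tail \<delta> R) x * Ad x) + (LBINT x. indicator (tail \<delta> R) x * Bd x) + (LBINT x. indicator (tail \<delta> R) x * Cd x))"
proof -
  define n where "n = real CARD('n)"
  have n2: "n \<ge> 2" using dim by (simp add: n_def)
  define JA JB JC where "JA = (LBINT x. psi \<delta> R x * Ad x)" and "JB = (LBINT x. psi \<delta> R x * Bd x)" and "JC = (LBINT x. psi \<delta> R x * Cd x)"
  define TA TB TC where "TA = (LBINT x. indicator (tail \<delta> R) x * Ad x)" and "TB = (LBINT x. indicator (tail \<delta> R) x * Bd x)" and "TC = (LBINT x. indicator (tail \<delta> R) x * Cd x)"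
  have J0: "JA \<ge> 0" "JB \<ge> 0" "JC \<ge> 0" unfolding JA_def JB_def JC_def
    by (intro integral_nonneg_AE AE_I2 mult_nonneg_nonneg psi_range(1)[OF R]; simp)+
  have T0: "TA \<ge> 0" "TB \<ge> 0" "TC \<ge> 0" unfolding TA_def TB_def TC_def by (intro integral_nonneg_AE AE_I2 mult_nonneg_nonneg; simp)+
  have L0: "L > 0" using L by (simp add: cut_lipschitz_def)
  define K1 K2 where "K1 = 2 powr n * (32 * L)" and "K2 = 2 * L * (24 * 2 ^ CARD('n) + 1)"
  have K0: "K1 \<ge> 0" "K2 \<ge> 0" using L0 by (auto simp: K1_def K2_def)
  define \<Lambda> where "\<Lambda> = (2 - n) / 2 * JA + (b - n) / q * JB - (\<eta> - n) / r * JC"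
  define T where "T = (K1 + K2) * (TA + TB + TC)"
  have main: "\<Lambda> \<ge> - T - e * (JA + JB + JC + 1) \<and> - \<Lambda> \<ge> - T - e * (JA + JB + JC + 1)" if e: "e > 0" for e
  proof -
    obtain dA where dA: "dA > 0" "\<And>l. \<bar>l - 1\<bar> < dA \<Longrightarrow> \<bar>l powr (2 - n) - 1 - (2 - n) * (l - 1)\<bar> \<le> e * \<bar>l - 1\<bar>"
      using powr_linear_approx[OF e] by metis
    obtain dB where dB: "dB > 0" "\<And>l. \<bar>l - 1\<bar> < dB \<Longrightarrow> \<bar>l powr (b - n) - 1 - (b - n) * (l - 1)\<bar> \<le> e * \<bar>l - 1\<bar>"
      using powr_linear_approx[OF e] by metis
    obtain dC where dC: "dC > 0" "\<And>l. \<bar>l - 1\<bar> < dC \<Longrightarrow> \<bar>l powr (\<eta> - n) - 1 - (\<eta> - n) * (l - 1)\<bar> \<le> e * \<bar>l - 1\<bar>"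
      using powr_linear_approx[OF e] by metis
    obtain dS where dS: "dS > 0" and dS': "\<forall>l. \<bar>l - 1\<bar> < dS \<and> l \<noteq> 1 \<longrightarrow>
       (LBINT x. psi \<delta> R x * defect l x) \<le> (LBINT x. psi \<delta> R x * (norm (Dw l x))\<^sup>2) / 2 + e * \<bar>l - 1\<bar>"
      using defect_small[OF reg R e] by (elim exE conjE)
    define t where "t = min (min dA dB) (min (min dC dS) 1) / 2"
    have t: "t > 0" "t < dA" "t < dB" "t < dC" "t < dS" "t \<le> 1 / 2" using dA(1) dB(1) dC(1) dS by (auto simp: t_def)
    have step: "0 \<le> (l - 1) * \<Lambda> + t * (T + e * (JA + JB + JC + 1))" if l: "\<bar>l - 1\<bar> = t" for l
    proof -
      have l2: "1 / 2 \<le> l" "l \<le> 2" "l \<noteq> 1" using l t by linarith+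
      have l0: "l > 0" using l2 by simp
      define XA where "XA = l powr (2 - n) * (LBINT x. psi \<delta> R (x /\<^sub>R l) * Ad x) - JA"
      define XB where "XB = l powr (b - n) * (LBINT x. psi \<delta> R (x /\<^sub>R l) * Bd x) - JB"
      define XC where "XC = l powr (\<eta> - n) * (LBINT x. psi \<delta> R (x /\<^sub>R l) * Cd x) - JC"
      define Z where "Z = (LBINT x. w l x * (g x \<bullet> grad (psi \<delta> R) x))"
      have a: "\<bar>XA - (2 - n) * (l - 1) * JA\<bar> \<le> t * (K1 * TA + e * JA)"
        using scaled_linear_part[OF L l2(1,2) R Aint _ _ dA(2)[of l, unfolded n_def]] n2 t l
        unfolding XA_def JA_def TA_def K1_def n_def by simp
      have bb: "\<bar>XB - (b - n) * (l - 1) * JB\<bar> \<le> t * (K1 * TB + e * JB)"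
        using scaled_linear_part[OF L l2(1,2) R Bint _ _ dB(2)[of l, unfolded n_def]] n2 t l b
        unfolding XB_def JB_def TB_def K1_def n_def by simp
      have c: "\<bar>XC - (\<eta> - n) * (l - 1) * JC\<bar> \<le> t * (K1 * TC + e * JC)"
        using scaled_linear_part[OF L l2(1,2) R Cint _ _ dC(2)[of l, unfolded n_def]] n2 t l \<eta>
        unfolding XC_def JC_def TC_def K1_def n_def by simp
      have z: "\<bar>Z\<bar> \<le> t * (K2 * TA)" unfolding Z_def K2_def TA_def l[symmetric] by (rule commutator_bound[OF L l2 R])
      have s: "(LBINT x. psi \<delta> R x * defect l x) \<le> (LBINT x. psi \<delta> R x * (norm (Dw l x))\<^sup>2) / 2 + e * t"
        using spec[OF dS', of l] l t l2 by simp
      have k: "0 \<le> XA / 2 + XB / q - XC / r + Z + e * t"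
        using dilation_inequality(1)[OF l0 R] s
        unfolding XA_def XB_def XC_def JA_def JB_def JC_def Z_def n_def by linarith
      have half: "y / m - y' / m \<le> z" if "\<bar>y - y'\<bar> \<le> z" "m \<ge> 1" for y y' z m :: real
      proof -
        have "(y - y') / m \<le> \<bar>y - y'\<bar> / 1" using that by (intro frac_le) auto
        then show ?thesis using that by (simp add: diff_divide_distrib)
      qed
      have "XA / 2 - (2 - n) * (l - 1) * JA / 2 \<le> t * (K1 * TA + e * JA)" by (rule half[OF a]) simp
      moreover have "XB / q - (b - n) * (l - 1) * JB / q \<le> t * (K1 * TB + e * JB)" by (rule half[OF bb]) (use q in simp)
      moreover have "(\<eta> - n) * (l - 1) * JC / r - XC / r \<le> t * (K1 * TC + e * JC)"
        by (rule half) (use c r in \<open>auto simp: abs_minus_commute\<close>)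
      ultimately have "0 \<le> ((2 - n) * (l - 1) * JA / 2 + (b - n) * (l - 1) * JB / q - (\<eta> - n) * (l - 1) * JC / r)
          + (t * (K1 * TA + e * JA) + t * (K1 * TB + e * JB) + t * (K1 * TC + e * JC) + t * (K2 * TA) + e * t)"
        using k z by linarith
      also have "(2 - n) * (l - 1) * JA / 2 + (b - n) * (l - 1) * JB / q - (\<eta> - n) * (l - 1) * JC / r = (l - 1) * \<Lambda>"
        by (simp add: \<Lambda>_def algebra_simps)
      also have "t * (K1 * TA + e * JA) + t * (K1 * TB + e * JB) + t * (K1 * TC + e * JC) + t * (K2 * TA) + e * t
         = t * (K1 * (TA + TB + TC) + K2 * TA + e * (JA + JB + JC + 1))" by (simp add: algebra_simps)
      also have "(l - 1) * \<Lambda> + \<dots> \<le> (l - 1) * \<Lambda> + t * (T + e * (JA + JB + JC + 1))"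
      proof -
        have "K2 * TA \<le> K2 * (TA + TB + TC)" using K0 T0 by (intro mult_left_mono) auto
        then show ?thesis using t(1) by (intro add_left_mono mult_left_mono) (auto simp: T_def distrib_right)
      qed
      finally show ?thesis .
    qed
    have p: "0 \<le> t * (\<Lambda> + (T + e * (JA + JB + JC + 1)))" using step[of "1 + t"] t by (simp add: distrib_left)
    have m: "0 \<le> t * (- \<Lambda> + (T + e * (JA + JB + JC + 1)))" using step[of "1 - t"] t by (simp add: distrib_left right_diff_distrib)
    have "0 \<le> \<Lambda> + (T + e * (JA + JB + JC + 1))" using p t(1) by (simp add: zero_le_mult_iff)
    moreover have "0 \<le> - \<Lambda> + (T + e * (JA + JB + JC + 1))" using m t(1) zero_le_mult_iff[of t "- \<Lambda> + (T + e * (JA + JB + JC + 1))"] by linarith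
    ultimately show ?thesis by linarith
  qed
  have "\<bar>\<Lambda>\<bar> \<le> T"
  proof (rule field_le_epsilon)
    fix x :: real assume x: "x > 0"
    define e where "e = x / (JA + JB + JC + 1)"
    have e: "e > 0" "e * (JA + JB + JC + 1) = x" using x J0 by (auto simp: e_def)
    show "\<bar>\<Lambda>\<bar> \<le> T + x" using main[OF e(1)] unfolding e(2) by linarith
  qed
  then show ?thesis unfolding \<Lambda>_def T_def JA_def JB_def JC_def TA_def TB_def TC_def K1_def K2_def n_def .
qed

section \<open>The Nehari identity on a shell\<close>

text \<open>The scale invariant \<open>L^2\<close> mass times the energy of one dyadic shell.\<close>

definition shell_product :: "real \<Rightarrow> real" where
  "shell_product \<rho> = (LBINT x. indicator (ann \<rho> (2 * \<rho>)) x * (u x)\<^sup>2) / \<rho>\<^sup>2 * (LBINT x. indicator (ann \<rho> (2 * \<rho>)) x * Ad x)"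

lemma square_ann_integrable: "integrable lborel (\<lambda>x. indicator (ann s t) x * (u x)\<^sup>2)"
proof -
  have "integrable lborel (\<lambda>x. indicator (cball 0 t) x * (u x)\<^sup>2)" using H by (auto simp: H1loc_def)
  from integrable_indicator_mult[OF this, of "ann s t"]
  have "integrable lborel (\<lambda>x. indicator (ann s t) x * (indicator (cball 0 t) x * (u x)\<^sup>2))" by simp
  moreover have "indicator (ann s t) x * (indicator (cball 0 t) x * (u x)\<^sup>2) = indicator (ann s t) x * (u x)\<^sup>2" for x
    by (auto simp: indicator_def ann_def)
  ultimately show ?thesis by simp
qed

lemma energy_ann_integrable: "integrable lborel (\<lambda>x. indicator (ann s t) x * Ad x)"
  by (intro integrable_indicator_mult Aint) simp

text \<open>Testing with \<open>\<psi> u\<close> leaves the error \<open>\<integral>u \<nabla>\<psi> \<bullet> \<nabla>u\<close> on the two transition layers, which the Cauchy-Schwarz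
  inequality bounds by the square roots of the shell products.\<close>

lemma nehari_local:
  assumes L: "cut_lipschitz TYPE('n) L" and R: "0 < \<delta>" "8 * \<delta> \<le> R"
  shows "\<bar>(LBINT x. psi \<delta> R x * Ad x) + (LBINT x. psi \<delta> R x * Bd x) - (LBINT x. psi \<delta> R x * Cd x)\<bar>
     \<le> 2 * L * (sqrt (shell_product \<delta>) + sqrt (shell_product R))"
proof -
  have R0: "R > 0" using R by simp
  have L0: "L > 0" using L by (simp add: cut_lipschitz_def)
  let ?p = "psi \<delta> R"
  have pt: "?p \<in> test_functions" by (rule psi_test[OF R(1) R0])
  have pm[measurable]: "?p \<in> borel_measurable borel" by (rule test_borel[OF pt])
  define v where "v x = ?p x * u x" for x
  define gv where "gv x = ?p x *\<^sub>R g x + u x *\<^sub>R grad ?p x" for x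
  have Hv: "H1c v gv" unfolding v_def[abs_def] gv_def[abs_def] by (rule H1loc_cutoff[OF H pt])
  have v0: "norm x < \<delta> \<Longrightarrow> v x = 0" for x using psi_0[OF R, of x] by (auto simp: v_def ann_def)
  have vq: "integrable lborel (\<lambda>x. \<bar>v x\<bar> powr q)" unfolding v_def using q by (intro psi_Lp(1)[OF R um Bint b(1)]) auto
  have vr: "integrable lborel (\<lambda>x. \<bar>v x\<bar> powr r)" unfolding v_def using r by (intro psi_Lp(1)[OF R um Cint \<eta>(1)]) auto
  note W = weak_eq_ext[OF Hv R(1) v0 vq vr]
  have pA: "integrable lborel (\<lambda>x. ?p x * Ad x)" by (rule psi_mult_integrable(1)[OF R Aint])
  have ggv: "g x \<bullet> gv x = ?p x * Ad x + u x * (g x \<bullet> grad ?p x)" for x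
    by (simp add: gv_def inner_add_right power2_norm_eq_inner)
  have "integrable lborel (\<lambda>x. g x \<bullet> gv x - ?p x * Ad x)" using W(2) pA by simp
  then have ZI: "integrable lborel (\<lambda>x. u x * (g x \<bullet> grad ?p x))" by (simp add: ggv)
  define Z where "Z = (LBINT x. u x * (g x \<bullet> grad ?p x))"
  have "spow (q - 1) (u x) * v x * norm x powr (- b) = ?p x * Bd x" for x
    using spow_mult_self[of "q - 1" "u x"] by (simp add: v_def mult_ac)
  then have eq_q: "(LBINT x. spow (q - 1) (u x) * v x * norm x powr (- b)) = (LBINT x. ?p x * Bd x)" by (simp only:)
  have "spow (r - 1) (u x) * v x * norm x powr (- \<eta>) = ?p x * Cd x" for x
    using spow_mult_self[of "r - 1" "u x"] by (simp add: v_def mult_ac)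
  then have eq_r: "(LBINT x. spow (r - 1) (u x) * v x * norm x powr (- \<eta>)) = (LBINT x. ?p x * Cd x)" by (simp only:)
  have "(LBINT x. g x \<bullet> gv x) = (LBINT x. ?p x * Ad x) + Z" using pA ZI by (simp add: ggv Z_def)
  then have eq1: "(LBINT x. ?p x * Ad x) + Z + (LBINT x. ?p x * Bd x) = (LBINT x. ?p x * Cd x)"
    using W(1) unfolding eq_q eq_r by linarith
  define I where "I \<rho> x = \<bar>(indicator (ann \<rho> (2 * \<rho>)) x * u x) * (indicator (ann \<rho> (2 * \<rho>)) x * norm (g x))\<bar>" for \<rho> x
  have CS: "integrable lborel (I \<rho>)" "(LBINT x. I \<rho> x) \<le> \<rho> * sqrt (shell_product \<rho>)" if \<rho>: "\<rho> > 0" for \<rho>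
  proof -
    have sq: "(indicator (ann \<rho> (2 * \<rho>)) x * u x)\<^sup>2 = indicator (ann \<rho> (2 * \<rho>)) x * (u x)\<^sup>2"
      "(indicator (ann \<rho> (2 * \<rho>)) x * norm (g x))\<^sup>2 = indicator (ann \<rho> (2 * \<rho>)) x * Ad x" for x
      by (auto simp: indicator_def)
    have m1: "(\<lambda>x. indicator (ann \<rho> (2 * \<rho>)) x * u x) \<in> borel_measurable lborel" by measurable
    have m2: "(\<lambda>x. indicator (ann \<rho> (2 * \<rho>)) x * norm (g x)) \<in> borel_measurable lborel" by measurable
    have i1: "integrable lborel (\<lambda>x. (indicator (ann \<rho> (2 * \<rho>)) x * u x)\<^sup>2)" unfolding sq by (rule square_ann_integrable)
    have i2: "integrable lborel (\<lambda>x. (indicator (ann \<rho> (2 * \<rho>)) x * norm (g x))\<^sup>2)" unfolding sq by (rule energy_ann_integrable)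
    note C = cauchy_schwarz_integral[OF m1 m2 i1 i2, unfolded sq]
    show "integrable lborel (I \<rho>)" unfolding I_def[abs_def] by (rule integrable_abs[OF C(1)])
    have "(LBINT x. I \<rho> x)\<^sup>2 \<le> \<rho>\<^sup>2 * shell_product \<rho>" using C(2) \<rho> by (simp add: shell_product_def I_def)
    then have "(LBINT x. I \<rho> x) \<le> sqrt (\<rho>\<^sup>2 * shell_product \<rho>)" by (rule real_le_rsqrt)
    then show "(LBINT x. I \<rho> x) \<le> \<rho> * sqrt (shell_product \<rho>)" using \<rho> by (simp add: real_sqrt_mult)
  qed
  have pw: "\<bar>u x * (g x \<bullet> grad ?p x)\<bar> \<le> 2 * (L / \<delta>) * I \<delta> x + 2 * (L / R) * I R x" for x
  proof -
    have i: "indicator (ann \<rho> (2 * \<rho>)) x * (\<bar>u x\<bar> * norm (g x)) = I \<rho> x" for \<rho>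
      by (auto simp: I_def indicator_def abs_mult)
    have "\<bar>u x * (g x \<bullet> grad ?p x)\<bar> \<le> \<bar>u x\<bar> * (norm (g x) * norm (grad ?p x))"
      by (simp add: abs_mult mult_left_mono Cauchy_Schwarz_ineq2)
    also have "\<dots> \<le> \<bar>u x\<bar> * (norm (g x) * (2 * (L / \<delta> * indicator (ann \<delta> (2 * \<delta>)) x + L / R * indicator (ann R (2 * R)) x)))"
      by (intro mult_left_mono grad_psi_bound L R) auto
    also have "\<dots> = 2 * (L / \<delta>) * (indicator (ann \<delta> (2 * \<delta>)) x * (\<bar>u x\<bar> * norm (g x))) + 2 * (L / R) * (indicator (ann R (2 * R)) x * (\<bar>u x\<bar> * norm (g x)))"
      by (simp add: algebra_simps)
    finally show ?thesis unfolding i .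
  qed
  have "\<bar>Z\<bar> \<le> (LBINT x. 2 * (L / \<delta>) * I \<delta> x + 2 * (L / R) * I R x)" unfolding Z_def
    by (rule integral_abs_bound_integral) (use pw ZI CS(1)[OF R(1)] CS(1)[OF R0] in auto)
  also have "\<dots> = 2 * (L / \<delta>) * (LBINT x. I \<delta> x) + 2 * (L / R) * (LBINT x. I R x)"
    using CS(1)[OF R(1)] CS(1)[OF R0] by simp
  also have "\<dots> \<le> 2 * (L / \<delta>) * (\<delta> * sqrt (shell_product \<delta>)) + 2 * (L / R) * (R * sqrt (shell_product R))"
    using CS(2)[OF R(1)] CS(2)[OF R0] L0 R R0 by (intro add_mono mult_left_mono) auto
  also have "\<dots> = 2 * L * (sqrt (shell_product \<delta>) + sqrt (shell_product R))" using R R0 by (simp add: algebra_simps)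
  finally show ?thesis using eq1 by simp
qed

text \<open>With \<open>t = 2 \<rho>\<close>, splitting \<open>u^2 \<le> \<alpha>^2 (1 + (|u|/\<alpha>)^q)\<close> at \<open>\<alpha> = t^((b - N)/q)\<close> balances the volume \<open>t^N\<close> of the shell
  against the weighted mass; subcriticality of \<open>q\<close> makes the scaled mass bounded, and the energy of far shells vanishes.\<close>

lemma shell_product_at_infinity:
  assumes sub: "q * (real CARD('n) - 2) \<le> 2 * (real CARD('n) - b)"
  shows "(\<lambda>n. shell_product (real (Suc n))) \<longlonglongrightarrow> 0"
proof -
  define V where "V = (LBINT x. indicator (cball (0 :: real ^ 'n) 1) x :: real)"
  define B where "B = (LBINT x. Bd x)"
  have bI: "integrable lborel (indicator (cball (0 :: real ^ 'n) t) :: _ \<Rightarrow> real)" for t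
    using emeasure_bounded_finite[of "cball (0 :: real ^ 'n) t"] by (intro integrable_real_indicator) auto
  have V0: "V \<ge> 0" and B0: "B \<ge> 0" unfolding V_def B_def by (intro integral_nonneg_AE AE_I2; simp)+
  define a where "a \<rho> = (LBINT x. indicator (ann \<rho> (2 * \<rho>)) x * (u x)\<^sup>2) / \<rho>\<^sup>2" for \<rho>
  define G where "G \<rho> = (LBINT x. indicator (ann \<rho> (2 * \<rho>)) x * Ad x)" for \<rho>
  have bound: "a \<rho> \<le> 4 * (V + B)" if \<rho>: "\<rho> \<ge> 1" for \<rho>
  proof -
    define t where "t = 2 * \<rho>"
    have t: "t \<ge> 1" "t > 0" using \<rho> by (auto simp: t_def)
    define X where "X = (ann \<rho> t :: (real ^ 'n) set)"
    have XI: "integrable lborel (indicator X :: real ^ 'n \<Rightarrow> real)" unfolding X_def by (rule ann_integrable)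
    have Vt: "(LBINT x. indicator X x) \<le> V * t ^ CARD('n)"
    proof -
      have "(LBINT x. indicator X x) \<le> (LBINT x. indicator (cball (0 :: real ^ 'n) t) x :: real)"
        by (intro integral_mono XI bI) (auto simp: X_def ann_def indicator_def)
      also have "\<dots> = V * t ^ CARD('n)"
      proof -
        have "indicator (cball (0 :: real ^ 'n) t) (t *\<^sub>R x) = (indicator (cball 0 1) x :: real)" for x :: "real ^ 'n"
          using t by (auto simp: indicator_def)
        then have "V = (LBINT x. indicator (cball (0 :: real ^ 'n) t) (t *\<^sub>R x))" by (simp add: V_def)
        also have "\<dots> = (LBINT x. indicator (cball (0 :: real ^ 'n) t) x) / t ^ CARD('n)"
          by (rule dilate_integral) (use t in auto)
        finally show ?thesis using t by simp
      qed
      finally show ?thesis .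
    qed
    define \<alpha> where "\<alpha> = t powr ((b - real CARD('n)) / q)"
    have al: "\<alpha> > 0" using t by (simp add: \<alpha>_def)
    have alq: "\<alpha> powr q = t powr (b - real CARD('n))" using q by (simp add: \<alpha>_def powr_powr)
    have c: "t powr b / \<alpha> powr q = t ^ CARD('n)"
      unfolding alq using t by (simp add: powr_diff powr_realpow)
    have pw: "indicator X x * (u x)\<^sup>2 \<le> \<alpha>\<^sup>2 * (indicator X x + t powr b / \<alpha> powr q * Bd x)" for x
    proof (cases "x \<in> X")
      case True
      have "(\<bar>u x\<bar> / \<alpha>)\<^sup>2 \<le> 1 + (\<bar>u x\<bar> / \<alpha>) powr q" using al q by (intro square_le_one_plus_powr) auto
      then have "\<alpha>\<^sup>2 * (\<bar>u x\<bar> / \<alpha>)\<^sup>2 \<le> \<alpha>\<^sup>2 * (1 + (\<bar>u x\<bar> / \<alpha>) powr q)" by (intro mult_left_mono) auto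
      moreover have "\<alpha>\<^sup>2 * (\<bar>u x\<bar> / \<alpha>)\<^sup>2 = (u x)\<^sup>2" using al by (simp add: power_divide)
      moreover have "(\<bar>u x\<bar> / \<alpha>) powr q \<le> t powr b / \<alpha> powr q * Bd x"
      proof -
        have "indicator (ann \<rho> t) x * \<bar>u x\<bar> powr q \<le> t powr b * Bd x" by (rule ann_Lp(2)[OF um Bint b(1)]) (use \<rho> t in auto)
        then have "\<bar>u x\<bar> powr q / \<alpha> powr q \<le> t powr b * Bd x / \<alpha> powr q" using True by (intro divide_right_mono) (auto simp: X_def)
        then show ?thesis using al by (simp add: powr_divide)
      qed
      then have "\<alpha>\<^sup>2 * (1 + (\<bar>u x\<bar> / \<alpha>) powr q) \<le> \<alpha>\<^sup>2 * (1 + t powr b / \<alpha> powr q * Bd x)" by (intro mult_left_mono) auto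
      ultimately show ?thesis using True by simp
    qed simp
    have "(LBINT x. indicator X x * (u x)\<^sup>2) \<le> (LBINT x. \<alpha>\<^sup>2 * (indicator X x + t powr b / \<alpha> powr q * Bd x))"
      by (intro integral_mono pw) (use XI Bint square_ann_integrable in \<open>auto simp: X_def\<close>)
    also have "\<dots> = \<alpha>\<^sup>2 * ((LBINT x. indicator X x) + t ^ CARD('n) * B)" using XI Bint by (simp add: c B_def)
    also have "\<dots> \<le> \<alpha>\<^sup>2 * (V * t ^ CARD('n) + t ^ CARD('n) * B)" using Vt by (intro mult_left_mono add_right_mono) auto
    also have "\<dots> = (\<alpha>\<^sup>2 * t ^ CARD('n)) * (V + B)" by (simp add: algebra_simps)
    also have "\<alpha>\<^sup>2 * t ^ CARD('n) \<le> t\<^sup>2"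
    proof -
      have "\<alpha>\<^sup>2 = t powr (2 * ((b - real CARD('n)) / q))" using t by (simp add: \<alpha>_def power2_eq_square powr_add[symmetric])
      then have "\<alpha>\<^sup>2 * t ^ CARD('n) = t powr (2 * ((b - real CARD('n)) / q) + real CARD('n))"
        using t by (simp add: powr_add powr_realpow)
      also have "\<dots> \<le> t powr 2"
      proof (rule powr_mono)
        show "2 * ((b - real CARD('n)) / q) + real CARD('n) \<le> 2" using sub q by (simp add: field_simps)
      qed (use t in simp)
      finally show ?thesis using t by (simp add: powr_numeral)
    qed
    then have "(\<alpha>\<^sup>2 * t ^ CARD('n)) * (V + B) \<le> t\<^sup>2 * (V + B)" using V0 B0 by (intro mult_right_mono) auto
    finally have "(LBINT x. indicator X x * (u x)\<^sup>2) \<le> t\<^sup>2 * (V + B)" by simp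
    then have le: "(LBINT x. indicator (ann \<rho> (2 * \<rho>)) x * (u x)\<^sup>2) \<le> 4 * (V + B) * \<rho>\<^sup>2"
    proof -
      assume I: "(LBINT x. indicator X x * (u x)\<^sup>2) \<le> t\<^sup>2 * (V + B)"
      have t2: "t\<^sup>2 = 4 * \<rho>\<^sup>2" by (simp add: t_def power_mult_distrib)
      have "t\<^sup>2 * (V + B) = 4 * (V + B) * \<rho>\<^sup>2" by (simp only: t2 mult_ac)
      with I show ?thesis by (simp only: X_def t_def)
    qed
    have "\<rho>\<^sup>2 > 0" using \<rho> by simp
    then show ?thesis unfolding a_def by (simp only: pos_divide_le_eq le)
  qed
  have "(\<lambda>n. LBINT x. indicator (ann (real (Suc n)) (2 * real (Suc n))) x * Ad x) \<longlonglongrightarrow> (\<integral>x. 0 \<partial>(lborel :: (real ^ 'n) measure))"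
  proof (rule integral_dominated_convergence[where w = Ad])
    show "AE x in lborel. (\<lambda>n. indicator (ann (real (Suc n)) (2 * real (Suc n))) x * Ad x) \<longlonglongrightarrow> 0"
    proof (rule AE_I2)
      fix x :: "real ^ 'n"
      obtain k where k: "norm x < real k" using reals_Archimedean2 by blast
      have "indicator (ann (real (Suc n)) (2 * real (Suc n))) x * Ad x = 0" if "n \<ge> k" for n
      proof -
        have "real k \<le> real n" using that by simp
        then show ?thesis using k by (simp add: ann_def)
      qed
      then show "(\<lambda>n. indicator (ann (real (Suc n)) (2 * real (Suc n))) x * Ad x) \<longlonglongrightarrow> 0"
        by (intro tendsto_eventually) (auto simp: eventually_sequentially simp del: of_nat_Suc)
    qed
    show "AE x in lborel. norm (indicator (ann (real (Suc n)) (2 * real (Suc n))) x * Ad x) \<le> Ad x" for n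
      by (intro AE_I2) (auto simp: indicator_def)
  qed (use Aint in auto)
  then have "(\<lambda>n. 4 * (V + B) * G (real (Suc n))) \<longlonglongrightarrow> 4 * (V + B) * 0"
    unfolding G_def by (intro tendsto_intros) (simp del: of_nat_Suc)
  then have lim: "(\<lambda>n. 4 * (V + B) * G (real (Suc n))) \<longlonglongrightarrow> 0" by simp
  show ?thesis
  proof (rule Lim_null_comparison[OF _ lim], rule always_eventually, rule allI)
    fix n
    have G0: "G (real (Suc n)) \<ge> 0" unfolding G_def by (intro integral_nonneg_AE AE_I2) simp
    have a0: "a (real (Suc n)) \<ge> 0" unfolding a_def by (intro divide_nonneg_nonneg integral_nonneg_AE AE_I2) auto
    have "shell_product (real (Suc n)) = a (real (Suc n)) * G (real (Suc n))" by (simp add: shell_product_def a_def G_def)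
    moreover have "a (real (Suc n)) * G (real (Suc n)) \<le> 4 * (V + B) * G (real (Suc n))"
      by (intro mult_right_mono bound G0) simp
    ultimately show "norm (shell_product (real (Suc n))) \<le> 4 * (V + B) * G (real (Suc n))" using a0 G0 by (simp del: of_nat_Suc)
  qed
qed

end

section \<open>Integral identities on the whole space\<close>

context dilation_setting
begin

text \<open>Comparing a shell with the next one through the dilation by 1/2 gives \<open>a (j+1) \<le> (1 + \<tau>) a j + (1 + 1/\<tau>) K G j\<close>, where the
  Jacobian \<open>2^(-N)\<close> and \<open>N \<ge> 2\<close> make the scaled mass \<open>a\<close> not grow. With \<open>\<tau> = 1/(j+1)\<close> the quotients \<open>a j/(j+1)\<close> increase by at
  most \<open>K G j\<close>. The energies \<open>G j\<close> of overlapping shells telescope in steps of four.\<close>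

lemma dyadic_growth:
  "\<exists>C>0. \<forall>j. (LBINT x. indicator (ann ((1 / 2) ^ j) (2 * (1 / 2) ^ j)) x * (u x)\<^sup>2) / ((1 / 2) ^ j)\<^sup>2 \<le> C * real (Suc j)"
  and dyadic_sum: "(\<Sum>j<n. LBINT x. indicator (ann ((1 / 2) ^ j / 2) (4 * (1 / 2) ^ j)) x * Ad x) \<le> 4 * (LBINT x. Ad x)"
proof -
  define \<rho> where "\<rho> j = (1 / 2 :: real) ^ j" for j :: nat
  have \<rho>: "\<rho> j > 0" "\<rho> (Suc j) = \<rho> j / 2" for j by (auto simp: \<rho>_def)
  define A where "A = (LBINT x. Ad x)"
  have A0: "A \<ge> 0" by (simp add: A_def)
  define a where "a j = (LBINT x. indicator (ann (\<rho> j) (2 * \<rho> j)) x * (u x)\<^sup>2) / (\<rho> j)\<^sup>2" for j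
  define G where "G j = (LBINT x. indicator (ann (\<rho> j / 2) (4 * \<rho> j)) x * Ad x)" for j
  have a0: "a j \<ge> 0" for j unfolding a_def by (intro divide_nonneg_nonneg integral_nonneg_AE AE_I2) auto
  have G0: "G j \<ge> 0" for j unfolding G_def by (intro integral_nonneg_AE AE_I2) auto
  define K :: real where "K = 6 * 2 ^ CARD('n)"
  have K0: "K \<ge> 0" by (simp add: K_def)
  \<comment> \<open>\<open>G j\<close> is at most \<open>h j - h (j + 4)\<close>, so the sum telescopes\<close>
  define h where "h j = (LBINT x. indicator (cball 0 (4 * \<rho> j)) x * Ad x)" for j
  have bI: "integrable lborel (\<lambda>x. indicator (cball 0 t) x * Ad x)" for t
    by (intro integrable_indicator_mult Aint) simp
  have h: "0 \<le> h j" "h j \<le> A" for j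
  proof -
    show "0 \<le> h j" unfolding h_def by (intro integral_nonneg_AE AE_I2) auto
    show "h j \<le> A" unfolding h_def A_def by (intro integral_mono bI Aint) (auto simp: indicator_def)
  qed
  have Gh: "G j \<le> h j - h (j + 4)" for j
  proof -
    have r4: "4 * \<rho> (j + 4) = \<rho> j / 4" by (simp add: \<rho>_def power_add power_one_over)
    have "G j \<le> (LBINT x. indicator (cball 0 (4 * \<rho> j)) x * Ad x - indicator (cball 0 (4 * \<rho> (j + 4))) x * Ad x)"
      unfolding G_def
    proof (rule integral_mono[OF energy_ann_integrable])
      fix x
      show "indicator (ann (\<rho> j / 2) (4 * \<rho> j)) x * Ad x \<le> indicator (cball 0 (4 * \<rho> j)) x * Ad x - indicator (cball 0 (4 * \<rho> (j + 4))) x * Ad x"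
        unfolding r4 using \<rho>(1)[of j] by (auto simp: indicator_def ann_def)
    qed (use bI in auto)
    then show ?thesis unfolding h_def using bI by simp
  qed
  have "(\<Sum>j<n. G j) \<le> h 0 + h 1 + h 2 + h 3 - (h n + h (n + 1) + h (n + 2) + h (n + 3))" for n
  proof (induction n)
    case (Suc n)
    have "n + 4 = Suc n + 3" by simp
    then show ?case using Suc Gh[of n] by (simp add: numeral_eq_Suc)
  qed (simp add: numeral_eq_Suc)
  then have sumG: "(\<Sum>j<n. G j) \<le> 4 * A" for n
    using h(2)[of 0] h(2)[of 1] h(2)[of 2] h(2)[of 3] h(1)[of n] h(1)[of "n + 1"] h(1)[of "n + 2"] h(1)[of "n + 3"]
    by (smt (verit))
  then show "(\<Sum>j<n. LBINT x. indicator (ann ((1 / 2) ^ j / 2) (4 * (1 / 2) ^ j)) x * Ad x) \<le> 4 * (LBINT x. Ad x)"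
    unfolding G_def \<rho>_def A_def .
  have step: "a (Suc j) \<le> (1 + \<tau>) * a j + (1 + 1 / \<tau>) * (K * G j)" if t: "\<tau> > 0" for j \<tau>
  proof -
    define X where "X = (ann (\<rho> j) (2 * \<rho> j) :: (real ^ 'n) set)"
    define f where "f x = indicator (ann (\<rho> (Suc j)) (2 * \<rho> (Suc j))) x * (u x)\<^sup>2" for x
    have [measurable]: "f \<in> borel_measurable borel" unfolding f_def by measurable
    have fx: "f ((1 / 2) *\<^sub>R x) = indicator X x * (u ((1 / 2) *\<^sub>R x))\<^sup>2" for x
      by (auto simp: f_def X_def \<rho>(2) ann_def indicator_def)
    have DI: "integrable lborel (\<lambda>x. indicator X x * (u ((1 / 2) *\<^sub>R x) - u x)\<^sup>2)"
      unfolding X_def by (rule dilation_H1loc_integrable[OF H]) simp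
    have D: "(LBINT x. indicator X x * (u ((1 / 2) *\<^sub>R x) - u x)\<^sup>2) \<le> (\<rho> j)\<^sup>2 * (K * G j)"
      using dilation_H1loc[OF H, of "1 / 2" "\<rho> j" "2 * \<rho> j"] \<rho>(1)[of j]
      by (simp add: X_def K_def G_def power_mult_distrib power_divide mult_ac)
    have F: "(LBINT x. indicator X x * (u ((1 / 2) *\<^sub>R x))\<^sup>2) \<le> (\<rho> j)\<^sup>2 * ((1 + \<tau>) * a j + (1 + 1 / \<tau>) * (K * G j))"
    proof -
      have "(LBINT x. indicator X x * (u ((1 / 2) *\<^sub>R x))\<^sup>2)
        \<le> (LBINT x. (1 + \<tau>) * (indicator X x * (u x)\<^sup>2) + (1 + 1 / \<tau>) * (indicator X x * (u ((1 / 2) *\<^sub>R x) - u x)\<^sup>2))"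
      proof (rule integral_mono')
        show "integrable lborel (\<lambda>x. (1 + \<tau>) * (indicator X x * (u x)\<^sup>2) + (1 + 1 / \<tau>) * (indicator X x * (u ((1 / 2) *\<^sub>R x) - u x)\<^sup>2))"
          using DI square_ann_integrable by (simp add: X_def)
        fix x
        have sq: "(p + d)\<^sup>2 \<le> (1 + \<tau>) * p\<^sup>2 + (1 + 1 / \<tau>) * d\<^sup>2" for p d :: real
        proof -
          have "0 \<le> (\<tau> * p - d)\<^sup>2 / \<tau>" using t by simp
          also have "\<dots> = \<tau> * p\<^sup>2 - 2 * p * d + d\<^sup>2 / \<tau>" using t by (simp add: power2_eq_square field_simps)
          finally show ?thesis by (simp add: power2_sum distrib_right)
        qed
        show "indicator X x * (u ((1 / 2) *\<^sub>R x))\<^sup>2 \<le> (1 + \<tau>) * (indicator X x * (u x)\<^sup>2) + (1 + 1 / \<tau>) * (indicator X x * (u ((1 / 2) *\<^sub>R x) - u x)\<^sup>2)"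
          using sq[of "u x" "u ((1 / 2) *\<^sub>R x) - u x"] by (cases "x \<in> X") auto
        show "0 \<le> (1 + \<tau>) * (indicator X x * (u x)\<^sup>2) + (1 + 1 / \<tau>) * (indicator X x * (u ((1 / 2) *\<^sub>R x) - u x)\<^sup>2)"
          using t by simp
      qed
      also have "\<dots> = (1 + \<tau>) * (LBINT x. indicator X x * (u x)\<^sup>2) + (1 + 1 / \<tau>) * (LBINT x. indicator X x * (u ((1 / 2) *\<^sub>R x) - u x)\<^sup>2)"
        using DI square_ann_integrable by (simp add: X_def)
      also have "\<dots> \<le> (1 + \<tau>) * ((\<rho> j)\<^sup>2 * a j) + (1 + 1 / \<tau>) * ((\<rho> j)\<^sup>2 * (K * G j))"
        using t D \<rho>(1)[of j] by (intro add_mono mult_left_mono) (auto simp: a_def X_def)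
      finally show ?thesis by (simp add: algebra_simps)
    qed
    have "(LBINT x. f x) = (LBINT x. f ((1 / 2) *\<^sub>R x)) / 2 ^ CARD('n)"
      using dilate_integral[of f "1 / 2"] by (simp add: power_one_over)
    also have "\<dots> \<le> (LBINT x. f ((1 / 2) *\<^sub>R x)) / 2 ^ 2"
    proof (rule divide_left_mono)
      show "(2 :: real) ^ 2 \<le> 2 ^ CARD('n)" by (rule power_increasing[OF dim]) simp
      show "0 \<le> (LBINT x. f ((1 / 2) *\<^sub>R x))" unfolding f_def by (intro integral_nonneg_AE AE_I2) auto
    qed simp
    finally have "(LBINT x. f x) * 4 \<le> (\<rho> j)\<^sup>2 * ((1 + \<tau>) * a j + (1 + 1 / \<tau>) * (K * G j))"
      using F unfolding fx by simp
    moreover have "a (Suc j) = (LBINT x. f x) * 4 / (\<rho> j)\<^sup>2" by (simp add: a_def f_def \<rho>(2) power_divide)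
    ultimately show ?thesis using \<rho>(1)[of j] by (simp add: divide_le_eq mult.commute)
  qed
  have growth: "a j \<le> real (Suc j) * (a 0 + K * (\<Sum>i<j. G i))" for j
  proof (induction j)
    case (Suc j)
    define m where "m = real (Suc j)"
    have m: "m > 0" "real (Suc (Suc j)) = m + 1" by (auto simp: m_def)
    define S where "S = a 0 + K * (\<Sum>i<j. G i)"
    have "a (Suc j) \<le> (1 + 1 / m) * a j + (1 + m) * (K * G j)" using step[of "1 / m" j] m by simp
    also have "\<dots> \<le> (1 + 1 / m) * (m * S) + (1 + m) * (K * G j)"
      using Suc m by (intro add_right_mono mult_left_mono) (auto simp: m_def S_def)
    also have "\<dots> = (m + 1) * (S + K * G j)" using m by (simp add: field_simps)
    finally show ?case unfolding m(2) S_def by (simp add: algebra_simps)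
  qed simp
  show "\<exists>C>0. \<forall>j. (LBINT x. indicator (ann ((1 / 2) ^ j) (2 * (1 / 2) ^ j)) x * (u x)\<^sup>2) / ((1 / 2) ^ j)\<^sup>2 \<le> C * real (Suc j)"
  proof (intro exI[of _ "a 0 + K * (4 * A) + 1"] conjI allI)
    show "a 0 + K * (4 * A) + 1 > 0" using a0[of 0] K0 A0 by (simp add: add_nonneg_pos)
    fix j
    have "real (Suc j) * (a 0 + K * (\<Sum>i<j. G i)) \<le> real (Suc j) * (a 0 + K * (4 * A) + 1)"
      using mult_left_mono[OF sumG[of j] K0] by (intro mult_left_mono) auto
    then have "a j \<le> real (Suc j) * (a 0 + K * (4 * A) + 1)" using growth[of j] by linarith
    then show "(LBINT x. indicator (ann ((1 / 2) ^ j) (2 * (1 / 2) ^ j)) x * (u x)\<^sup>2) / ((1 / 2) ^ j)\<^sup>2 \<le> (a 0 + K * (4 * A) + 1) * real (Suc j)"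
      unfolding a_def \<rho>_def by (simp only: mult.commute)
  qed
qed

text \<open>Otherwise the energies would be bounded below by a multiple of \<open>1/(j+1)\<close>, and they are summable.\<close>

lemma shell_product_small_near_zero:
  assumes e: "e > 0" shows "\<exists>j\<ge>m. shell_product ((1 / 2) ^ j) < e"
proof (rule ccontr)
  assume "\<not> (\<exists>j\<ge>m. shell_product ((1 / 2) ^ j) < e)"
  then have ge: "shell_product ((1 / 2) ^ j) \<ge> e" if "j \<ge> m" for j using that by (meson not_le)
  define G where "G j = (LBINT x. indicator (ann ((1 / 2) ^ j / 2) (4 * (1 / 2) ^ j)) x * Ad x)" for j :: nat
  have G0: "G j \<ge> 0" for j unfolding G_def by (intro integral_nonneg_AE AE_I2) auto
  obtain C where C: "C > 0" and C': "\<forall>j. (LBINT x. indicator (ann ((1 / 2) ^ j) (2 * (1 / 2) ^ j)) x * (u x)\<^sup>2) / ((1 / 2) ^ j)\<^sup>2 \<le> C * real (Suc j)"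
    using dyadic_growth by (elim exE conjE)
  have EG: "shell_product ((1 / 2) ^ j) \<le> C * real (Suc j) * G j" for j
  proof -
    have "(1 / 2 :: real) ^ j > 0" by simp
    then have "(LBINT x. indicator (ann ((1 / 2) ^ j) (2 * (1 / 2) ^ j)) x * Ad x) \<le> G j"
      unfolding G_def by (intro integral_mono energy_ann_integrable) (auto simp: indicator_def ann_def)
    moreover have "(LBINT x. indicator (ann ((1 / 2) ^ j) (2 * (1 / 2) ^ j)) x * Ad x) \<ge> 0"
      by (intro integral_nonneg_AE AE_I2) auto
    moreover have "C * real (Suc j) \<ge> 0" using C by simp
    ultimately show ?thesis unfolding shell_product_def using spec[OF C', of j] by (intro mult_mono) auto
  qed
  have "summable G"
  proof (rule summableI_nonneg_bounded)
    show "(\<Sum>j<n. G j) \<le> 4 * (LBINT x. Ad x)" for n unfolding G_def by (rule dyadic_sum)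
  qed (rule G0)
  then have sG: "summable (\<lambda>j. C / e * G j)" by (rule summable_mult)
  have "summable (\<lambda>j. inverse (real (Suc j)))"
  proof (rule summable_comparison_test'[OF sG, of m])
    fix j assume "j \<ge> m"
    then have "e \<le> C * real (Suc j) * G j" using ge[of j] EG[of j] by linarith
    then show "norm (inverse (real (Suc j))) \<le> C / e * G j" using e by (simp add: field_simps)
  qed
  then have "summable (\<lambda>j. inverse (real j))" by (subst (asm) summable_Suc_iff)
  then show False using not_summable_harmonic[where 'a = real] by blast
qed

text \<open>The inner radius runs through the dyadic sequence on which the shell product tends to 0; in the limit all tail errors
  vanish.\<close>

lemma integral_identities:
  assumes sub: "q * (real CARD('n) - 2) \<le> 2 * (real CARD('n) - b)" and reg: regular
  defines "A \<equiv> (LBINT x. Ad x)" and "B \<equiv> (LBINT x. Bd x)" and "C \<equiv> (LBINT x. Cd x)"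
  shows "A + B = C"
    and "(2 - real CARD('n)) / 2 * A + (b - real CARD('n)) / q * B = (\<eta> - real CARD('n)) / r * C"
proof -
  obtain L where L: "cut_lipschitz TYPE('n) L" using cut_lipschitz_exists by blast
  have "\<forall>n. \<exists>j\<ge>n + 3. shell_product ((1 / 2) ^ j) < inverse (real (Suc n))"
    by (intro allI shell_product_small_near_zero) simp
  then obtain j where j: "\<And>n. j n \<ge> n + 3" "\<And>n. shell_product ((1 / 2) ^ j n) < inverse (real (Suc n))" by metis
  define \<delta> where "\<delta> n = (1 / 2 :: real) ^ j n" for n
  define R where "R n = real (Suc n)" for n
  have pos: "0 < \<delta> n" "8 * \<delta> n \<le> R n" for n
  proof -
    show "0 < \<delta> n" by (simp add: \<delta>_def)
    have "\<delta> n \<le> (1 / 2) ^ (n + 3)" unfolding \<delta>_def by (rule power_decreasing) (use j(1) in auto)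
    also have "\<dots> \<le> (1 / 2) ^ 3" by (rule power_decreasing) auto
    finally have "8 * \<delta> n \<le> 1" by (simp add: power3_eq_cube)
    then show "8 * \<delta> n \<le> R n" by (simp add: R_def)
  qed
  have d0: "\<delta> \<longlonglongrightarrow> 0"
  proof (rule Lim_null_comparison)
    show "\<forall>\<^sub>F n in sequentially. norm (\<delta> n) \<le> (1 / 2) ^ n"
    proof (rule always_eventually, rule allI)
      fix n
      have "j n \<ge> n" using j(1)[of n] by simp
      then show "norm (\<delta> n) \<le> (1 / 2) ^ n" unfolding \<delta>_def by (simp add: power_decreasing)
    qed
    show "(\<lambda>n. (1 / 2 :: real) ^ n) \<longlonglongrightarrow> 0" by (rule LIMSEQ_power_zero) simp
  qed
  have Rinf: "filterlim R at_top sequentially"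
    unfolding R_def by (rule filterlim_compose[OF filterlim_real_sequentially filterlim_Suc])
  note lims = psi_tail_limits[OF _ d0 Rinf pos]
  have E1: "(\<lambda>n. shell_product (\<delta> n)) \<longlonglongrightarrow> 0"
  proof (rule Lim_null_comparison[OF _ LIMSEQ_inverse_real_of_nat], rule always_eventually, rule allI)
    fix n
    have "shell_product (\<delta> n) \<ge> 0" unfolding shell_product_def by (intro mult_nonneg_nonneg divide_nonneg_nonneg integral_nonneg_AE AE_I2) auto
    then show "norm (shell_product (\<delta> n)) \<le> inverse (real (Suc n))" using j(2)[of n] by (simp add: \<delta>_def del: of_nat_Suc)
  qed
  have E2: "(\<lambda>n. shell_product (R n)) \<longlonglongrightarrow> 0" unfolding R_def by (rule shell_product_at_infinity[OF sub])
  let ?JA = "\<lambda>n. LBINT x. psi (\<delta> n) (R n) x * Ad x" and ?JB = "\<lambda>n. LBINT x. psi (\<delta> n) (R n) x * Bd x"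
    and ?JC = "\<lambda>n. LBINT x. psi (\<delta> n) (R n) x * Cd x"
  have JA: "?JA \<longlonglongrightarrow> A" and JB: "?JB \<longlonglongrightarrow> B" and JC: "?JC \<longlonglongrightarrow> C"
    unfolding A_def B_def C_def by (rule lims(1)[OF Aint], rule lims(1)[OF Bint], rule lims(1)[OF Cint])
  have "(\<lambda>n. 2 * L * (sqrt (shell_product (\<delta> n)) + sqrt (shell_product (R n)))) \<longlonglongrightarrow> 2 * L * (sqrt 0 + sqrt 0)"
    by (intro tendsto_intros E1 E2)
  then have z1: "(\<lambda>n. 2 * L * (sqrt (shell_product (\<delta> n)) + sqrt (shell_product (R n)))) \<longlonglongrightarrow> 0" by simp
  have n0: "(\<lambda>n. ?JA n + ?JB n - ?JC n) \<longlonglongrightarrow> 0"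
    by (rule Lim_null_comparison[OF _ z1], rule always_eventually, rule allI, unfold real_norm_def, rule nehari_local[OF L pos])
  have "(\<lambda>n. ?JA n + ?JB n - ?JC n) \<longlonglongrightarrow> A + B - C" by (intro tendsto_intros JA JB JC)
  from LIMSEQ_unique[OF this n0] show "A + B = C" by simp
  define K where "K = 2 powr real CARD('n) * (32 * L) + 2 * L * (24 * 2 ^ CARD('n) + 1)"
  have "(\<lambda>n. K * ((LBINT x. indicator (tail (\<delta> n) (R n)) x * Ad x) + (LBINT x. indicator (tail (\<delta> n) (R n)) x * Bd x) + (LBINT x. indicator (tail (\<delta> n) (R n)) x * Cd x))) \<longlonglongrightarrow> K * (0 + 0 + 0)"
    by (intro tendsto_intros lims(2)[OF Aint] lims(2)[OF Bint] lims(2)[OF Cint])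
  then have z2: "(\<lambda>n. K * ((LBINT x. indicator (tail (\<delta> n) (R n)) x * Ad x) + (LBINT x. indicator (tail (\<delta> n) (R n)) x * Bd x) + (LBINT x. indicator (tail (\<delta> n) (R n)) x * Cd x))) \<longlonglongrightarrow> 0" by simp
  have p0: "(\<lambda>n. (2 - real CARD('n)) / 2 * ?JA n + (b - real CARD('n)) / q * ?JB n - (\<eta> - real CARD('n)) / r * ?JC n) \<longlonglongrightarrow> 0"
    by (rule Lim_null_comparison[OF _ z2], rule always_eventually, rule allI, unfold real_norm_def K_def, rule pohozaev_local[OF reg L pos])
  have "(\<lambda>n. (2 - real CARD('n)) / 2 * ?JA n + (b - real CARD('n)) / q * ?JB n - (\<eta> - real CARD('n)) / r * ?JC n) \<longlonglongrightarrow>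
     (2 - real CARD('n)) / 2 * A + (b - real CARD('n)) / q * B - (\<eta> - real CARD('n)) / r * C" by (intro tendsto_intros JA JB JC)
  from LIMSEQ_unique[OF this p0]
  show "(2 - real CARD('n)) / 2 * A + (b - real CARD('n)) / q * B = (\<eta> - real CARD('n)) / r * C" by simp
qed

lemma zero_if_mass_zero:
  assumes "(LBINT x. Bd x) = 0" shows "AE x in lborel. u x = 0"
proof -
  have "AE x in lborel. Bd x = 0" using assms Bint by (subst (asm) integral_nonneg_eq_0_iff_AE) auto
  moreover have "AE x in lborel. x \<noteq> (0 :: real ^ 'n)" by (rule AE_lborel_singleton)
  ultimately show ?thesis by eventually_elim auto
qed

text \<open>The dilation estimate gives \<open>u(2x) = u(x)\<close> almost everywhere, so the weighted mass equals \<open>2^(b-N)\<close> times itself.\<close>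

lemma mass_zero_if_energy_zero:
  assumes "(LBINT x. Ad x) = 0" shows "(LBINT x. Bd x) = 0"
proof -
  have A0: "(LBINT x. indicator (ann s t) x * Ad x) = 0" for s t
  proof -
    have "(LBINT x. indicator (ann s t) x * Ad x) \<le> (LBINT x. Ad x)"
      by (intro integral_mono energy_ann_integrable Aint) (auto simp: indicator_def)
    moreover have "(LBINT x. indicator (ann s t) x * Ad x) \<ge> 0" by (intro integral_nonneg_AE AE_I2) auto
    ultimately show ?thesis using assms by simp
  qed
  have "AE x in lborel. indicator (ann 0 (real n)) x * (u (2 *\<^sub>R x) - u x)\<^sup>2 = 0" for n :: nat
  proof -
    have "(LBINT x. indicator (ann 0 (real n)) x * (u (2 *\<^sub>R x) - u x)\<^sup>2) \<le> 0"
      using dilation_H1loc[OF H, of 2 0 "real n"] by (simp add: A0)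
    moreover have "(LBINT x. indicator (ann 0 (real n)) x * (u (2 *\<^sub>R x) - u x)\<^sup>2) \<ge> 0" by (intro integral_nonneg_AE AE_I2) auto
    ultimately have "(LBINT x. indicator (ann 0 (real n)) x * (u (2 *\<^sub>R x) - u x)\<^sup>2) = 0" by simp
    then show ?thesis
      using dilation_H1loc_integrable[OF H, of 2 0 "real n"] by (subst (asm) integral_nonneg_eq_0_iff_AE) auto
  qed
  then have "AE x in lborel. \<forall>n::nat. indicator (ann 0 (real n)) x * (u (2 *\<^sub>R x) - u x)\<^sup>2 = 0"
    unfolding AE_all_countable by blast
  then have u2: "AE x in lborel. u (2 *\<^sub>R x) = u x"
  proof eventually_elim
    case (elim x)
    obtain n :: nat where "norm x \<le> real n" using real_arch_simple by blast
    then show ?case using spec[OF elim, of n] by (simp add: ann_def)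
  qed
  define B where "B = (LBINT x. Bd x)"
  have "(LBINT x. \<bar>u (2 *\<^sub>R x)\<bar> powr q * norm x powr (- b)) = 2 powr (b - real CARD('n)) * B"
    using density_scaling[of u "\<lambda>_. 1" 2 q b] by (simp add: B_def)
  moreover have "(LBINT x. \<bar>u (2 *\<^sub>R x)\<bar> powr q * norm x powr (- b)) = B"
    unfolding B_def using u2 by (intro integral_cong_AE) (auto elim!: eventually_mono)
  ultimately have "B = 2 powr (b - real CARD('n)) * B" by simp
  moreover have "2 powr (b - real CARD('n)) < 1"
  proof -
    have "b < real CARD('n)" using b dim by linarith
    then show ?thesis using powr_less_mono[of "b - real CARD('n)" 0 2] by simp
  qed
  ultimately show ?thesis unfolding B_def[symmetric] by auto
qed

theorem vanishing:
  assumes sub: "q * (real CARD('n) - 2) < 2 * (real CARD('n) - b)" and reg: regular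
    and exponent: "2 * (real CARD('n) - \<eta>) \<le> r * (real CARD('n) - 2) \<or> r * (real CARD('n) - b) \<le> q * (real CARD('n) - \<eta>)"
  shows "AE x in lborel. u x = 0"
proof -
  define n where "n = real CARD('n)"
  define A B where "A = (LBINT x. Ad x)" and "B = (LBINT x. Bd x)"
  have A0: "A \<ge> 0" and B0: "B \<ge> 0" unfolding A_def B_def by (intro integral_nonneg_AE AE_I2; simp)+
  have sub': "q * (real CARD('n) - 2) \<le> 2 * (real CARD('n) - b)" using sub by simp
  note I = integral_identities[OF sub' reg, folded A_def B_def n_def]
  define \<alpha> \<beta> \<gamma> where "\<alpha> = (n - 2) / 2" and "\<beta> = (n - b) / q" and "\<gamma> = (n - \<eta>) / r"
  have ab: "\<alpha> < \<beta>" using sub q by (simp add: \<alpha>_def \<beta>_def n_def field_simps)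
  have "- \<alpha> * A + - \<beta> * B = - \<gamma> * (A + B)"
    using I(2) unfolding I(1)[symmetric] \<alpha>_def \<beta>_def \<gamma>_def by (simp add: minus_divide_left)
  then have P: "(\<gamma> - \<alpha>) * A + (\<gamma> - \<beta>) * B = 0" by (simp add: algebra_simps)
  show ?thesis
  proof (cases "2 * (n - \<eta>) \<le> r * (n - 2)")
    case True
    then have "\<gamma> \<le> \<alpha>" using r by (simp add: \<alpha>_def \<gamma>_def field_simps)
    then have "(\<gamma> - \<alpha>) * A \<le> 0" "(\<gamma> - \<beta>) * B \<le> 0" using A0 B0 ab by (auto simp: mult_le_0_iff)
    then have "(\<gamma> - \<beta>) * B = 0" using P by linarith
    then have "B = 0" using \<open>\<gamma> \<le> \<alpha>\<close> ab by auto
    then show ?thesis unfolding B_def by (rule zero_if_mass_zero)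
  next
    case False
    then have "r * (n - b) \<le> q * (n - \<eta>)" using exponent by (simp add: n_def)
    then have "\<beta> \<le> \<gamma>" using r q by (simp add: \<beta>_def \<gamma>_def field_simps)
    then have "(\<gamma> - \<alpha>) * A \<ge> 0" "(\<gamma> - \<beta>) * B \<ge> 0" using A0 B0 ab by auto
    then have "(\<gamma> - \<alpha>) * A = 0" using P by linarith
    then have "A = 0" using \<open>\<beta> \<le> \<gamma>\<close> ab by auto
    then have "B = 0" unfolding A_def B_def by (rule mass_zero_if_energy_zero)
    then show ?thesis unfolding B_def by (rule zero_if_mass_zero)
  qed
qed

end

section \<open>Lebesgue representatives and the theorem\<close>

text \<open>Transfer of an integral from Lebesgue measure to Borel measure along a Borel representative.\<close>

lemma lebesgue_to_lborel:
  fixes f f' :: "real ^ 'n \<Rightarrow> real"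
  assumes f': "f' \<in> borel_measurable borel" and ae: "AE x in lborel. f x = f' x"
    and f: "f \<in> borel_measurable lebesgue"
  shows "integrable lebesgue f \<longleftrightarrow> integrable lborel f'" and "(LINT x|lebesgue. f x) = (LINT x|lborel. f' x)"
proof -
  have ae': "AE x in lebesgue. f x = f' x" by (rule AE_completion[OF ae])
  have fl: "f' \<in> borel_measurable lebesgue" using f' by (simp add: measurable_completion)
  show "integrable lebesgue f \<longleftrightarrow> integrable lborel f'"
    using integrable_cong_AE[OF f fl ae'] integrable_completion[of f' lborel] f' by simp
  show "(LINT x|lebesgue. f x) = (LINT x|lborel. f' x)"
    using integral_cong_AE[OF f fl ae'] integral_completion[of f' lborel] f' by simp
qed

lemma L1_loc_test_integrable:
  fixes G v :: "real ^ 'n \<Rightarrow> real"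
  assumes G: "G \<in> L1_loc" and v: "v \<in> test_functions"
  shows "integrable lebesgue (\<lambda>x. G x * v x)"
proof -
  obtain R where R: "\<And>x. norm x > R \<Longrightarrow> v x = 0" using test_support[OF v] by metis
  obtain B where B: "\<And>x. \<bar>v x\<bar> \<le> B" using test_bounded[OF v] by metis
  have I: "integrable lebesgue (\<lambda>x. indicator (cball 0 R) x * G x)"
    using G by (auto simp: L1_loc_def set_integrable_def)
  have vm: "v \<in> borel_measurable lebesgue" using test_borel[OF v] by (simp add: measurable_completion)
  have eq: "G x * v x = (indicator (cball 0 R) x * G x) * v x" for x
    using R[of x] by (cases "norm x > R") auto
  show ?thesis unfolding eq
  proof (rule Bochner_Integration.integrable_bound)
    show "integrable lebesgue (\<lambda>x. B * (indicator (cball 0 R) x * G x))" using I by simp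
    show "(\<lambda>x. (indicator (cball 0 R) x * G x) * v x) \<in> borel_measurable lebesgue"
      using borel_measurable_integrable[OF I] vm by (rule borel_measurable_times)
    show "AE x in lebesgue. norm ((indicator (cball 0 R) x * G x) * v x) \<le> norm (B * (indicator (cball 0 R) x * G x))"
    proof (rule AE_I2)
      fix x
      have "\<bar>indicator (cball 0 R) x * G x\<bar> * \<bar>v x\<bar> \<le> \<bar>indicator (cball 0 R) x * G x\<bar> * \<bar>B\<bar>"
        using B[of x] by (intro mult_left_mono) auto
      then show "norm ((indicator (cball 0 R) x * G x) * v x) \<le> norm (B * (indicator (cball 0 R) x * G x))"
        by (simp only: real_norm_def abs_mult mult.commute)
    qed
  qed
qed

text \<open>Components of \<open>grad v\<close> are test functions, so the pairing of any weak gradient with \<open>grad v\<close> is determined by \<open>u\<close>. Hence the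
  representative chosen by \<open>weak_grad\<close> may be replaced by a square integrable one in the equation.\<close>

lemma weak_gradient_pairing_unique:
  fixes u :: "real ^ 'n \<Rightarrow> real"
  assumes g: "has_weak_gradient u g" and h: "has_weak_gradient u h" and v: "v \<in> test_functions"
  shows "(LINT x|lebesgue. g x \<bullet> grad v x) = (LINT x|lebesgue. h x \<bullet> grad v x)"
proof -
  have *: "(LINT x|lebesgue. G x \<bullet> grad v x) = - (\<Sum>i\<in>UNIV. LINT x|lebesgue. u x * grad (\<lambda>x. grad v x $ i) x $ i)"
    if G: "has_weak_gradient u G" for G
  proof -
    have I: "integrable lebesgue (\<lambda>x. G x $ i * grad v x $ i)" for i
      using G by (intro L1_loc_test_integrable test_grad[OF v]) (auto simp: has_weak_gradient_def)
    have "(LINT x|lebesgue. G x \<bullet> grad v x) = (\<Sum>i\<in>UNIV. LINT x|lebesgue. G x $ i * grad v x $ i)"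
      unfolding inner_vec_def using I by simp
    also have "\<dots> = (\<Sum>i\<in>UNIV. - (LINT x|lebesgue. u x * grad (\<lambda>x. grad v x $ i) x $ i))"
      using G test_grad[OF v] by (intro sum.cong refl) (auto simp: has_weak_gradient_def)
    finally show ?thesis by (simp add: sum_negf)
  qed
  show ?thesis using *[OF g] *[OF h] by simp
qed

theorem proposition2p6:
  fixes u :: "real ^ 'n \<Rightarrow> real" and b q r \<eta> :: real
  assumes "CARD('n) \<ge> 2"
    and "0 \<le> b" and "b < 2" and "2 < q" and "ereal q < crit_exp CARD('n) b"
    and "0 \<le> \<eta>" and "\<eta> < 2"
    and "u \<in> E_space q b \<inter> weighted_L r \<eta>"
    and "weak_solution q b (\<lambda>x s. \<bar>s\<bar> powr (r - 2) * s * norm x powr (- \<eta>)) u"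
    and "ereal r > crit_exp CARD('n) 0 \<Longrightarrow> u \<in> Linfty_loc (- {0})"
    and "(CARD('n) \<ge> 3 \<and>
            (ereal r \<ge> crit_exp CARD('n) \<eta> \<or>
             (1 < r \<and> r \<le> q * (real CARD('n) - \<eta>) / (real CARD('n) - b)))) \<or>
         (CARD('n) = 2 \<and> 1 < r \<and> r \<le> q * (real CARD('n) - \<eta>) / (real CARD('n) - b))"
  shows "AE x in lebesgue. u x = 0"
proof -
  define n where "n = real CARD('n)"
  have n2: "n \<ge> 2" using assms(1) by (simp add: n_def)
  have nb: "n - b > 0" using n2 assms(3) by simp
  have sub: "q * (n - 2) < 2 * (n - b)"
  proof (cases "CARD('n) = 2")
    case True
    then show ?thesis using assms(3) by (simp add: n_def)
  next
    case False
    then have "n > 2" using assms(1) by (simp add: n_def)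
    moreover have "q < 2 * (n - b) / (n - 2)" using assms(5) False by (simp add: crit_exp_def n_def)
    ultimately show ?thesis by (simp add: less_divide_eq)
  qed
  have r1: "r > 1" and exponent: "2 * (n - \<eta>) \<le> r * (n - 2) \<or> r * (n - b) \<le> q * (n - \<eta>)"
  proof -
    have "(CARD('n) \<ge> 3 \<and> ereal r \<ge> crit_exp CARD('n) \<eta>) \<or> (1 < r \<and> r \<le> q * (n - \<eta>) / (n - b))"
      using assms(11) unfolding n_def by blast
    then have "r > 1 \<and> (2 * (n - \<eta>) \<le> r * (n - 2) \<or> r * (n - b) \<le> q * (n - \<eta>))"
    proof
      assume c: "CARD('n) \<ge> 3 \<and> ereal r \<ge> crit_exp CARD('n) \<eta>"
      then have n3: "n \<ge> 3" by (simp add: n_def)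
      have "r \<ge> 2 * (n - \<eta>) / (n - 2)" using c by (auto simp: crit_exp_def n_def)
      then have le: "2 * (n - \<eta>) \<le> r * (n - 2)" using n3 by (simp add: divide_le_eq)
      have "2 * (n - 2) < r * (n - 2)" using le assms(7) by simp
      then have "r > 2" by (rule mult_right_less_imp_less) (use n3 in simp)
      then show ?thesis using le by simp
    next
      assume "1 < r \<and> r \<le> q * (n - \<eta>) / (n - b)"
      then show ?thesis using nb by (simp add: le_divide_eq)
    qed
    then show "r > 1" "2 * (n - \<eta>) \<le> r * (n - 2) \<or> r * (n - b) \<le> q * (n - \<eta>)" by auto
  qed
  \<comment> \<open>\<open>u\<close> and the components of a square integrable weak gradient are only Lebesgue measurable\<close>
  have uE: "u \<in> weighted_L q b" and uL: "u \<in> weighted_L r \<eta>" using assms(8) by (auto simp: E_space_def)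
  obtain G where G: "has_weak_gradient u G" and G2: "\<And>i. (\<lambda>x. G x $ i) \<in> weighted_L 2 0"
    using assms(8) by (auto simp: E_space_def)
  have um: "u \<in> borel_measurable lebesgue" using uE by (simp add: weighted_L_def)
  have Gm: "(\<lambda>x. G x $ i) \<in> borel_measurable lebesgue" for i using G2[of i] by (simp add: weighted_L_def)
  obtain u' where u'[measurable]: "u' \<in> borel_measurable borel" and uu': "AE x in lborel. u x = u' x"
    using completion_ex_borel_measurable_real[OF um] by auto
  have "\<exists>g. g \<in> borel_measurable borel \<and> (AE x in lborel. G x $ i = g x)" for i
    using completion_ex_borel_measurable_real[OF Gm[of i]] by auto
  then obtain gi where gi[measurable]: "\<And>i. gi i \<in> borel_measurable borel" and Gg: "\<And>i. AE x in lborel. G x $ i = gi i x"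
    by metis
  define g where "g x = (\<chi> i. gi i x)" for x
  have gcomp: "g x $ i = gi i x" for x i by (simp add: g_def)
  have gm[measurable]: "g \<in> borel_measurable borel"
  proof (rule borel_measurable_euclidean_space[THEN iffD2], rule ballI)
    fix e :: "real ^ 'n" assume "e \<in> Basis"
    then obtain j where "e = axis j 1" by (auto simp: Basis_vec_def)
    then show "(\<lambda>x. g x \<bullet> e) \<in> borel_measurable borel" by (simp add: inner_axis gcomp)
  qed
  have lm: "f \<in> borel_measurable lebesgue" if "f \<in> borel_measurable borel" for f :: "real ^ 'n \<Rightarrow> real"
    using that by (simp add: measurable_completion)
  have wm: "(\<lambda>x :: real ^ 'n. norm x powr c) \<in> borel_measurable lebesgue" for c by (rule lm) measurable
  have tm: "v \<in> borel_measurable lebesgue" if "v \<in> test_functions" for v :: "real ^ 'n \<Rightarrow> real"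
    by (rule lm[OF test_borel[OF that]])
  note um' [measurable] = um
  have Bint: "integrable lborel (\<lambda>x. \<bar>u' x\<bar> powr q * norm x powr (- b))"
  proof (subst lebesgue_to_lborel(1)[symmetric, of _ "\<lambda>x. \<bar>u x\<bar> powr q * norm x powr (- b)"])
    show "AE x in lborel. \<bar>u x\<bar> powr q * norm x powr (- b) = \<bar>u' x\<bar> powr q * norm x powr (- b)" using uu' by eventually_elim simp
    show "(\<lambda>x. \<bar>u x\<bar> powr q * norm x powr (- b)) \<in> borel_measurable lebesgue"
      by (rule borel_measurable_times[OF _ wm]) measurable
    show "integrable lebesgue (\<lambda>x. \<bar>u x\<bar> powr q * norm x powr (- b))" using uE by (simp add: weighted_L_def)
  qed measurable
  have Cint: "integrable lborel (\<lambda>x. \<bar>u' x\<bar> powr r * norm x powr (- \<eta>))"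
  proof (subst lebesgue_to_lborel(1)[symmetric, of _ "\<lambda>x. \<bar>u x\<bar> powr r * norm x powr (- \<eta>)"])
    show "AE x in lborel. \<bar>u x\<bar> powr r * norm x powr (- \<eta>) = \<bar>u' x\<bar> powr r * norm x powr (- \<eta>)" using uu' by eventually_elim simp
    show "(\<lambda>x. \<bar>u x\<bar> powr r * norm x powr (- \<eta>)) \<in> borel_measurable lebesgue"
      by (rule borel_measurable_times[OF _ wm]) measurable
    show "integrable lebesgue (\<lambda>x. \<bar>u x\<bar> powr r * norm x powr (- \<eta>))" using uL by (simp add: weighted_L_def)
  qed measurable
  have nz: "AE x in lborel. x \<noteq> (0 :: real ^ 'n)" by (rule AE_lborel_singleton)
  have giI: "integrable lborel (\<lambda>x. (gi i x)\<^sup>2)" for i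
  proof (subst lebesgue_to_lborel(1)[symmetric, of _ "\<lambda>x. \<bar>G x $ i\<bar> powr 2 * norm x powr (- 0)"])
    show "AE x in lborel. \<bar>G x $ i\<bar> powr 2 * norm x powr (- 0) = (gi i x)\<^sup>2" using Gg[of i] nz
      by eventually_elim (simp only: abs_powr_2, simp)
    show "(\<lambda>x. \<bar>G x $ i\<bar> powr 2 * norm x powr (- 0)) \<in> borel_measurable lebesgue"
      by (rule borel_measurable_times[OF _ wm]) (use Gm[of i] in measurable)
    show "integrable lebesgue (\<lambda>x. \<bar>G x $ i\<bar> powr 2 * norm x powr (- 0))" using G2[of i] by (simp add: weighted_L_def)
  qed measurable
  have Aint: "integrable lborel (\<lambda>x. (norm (g x))\<^sup>2)"
    unfolding norm_sq_vec gcomp by (intro Bochner_Integration.integrable_sum giI)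
  have uloc: "integrable lborel (\<lambda>x. indicator (cball 0 R) x * (u' x)\<^sup>2)" for R
  proof (rule Bochner_Integration.integrable_bound)
    define R' where "R' = max R 1"
    have R': "R' > 0" "R \<le> R'" by (auto simp: R'_def)
    have "integrable lborel (\<lambda>x :: real ^ 'n. indicator (cball 0 R) x :: real)"
      using emeasure_bounded_finite[of "cball (0 :: real ^ 'n) R"] by (intro integrable_real_indicator) auto
    then show "integrable lborel (\<lambda>x. indicator (cball 0 R) x + R' powr b * (\<bar>u' x\<bar> powr q * norm x powr (- b)))"
      using Bint by simp
    show "AE x in lborel. norm (indicator (cball 0 R) x * (u' x)\<^sup>2) \<le> norm (indicator (cball 0 R) x + R' powr b * (\<bar>u' x\<bar> powr q * norm x powr (- b)))"
      using nz
    proof eventually_elim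
      case (elim x)
      show ?case
      proof (cases "x \<in> cball 0 R")
        case True
        then have x: "x \<in> ann (norm x) R'" "norm x > 0" using elim R' by (auto simp: ann_def)
        have "(u' x)\<^sup>2 \<le> 1 + \<bar>u' x\<bar> powr q" using square_le_one_plus_powr[of "\<bar>u' x\<bar>" q] assms(4) by simp
        also have "\<bar>u' x\<bar> powr q \<le> R' powr b * (\<bar>u' x\<bar> powr q * norm x powr (- b))"
          using ann_Lp(2)[OF u' Bint assms(2) x(2) R'(1), of x] x(1) by simp
        finally show ?thesis using True by simp
      qed simp
    qed
  qed measurable
  have wg: "wgrad u' g" unfolding wgrad_def
  proof (intro ballI allI)
    fix v :: "real ^ 'n \<Rightarrow> real" and i assume v: "v \<in> test_functions"
    note vi = test_grad[OF v, of i]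
    have [measurable]: "v \<in> borel_measurable borel" "(\<lambda>x. grad v x $ i) \<in> borel_measurable borel"
      using v vi by (auto intro: test_borel)
    have "(LINT x|lebesgue. u x * grad v x $ i) = (LBINT x. u' x * grad v x $ i)"
    proof (rule lebesgue_to_lborel(2))
      show "AE x in lborel. u x * grad v x $ i = u' x * grad v x $ i" using uu' by eventually_elim simp
      show "(\<lambda>x. u x * grad v x $ i) \<in> borel_measurable lebesgue" by (rule borel_measurable_times[OF um tm[OF vi]])
    qed measurable
    moreover have "(LINT x|lebesgue. G x $ i * v x) = (LBINT x. g x $ i * v x)"
    proof (rule lebesgue_to_lborel(2))
      show "AE x in lborel. G x $ i * v x = g x $ i * v x" using Gg[of i] by eventually_elim (simp add: gcomp)
      show "(\<lambda>x. G x $ i * v x) \<in> borel_measurable lebesgue" by (rule borel_measurable_times[OF Gm tm[OF v]])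
    qed measurable
    moreover have "(LINT x|lebesgue. u x * grad v x $ i) = - (LINT x|lebesgue. G x $ i * v x)"
      using G v by (simp add: has_weak_gradient_def)
    ultimately show "(LBINT x. u' x * grad v x $ i) = - (LBINT x. g x $ i * v x)" by simp
  qed
  have H: "H1loc u' g" unfolding H1loc_def using uloc Aint wg by auto
  have eq: "(LBINT x. g x \<bullet> grad v x) + (LBINT x. spow (q - 1) (u' x) * v x * norm x powr (- b))
      = (LBINT x. spow (r - 1) (u' x) * v x * norm x powr (- \<eta>))" if v: "v \<in> test_functions" for v
  proof -
    have [measurable]: "v \<in> borel_measurable borel" "grad v \<in> borel_measurable borel"
      using v by (auto intro: test_borel grad_borel)
    have ws: "(LINT x|lebesgue. weak_grad u x \<bullet> grad v x)
        + (LINT x|lebesgue. \<bar>u x\<bar> powr (q - 2) * u x * v x * norm x powr (- b))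
        = (LINT x|lebesgue. \<bar>u x\<bar> powr (r - 2) * u x * norm x powr (- \<eta>) * v x)"
      using assms(9) v by (simp add: weak_solution_def)
    have "has_weak_gradient u (weak_grad u)" unfolding weak_grad_def by (rule someI[of "has_weak_gradient u", OF G])
    then have "(LINT x|lebesgue. weak_grad u x \<bullet> grad v x) = (LINT x|lebesgue. G x \<bullet> grad v x)"
      by (rule weak_gradient_pairing_unique[OF _ G v])
    also have "\<dots> = (LBINT x. g x \<bullet> grad v x)"
    proof (rule lebesgue_to_lborel(2))
      have "AE x in lborel. \<forall>i\<in>UNIV. G x $ i = gi i x" by (rule AE_finite_allI) (auto intro: Gg)
      then show "AE x in lborel. G x \<bullet> grad v x = g x \<bullet> grad v x" by eventually_elim (simp add: inner_vec_def gcomp)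
      show "(\<lambda>x. G x \<bullet> grad v x) \<in> borel_measurable lebesgue"
        unfolding inner_vec_def inner_real_def
        by (intro borel_measurable_sum borel_measurable_times Gm tm test_grad v)
    qed measurable
    finally have e1: "(LINT x|lebesgue. weak_grad u x \<bullet> grad v x) = (LBINT x. g x \<bullet> grad v x)" .
    have e2: "(LINT x|lebesgue. \<bar>u x\<bar> powr (q - 2) * u x * v x * norm x powr (- b)) = (LBINT x. spow (q - 1) (u' x) * v x * norm x powr (- b))"
      unfolding spow_eq
    proof (rule lebesgue_to_lborel(2))
      show "AE x in lborel. spow (q - 1) (u x) * v x * norm x powr (- b) = spow (q - 1) (u' x) * v x * norm x powr (- b)" using uu' by eventually_elim simp
      show "(\<lambda>x. spow (q - 1) (u x) * v x * norm x powr (- b)) \<in> borel_measurable lebesgue"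
        by (intro borel_measurable_times wm tm v spow_measurable um)
    qed measurable
    have e3: "(LINT x|lebesgue. \<bar>u x\<bar> powr (r - 2) * u x * norm x powr (- \<eta>) * v x) = (LBINT x. spow (r - 1) (u' x) * v x * norm x powr (- \<eta>))"
      unfolding spow_eq
    proof (rule lebesgue_to_lborel(2))
      show "AE x in lborel. spow (r - 1) (u x) * norm x powr (- \<eta>) * v x = spow (r - 1) (u' x) * v x * norm x powr (- \<eta>)" using uu' by eventually_elim simp
      show "(\<lambda>x. spow (r - 1) (u x) * norm x powr (- \<eta>) * v x) \<in> borel_measurable lebesgue"
        by (intro borel_measurable_times wm tm v spow_measurable um)
    qed measurable
    show ?thesis using ws unfolding e1 e2 e3 .
  qed
  interpret dilation_setting u' g b q r \<eta>
    by unfold_locales (use assms r1 H Bint Cint eq in auto)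
  have reg: regular
  proof (cases "ereal r > crit_exp CARD('n) 0")
    case True
    have loc: "u \<in> Linfty_loc (- {0})" by (rule assms(10)[OF True])
    have "\<exists>M. AE x in lborel. x \<in> ann s t \<longrightarrow> \<bar>u' x\<bar> \<le> M" if s: "s > 0" for s t
    proof -
      have "(ann s t :: (real ^ 'n) set) = cball 0 t - ball 0 s" by (auto simp: ann_def)
      then have "compact (ann s t :: (real ^ 'n) set)" by (simp add: compact_diff)
      moreover have "(ann s t :: (real ^ 'n) set) \<subseteq> - {0}" using s by (auto simp: ann_def)
      ultimately obtain M where "AE x in lebesgue. x \<in> ann s t \<longrightarrow> \<bar>u x\<bar> \<le> M"
        using loc unfolding Linfty_loc_def by blast
      then have "AE x in lborel. x \<in> ann s t \<longrightarrow> \<bar>u x\<bar> \<le> M" by (simp add: AE_completion_iff)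
      then have "AE x in lborel. x \<in> ann s t \<longrightarrow> \<bar>u' x\<bar> \<le> M" using uu' by eventually_elim simp
      then show ?thesis by blast
    qed
    then show ?thesis unfolding regular_def by blast
  next
    case False
    then have "CARD('n) \<ge> 3 \<longrightarrow> r \<le> 2 * real CARD('n) / (real CARD('n) - 2)"
      by (auto simp: crit_exp_def not_less)
    then show ?thesis unfolding regular_def by blast
  qed
  have "AE x in lborel. u' x = 0"
    by (rule vanishing[OF _ reg]) (use sub exponent in \<open>simp_all add: n_def\<close>)
  then have "AE x in lborel. u x = 0" using uu' by eventually_elim simp
  then show ?thesis by (rule AE_completion)
qed

end
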